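(* Let $K$ be an algebraically closed field, let $P\subset\mathbb{R}^2$ be a (two-dimensional) lattice polygon, and suppose that the corresponding projective toric surface $X_P$ over $K$ is non-singular. Then the Fano scheme of lines $\mathbf{F}_1(X_P)$ is non-singular. In particular, it is reduced.
   Context: For a lattice polygon $P\subset\mathbb{R}^2$ (two-dimensional, vertices in $\mathbb{Z}^2$), let $S_P$ be the subsemigroup of $\mathbb{Z}^2\times\mathbb{Z}$ generated by $(P\cap\mathbb{Z}^2)\times\{1\}$, and set $X_P=\operatorname{Proj} K[S_P]$, embedded in $\mathbb{P}^n$, $n=\#(P\cap\mathbb{Z}^2)-1$, with coordinates $x_u$ indexed by $u\in P\cap\mathbb{Z}^2$. (This is always normal and embedded by a complete linear system, and every normal projective toric surface embedded by the complete linear system of a very ample divisor arises this way.) $\mathbf{F}_1(X_P)$ is the fine moduli space parametrizing lines of $\mathbb{P}^n$ contained in $X_P$; it may be empty. *)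

theory Defs
  imports "HOL-Analysis.Polytope" "HOL-Algebra.Ring_Divisibility" "HOL-Library.Poly_Mapping"
    "HOL-Library.Extended_Nat" "HOL-Computational_Algebra.Polynomial"
begin

section \<open>Regular local rings\<close>

text \<open>The class of the fraction \<open>a / s\<close> in the localization of \<open>R\<close> at the multiplicative set \<open>M\<close>.\<close>

definition fraction :: "('a, 'm) ring_scheme \<Rightarrow> 'a set \<Rightarrow> 'a \<Rightarrow> 'a \<Rightarrow> ('a \<times> 'a) set" where
  "fraction R M a s = {(b, t). b \<in> carrier R \<and> t \<in> M \<and>
     (\<exists>w\<in>M. w \<otimes>\<^bsub>R\<^esub> (t \<otimes>\<^bsub>R\<^esub> a) = w \<otimes>\<^bsub>R\<^esub> (s \<otimes>\<^bsub>R\<^esub> b))}"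

text \<open>Each union below ranges over representatives, all of which give the same class.\<close>

definition localization :: "('a, 'm) ring_scheme \<Rightarrow> 'a set \<Rightarrow> ('a \<times> 'a) set ring" where
  "localization R M =
    \<lparr> carrier = {fraction R M a s | a s. a \<in> carrier R \<and> s \<in> M},
      mult = (\<lambda>X Y. \<Union>(a, s)\<in>X. \<Union>(b, t)\<in>Y. fraction R M (a \<otimes>\<^bsub>R\<^esub> b) (s \<otimes>\<^bsub>R\<^esub> t)),
      one = fraction R M \<one>\<^bsub>R\<^esub> \<one>\<^bsub>R\<^esub>,
      zero = fraction R M \<zero>\<^bsub>R\<^esub> \<one>\<^bsub>R\<^esub>,
      add = (\<lambda>X Y. \<Union>(a, s)\<in>X. \<Union>(b, t)\<in>Y.
        fraction R M ((t \<otimes>\<^bsub>R\<^esub> a) \<oplus>\<^bsub>R\<^esub> (s \<otimes>\<^bsub>R\<^esub> b)) (s \<otimes>\<^bsub>R\<^esub> t)) \<rparr>"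

definition krull_dim :: "('a, 'm) ring_scheme \<Rightarrow> enat" where
  "krull_dim R = Sup {enat n | n. \<exists>c :: nat \<Rightarrow> 'a set.
     (\<forall>i\<le>n. primeideal (c i) R) \<and> (\<forall>i<n. c i \<subset> c (Suc i))}"

text \<open>A Noetherian local ring whose maximal ideal is generated by as many elements as its dimension.\<close>

definition regular_local_ring :: "('a, 'm) ring_scheme \<Rightarrow> bool" where
  "regular_local_ring R \<longleftrightarrow> cring R \<and> noetherian_ring R \<and> (\<exists>!m. maximalideal m R) \<and>
     (\<forall>m. maximalideal m R \<longrightarrow>
       (\<exists>B. B \<subseteq> carrier R \<and> finite B \<and> m = Idl\<^bsub>R\<^esub> B \<and> enat (card B) = krull_dim R))"

definition reduced_ring :: "('a, 'm) ring_scheme \<Rightarrow> bool" where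
  "reduced_ring R \<longleftrightarrow>
     (\<forall>x\<in>carrier R. \<forall>n::nat. x [^]\<^bsub>R\<^esub> n = \<zero>\<^bsub>R\<^esub> \<longrightarrow> x = \<zero>\<^bsub>R\<^esub>)"

section \<open>Schemes through their local rings\<close>

text \<open>
  Being non-singular (all local rings are regular) and being reduced (all local rings are reduced)
  involve only the points of a scheme and the local rings at them, so that is the part of a
  scheme recorded here. When a scheme is given by an affine open cover, a point may be listed once
  for every chart containing it; its local ring is, up to isomorphism, the same in each chart.
\<close>

record ('p, 'a) scheme_stalks =
  points :: "'p set"
  stalk :: "'p \<Rightarrow> 'a ring"

definition nonsingular :: "('p, 'a) scheme_stalks \<Rightarrow> bool" where
  "nonsingular X \<longleftrightarrow> (\<forall>p\<in>points X. regular_local_ring (stalk X p))"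

definition reduced_scheme :: "('p, 'a) scheme_stalks \<Rightarrow> bool" where
  "reduced_scheme X \<longleftrightarrow> (\<forall>p\<in>points X. reduced_ring (stalk X p))"

text \<open>The scheme covered by the affine open subschemes \<open>Spec (R i)\<close>, \<open>i \<in> J\<close>.\<close>

definition affine_cover_scheme ::
  "'i set \<Rightarrow> ('i \<Rightarrow> 'a ring) \<Rightarrow> ('i \<times> 'a set, ('a \<times> 'a) set) scheme_stalks" where
  "affine_cover_scheme J R =
    \<lparr> points = {(i, q). i \<in> J \<and> primeideal q (R i)},
      stalk = (\<lambda>(i, q). localization (R i) (carrier (R i) - q)) \<rparr>"

text \<open>
  \<open>Proj R\<close> for a ring \<open>R\<close> with homogeneous components \<open>G d\<close>: the points are the homogeneous primes
  that do not contain the irrelevant ideal, the local rings the homogeneous localizations.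
\<close>

definition Proj :: "'a ring \<Rightarrow> (nat \<Rightarrow> 'a set) \<Rightarrow> ('a set, ('a \<times> 'a) set) scheme_stalks" where
  "Proj R G =
    \<lparr> points = {p. primeideal p R \<and> p = Idl\<^bsub>R\<^esub> (p \<inter> (\<Union>d. G d)) \<and> \<not> (\<Union>d\<in>{1..}. G d) \<subseteq> p},
      stalk = (\<lambda>p. let M = (\<Union>d. G d) - p in
        (localization R M)\<lparr> carrier := {fraction R M a s | a s d. a \<in> G d \<and> s \<in> G d - p} \<rparr>) \<rparr>"

section \<open>Polynomials\<close>

text \<open>Polynomials in the variables \<open>'v\<close>: finitely supported functions on exponent vectors.\<close>

type_synonym ('v, 'k) mpoly = "('v \<Rightarrow>\<^sub>0 nat) \<Rightarrow>\<^sub>0 'k"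

abbreviation Const :: "'k \<Rightarrow> ('v, 'k::zero) mpoly" where
  "Const c \<equiv> Poly_Mapping.single 0 c"

abbreviation Var :: "'v \<Rightarrow> ('v, 'k::zero_neq_one) mpoly" where
  "Var w \<equiv> Poly_Mapping.single (Poly_Mapping.single w 1) 1"

text \<open>A subset of a type-class ring, viewed as a ring with that carrier.\<close>

definition ring_on :: "'a::comm_ring_1 set \<Rightarrow> 'a ring" where
  "ring_on C = \<lparr> carrier = C, mult = (*), one = 1, zero = 0, add = (+) \<rparr>"

definition polys_in :: "'v set \<Rightarrow> ('v, 'k::zero) mpoly set" where
  "polys_in V = {f. \<forall>m\<in>Poly_Mapping.keys f. Poly_Mapping.keys m \<subseteq> V}"

text \<open>Substitute \<open>g w\<close> for the variable \<open>w\<close>, mapping the coefficients by \<open>\<phi>\<close>.\<close>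

definition substitute ::
  "('k::zero \<Rightarrow> 'a::comm_ring_1) \<Rightarrow> ('v \<Rightarrow> 'a) \<Rightarrow> ('v, 'k) mpoly \<Rightarrow> 'a" where
  "substitute \<phi> g f =
     (\<Sum>m\<in>Poly_Mapping.keys f. \<phi> (Poly_Mapping.lookup f m) *
       (\<Prod>w\<in>Poly_Mapping.keys m. g w ^ Poly_Mapping.lookup m w))"

section \<open>Toric surfaces\<close>

definition lattice_polygon :: "(real \<times> real) set \<Rightarrow> bool" where
  "lattice_polygon P \<longleftrightarrow> polytope P \<and> aff_dim P = 2 \<and> (\<forall>x. x extreme_point_of P \<longrightarrow> x \<in> \<int> \<times> \<int>)"

definition lattice_points :: "(real \<times> real) set \<Rightarrow> (int \<times> int) set" where
  "lattice_points P = {(a, b). (of_int a, of_int b) \<in> P}"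

text \<open>The semigroup contains \<open>0\<close>, so that its semigroup algebra has a unit.\<close>

inductive_set cone_semigroup :: "(real \<times> real) set \<Rightarrow> ((int \<times> int) \<times> int) set"
  for P where
  zero: "0 \<in> cone_semigroup P"
| add: "u \<in> lattice_points P \<Longrightarrow> x \<in> cone_semigroup P \<Longrightarrow> (u, 1) + x \<in> cone_semigroup P"

type_synonym 'k torus_algebra = "((int \<times> int) \<times> int) \<Rightarrow>\<^sub>0 'k"

definition semigroup_algebra :: "(real \<times> real) set \<Rightarrow> 'k::field torus_algebra ring" where
  "semigroup_algebra P = ring_on {f. Poly_Mapping.keys f \<subseteq> cone_semigroup P}"

definition semigroup_algebra_component ::
  "(real \<times> real) set \<Rightarrow> nat \<Rightarrow> 'k::field torus_algebra set" where
  "semigroup_algebra_component P d =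
     {f. Poly_Mapping.keys f \<subseteq> {x \<in> cone_semigroup P. snd x = int d}}"

definition toric_surface :: "'k::field itself \<Rightarrow> (real \<times> real) set \<Rightarrow>
    ('k torus_algebra set, ('k torus_algebra \<times> 'k torus_algebra) set) scheme_stalks" where
  "toric_surface _ P = Proj (semigroup_algebra P) (semigroup_algebra_component P)"

text \<open>
  The homogeneous ideal of the toric surface in projective space with coordinates indexed by the
  lattice points: the kernel of the map sending \<open>x\<^sub>u\<close> to the monomial with exponent \<open>(u, 1)\<close>.
\<close>

definition toric_ideal :: "(real \<times> real) set \<Rightarrow> (int \<times> int, 'k::field) mpoly set" where
  "toric_ideal P = {f \<in> polys_in (lattice_points P).
     substitute (Poly_Mapping.single 0)
       (\<lambda>u. Poly_Mapping.single (u, 1) 1 :: 'k torus_algebra) f = 0}"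

section \<open>The Fano scheme of lines\<close>

text \<open>
  Let \<open>\<phi>\<close> make \<open>'a\<close> an algebra over \<open>'k\<close>. A \<open>2 \<times> A\<close> matrix \<open>M\<close> over \<open>'a\<close> spanning a rank 2 direct
  summand is a family of lines over \<open>Spec 'a\<close> in the projective space with coordinates indexed by
  \<open>A\<close>. The polynomial \<open>f\<close>, restricted to the line with parameters \<open>Var False\<close> and \<open>Var True\<close>, becomes
  a polynomial in these parameters.
\<close>

definition restrict_to_line ::
  "('k::zero \<Rightarrow> 'a::comm_ring_1) \<Rightarrow> (bool \<Rightarrow> 'v \<Rightarrow> 'a) \<Rightarrow> ('v, 'k) mpoly \<Rightarrow> (bool, 'a) mpoly" where
  "restrict_to_line \<phi> M =
     substitute (\<lambda>c. Const (\<phi> c)) (\<lambda>w. \<Sum>r\<in>UNIV. Const (M r w) * Var r)"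

definition line_contained ::
  "('k::zero \<Rightarrow> 'a::comm_ring_1) \<Rightarrow> (bool \<Rightarrow> 'v \<Rightarrow> 'a) \<Rightarrow> ('v, 'k) mpoly set \<Rightarrow> bool" where
  "line_contained \<phi> M I \<longleftrightarrow> (\<forall>f\<in>I. restrict_to_line \<phi> M f = 0)"

text \<open>
  The Grassmannian of lines has the affine charts (one for each pair \<open>u \<noteq> v\<close>) where the
  columns \<open>u\<close> and \<open>v\<close> of the matrix form an invertible minor. Every line in the chart is the row
  space of exactly one matrix in which this minor is the identity matrix.
\<close>

definition normalized_at :: "'v \<Rightarrow> 'v \<Rightarrow> (bool \<Rightarrow> 'v \<Rightarrow> 'a::zero_neq_one) \<Rightarrow> bool" where
  "normalized_at u v M \<longleftrightarrow>
     M False u = 1 \<and> M False v = 0 \<and> M True u = 0 \<and> M True v = 1"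

definition universal_line :: "'v \<Rightarrow> 'v \<Rightarrow> bool \<Rightarrow> 'v \<Rightarrow> (bool \<times> 'v, 'k::comm_ring_1) mpoly" where
  "universal_line u v r w =
     (if w = u then (if r then 0 else 1) else if w = v then (if r then 1 else 0) else Var (r, w))"

definition fano_equations ::
  "('v, 'k::field) mpoly set \<Rightarrow> 'v \<Rightarrow> 'v \<Rightarrow> (bool \<times> 'v, 'k) mpoly set" where
  "fano_equations I u v =
     {Poly_Mapping.lookup (restrict_to_line Const (universal_line u v) f) m | f m. f \<in> I}"

text \<open>
  The coordinate ring of the chart at \<open>u, v\<close> of the scheme of lines contained in the closed
  subscheme with homogeneous ideal \<open>I\<close>.
\<close>

definition fano_chart ::
  "'v set \<Rightarrow> ('v, 'k::field) mpoly set \<Rightarrow> 'v \<times> 'v \<Rightarrow> (bool \<times> 'v, 'k) mpoly set ring" where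
  "fano_chart A I = (\<lambda>(u, v).
     let R = ring_on (polys_in (UNIV \<times> (A - {u, v})))
     in R Quot (Idl\<^bsub>R\<^esub> (fano_equations I u v)))"

type_synonym ('v, 'k) chart_function = "(bool \<times> 'v, 'k) mpoly set"

definition fano_scheme_lines :: "'v set \<Rightarrow> ('v, 'k::field) mpoly set \<Rightarrow>
    (('v \<times> 'v) \<times> ('v, 'k) chart_function set,
     (('v, 'k) chart_function \<times> ('v, 'k) chart_function) set) scheme_stalks" where
  "fano_scheme_lines A I =
     affine_cover_scheme {(u, v). u \<in> A \<and> v \<in> A \<and> u \<noteq> v} (fano_chart A I)"

definition toric_fano_scheme :: "'k::field itself \<Rightarrow> (real \<times> real) set \<Rightarrow>
    (((int \<times> int) \<times> (int \<times> int)) \<times> (int \<times> int, 'k) chart_function set,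
     ((int \<times> int, 'k) chart_function \<times> (int \<times> int, 'k) chart_function) set) scheme_stalks" where
  "toric_fano_scheme _ P = fano_scheme_lines (lattice_points P) (toric_ideal P)"

section \<open>Representability of the charts\<close>

lemma mon_superset:
  fixes g :: "'v \<Rightarrow> 'a::comm_ring_1"
  assumes "finite S" "Poly_Mapping.keys m \<subseteq> S"
  shows "(\<Prod>w\<in>Poly_Mapping.keys m. g w ^ Poly_Mapping.lookup m w) =
    (\<Prod>w\<in>S. g w ^ Poly_Mapping.lookup m w)"
  using assms by (intro prod.mono_neutral_left) (auto simp: in_keys_iff)

lemma mon_add:
  fixes g :: "'v \<Rightarrow> 'a::comm_ring_1"
  shows "(\<Prod>w\<in>Poly_Mapping.keys (m + n). g w ^ Poly_Mapping.lookup (m + n) w) =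
   (\<Prod>w\<in>Poly_Mapping.keys m. g w ^ Poly_Mapping.lookup m w) * (\<Prod>w\<in>Poly_Mapping.keys n. g w ^ Poly_Mapping.lookup n w)"
proof -
  let ?S = "Poly_Mapping.keys m \<union> Poly_Mapping.keys n"
  have "Poly_Mapping.keys (m + n) \<subseteq> ?S" by (rule Poly_Mapping.keys_add)
  then show ?thesis
    by (subst mon_superset[of ?S "m+n"], simp, simp, subst mon_superset[of ?S m], simp, simp, subst mon_superset[of ?S n], simp, simp)
      (simp add: lookup_add power_add prod.distrib)
qed

locale coeff_hom =
  fixes \<phi> :: "'k::comm_ring_1 \<Rightarrow> 'a::comm_ring_1"
  assumes hom_add: "\<phi> (a + b) = \<phi> a + \<phi> b"
    and hom_mult: "\<phi> (a * b) = \<phi> a * \<phi> b"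
    and hom_one: "\<phi> 1 = 1"
begin

lemma hom_zero: "\<phi> 0 = 0"
  using hom_add[of 0 0] by simp

lemma substitute_superset:
  assumes "finite S" "Poly_Mapping.keys f \<subseteq> S"
  shows "substitute \<phi> g f = (\<Sum>m\<in>S. \<phi> (Poly_Mapping.lookup f m) * (\<Prod>w\<in>Poly_Mapping.keys m. g w ^ Poly_Mapping.lookup m w))"
  unfolding substitute_def using assms
  by (intro sum.mono_neutral_left) (auto simp: in_keys_iff hom_zero)

lemma substitute_zero: "substitute \<phi> g 0 = 0"
  by (simp add: substitute_def)

lemma substitute_add: "substitute \<phi> g (f + h) = substitute \<phi> g f + substitute \<phi> g h"
proof -
  let ?S = "Poly_Mapping.keys f \<union> Poly_Mapping.keys h"
  have "Poly_Mapping.keys (f + h) \<subseteq> ?S" by (rule Poly_Mapping.keys_add)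
  then show ?thesis
    by (simp add: substitute_superset[of ?S "f+h"] substitute_superset[of ?S f] substitute_superset[of ?S h]
      lookup_add hom_add distrib_right sum.distrib)
qed

lemma substitute_sum: "substitute \<phi> g (sum F S) = (\<Sum>i\<in>S. substitute \<phi> g (F i))"
  by (induction S rule: infinite_finite_induct) (auto simp: substitute_zero substitute_add)

lemma substitute_single: "substitute \<phi> g (Poly_Mapping.single m c) =
   \<phi> c * (\<Prod>w\<in>Poly_Mapping.keys m. g w ^ Poly_Mapping.lookup m w)"
  by (subst substitute_superset[of "{m}"]) auto

lemma substitute_const: "substitute \<phi> g (Const c) = \<phi> c"
  by (simp add: substitute_single)

lemma substitute_var: "substitute \<phi> g (Var w) = g w"
  by (simp add: substitute_single hom_one)

lemma substitute_mult: "substitute \<phi> g (f * h) = substitute \<phi> g f * substitute \<phi> g h"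
proof -
  let ?s = "\<lambda>m. Poly_Mapping.single m (Poly_Mapping.lookup f m)"
  let ?t = "\<lambda>m. Poly_Mapping.single m (Poly_Mapping.lookup h m)"
  have dec: "p = (\<Sum>m\<in>Poly_Mapping.keys p. Poly_Mapping.single m (Poly_Mapping.lookup p m))" for p :: "('v, 'k) mpoly"
    by (rule poly_mapping_eqI) (simp add: lookup_sum lookup_single when_def in_keys_iff)
  have "f * h = (\<Sum>m\<in>Poly_Mapping.keys f. \<Sum>n\<in>Poly_Mapping.keys h. ?s m * ?t n)"
    by (subst dec[of f], subst dec[of h]) (simp add: sum_product)
  moreover have "substitute \<phi> g (?s m * ?t n) = substitute \<phi> g (?s m) * substitute \<phi> g (?t n)" for m n
    by (simp add: mult_single substitute_single mon_add hom_mult mult_ac)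
  ultimately have "substitute \<phi> g (f * h) = 
    (\<Sum>m\<in>Poly_Mapping.keys f. \<Sum>n\<in>Poly_Mapping.keys h. substitute \<phi> g (?s m) * substitute \<phi> g (?t n))"
    by (simp add: substitute_sum)
  also have "\<dots> = substitute \<phi> g (\<Sum>m\<in>Poly_Mapping.keys f. ?s m) * substitute \<phi> g (\<Sum>m\<in>Poly_Mapping.keys h. ?t m)"
    by (simp add: substitute_sum sum_product)
  finally show ?thesis
    using dec[of f] dec[of h] by simp
qed

lemma substitute_hom: "coeff_hom (substitute \<phi> g)"
  by unfold_locales (auto simp: substitute_add substitute_mult substitute_const hom_one simp flip: single_one)

lemma hom_prod: "\<phi> (prod F S) = (\<Prod>i\<in>S. \<phi> (F i))"
  by (induction S rule: infinite_finite_induct) (auto simp: hom_one hom_mult)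

lemma hom_sum: "\<phi> (sum F S) = (\<Sum>i\<in>S. \<phi> (F i))"
  by (induction S rule: infinite_finite_induct) (auto simp: hom_zero hom_add)

lemma hom_power: "\<phi> (a ^ n) = \<phi> a ^ n"
  by (induction n) (auto simp: hom_one hom_mult)

lemma hom_substitute: "\<phi> (substitute \<psi> g f) = substitute (\<lambda>c. \<phi> (\<psi> c)) (\<lambda>w. \<phi> (g w)) f"
  by (simp add: substitute_def hom_sum hom_mult hom_prod hom_power)

end

lemma Const_hom: "coeff_hom Const"
  by unfold_locales (auto simp: single_add mult_single)

lemma var_power: "(Var w :: ('v,'k::comm_ring_1) mpoly) ^ n = Poly_Mapping.single (Poly_Mapping.single w n) 1"
  by (induction n) (auto simp: mult_single simp flip: single_add)

lemma var_prod: "finite S \<Longrightarrow> (\<Prod>w\<in>S. (Poly_Mapping.single (F w) 1 :: ('v,'k::comm_ring_1) mpoly)) = Poly_Mapping.single (\<Sum>w\<in>S. F w) 1"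
  by (induction S rule: finite_induct) (auto simp: mult_single)

lemma mon_var: "(\<Prod>w\<in>Poly_Mapping.keys m. (Var w :: ('v,'k::comm_ring_1) mpoly) ^ Poly_Mapping.lookup m w) = Poly_Mapping.single m 1"
proof -
  have "m = (\<Sum>w\<in>Poly_Mapping.keys m. Poly_Mapping.single w (Poly_Mapping.lookup m w))"
    by (rule poly_mapping_eqI) (simp add: lookup_sum lookup_single when_def in_keys_iff)
  then show ?thesis unfolding var_power
    by (simp add: var_prod)
qed

text \<open>
  The charts represent the moduli functor of lines: for an algebra \<open>'a\<close> over \<open>'k\<close>, a normalized
  matrix over \<open>'a\<close> is a line contained in the scheme with ideal \<open>I\<close> exactly if the evaluation
  homomorphism it defines kills the equations of the chart.
\<close>

lemma fano_equations_universal: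
  fixes \<phi> :: "'k::field \<Rightarrow> 'a::comm_ring_1"
  assumes add: "\<And>a b. \<phi> (a + b) = \<phi> a + \<phi> b"
    and mult: "\<And>a b. \<phi> (a * b) = \<phi> a * \<phi> b"
    and one: "\<phi> 1 = 1"
    and uv: "u \<noteq> v" and M: "normalized_at u v M"
  shows "line_contained \<phi> M I \<longleftrightarrow>
    (\<forall>g\<in>fano_equations I u v. substitute \<phi> (\<lambda>(r, w). M r w) g = 0)"
proof -
  interpret phi: coeff_hom \<phi> by unfold_locales (fact add mult one)+
  let ?e = "substitute \<phi> (\<lambda>(r, w). M r w) :: (bool \<times> _, _) mpoly \<Rightarrow> _"
  interpret e: coeff_hom ?e by (rule phi.substitute_hom)
  interpret C: coeff_hom "Const :: 'a \<Rightarrow> (bool, 'a) mpoly" by (rule Const_hom)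
  interpret Ce: coeff_hom "\<lambda>g. Const (?e g) :: (bool, 'a) mpoly"
    by unfold_locales (simp_all add: e.hom_add e.hom_mult C.hom_add C.hom_mult e.hom_one)
  let ?T = "substitute (\<lambda>g. Const (?e g) :: (bool, 'a) mpoly) Var"
  interpret T: coeff_hom ?T by (rule Ce.substitute_hom)
  have lookT: "Poly_Mapping.lookup (?T F) m = ?e (Poly_Mapping.lookup F m)" for F m
    unfolding substitute_def[of "\<lambda>g. Const (?e g)"] mon_var
    by (simp add: mult_single lookup_sum lookup_single when_def in_keys_iff e.hom_zero)
  have ent: "?e (universal_line u v r w) = M r w" for r w
    using uv M by (auto simp: universal_line_def normalized_at_def e.hom_zero e.hom_one phi.substitute_single one)
  have "?T (restrict_to_line Const (universal_line u v) f) = restrict_to_line \<phi> M f" for f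
    unfolding restrict_to_line_def T.hom_substitute
    by (simp add: Ce.substitute_sum Ce.substitute_mult Ce.substitute_single e.hom_one ent phi.substitute_single)
  then have "Poly_Mapping.lookup (restrict_to_line \<phi> M f) m = ?e (Poly_Mapping.lookup (restrict_to_line Const (universal_line u v) f) m)" for f m
    by (metis lookT)
  moreover have "restrict_to_line \<phi> M f = 0 \<longleftrightarrow> (\<forall>m. Poly_Mapping.lookup (restrict_to_line \<phi> M f) m = 0)" for f
    by (metis lookup_zero poly_mapping_eqI)
  ultimately show ?thesis
    unfolding line_contained_def fano_equations_def by fastforce
qed

end

theory Submission
  imports Defs "HOL-Computational_Algebra.Fraction_Field"
begin

text \<open>
  In the chart where the columns \<open>u\<close> and \<open>v\<close> are normalized, a line on the
  surface is a family of linear forms \<open>\<alpha>\<^sub>w x + \<beta>\<^sub>w y\<close>, one for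
  each lattice point \<open>w\<close>, which satisfies every multiplicative relation between lattice
  points. Over the local ring of the Fano scheme at a point, only three shapes are possible: all
  forms except those at \<open>u\<close> and \<open>v\<close> vanish; or the polygon has lattice
  width one and, in coordinates \<open>(h, j)\<close> with \<open>h \<in> {0, 1}\<close>, the form
  at \<open>w\<close> is \<open>c\<^sup>j x\<close> or \<open>c\<^sup>j y\<close> for a single
  parameter \<open>c\<close>; or the polygon is a unimodular triangle. The essential input is that
  the semigroup at a vertex is generated by two elements. This holds because every irreducible
  element of the semigroup gives a tangent direction at the corresponding fixed point, whose local
  ring is regular of dimension at most two. In the three cases the local ring is generated, up to
  inverting units, by zero, one or two functions. These are algebraically independent, because the
  isolated lines, the rulings and the lines in the plane form families with that many parameters.
  Hence it is a localization at a prime ideal of \<open>K\<close>, \<open>K[t]\<close> or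
  \<open>K[s, t]\<close>, and therefore regular and reduced.
\<close>

section \<open>Localization\<close>

text \<open>Reducedness is part of the claim, so checking points over a field would not be enough:
  the classification of lines runs over the local ring, where a non-unit need not vanish. Hence each
  vanishing is won either by comparing coefficients in a relation or by cancelling a unit, and the
  pair (\<open>N\<close>, \<open>U\<close>) of kernel and units is all that is remembered of the
  ring. In lattice terms the segment from \<open>u\<close> to \<open>v\<close> is either an edge,
  and then the cases follow the self-intersection number 1, 0 or negative of the corresponding
  curve, or it crosses the polygon, and then only the ruling of a strip of width one survives. The
  relations used are binomials in at most four points; that the remaining equations impose nothing
  more is what the explicit families of lines prove. Both dimension bounds, for the stalk at a
  vertex and for the polynomial ring in two variables, come from one count: the (n+1)^3 products of
  three elements outgrow the quadratically many available coefficients, while four nested primes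
  forbid the resulting algebraic relation.\<close>

lemma UN_UN_const:
  assumes "x \<in> X" "y \<in> Y" "\<And>a s b t. (a, s) \<in> X \<Longrightarrow> (b, t) \<in> Y \<Longrightarrow> f a s b t = C"
  shows "(\<Union>(a, s)\<in>X. \<Union>(b, t)\<in>Y. f a s b t) = C"
proof -
  have "(case p of (a, s) \<Rightarrow> \<Union>(b, t)\<in>Y. f a s b t) = C" if "p \<in> X" for p
  proof -
    have "(\<Union>(b, t)\<in>Y. f (fst p) (snd p) b t) = (\<Union>q\<in>Y. C)"
      using assms(3)[of "fst p" "snd p"] that by (intro SUP_cong) (auto split: prod.splits)
    then show ?thesis using assms(2) by (auto simp: case_prod_beta)
  qed
  then have "(\<Union>(a, s)\<in>X. \<Union>(b, t)\<in>Y. f a s b t) = (\<Union>p\<in>X. C)"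
    by (intro SUP_cong) auto
  then show ?thesis using assms(1) by auto
qed

locale mult_closed_set = cring R for R (structure) +
  fixes M
  assumes M_carrier: "M \<subseteq> carrier R"
    and M_one: "\<one> \<in> M"
    and M_mult: "\<lbrakk>s \<in> M; t \<in> M\<rbrakk> \<Longrightarrow> s \<otimes> t \<in> M"
begin

lemma M_closed [simp]: "s \<in> M \<Longrightarrow> s \<in> carrier R"
  using M_carrier by blast

lemma fraction_self: "\<lbrakk>a \<in> carrier R; s \<in> M\<rbrakk> \<Longrightarrow> (a, s) \<in> fraction R M a s"
  unfolding fraction_def using M_one by auto

lemma fraction_eqI:
  assumes "a \<in> carrier R" "b \<in> carrier R" "s \<in> M" "t \<in> M" "w \<in> M"
    and "w \<otimes> (t \<otimes> a) = w \<otimes> (s \<otimes> b)"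
  shows "fraction R M a s = fraction R M b t"
proof -
  have *: "fraction R M a' s' \<subseteq> fraction R M b' t'"
    if h: "a' \<in> carrier R" "b' \<in> carrier R" "s' \<in> M" "t' \<in> M"
      "w \<otimes> (t' \<otimes> a') = w \<otimes> (s' \<otimes> b')" for a' b' s' t'
  proof (clarsimp simp: fraction_def)
    fix c r w'
    assume c: "c \<in> carrier R" "r \<in> M" "w' \<in> M" "w' \<otimes> (r \<otimes> a') = w' \<otimes> (s' \<otimes> c)"
    \<comment> \<open>The two witnesses and the middle denominator multiply to a witness for the
      composed equality: this is transitivity of equality of fractions.\<close>
    have "(w \<otimes> w' \<otimes> s') \<otimes> (r \<otimes> b') = (w' \<otimes> r) \<otimes> (w \<otimes> (s' \<otimes> b'))"
      using h(1-4) c(1-3) assms(5) by (simp add: m_ac)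
    also have "\<dots> = (w \<otimes> t') \<otimes> (w' \<otimes> (r \<otimes> a'))"
      unfolding h(5)[symmetric] using h(1-4) c(1-3) assms(5) by (simp add: m_ac)
    also have "\<dots> = (w \<otimes> w' \<otimes> s') \<otimes> (t' \<otimes> c)"
      unfolding c(4) using h(1-4) c(1-3) assms(5) by (simp add: m_ac)
    finally show "\<exists>w\<in>M. w \<otimes> (r \<otimes> b') = w \<otimes> (t' \<otimes> c)"
      using h c assms(5) by (intro bexI[of _ "w \<otimes> w' \<otimes> s'"]) (auto intro!: M_mult)
  qed
  show ?thesis using assms by (intro equalityI *) auto
qed

lemma fraction_eq_iff:
  assumes "a \<in> carrier R" "b \<in> carrier R" "s \<in> M" "t \<in> M"
  shows "fraction R M a s = fraction R M b t \<longleftrightarrow> (\<exists>w\<in>M. w \<otimes> (t \<otimes> a) = w \<otimes> (s \<otimes> b))"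
proof
  assume "fraction R M a s = fraction R M b t"
  then have "(b, t) \<in> fraction R M a s" using fraction_self assms by blast
  then show "\<exists>w\<in>M. w \<otimes> (t \<otimes> a) = w \<otimes> (s \<otimes> b)" by (auto simp: fraction_def)
qed (use fraction_eqI assms in blast)

text \<open>Witnesses for two changes of representatives multiply to a witness for the change of the
  product, so the double union in the definition ranges over one and the same class.\<close>

lemma localization_mult:
  assumes "a \<in> carrier R" "b \<in> carrier R" "s \<in> M" "t \<in> M"
  shows "fraction R M a s \<otimes>\<^bsub>localization R M\<^esub> fraction R M b t = fraction R M (a \<otimes> b) (s \<otimes> t)"
proof -
  have *: "fraction R M (a' \<otimes> b') (s' \<otimes> t') = fraction R M (a \<otimes> b) (s \<otimes> t)"
    if that': "(a', s') \<in> fraction R M a s" "(b', t') \<in> fraction R M b t" for a' b' s' t'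
  proof -
    obtain w where w: "a' \<in> carrier R" "s' \<in> M" "w \<in> M" "w \<otimes> (s' \<otimes> a) = w \<otimes> (s \<otimes> a')"
      using that'(1) by (auto simp: fraction_def)
    obtain z where z: "b' \<in> carrier R" "t' \<in> M" "z \<in> M" "z \<otimes> (t' \<otimes> b) = z \<otimes> (t \<otimes> b')"
      using that'(2) by (auto simp: fraction_def)
    have "(w \<otimes> z) \<otimes> ((s \<otimes> t) \<otimes> (a' \<otimes> b')) = (w \<otimes> (s \<otimes> a')) \<otimes> (z \<otimes> (t \<otimes> b'))"
      using assms w(1-3) z(1-3) by (simp add: m_ac)
    also have "\<dots> = (w \<otimes> z) \<otimes> ((s' \<otimes> t') \<otimes> (a \<otimes> b))"
      unfolding w(4)[symmetric] z(4)[symmetric] using assms w(1-3) z(1-3) by (simp add: m_ac)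
    finally show ?thesis
      using assms w(1-3) z(1-3)
      by (intro fraction_eqI[of _ _ _ _ "w \<otimes> z", OF _ _ _ _ _ sym]) (simp_all add: M_mult)
  qed
  have "(\<Union>(a, s)\<in>fraction R M a s. \<Union>(b, t)\<in>fraction R M b t. fraction R M (a \<otimes> b) (s \<otimes> t))
    = fraction R M (a \<otimes> b) (s \<otimes> t)"
    by (rule UN_UN_const[OF fraction_self fraction_self *]) (use assms in auto)
  then show ?thesis by (simp add: localization_def)
qed

lemma localization_add:
  assumes "a \<in> carrier R" "b \<in> carrier R" "s \<in> M" "t \<in> M"
  shows "fraction R M a s \<oplus>\<^bsub>localization R M\<^esub> fraction R M b t =
    fraction R M ((t \<otimes> a) \<oplus> (s \<otimes> b)) (s \<otimes> t)"
proof -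
  have *: "fraction R M ((t' \<otimes> a') \<oplus> (s' \<otimes> b')) (s' \<otimes> t') = fraction R M ((t \<otimes> a) \<oplus> (s \<otimes> b)) (s \<otimes> t)"
    if that': "(a', s') \<in> fraction R M a s" "(b', t') \<in> fraction R M b t" for a' b' s' t'
  proof -
    obtain w where w: "a' \<in> carrier R" "s' \<in> M" "w \<in> M" "w \<otimes> (s' \<otimes> a) = w \<otimes> (s \<otimes> a')"
      using that'(1) by (auto simp: fraction_def)
    obtain z where z: "b' \<in> carrier R" "t' \<in> M" "z \<in> M" "z \<otimes> (t' \<otimes> b) = z \<otimes> (t \<otimes> b')"
      using that'(2) by (auto simp: fraction_def)
    have "(w \<otimes> z) \<otimes> ((s \<otimes> t) \<otimes> ((t' \<otimes> a') \<oplus> (s' \<otimes> b'))) =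
      (z \<otimes> (t \<otimes> t')) \<otimes> (w \<otimes> (s \<otimes> a')) \<oplus> (w \<otimes> (s \<otimes> s')) \<otimes> (z \<otimes> (t \<otimes> b'))"
      using assms w(1-3) z(1-3) by (simp add: m_ac r_distr)
    also have "\<dots> = (w \<otimes> z) \<otimes> ((s' \<otimes> t') \<otimes> ((t \<otimes> a) \<oplus> (s \<otimes> b)))"
      unfolding w(4)[symmetric] z(4)[symmetric] using assms w(1-3) z(1-3) by (simp add: m_ac r_distr)
    finally show ?thesis
      using assms w(1-3) z(1-3)
      by (intro fraction_eqI[of _ _ _ _ "w \<otimes> z", OF _ _ _ _ _ sym]) (simp_all add: M_mult)
  qed
  have "(\<Union>(a, s)\<in>fraction R M a s. \<Union>(b, t)\<in>fraction R M b t. fraction R M ((t \<otimes> a) \<oplus> (s \<otimes> b)) (s \<otimes> t))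
    = fraction R M ((t \<otimes> a) \<oplus> (s \<otimes> b)) (s \<otimes> t)"
    by (rule UN_UN_const[OF fraction_self fraction_self *]) (use assms in auto)
  then show ?thesis by (simp add: localization_def)
qed

lemma fraction_in_carrier [simp]:
  "a \<in> carrier R \<Longrightarrow> s \<in> M \<Longrightarrow> fraction R M a s \<in> carrier (localization R M)"
  by (auto simp: localization_def)

lemma localization_one: "\<one>\<^bsub>localization R M\<^esub> = fraction R M \<one> \<one>"
  by (simp add: localization_def)

lemma localization_zero: "\<zero>\<^bsub>localization R M\<^esub> = fraction R M \<zero> \<one>"
  by (simp add: localization_def)

lemma localization_cases:
  assumes "x \<in> carrier (localization R M)"
  obtains a s where "a \<in> carrier R" "s \<in> M" "x = fraction R M a s"
  using assms by (auto simp: localization_def)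

lemma fraction_zero: "s \<in> M \<Longrightarrow> fraction R M \<zero> s = fraction R M \<zero> \<one>"
  using M_one by (intro fraction_eqI[of _ _ _ _ \<one>]) auto

lemma fraction_unit: "s \<in> M \<Longrightarrow> fraction R M s s = fraction R M \<one> \<one>"
  using M_one by (intro fraction_eqI[of _ _ _ _ \<one>]) auto

lemma cring_localization: "cring (localization R M)"
proof (rule cringI)
  let ?L = "localization R M"
  show "abelian_group ?L"
  proof (rule abelian_groupI)
    fix x y z assume "x \<in> carrier ?L" "y \<in> carrier ?L" "z \<in> carrier ?L"
    then obtain a s b t c r where *: "a \<in> carrier R" "s \<in> M" "x = fraction R M a s"
      "b \<in> carrier R" "t \<in> M" "y = fraction R M b t" "c \<in> carrier R" "r \<in> M" "z = fraction R M c r"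
      by (metis localization_cases)
    then show "x \<oplus>\<^bsub>?L\<^esub> y \<oplus>\<^bsub>?L\<^esub> z = x \<oplus>\<^bsub>?L\<^esub> (y \<oplus>\<^bsub>?L\<^esub> z)"
      by (simp add: localization_add M_mult) (simp add: m_ac r_distr a_ac)
    from * show "x \<oplus>\<^bsub>?L\<^esub> y = y \<oplus>\<^bsub>?L\<^esub> x" "x \<oplus>\<^bsub>?L\<^esub> y \<in> carrier ?L"
      by (simp_all add: localization_add m_ac a_ac M_mult)
    from * M_one show "\<zero>\<^bsub>?L\<^esub> \<oplus>\<^bsub>?L\<^esub> x = x" by (simp add: localization_add localization_zero)
    have "fraction R M (\<ominus> a) s \<oplus>\<^bsub>?L\<^esub> x = \<zero>\<^bsub>?L\<^esub>"
      using * by (simp add: localization_add localization_zero flip: r_distr) (simp add: l_neg fraction_zero M_mult)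
    then show "\<exists>y\<in>carrier ?L. y \<oplus>\<^bsub>?L\<^esub> x = \<zero>\<^bsub>?L\<^esub>"
      using * by (metis a_inv_closed fraction_in_carrier)
  qed (use M_one in \<open>simp add: localization_zero\<close>)
  show "Group.comm_monoid ?L"
  proof (rule comm_monoidI)
    fix x y z assume "x \<in> carrier ?L" "y \<in> carrier ?L" "z \<in> carrier ?L"
    then obtain a s b t c r where *: "a \<in> carrier R" "s \<in> M" "x = fraction R M a s"
      "b \<in> carrier R" "t \<in> M" "y = fraction R M b t" "c \<in> carrier R" "r \<in> M" "z = fraction R M c r"
      by (metis localization_cases)
    then show "x \<otimes>\<^bsub>?L\<^esub> y \<otimes>\<^bsub>?L\<^esub> z = x \<otimes>\<^bsub>?L\<^esub> (y \<otimes>\<^bsub>?L\<^esub> z)"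
      by (simp add: localization_mult M_mult m_ac)
    from * show "x \<otimes>\<^bsub>?L\<^esub> y = y \<otimes>\<^bsub>?L\<^esub> x" "x \<otimes>\<^bsub>?L\<^esub> y \<in> carrier ?L"
      by (simp_all add: localization_mult m_ac M_mult)
    from * M_one show "\<one>\<^bsub>?L\<^esub> \<otimes>\<^bsub>?L\<^esub> x = x" by (simp add: localization_mult localization_one)
  qed (use M_one in \<open>simp add: localization_one\<close>)
  fix x y z assume "x \<in> carrier ?L" "y \<in> carrier ?L" "z \<in> carrier ?L"
  then obtain a s b t c r where *: "a \<in> carrier R" "s \<in> M" "x = fraction R M a s"
    "b \<in> carrier R" "t \<in> M" "y = fraction R M b t" "c \<in> carrier R" "r \<in> M" "z = fraction R M c r"
    by (metis localization_cases)
  then show "(x \<oplus>\<^bsub>?L\<^esub> y) \<otimes>\<^bsub>?L\<^esub> z = x \<otimes>\<^bsub>?L\<^esub> z \<oplus>\<^bsub>?L\<^esub> y \<otimes>\<^bsub>?L\<^esub> z"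
    using M_one
    apply (simp add: localization_add localization_mult M_mult)
    apply (intro fraction_eqI[of _ _ _ _ \<one>])
    apply (simp_all add: M_mult)
    apply (simp add: m_ac r_distr)
    done
qed

end

section \<open>Linear algebra and counting behind algebraic relations\<close>

lemma homogeneous_system_nontrivial:
  fixes F :: "'i \<Rightarrow> 'e \<Rightarrow> 'k::field"
  assumes "finite E" "finite I" "card E < card I"
  shows "\<exists>c. (\<exists>i\<in>I. c i \<noteq> 0) \<and> (\<forall>e\<in>E. (\<Sum>i\<in>I. c i * F i e) = 0)"
  using assms
proof (induction E arbitrary: I F rule: finite_induct)
  case empty
  then obtain i where "i \<in> I" by fastforce
  then show ?case by (intro exI[of _ "\<lambda>_. 1"]) auto
next
  case (insert e E)
  show ?case
  proof (cases "\<forall>i\<in>I. F i e = 0")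
    case True
    obtain c where "\<exists>i\<in>I. c i \<noteq> 0" "\<forall>e\<in>E. (\<Sum>i\<in>I. c i * F i e) = 0"
      using insert.IH[of I F] insert.prems insert.hyps by auto
    with True show ?thesis by (intro exI[of _ c]) auto
  next
    case False
    \<comment> \<open>Gaussian elimination: equation \<open>e\<close> is solved for the unknown with
      index \<open>p\<close>, which subtracts a multiple of row \<open>p\<close> from every other
      row; \<open>d\<close> puts the value of that unknown back.\<close>
    then obtain p where p: "p \<in> I" "F p e \<noteq> 0" by auto
    define I' where "I' = I - {p}"
    have I': "finite I'" "I = insert p I'" "p \<notin> I'" using insert.prems p by (auto simp: I'_def)
    have "card E < card I'" using insert.prems insert.hyps I' by auto
    then obtain c where c: "\<exists>i\<in>I'. c i \<noteq> 0"
      "\<forall>x\<in>E. (\<Sum>i\<in>I'. c i * (F i x - F i e / F p e * F p x)) = 0"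
      using insert.IH[of I' "\<lambda>i x. F i x - F i e / F p e * F p x"] I' by auto
    define d where "d = (\<lambda>i. if i = p then - (\<Sum>i\<in>I'. c i * F i e) / F p e else c i)"
    have S: "(\<Sum>i\<in>I. d i * F i x) = (\<Sum>i\<in>I'. c i * F i x) - (\<Sum>i\<in>I'. c i * F i e) / F p e * F p x" for x
    proof -
      have "(\<Sum>i\<in>I. d i * F i x) = d p * F p x + (\<Sum>i\<in>I'. d i * F i x)"
        using I' by simp
      also have "(\<Sum>i\<in>I'. d i * F i x) = (\<Sum>i\<in>I'. c i * F i x)"
        using I' by (intro sum.cong) (auto simp: d_def)
      finally show ?thesis by (simp add: d_def)
    qed
    have "(\<Sum>i\<in>I'. c i * (F i x - F i e / F p e * F p x)) =
        (\<Sum>i\<in>I'. c i * F i x) - (\<Sum>i\<in>I'. c i * F i e) / F p e * F p x" for x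
      by (simp add: right_diff_distrib sum_subtractf sum_divide_distrib sum_distrib_right mult.assoc)
    then have "\<forall>x\<in>insert e E. (\<Sum>i\<in>I. d i * F i x) = 0"
      using c(2) p S by auto
    moreover have "\<exists>i\<in>I. d i \<noteq> 0"
      using c(1) I' by (auto simp: d_def)
    ultimately show ?thesis by blast
  qed
qed

text \<open>Compares the (n+1)^3 monomials in three elements with exponents at most n with the
  number of coefficients they can have in two variables.\<close>

lemma cubic_exceeds_square:
  fixes D :: nat
  obtains n where "(D * n + 1)\<^sup>2 < (n + 1) ^ 3"
proof
  define n where "n = (D + 1)\<^sup>2"
  have "D * n + 1 \<le> (D + 1) * (n + 1)" by (simp add: algebra_simps)
  then have "(D * n + 1)\<^sup>2 \<le> ((D + 1) * (n + 1))\<^sup>2" by (rule power_mono) simp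
  also have "\<dots> = n * (n + 1)\<^sup>2" by (simp only: power_mult_distrib n_def)
  also have "\<dots> < (n + 1) * (n + 1)\<^sup>2" by simp
  finally show "(D * n + 1)\<^sup>2 < (n + 1) ^ 3" by (simp only: power3_eq_cube power2_eq_square mult.assoc)
qed

section \<open>Chains of graded primes\<close>

text \<open>\<open>C i n\<close> is the degree n part of the i-th of four nested primes. Arguing
  degree by degree covers two situations: with constant \<open>G\<close> this is an ordinary chain
  of primes in a ring, and with numerators over powers of a common denominator it is a chain in a
  homogeneous localization.\<close>

locale graded_prime_chain =
  fixes G :: "nat \<Rightarrow> 't::comm_ring_1 set" and C :: "nat \<Rightarrow> nat \<Rightarrow> 't set"
  assumes G_zero: "0 \<in> G n" and G_one: "1 \<in> G 0"
    and G_add: "\<lbrakk>x \<in> G n; y \<in> G n\<rbrakk> \<Longrightarrow> x + y \<in> G n"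
    and G_mult: "\<lbrakk>x \<in> G m; y \<in> G n\<rbrakk> \<Longrightarrow> x * y \<in> G (m + n)"
    and C_zero: "0 \<in> C i n"
    and C_diff: "\<lbrakk>i \<le> 3; x \<in> C i n; y \<in> C i n\<rbrakk> \<Longrightarrow> x - y \<in> C i n"
    and C_mult: "\<lbrakk>i \<le> 3; x \<in> C i m; y \<in> G n\<rbrakk> \<Longrightarrow> x * y \<in> C i (m + n)"
    and C_prime: "\<lbrakk>i \<le> 3; x \<in> G m; y \<in> G n; x * y \<in> C i (m + n)\<rbrakk> \<Longrightarrow> x \<in> C i m \<or> y \<in> C i n"
    and C_mono: "i < 3 \<Longrightarrow> C i n \<subseteq> C (Suc i) n"
begin

lemma G_power: "a \<in> G 1 \<Longrightarrow> a ^ n \<in> G n"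
  using G_mult[of a 1] by (induction n) (auto simp: G_one)

lemma G_sum: "(\<And>x. x \<in> X \<Longrightarrow> f x \<in> G n) \<Longrightarrow> sum f X \<in> G n"
  by (induction X rule: infinite_finite_induct) (auto simp: G_zero G_add)

lemma power_cancel:
  assumes "i \<le> 3" "a \<in> G 1" "a \<notin> C i 1" "K \<in> G m" "a ^ j * K \<in> C i (j + m)"
  shows "K \<in> C i m"
  using assms(5)
proof (induction j)
  case (Suc j)
  have "a * (a ^ j * K) \<in> C i (1 + (j + m))" using Suc.prems by (simp add: mult.assoc)
  moreover have "a ^ j * K \<in> G (j + m)" using assms by (intro G_mult G_power)
  ultimately show ?case using Suc.IH C_prime[of i a 1 "a ^ j * K" "j + m"] assms by blast
qed simp

text \<open>The power \<open>a ^ j0\<close> divides out because \<open>a\<close> lies outside the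
  i-th prime. Modulo the next prime, which contains \<open>a\<close>, only the coefficient of the
  lowest power remains.\<close>

lemma lowest_term:
  assumes i: "i < 3" and a: "a \<in> G 1" "a \<notin> C i 1" "a \<in> C (Suc i) 1"
    and H: "\<And>j. j \<le> n \<Longrightarrow> H j \<in> G (N - j)" and n: "n \<le> N" "j0 \<le> n"
    and low: "\<And>j. j < j0 \<Longrightarrow> H j = 0"
    and sum: "(\<Sum>j\<le>n. a ^ j * H j) \<in> C i N"
  shows "H j0 \<in> C (Suc i) (N - j0)"
proof -
  define K where "K = (\<Sum>j\<in>{j0..n}. a ^ (j - j0) * H j)"
  define K' where "K' = (\<Sum>j\<in>{Suc j0..n}. a ^ (j - Suc j0) * H j)"
  have "(\<Sum>j\<le>n. a ^ j * H j) = (\<Sum>j\<in>{j0..n}. a ^ j * H j)"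
    using low by (intro sum.mono_neutral_right) auto
  also have "\<dots> = a ^ j0 * K"
    unfolding K_def sum_distrib_left
    by (intro sum.cong) (auto simp: mult.assoc[symmetric] power_add[symmetric])
  finally have K: "a ^ j0 * K \<in> C i (j0 + (N - j0))" using sum n by simp
  have summand: "a ^ (j - m) * H j \<in> G (N - m)" if "m \<le> j" "j \<le> n" for j m
    using G_mult[OF G_power[OF a(1), of "j - m"] H[of j]] that n by simp
  have "K \<in> G (N - j0)"
    unfolding K_def using summand by (intro G_sum) auto
  then have "K \<in> C i (N - j0)"
    using K power_cancel[of i a K "N - j0" j0] a i by simp
  then have "K \<in> C (Suc i) (N - j0)" using C_mono i by blast
  moreover have "a * K' \<in> C (Suc i) (N - j0)"
  proof (cases "j0 = n")
    case True then show ?thesis by (simp add: K'_def C_zero)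
  next
    case False
    have "K' \<in> G (N - Suc j0)" unfolding K'_def using summand by (intro G_sum) auto
    then show ?thesis using C_mult[of "Suc i" a 1 K' "N - Suc j0"] a i n False by (simp add: Suc_diff_Suc)
  qed
  moreover have "K = H j0 + a * K'"
  proof -
    have "K = H j0 + (\<Sum>j\<in>{Suc j0..n}. a ^ (j - j0) * H j)"
      unfolding K_def using n by (subst sum.atLeast_Suc_atMost) auto
    also have "(\<Sum>j\<in>{Suc j0..n}. a ^ (j - j0) * H j) = a * K'"
      unfolding K'_def sum_distrib_left
      by (intro sum.cong) (auto simp: mult.assoc[symmetric] power_Suc[symmetric] Suc_diff_Suc simp del: power_Suc)
    finally show ?thesis .
  qed
  ultimately show ?thesis using C_diff[of "Suc i" K "N - j0" "a * K'"] i by simp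
qed

text \<open>Along a chain of four primes, three successive elements are algebraically independent:
  a relation would put its lexicographically lowest coefficient into the last prime.\<close>

theorem no_algebraic_relation:
  fixes f :: "nat \<Rightarrow> nat \<Rightarrow> nat \<Rightarrow> 'k::zero"
  assumes a: "\<And>i. i < 3 \<Longrightarrow> a i \<in> G 1" "\<And>i. i < 3 \<Longrightarrow> a i \<notin> C i 1" "\<And>i. i < 3 \<Longrightarrow> a i \<in> C (Suc i) 1"
    and s: "s \<in> G 1" "\<And>m. s ^ m \<notin> C 3 m"
    and \<kappa>: "\<And>c. \<kappa> c \<in> G 0" "\<kappa> 0 = 0" "\<And>c. c \<noteq> 0 \<Longrightarrow> \<exists>d\<in>G 0. \<kappa> c * d = 1"
    and rel: "(\<Sum>i\<le>n. \<Sum>j\<le>n. \<Sum>k\<le>n. \<kappa> (f i j k) * (a 0 ^ i * a 1 ^ j * a 2 ^ k * s ^ (3 * n - i - j - k))) = 0"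
    and ijk: "i \<le> n" "j \<le> n" "k \<le> n"
  shows "f i j k = 0"
proof (rule ccontr)
  assume nz: "f i j k \<noteq> 0"
  define i0 where "i0 = (LEAST i. i \<le> n \<and> (\<exists>j\<le>n. \<exists>k\<le>n. f i j k \<noteq> 0))"
  have i0: "i0 \<le> n" "\<exists>j\<le>n. \<exists>k\<le>n. f i0 j k \<noteq> 0"
    using LeastI[of "\<lambda>i. i \<le> n \<and> (\<exists>j\<le>n. \<exists>k\<le>n. f i j k \<noteq> 0)" i] nz ijk unfolding i0_def by blast+
  have i0_min: "f i j k = 0" if "i < i0" "j \<le> n" "k \<le> n" for i j k
    using not_less_Least[of i] that i0(1) unfolding i0_def by fastforce
  define j0 where "j0 = (LEAST j. j \<le> n \<and> (\<exists>k\<le>n. f i0 j k \<noteq> 0))"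
  have j0: "j0 \<le> n" "\<exists>k\<le>n. f i0 j0 k \<noteq> 0"
    using LeastI_ex[of "\<lambda>j. j \<le> n \<and> (\<exists>k\<le>n. f i0 j k \<noteq> 0)"] i0 unfolding j0_def by blast+
  have j0_min: "f i0 j k = 0" if "j < j0" "k \<le> n" for j k
    using not_less_Least[of j] that j0(1) unfolding j0_def by fastforce
  define k0 where "k0 = (LEAST k. k \<le> n \<and> f i0 j0 k \<noteq> 0)"
  have k0: "k0 \<le> n" "f i0 j0 k0 \<noteq> 0"
    using LeastI_ex[of "\<lambda>k. k \<le> n \<and> f i0 j0 k \<noteq> 0"] j0 unfolding k0_def by blast+
  have k0_min: "f i0 j0 k = 0" if "k < k0" for k
    using not_less_Least[of k] that k0(1) unfolding k0_def by fastforce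
  \<comment> \<open>The relation is a polynomial in \<open>a 0\<close> with coefficients
    \<open>H0\<close>, each of which is a polynomial in \<open>a 1\<close> with coefficients
    \<open>H1\<close>, each of which is a polynomial in \<open>a 2\<close> with coefficients
    \<open>H2\<close>. The exponent of \<open>s\<close> completes every term to degree 3n, so
    \<open>lowest_term\<close> applies three times in a row.\<close>
  define H2 where "H2 i j k = \<kappa> (f i j k) * s ^ (3 * n - i - j - k)" for i j k
  define H1 where "H1 i j = (\<Sum>k\<le>n. a 2 ^ k * H2 i j k)" for i j
  define H0 where "H0 i = (\<Sum>j\<le>n. a 1 ^ j * H1 i j)" for i
  have H2: "H2 i j k \<in> G (3 * n - i - j - k)" for i j k
    using G_mult[OF \<kappa>(1) G_power[OF s(1)], of "f i j k"] by (simp add: H2_def)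
  have H1: "H1 i j \<in> G (3 * n - i - j)" if "i \<le> n" "j \<le> n" for i j
    unfolding H1_def
  proof (intro G_sum)
    fix k assume "k \<in> {..n}"
    then have "k + (3 * n - i - j - k) = 3 * n - i - j" using that by auto
    moreover have "a 2 ^ k * H2 i j k \<in> G (k + (3 * n - i - j - k))"
      by (intro G_mult G_power a H2) simp
    ultimately show "a 2 ^ k * H2 i j k \<in> G (3 * n - i - j)" by simp
  qed
  have H0: "H0 i \<in> G (3 * n - i)" if "i \<le> n" for i
    unfolding H0_def
  proof (intro G_sum)
    fix j assume j: "j \<in> {..n}"
    then have "j + (3 * n - i - j) = 3 * n - i" using that by auto
    moreover have "a 1 ^ j * H1 i j \<in> G (j + (3 * n - i - j))"
      using j that by (intro G_mult G_power a H1) simp_all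
    ultimately show "a 1 ^ j * H1 i j \<in> G (3 * n - i)" by simp
  qed
  have "(\<Sum>i\<le>n. a 0 ^ i * H0 i) = 0"
    unfolding rel[symmetric] H0_def H1_def H2_def sum_distrib_left
    by (intro sum.cong) (simp_all add: mult_ac)
  then have "(\<Sum>i\<le>n. a 0 ^ i * H0 i) \<in> C 0 (3 * n)" by (simp add: C_zero)
  moreover have "H0 i = 0" if "i < i0" for i
    using that i0_min by (simp add: H0_def H1_def H2_def \<kappa>)
  ultimately have "H0 i0 \<in> C 1 (3 * n - i0)"
    using lowest_term[of 0 "a 0" n H0 "3 * n" i0] a[of 0] H0 i0 by simp
  moreover have "H1 i0 j = 0" if "j < j0" for j
    using that j0_min by (simp add: H1_def H2_def \<kappa>)
  ultimately have "H1 i0 j0 \<in> C 2 (3 * n - i0 - j0)"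
    using lowest_term[of 1 "a 1" n "H1 i0" "3 * n - i0" j0] a[of 1] H1[of i0] i0 j0
    by (simp add: H0_def numeral_2_eq_2)
  moreover have "H2 i0 j0 k = 0" if "k < k0" for k
    using that k0_min by (simp add: H2_def \<kappa>)
  ultimately have "H2 i0 j0 k0 \<in> C 3 (3 * n - i0 - j0 - k0)"
    using lowest_term[of 2 "a 2" n "H2 i0 j0" "3 * n - i0 - j0" k0] a[of 2] H2[of i0 j0] i0 j0 k0
    by (simp add: H1_def numeral_3_eq_3)
  \<comment> \<open>A nonzero constant is invertible in degree 0, so a power of \<open>s\<close>
    itself would have to lie in the last prime.\<close>
  moreover obtain d where d: "d \<in> G 0" "\<kappa> (f i0 j0 k0) * d = 1" using \<kappa>(3) k0(2) by blast
  ultimately have "H2 i0 j0 k0 * d \<in> C 3 (3 * n - i0 - j0 - k0)"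
    using C_mult[of 3 "H2 i0 j0 k0" _ d 0] by simp
  moreover have "H2 i0 j0 k0 * d = s ^ (3 * n - i0 - j0 - k0)"
  proof -
    have "H2 i0 j0 k0 * d = (\<kappa> (f i0 j0 k0) * d) * s ^ (3 * n - i0 - j0 - k0)"
      by (simp only: H2_def mult_ac)
    then show ?thesis using d(2) by simp
  qed
  ultimately show False using s(2) by simp
qed

end

section \<open>Regular primes of polynomial rings\<close>

text \<open>A ring as a module over itself: \<open>self.subspace\<close> means ideal and
  \<open>self.span\<close> means generated ideal. The rule \<open>scale_scale\<close> is then
  associativity of multiplication, which should not be a rewrite rule.\<close>

interpretation self: Modules.module "(*) :: 'a::comm_ring_1 \<Rightarrow> 'a \<Rightarrow> 'a"
  by unfold_locales (simp_all add: algebra_simps)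

declare self.scale_scale [simp del]

definition prime_set :: "'a::comm_ring_1 set \<Rightarrow> bool" where
  "prime_set p \<longleftrightarrow> self.subspace p \<and> 1 \<notin> p \<and> (\<forall>a b. a * b \<in> p \<longrightarrow> a \<in> p \<or> b \<in> p)"

definition prime_chain :: "'a::comm_ring_1 set \<Rightarrow> nat \<Rightarrow> (nat \<Rightarrow> 'a set) \<Rightarrow> bool" where
  "prime_chain p n c \<longleftrightarrow> (\<forall>i\<le>n. prime_set (c i) \<and> c i \<subseteq> p) \<and> (\<forall>i<n. c i \<subset> c (Suc i))"

text \<open>\<open>regular_prime p n\<close>: the localization at \<open>p\<close> has dimension \<open>n\<close>, and its maximal ideal is
  generated by \<open>n\<close> elements.\<close>

definition regular_prime :: "'a::comm_ring_1 set \<Rightarrow> nat \<Rightarrow> bool" where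
  "regular_prime p n \<longleftrightarrow>
     (\<exists>B\<subseteq>p. finite B \<and> card B = n \<and> (\<forall>g\<in>p. \<exists>s. s \<notin> p \<and> s * g \<in> self.span B)) \<and>
     (\<exists>c. prime_chain p n c) \<and> \<not> (\<exists>c. prime_chain p (Suc n) c)"

definition noetherian_type :: "'a::comm_ring_1 itself \<Rightarrow> bool" where
  "noetherian_type _ \<longleftrightarrow>
     (\<forall>I::'a set. self.subspace I \<longrightarrow> (\<exists>B. finite B \<and> B \<subseteq> I \<and> I \<subseteq> self.span B))"

lemma prime_setD:
  assumes "prime_set p"
  shows "self.subspace p" "1 \<notin> p" "a * b \<in> p \<Longrightarrow> a \<in> p \<or> b \<in> p" "0 \<in> p"
    "a \<in> p \<Longrightarrow> b \<in> p \<Longrightarrow> a + b \<in> p" "a \<in> p \<Longrightarrow> b \<in> p \<Longrightarrow> a - b \<in> p"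
    "a \<in> p \<Longrightarrow> b * a \<in> p" "a \<in> p \<Longrightarrow> a * b \<in> p"
  using assms self.subspace_0 self.subspace_add self.subspace_diff self.subspace_scale
  by (auto simp: prime_set_def mult.commute)

lemma noetherian_field: "noetherian_type TYPE('k::field)"
  unfolding noetherian_type_def
proof (intro allI impI)
  fix I :: "'k set" assume I: "self.subspace I"
  show "\<exists>B. finite B \<and> B \<subseteq> I \<and> I \<subseteq> self.span B"
  proof (cases "I = {0}")
    case False
    then obtain x where x: "x \<in> I" "x \<noteq> 0" using self.subspace_0[OF I] by blast
    have "y \<in> self.span {x}" for y
      using self.span_scale[OF self.span_base[of x "{x}"], of "y / x"] x by simp
    with x show ?thesis by (intro exI[of _ "{x}"]) auto
  qed (auto intro: exI[of _ "{0}"])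
qed

text \<open>Hilbert's basis theorem, with one finite set of generators for the leading coefficients and
  one for the coefficients in each of the finitely many low degrees.\<close>

theorem noetherian_poly:
  assumes "noetherian_type TYPE('a::comm_ring_1)"
  shows "noetherian_type TYPE('a poly)"
  unfolding noetherian_type_def
proof (intro allI impI)
  fix I :: "'a poly set" assume I: "self.subspace I"
  note I_simps = self.subspace_0[OF I] self.subspace_add[OF I] self.subspace_scale[OF I] self.subspace_sum[OF I]
  have fg: "\<exists>B. finite B \<and> B \<subseteq> J \<and> J \<subseteq> self.span B" if "self.subspace J" for J :: "'a set"
    using assms that by (auto simp: noetherian_type_def)
  \<comment> \<open>Since \<open>d\<close> is only a bound for the degree, zero belongs to the set,
    and a sum of leading coefficients needs no case distinction on cancellation: both polynomials
    are shifted to degree \<open>d + e\<close>.\<close>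
  define LC where "LC = {c. \<exists>f\<in>I. \<exists>d. degree f \<le> d \<and> coeff f d = c}"
  define LCd where "LCd d = {c. \<exists>f\<in>I. degree f \<le> d \<and> coeff f d = c}" for d
  have "self.subspace LC"
  proof (rule self.subspaceI)
    show "0 \<in> LC" using I_simps(1) unfolding LC_def by (auto intro!: bexI[of _ 0])
    fix x y assume "x \<in> LC" "y \<in> LC"
    then obtain f d g e where *: "f \<in> I" "degree f \<le> d" "coeff f d = x" "g \<in> I" "degree g \<le> e" "coeff g e = y"
      by (auto simp: LC_def)
    let ?h = "monom 1 e * f + monom 1 d * g"
    have "?h \<in> I" using * I_simps by blast
    moreover have "degree ?h \<le> d + e"
      using * by (intro degree_add_le order.trans[OF degree_mult_le]) (simp_all add: degree_monom_eq)
    moreover have "coeff ?h (d + e) = x + y" using * by (simp add: coeff_monom_mult)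
    ultimately show "x + y \<in> LC"
      unfolding LC_def mem_Collect_eq by (intro bexI[of _ ?h] exI[of _ "d + e"] conjI)
  next
    fix c x assume "x \<in> LC"
    then obtain f d where *: "f \<in> I" "degree f \<le> d" "coeff f d = x" by (auto simp: LC_def)
    have "[:c:] * f \<in> I" "degree ([:c:] * f) \<le> d" "coeff ([:c:] * f) d = c * x"
      using * I_simps(3)[of f "[:c:]"] degree_smult_le[of c f] by auto
    then show "c * x \<in> LC" unfolding LC_def by blast
  qed
  then obtain C where C: "finite C" "C \<subseteq> LC" "LC \<subseteq> self.span C" using fg by blast
  then have "\<forall>c\<in>C. \<exists>F. fst F \<in> I \<and> degree (fst F) \<le> snd F \<and> coeff (fst F) (snd F) = c"
    by (fastforce simp: LC_def)
  then obtain F where F: "\<And>c. c \<in> C \<Longrightarrow> fst (F c) \<in> I \<and> degree (fst (F c)) \<le> snd (F c) \<and> coeff (fst (F c)) (snd (F c)) = c"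
    by metis
  obtain D where D: "\<And>c. c \<in> C \<Longrightarrow> snd (F c) \<le> D"
    using C(1) by (metis finite_imageI finite_nat_set_iff_bounded_le imageI)
  have "self.subspace (LCd d)" for d
  proof (rule self.subspaceI)
    show "0 \<in> LCd d" using I_simps(1) unfolding LCd_def by (auto intro!: bexI[of _ 0])
    fix x y assume "x \<in> LCd d" "y \<in> LCd d"
    then obtain f g where "f \<in> I" "degree f \<le> d" "coeff f d = x" "g \<in> I" "degree g \<le> d" "coeff g d = y"
      by (auto simp: LCd_def)
    then have "f + g \<in> I" "degree (f + g) \<le> d" "coeff (f + g) d = x + y"
      using I_simps degree_add_le by auto
    then show "x + y \<in> LCd d" unfolding LCd_def by blast
  next
    fix d c x assume "x \<in> LCd d"
    then obtain f where *: "f \<in> I" "degree f \<le> d" "coeff f d = x" by (auto simp: LCd_def)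
    have "[:c:] * f \<in> I" "degree ([:c:] * f) \<le> d" "coeff ([:c:] * f) d = c * x"
      using * I_simps(3)[of f "[:c:]"] degree_smult_le[of c f] by auto
    then show "c * x \<in> LCd d" unfolding LCd_def by blast
  qed
  then have "\<forall>d. \<exists>C. finite C \<and> C \<subseteq> LCd d \<and> LCd d \<subseteq> self.span C" using fg by blast
  then obtain Cd where Cd: "\<And>d. finite (Cd d)" "\<And>d. Cd d \<subseteq> LCd d" "\<And>d. LCd d \<subseteq> self.span (Cd d)" by metis
  then have "\<forall>d. \<forall>c\<in>Cd d. \<exists>f\<in>I. degree f \<le> d \<and> coeff f d = c" by (fastforce simp: LCd_def)
  then obtain Fd where Fd: "\<And>d c. c \<in> Cd d \<Longrightarrow> Fd d c \<in> I \<and> degree (Fd d c) \<le> d \<and> coeff (Fd d c) d = c"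
    by metis
  define B where "B = (fst \<circ> F) ` C \<union> (\<Union>d\<le>D. Fd d ` Cd d)"
  have B: "finite B" "B \<subseteq> I" using C Cd F Fd by (auto simp: B_def)
  have spanB: "f \<in> self.span B" if "f \<in> I" for f
    using that
  proof (induction "degree f" arbitrary: f rule: less_induct)
    case less
    \<comment> \<open>One division step: the generators are shifted to the degree of
      \<open>f\<close> and combined so that the coefficient in that degree cancels. The difference
      lies in the ideal and has smaller degree or is zero.\<close>
    have reduce: "f \<in> self.span B"
      if S: "finite S" "lead_coeff f \<in> self.span S" "\<And>c. c \<in> S \<Longrightarrow> g c \<in> B \<and> degree (g c) \<le> e c \<and> e c \<le> degree f \<and> coeff (g c) (e c) = c"
      for S :: "'a set" and g e
    proof -
      obtain r where r: "lead_coeff f = (\<Sum>c\<in>S. r c * c)"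
        using S(1,2) by (auto simp: self.span_finite)
      let ?h = "\<Sum>c\<in>S. monom (r c) (degree f - e c) * g c"
      have h: "?h \<in> self.span B" using S(3) by (intro self.span_sum self.span_scale self.span_base) auto
      then have "?h \<in> I" using self.span_minimal[OF B(2) I] by blast
      then have fh: "f - ?h \<in> I" using less.prems self.subspace_diff[OF I] by blast
      have "degree (monom (r c) (degree f - e c) * g c) \<le> degree f" if "c \<in> S" for c
        using S(3)[OF that] degree_mult_le[of "monom (r c) (degree f - e c)" "g c"]
          degree_monom_le[of "r c" "degree f - e c"] by linarith
      then have "degree ?h \<le> degree f" by (rule degree_sum_le[OF S(1)])
      then have le: "degree (f - ?h) \<le> degree f" by (simp add: degree_diff_le)
      have "coeff (monom (r c) (degree f - e c) * g c) (degree f) = r c * c" if "c \<in> S" for c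
        using S(3)[OF that] by (simp add: coeff_monom_mult)
      then have "coeff (f - ?h) (degree f) = 0" by (simp add: coeff_sum r)
      then have "f - ?h = 0 \<or> degree (f - ?h) < degree f"
        using le by (metis leading_coeff_0_iff le_neq_implies_less)
      then have "f - ?h \<in> self.span B" using less.hyps[OF _ fh] self.span_zero[of B] by auto
      then show ?thesis using self.span_add[OF _ h] by fastforce
    qed
    show ?case
    proof (cases "degree f \<le> D")
      case True
      have "lead_coeff f \<in> self.span (Cd (degree f))"
        using Cd(3)[of "degree f"] less.prems by (auto simp: LCd_def)
      then show ?thesis
        using reduce[of "Cd (degree f)" "Fd (degree f)" "\<lambda>_. degree f"] Cd(1) Fd True by (auto simp: B_def)
    next
      case False
      have "lead_coeff f \<in> LC" using less.prems by (auto simp: LC_def)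
      then have "lead_coeff f \<in> self.span C" using C by auto
      then show ?thesis
        using reduce[of C "fst \<circ> F" "snd \<circ> F"] C F D False by (fastforce simp: B_def)
    qed
  qed
  then show "\<exists>B. finite B \<and> B \<subseteq> I \<and> I \<subseteq> self.span B" using B by blast
qed

lemma regular_prime_zero:
  fixes p :: "'a::comm_ring_1 set"
  assumes "prime_set p" "p = {0}"
  shows "regular_prime p 0"
  unfolding regular_prime_def
proof (intro conjI)
  show "\<exists>B\<subseteq>p. finite B \<and> card B = 0 \<and> (\<forall>g\<in>p. \<exists>s. s \<notin> p \<and> s * g \<in> self.span B)"
    using assms by (intro exI[of _ "{}"]) (auto intro!: exI[of _ 1])
  show "\<exists>c. prime_chain p 0 c"
    using assms by (intro exI[of _ "\<lambda>_. p"]) (auto simp: prime_chain_def)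
  show "\<not> (\<exists>c. prime_chain p (Suc 0) c)"
  proof (intro notI, elim exE)
    fix c assume c: "prime_chain p (Suc 0) c"
    then have "c 0 \<subset> c 1" "c 1 \<subseteq> {0}" "prime_set (c 0)" using assms by (auto simp: prime_chain_def)
    then show False using prime_setD(4)[of "c 0"] by auto
  qed
qed

lemma zero_prime: "prime_set {0 :: 'a::idom}"
  by (simp add: prime_set_def)

text \<open>The descent along \<open>\<delta>\<close> replaces unique factorization.\<close>

lemma regular_prime_principal:
  fixes p :: "'a::idom set" and \<delta> :: "'a \<Rightarrow> nat"
  assumes p: "prime_set p" and f: "f \<in> p" "f \<noteq> 0"
    and div: "\<And>g. \<lbrakk>g \<in> p; g \<noteq> 0\<rbrakk> \<Longrightarrow> \<exists>s h. s \<notin> p \<and> s * g = f * h \<and> \<delta> h < \<delta> g"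
  shows "regular_prime p 1"
  unfolding regular_prime_def
proof (intro conjI)
  have "\<exists>s. s \<notin> p \<and> s * g \<in> self.span {f}" if gp: "g \<in> p" for g
  proof (cases "g = 0")
    case True then show ?thesis using prime_setD(2)[OF p] self.span_zero by (intro exI[of _ 1]) auto
  next
    case False
    then obtain s h where sh: "s \<notin> p" "s * g = f * h" using div[OF gp] by blast
    have "s * g \<in> self.span {f}"
      unfolding sh(2) mult.commute[of f h] by (intro self.span_scale self.span_base) simp
    then show ?thesis using sh(1) by blast
  qed
  then show "\<exists>B\<subseteq>p. finite B \<and> card B = 1 \<and> (\<forall>g\<in>p. \<exists>s. s \<notin> p \<and> s * g \<in> self.span B)"
    using f by (intro exI[of _ "{f}"]) auto
  show "\<exists>c. prime_chain p 1 c"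
    using p f zero_prime prime_setD(4)[OF p]
    by (intro exI[of _ "\<lambda>i. if i = 0 then {0} else p"]) (auto simp: prime_chain_def)
  show "\<not> (\<exists>c. prime_chain p (Suc 1) c)"
  proof (intro notI, elim exE)
    fix c assume c: "prime_chain p (Suc 1) c"
    have cs: "c 0 \<subset> c 1" "c 1 \<subset> c 2" "c 2 \<subseteq> p" "prime_set (c 0)" "prime_set (c 1)"
      using c unfolding prime_chain_def by (auto simp: numeral_2_eq_2)
    have sp: "s \<notin> c 1" if "s \<notin> p" for s using that cs by blast
    \<comment> \<open>If \<open>f\<close> lay in \<open>c 1\<close>, then
      \<open>s * g = f * h\<close> with \<open>s\<close> outside \<open>c 1\<close> would put every
      \<open>g\<close> of \<open>c 2\<close> into \<open>c 1\<close>.\<close>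
    have "f \<notin> c 1"
    proof
      assume f1: "f \<in> c 1"
      have "g \<in> c 1" if "g \<in> c 2" for g
      proof (cases "g = 0")
        case False
        then obtain s h where sh: "s \<notin> p" "s * g = f * h" using div[of g] \<open>g \<in> c 2\<close> cs(3) by blast
        have "s * g \<in> c 1" unfolding sh(2) using prime_setD(8)[OF cs(5) f1] .
        then show ?thesis using prime_setD(3)[OF cs(5)] sp[OF sh(1)] by blast
      qed (use prime_setD(4)[OF cs(5)] in simp)
      then show False using cs by blast
    qed
    \<comment> \<open>As \<open>f\<close> is outside the prime \<open>c 1\<close>, the cofactor
      \<open>h\<close> of an element of \<open>c 1\<close> lies in \<open>c 1\<close> again. This
      contradicts the choice of a nonzero element with least \<open>\<delta>\<close>.\<close>
    obtain g0 where "g0 \<in> c 1" "g0 \<notin> c 0" using cs(1) by blast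
    then have "\<exists>g\<in>c 1. g \<noteq> 0" using prime_setD(4)[OF cs(4)] by metis
    then obtain g where g: "g \<in> c 1" "g \<noteq> 0" and min: "\<And>h. h \<in> c 1 \<Longrightarrow> h \<noteq> 0 \<Longrightarrow> \<delta> g \<le> \<delta> h"
      using exists_least_iff[of "\<lambda>n. \<exists>g\<in>c 1. g \<noteq> 0 \<and> \<delta> g = n"] by (metis not_less)
    obtain s h where h: "s \<notin> p" "s * g = f * h" "\<delta> h < \<delta> g" using div[of g] g cs by blast
    have "f * h \<in> c 1" using h(2) g prime_setD(7)[OF cs(5)] by metis
    then have "h \<in> c 1" using prime_setD(3)[OF cs(5)] \<open>f \<notin> c 1\<close> by blast
    moreover have "s \<noteq> 0" using h prime_setD(4)[OF p] by blast
    then have "h \<noteq> 0" using h g by (metis mult_zero_right no_zero_divisors)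
    ultimately have "\<delta> g \<le> \<delta> h" by (rule min)
    then show False using h(3) by simp
  qed
qed

text \<open>Nonzero constants lie outside \<open>p\<close> and so behave like units there.
  Pseudo-division by an element of least degree therefore leaves no remainder, and as its degree is
  positive, the degree itself serves as the descent.\<close>

lemma regular_prime_poly:
  fixes p :: "'a::idom poly set"
  assumes p: "prime_set p" and c: "\<And>c. [:c:] \<in> p \<Longrightarrow> c = 0" and nz: "p \<noteq> {0}"
  shows "regular_prime p 1"
proof -
  have "\<exists>g\<in>p. g \<noteq> 0" using nz prime_setD(4)[OF p] by blast
  then obtain f where f: "f \<in> p" "f \<noteq> 0" and min: "\<And>h. h \<in> p \<Longrightarrow> h \<noteq> 0 \<Longrightarrow> degree f \<le> degree h"
    using exists_least_iff[of "\<lambda>n. \<exists>g\<in>p. g \<noteq> 0 \<and> degree g = n"] by (metis not_less)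
  have df: "degree f > 0"
    using f c by (metis degree_eq_zeroE gr0I pCons_eq_0_iff)
  show ?thesis
  proof (rule regular_prime_principal[OF p f, of degree])
    fix g assume g: "g \<in> p" "g \<noteq> 0"
    obtain q r where qr: "pseudo_divmod g f = (q, r)" by force
    define s where "s = lead_coeff f ^ (Suc (degree g) - degree f)"
    have eq: "[:s:] * g = f * q + r" and r: "r = 0 \<or> degree r < degree f"
      using pseudo_divmod[OF f(2) qr] by (simp_all add: s_def)
    have "[:s:] * g - f * q \<in> p" using f g p by (intro prime_setD(6,7,8)) auto
    then have "r = 0" using r min[of r] eq by (metis add_diff_cancel_left' not_less)
    moreover have "s \<noteq> 0" using f by (simp add: s_def)
    then have "[:s:] \<notin> p" using c by blast
    moreover have "degree g = degree f + degree q"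
    proof -
      have "q \<noteq> 0" using eq \<open>r = 0\<close> \<open>s \<noteq> 0\<close> g by auto
      then have "degree ([:s:] * g) = degree f + degree q" using f eq \<open>r = 0\<close> by (simp add: degree_mult_eq)
      then show ?thesis using \<open>s \<noteq> 0\<close> by simp
    qed
    ultimately show "\<exists>s h. s \<notin> p \<and> s * g = f * h \<and> degree h < degree g"
      using eq df by (intro exI[of _ "[:s:]"] exI[of _ q]) auto
  qed
qed

lemma regular_prime_field:
  fixes p :: "'k::field set"
  assumes "prime_set p"
  shows "\<exists>n. regular_prime p n"
proof -
  have "x = 0" if "x \<in> p" for x
    using prime_setD(7)[OF assms that, of "1 / x"] prime_setD(2)[OF assms] by (cases "x = 0") auto
  then have "p = {0}" using prime_setD(4)[OF assms] by auto
  then show ?thesis using regular_prime_zero assms by blast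
qed

lemma regular_prime_field_poly:
  fixes p :: "'k::field poly set"
  assumes "prime_set p"
  shows "\<exists>n. regular_prime p n"
proof (cases "p = {0}")
  case False
  have "c = 0" if "[:c:] \<in> p" for c
    using prime_setD(7)[OF assms that, of "[:1 / c:]"] prime_setD(2)[OF assms]
    by (cases "c = 0") (auto simp: one_pCons)
  then show ?thesis using regular_prime_poly[OF assms] False by blast
qed (use regular_prime_zero assms in blast)

text \<open>Splitting off roots one at a time, the prime must catch one of the linear factors. The
  map \<open>\<phi>\<close> embeds polynomials in one variable, so the lemma can be used for the
  inner as well as for the outer variable.\<close>

lemma prime_set_linear_factor:
  fixes q :: "'k::alg_closed_field poly"
  assumes mult: "\<And>a b. \<phi> (a * b) = \<phi> a * \<phi> b"
    and p: "prime_set p" and const: "\<And>c. c \<noteq> 0 \<Longrightarrow> \<phi> [:c:] \<notin> p" and q: "q \<noteq> 0" "\<phi> q \<in> p"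
  shows "\<exists>c. \<phi> [:-c, 1:] \<in> p"
  using q
proof (induction "degree q" arbitrary: q rule: less_induct)
  case less
  have "degree q > 0" using less.prems const by (metis degree_eq_zeroE gr0I pCons_eq_0_iff)
  then obtain c where "poly q c = 0" using alg_closed_imp_poly_has_root by blast
  then obtain r where r: "q = [:-c, 1:] * r" by (metis dvdE poly_eq_0_iff_dvd)
  then have "r \<noteq> 0" using less.prems by auto
  then have "degree r < degree q" unfolding r by (subst degree_mult_eq) auto
  moreover have "\<phi> [:-c, 1:] \<in> p \<or> \<phi> r \<in> p" using less.prems(2) mult prime_setD(3)[OF p] unfolding r by metis
  ultimately show ?case using less.hyps[of r] \<open>r \<noteq> 0\<close> by blast
qed

section \<open>Dimension of the polynomial ring in two variables\<close>

definition bidegree_le :: "nat \<Rightarrow> 'k::comm_ring_1 poly poly \<Rightarrow> bool" where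
  "bidegree_le D F \<longleftrightarrow> degree F \<le> D \<and> (\<forall>i. degree (coeff F i) \<le> D)"

lemma bidegree_le_mult:
  assumes "bidegree_le D F" "bidegree_le E G"
  shows "bidegree_le (D + E) (F * G)"
  unfolding bidegree_le_def
proof (intro conjI allI)
  show "degree (F * G) \<le> D + E"
    using assms degree_mult_le[of F G] by (auto simp: bidegree_le_def)
  fix i show "degree (coeff (F * G) i) \<le> D + E"
    unfolding coeff_mult using assms
    by (intro degree_sum_le order.trans[OF degree_mult_le]) (auto simp: bidegree_le_def intro: add_mono)
qed

lemma bidegree_le_power:
  assumes "bidegree_le D F"
  shows "bidegree_le (n * D) (F ^ n)"
proof (induction n)
  case 0 show ?case by (auto simp: bidegree_le_def coeff_1)
qed (use bidegree_le_mult assms in auto)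

lemma bidegree_le_mono: "bidegree_le D F \<Longrightarrow> D \<le> E \<Longrightarrow> bidegree_le E F"
  unfolding bidegree_le_def by (meson order.trans)

lemma bidegree_le_exists: "\<exists>D. bidegree_le D F"
proof -
  have "\<exists>E. \<forall>i\<le>degree F. degree (coeff F i) \<le> E"
    by (intro exI[of _ "Max ((\<lambda>i. degree (coeff F i)) ` {..degree F})"] allI impI Max_ge) auto
  then obtain E where E: "\<And>i. i \<le> degree F \<Longrightarrow> degree (coeff F i) \<le> E" by blast
  have "degree (coeff F i) \<le> E" for i
    using E[of i] by (cases "i \<le> degree F") (auto simp: coeff_eq_0)
  then have "bidegree_le (max E (degree F)) F"
    unfolding bidegree_le_def by (simp add: le_max_iff_disj)
  then show ?thesis by blast
qed

text \<open>With \<open>D\<close> the sum of the three bidegree bounds, the products with exponents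
  at most \<open>n\<close> have bidegree at most \<open>D * n\<close>. They are
  \<open>(n + 1) ^ 3\<close> vectors in a space of dimension \<open>(D * n + 1)\<^sup>2\<close>,
  hence linearly dependent for suitable \<open>n\<close>.\<close>

lemma algebraic_relation_poly_poly:
  fixes a :: "nat \<Rightarrow> 'k::field poly poly"
  obtains n f where "(\<Sum>i\<le>n. \<Sum>j\<le>n. \<Sum>k\<le>n. [:[:f i j k:]:] * (a 0 ^ i * a 1 ^ j * a 2 ^ k)) = 0"
    "\<exists>i\<le>n. \<exists>j\<le>n. \<exists>k\<le>n. f i j k \<noteq> 0"
proof -
  obtain D0 D1 D2 where D': "bidegree_le D0 (a 0)" "bidegree_le D1 (a 1)" "bidegree_le D2 (a 2)"
    using bidegree_le_exists by metis
  define D where "D = D0 + D1 + D2"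
  obtain n where n: "(D * n + 1)\<^sup>2 < (n + 1) ^ 3" by (rule cubic_exceeds_square)
  define I where "I = {..n} \<times> {..n} \<times> {..n}"
  define E where "E = {..D * n} \<times> {..D * n}"
  define co where "co = (\<lambda>(i, j, k) (l, m). coeff (coeff (a 0 ^ i * a 1 ^ j * a 2 ^ k) l) m)"
  have "Suc (D * n) * Suc (D * n) < Suc n * (Suc n * Suc n)"
    using n unfolding power2_eq_square power3_eq_cube Suc_eq_plus1 mult.assoc .
  then have "card E < card I"
    by (simp only: E_def I_def card_cartesian_product card_atMost)
  then obtain c where c: "\<exists>x\<in>I. c x \<noteq> 0" "\<forall>e\<in>E. (\<Sum>x\<in>I. c x * co x e) = 0"
    using homogeneous_system_nontrivial[of E I co] by (auto simp: E_def I_def)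
  define f where "f i j k = c (i, j, k)" for i j k
  have "bidegree_le (D * n) (a 0 ^ i * a 1 ^ j * a 2 ^ k)" if "i \<le> n" "j \<le> n" "k \<le> n" for i j k
  proof (rule bidegree_le_mono)
    show "bidegree_le (i * D0 + j * D1 + k * D2) (a 0 ^ i * a 1 ^ j * a 2 ^ k)"
      by (intro bidegree_le_mult bidegree_le_power D')
    have "i * D0 + j * D1 + k * D2 \<le> n * D0 + n * D1 + n * D2" using that by (intro add_mono mult_right_mono) auto
    then show "i * D0 + j * D1 + k * D2 \<le> D * n" by (simp add: D_def algebra_simps)
  qed
  then have bid: "bidegree_le (D * n) (a 0 ^ i * a 1 ^ j * a 2 ^ k)" if "i \<le> n" "j \<le> n" "k \<le> n" for i j k
    using that by blast
  have outside: "coeff (coeff F l) m = 0" if F: "bidegree_le (D * n) F" and "(l, m) \<notin> E" for F :: "'k poly poly" and l m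
  proof (cases "D * n < l")
    case True
    then show ?thesis using F by (simp add: bidegree_le_def coeff_eq_0)
  next
    case False
    then have "degree (coeff F l) < m" using that by (auto simp: bidegree_le_def E_def intro: le_less_trans)
    then show ?thesis by (rule coeff_eq_0)
  qed
  have big: "coeff (coeff (a 0 ^ i * a 1 ^ j * a 2 ^ k) l) m = 0"
    if "i \<le> n" "j \<le> n" "k \<le> n" "(l, m) \<notin> E" for i j k l m
    using outside[OF bid] that by blast
  have "(\<Sum>i\<le>n. \<Sum>j\<le>n. \<Sum>k\<le>n. f i j k * coeff (coeff (a 0 ^ i * a 1 ^ j * a 2 ^ k) l) m) = 0" for l m
  proof (cases "(l, m) \<in> E")
    case True
    then have "(\<Sum>x\<in>I. c x * co x (l, m)) = 0" using c(2) by blast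
    then show ?thesis by (simp add: I_def f_def co_def sum.cartesian_product case_prod_unfold)
  next
    case False
    then show ?thesis using big by (intro sum.neutral ballI) simp
  qed
  then have "(\<Sum>i\<le>n. \<Sum>j\<le>n. \<Sum>k\<le>n. [:[:f i j k:]:] * (a 0 ^ i * a 1 ^ j * a 2 ^ k)) = 0"
    by (intro poly_eqI) (simp add: coeff_sum)
  moreover have "\<exists>i\<le>n. \<exists>j\<le>n. \<exists>k\<le>n. f i j k \<noteq> 0"
    using c(1) unfolding I_def f_def by auto
  ultimately show thesis using that by blast
qed

lemma no_prime_chain_poly_poly:
  fixes p :: "'k::field poly poly set"
  shows "\<not> prime_chain p 3 c"
proof
  assume c: "prime_chain p 3 c"
  then have cp: "prime_set (c i)" if "i \<le> 3" for i using that by (auto simp: prime_chain_def)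
  have cs: "c i \<subset> c (Suc i)" if "i < 3" for i using c that by (auto simp: prime_chain_def)
  \<comment> \<open>The locale asks for zero in \<open>C i n\<close> at every index, so the whole
    ring is the default value beyond the fourth prime. The grading is constant, and 1 plays the part
    of \<open>s\<close>.\<close>
  define c' where "c' i = (if i \<le> 3 then c i else UNIV)" for i
  interpret graded_prime_chain "\<lambda>_. UNIV" "\<lambda>i _. c' i"
  proof unfold_locales
    show "0 \<in> c' i" for i using prime_setD(4)[OF cp] by (auto simp: c'_def)
    show "c' i \<subseteq> c' (Suc i)" if "i < 3" for i using cs that by (auto simp: c'_def)
    show "x - y \<in> c' i" if "i \<le> 3" "x \<in> c' i" "y \<in> c' i" for i x y
      using that prime_setD(6)[OF cp] by (simp add: c'_def)
    show "x * y \<in> c' i" if "i \<le> 3" "x \<in> c' i" for i x y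
      using that prime_setD(8)[OF cp] by (simp add: c'_def)
    show "x \<in> c' i \<or> y \<in> c' i" if "i \<le> 3" "x * y \<in> c' i" for i x y
      using that prime_setD(3)[OF cp] by (simp add: c'_def)
  qed auto
  have "\<forall>i. \<exists>a. i < 3 \<longrightarrow> a \<in> c (Suc i) \<and> a \<notin> c i" using cs by blast
  then obtain a where a: "\<And>i. i < 3 \<Longrightarrow> a i \<in> c (Suc i)" "\<And>i. i < 3 \<Longrightarrow> a i \<notin> c i" by metis
  obtain n f where f: "(\<Sum>i\<le>n. \<Sum>j\<le>n. \<Sum>k\<le>n. [:[:f i j k:]:] * (a 0 ^ i * a 1 ^ j * a 2 ^ k)) = 0"
    "\<exists>i\<le>n. \<exists>j\<le>n. \<exists>k\<le>n. f i j k \<noteq> 0"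
    by (rule algebraic_relation_poly_poly)
  have "f i j k = 0" if "i \<le> n" "j \<le> n" "k \<le> n" for i j k
  proof (rule no_algebraic_relation[of a 1 "\<lambda>c. [:[:c:]:]" f n])
    show "1 ^ m \<notin> c' 3" for m using prime_setD(2)[OF cp] by (simp add: c'_def)
    show "\<exists>d\<in>UNIV. [:[:x:]:] * d = 1" if "x \<noteq> 0" for x :: 'k
      using that by (intro bexI[of _ "[:[:1 / x:]:]"]) (auto simp: one_pCons)
    show "(\<Sum>i\<le>n. \<Sum>j\<le>n. \<Sum>k\<le>n. [:[:f i j k:]:] * (a 0 ^ i * a 1 ^ j * a 2 ^ k * 1 ^ (3 * n - i - j - k))) = 0"
      using f(1) by simp
    show "a i \<notin> c' i" "a i \<in> c' (Suc i)" if "i < 3" for i using a that by (simp_all add: c'_def)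
  qed (use that in auto)
  with f(2) show False by blast
qed


text \<open>A nonzero prime without nonzero polynomials in the inner variable x alone is principal
  up to units. Otherwise it contains some x - \<alpha>, and modulo this element it becomes a prime
  of the polynomial ring in the outer variable y: zero, or generated by some y - \<beta>.\<close>

theorem regular_prime_poly_poly:
  fixes p :: "'k::alg_closed_field poly poly set"
  assumes p: "prime_set p"
  shows "\<exists>n. regular_prime p n"
proof -
  have const: "c = 0" if "[:[:c:]:] \<in> p" for c
    using prime_setD(7)[OF p that, of "[:[:1 / c:]:]"] prime_setD(2)[OF p]
    by (cases "c = 0") (auto simp: one_pCons)
  consider "p = {0}" | "p \<noteq> {0}" "\<And>c. [:c:] \<in> p \<Longrightarrow> c = 0" | q where "[:q:] \<in> p" "q \<noteq> 0" by blast
  then show ?thesis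
  proof cases
    case 1 then show ?thesis using regular_prime_zero p by blast
  next
    case 2 then show ?thesis using regular_prime_poly[OF p] by blast
  next
    case 3
    then obtain \<alpha> where \<alpha>: "[:[:-\<alpha>, 1:]:] \<in> p"
      using prime_set_linear_factor[of "\<lambda>q. [:q:]" p q] p const by auto
    define f where "f = [:[:-\<alpha>, 1:]:]"
    have f: "f \<in> p" "f \<noteq> 0" using \<alpha> by (auto simp: f_def)
    \<comment> \<open>\<open>\<epsilon>\<close> sets the inner variable to \<open>\<alpha>\<close>,
      and \<open>\<iota>\<close> is a section of it. The kernel of \<open>\<epsilon>\<close>
      consists of the multiples of \<open>f\<close>, and \<open>pf\<close> below is this
      kernel.\<close>
    define \<epsilon> where "\<epsilon> = map_poly (\<lambda>c. poly c \<alpha>)"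
    define \<iota> where "\<iota> = map_poly (\<lambda>c::'k. [:c:])"
    have \<epsilon>_coeff: "coeff (\<epsilon> g) i = poly (coeff g i) \<alpha>" for g i
      by (simp add: \<epsilon>_def coeff_map_poly)
    have \<iota>_coeff: "coeff (\<iota> g) i = [:coeff g i:]" for g i
      by (simp add: \<iota>_def coeff_map_poly)
    have \<epsilon>_mult: "\<epsilon> (g * h) = \<epsilon> g * \<epsilon> h" for g h
      by (rule poly_eqI) (simp add: \<epsilon>_coeff coeff_mult poly_sum)
    have \<iota>_add: "\<iota> (g + h) = \<iota> g + \<iota> h" for g h
      by (rule poly_eqI) (simp add: \<iota>_coeff)
    have \<iota>_smult: "\<iota> (smult c g) = smult [:c:] (\<iota> g)" for c g
      by (rule poly_eqI) (simp add: \<iota>_coeff)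
    have \<iota>_pCons: "\<iota> (pCons c g) = pCons [:c:] (\<iota> g)" for c g
      by (rule poly_eqI) (simp add: \<iota>_coeff coeff_pCons split: nat.splits)
    have \<iota>_0: "\<iota> 0 = 0" by (rule poly_eqI) (simp add: \<iota>_coeff)
    have \<iota>_mult: "\<iota> (g * h) = \<iota> g * \<iota> h" for g h
      by (induction g) (simp_all add: \<iota>_0 \<iota>_pCons \<iota>_add \<iota>_smult)
    have \<epsilon>0: "\<exists>h. g = f * h" if "\<epsilon> g = 0" for g
    proof -
      have "[:-\<alpha>, 1:] dvd coeff g i" for i
        using \<epsilon>_coeff[of g i] that by (simp add: poly_eq_0_iff_dvd)
      then have "f dvd g" unfolding f_def by (subst const_poly_dvd_iff) blast
      then show ?thesis by blast
    qed
    have f_dvd: "\<epsilon> (f * h) = 0" for h unfolding \<epsilon>_mult by (simp add: f_def \<epsilon>_def map_poly_pCons)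
    have \<epsilon>\<iota>: "\<epsilon> (\<iota> q) = q" for q by (rule poly_eqI) (simp add: \<epsilon>_coeff \<iota>_coeff)
    have \<iota>\<epsilon>: "\<exists>h. g = f * h + \<iota> (\<epsilon> g)" for g
    proof -
      have "\<epsilon> (g - \<iota> (\<epsilon> g)) = 0" by (rule poly_eqI) (simp add: \<epsilon>_coeff \<iota>_coeff)
      then show ?thesis using \<epsilon>0[of "g - \<iota> (\<epsilon> g)"] by (metis diff_add_cancel)
    qed
    define pf where "pf = {g. \<epsilon> g = 0}"
    have \<epsilon>_add: "\<epsilon> (g + h) = \<epsilon> g + \<epsilon> h" for g h by (rule poly_eqI) (simp add: \<epsilon>_coeff)
    have \<epsilon>_01: "\<epsilon> 0 = 0" "\<epsilon> 1 = 1" by (simp_all add: \<epsilon>_def)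
    have pf: "prime_set pf"
      unfolding prime_set_def pf_def self.subspace_def
      by (simp add: \<epsilon>_mult \<epsilon>_add \<epsilon>_01)
    show ?thesis
    proof (cases "p \<subseteq> pf")
      case True
      \<comment> \<open>Division by \<open>f\<close> is exact and lowers the degree in the inner
        variable of the leading coefficient by one.\<close>
      have "regular_prime p 1"
      proof (rule regular_prime_principal[OF p f, of "\<lambda>g. degree (lead_coeff g)"])
        fix g assume g: "g \<in> p" "g \<noteq> 0"
        then obtain h where h: "g = f * h" using True \<epsilon>0 by (auto simp: pf_def)
        then have lc: "lead_coeff g = [:-\<alpha>, 1:] * lead_coeff h" unfolding h lead_coeff_mult by (simp add: f_def)
        moreover have "lead_coeff h \<noteq> 0" using g h by auto
        ultimately have "degree (lead_coeff g) = Suc (degree (lead_coeff h))"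
          unfolding lc by (subst degree_mult_eq) auto
        then show "\<exists>s h. s \<notin> p \<and> s * g = f * h \<and> degree (lead_coeff h) < degree (lead_coeff g)"
          using h prime_setD(2)[OF p] by (intro exI[of _ 1] exI[of _ h]) auto
      qed
      then show ?thesis by blast
    next
      case False
      then obtain g where g: "g \<in> p" "\<epsilon> g \<noteq> 0" by (auto simp: pf_def)
      have \<iota>p: "\<iota> (\<epsilon> g) \<in> p" if "g \<in> p" for g
      proof -
        obtain h where "g = f * h + \<iota> (\<epsilon> g)" using \<iota>\<epsilon> by blast
        then have "\<iota> (\<epsilon> g) = g - f * h" by (simp add: algebra_simps)
        then show ?thesis using that prime_setD(6,8)[OF p] f by simp
      qed
      have "\<iota> [:c:] = [:[:c:]:]" for c by (simp add: \<iota>_pCons \<iota>_0)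
      then obtain \<beta> where \<beta>: "\<iota> [:-\<beta>, 1:] \<in> p"
        using prime_set_linear_factor[of \<iota> p "\<epsilon> g", OF \<iota>_mult p _ g(2) \<iota>p[OF g(1)]] const by auto
      define f' where "f' = \<iota> [:-\<beta>, 1:]"
      have f': "f' \<in> p" "f' \<notin> pf" using \<beta> by (auto simp: f'_def pf_def \<epsilon>\<iota>)
      \<comment> \<open>Expansion at the point (\<alpha>, \<beta>): the part divisible by
        \<open>f\<close> is removed, the rest is divided by the linear polynomial in the outer
        variable, and the constant that remains lies in \<open>p\<close>, so it is zero.\<close>
      have gen: "h \<in> self.span {f, f'}" if h: "h \<in> p" for h
      proof -
        obtain r where r: "h = f * r + \<iota> (\<epsilon> h)" using \<iota>\<epsilon> by blast
        define q where "q = synthetic_div (\<epsilon> h) \<beta>"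
        have q: "[:-\<beta>, 1:] * q + [:poly (\<epsilon> h) \<beta>:] = \<epsilon> h"
          unfolding q_def by (rule synthetic_div_correct')
        have eq: "\<iota> (\<epsilon> h) = f' * \<iota> q + [:[:poly (\<epsilon> h) \<beta>:]:]"
          by (subst q[symmetric]) (simp only: \<iota>_add \<iota>_mult f'_def \<iota>_pCons \<iota>_0)
        have "f' * \<iota> q \<in> p" using f' prime_setD(8)[OF p] by blast
        then have "\<iota> (\<epsilon> h) - f' * \<iota> q \<in> p" using \<iota>p[OF h] prime_setD(6)[OF p] by blast
        moreover have "\<iota> (\<epsilon> h) - f' * \<iota> q = [:[:poly (\<epsilon> h) \<beta>:]:]"
          by (subst eq) (rule add_diff_cancel_left')
        ultimately have "[:[:poly (\<epsilon> h) \<beta>:]:] \<in> p" by simp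
        then have "poly (\<epsilon> h) \<beta> = 0" by (rule const)
        then have "\<iota> (\<epsilon> h) = f' * \<iota> q" unfolding eq by simp
        then have "h = r * f + \<iota> q * f'" using r by (simp add: mult.commute)
        moreover have "r * f + \<iota> q * f' \<in> self.span {f, f'}"
          by (intro self.span_add self.span_scale self.span_base) auto
        ultimately show ?thesis by simp
      qed
      have "pf \<subset> p"
      proof
        show "pf \<subseteq> p" using \<epsilon>0 prime_setD(8)[OF p f(1)] by (auto simp: pf_def)
      qed (use f' in blast)
      have "regular_prime p 2"
        unfolding regular_prime_def
      proof (intro conjI)
        have "f \<in> pf" using f_dvd[of 1] by (simp add: pf_def)
        then have "f \<noteq> f'" using f' by blast
        then show "\<exists>B\<subseteq>p. finite B \<and> card B = 2 \<and> (\<forall>g\<in>p. \<exists>s. s \<notin> p \<and> s * g \<in> self.span B)"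
          using f f' gen prime_setD(2)[OF p] by (intro exI[of _ "{f, f'}"]) (auto intro!: exI[of _ 1])
        have "{0} \<subset> pf" using \<open>f \<in> pf\<close> f(2) prime_setD(4)[OF pf] by blast
        then have "prime_chain p 2 (\<lambda>i. if i = 0 then {0} else if i = 1 then pf else p)"
          using p pf \<open>pf \<subset> p\<close> zero_prime
          by (auto simp: prime_chain_def less_2_cases_iff)
        then show "\<exists>c. prime_chain p 2 c" by blast
        show "\<not> (\<exists>c. prime_chain p (Suc 2) c)"
          using no_prime_chain_poly_poly[of p] by (simp add: numeral_3_eq_3 numeral_2_eq_2)
      qed
      then show ?thesis by blast
    qed
  qed
qed

section \<open>Localizations of domains\<close>

text \<open>\<open>L\<close> is the localization of the domain \<open>'s\<close> at the prime of elements with non-invertible image.\<close>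

locale domain_localization = cring L for L :: "('b, 'm) ring_scheme" (structure) +
  fixes \<psi> :: "'s::idom \<Rightarrow> 'b"
  assumes \<psi>_closed [simp]: "\<psi> a \<in> carrier L"
    and \<psi>_add: "\<psi> (a + b) = \<psi> a \<oplus> \<psi> b"
    and \<psi>_mult: "\<psi> (a * b) = \<psi> a \<otimes> \<psi> b"
    and \<psi>_one: "\<psi> 1 = \<one>"
    and \<psi>_inj: "\<psi> a = \<zero> \<Longrightarrow> a = 0"
    and \<psi>_fraction: "x \<in> carrier L \<Longrightarrow> \<exists>a b. \<psi> b \<in> Units L \<and> x \<otimes> \<psi> b = \<psi> a"
    and \<psi>_local: "\<lbrakk>\<psi> a \<notin> Units L; \<psi> b \<notin> Units L\<rbrakk> \<Longrightarrow> \<psi> (a + b) \<notin> Units L"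
begin

definition center :: "'s set" where "center = {a. \<psi> a \<notin> Units L}"

lemma \<psi>_zero: "\<psi> 0 = \<zero>"
  using \<psi>_add[of 0 0] by (metis \<psi>_closed add.l_cancel_one add.r_cancel_one' r_zero zero_closed add_0)

lemma one_not_zero: "\<one> \<noteq> \<zero>"
  using \<psi>_inj[of 1] \<psi>_one by auto

lemma zero_not_unit: "\<zero> \<notin> Units L"
  using one_not_zero by (metis Units_closed Units_r_inv_ex l_null)

lemma unit_factor: "\<lbrakk>x \<otimes> y \<in> Units L; x \<in> carrier L; y \<in> carrier L\<rbrakk> \<Longrightarrow> x \<in> Units L"
  using unit_factor by blast

lemma \<psi>_uminus: "\<psi> (- a) = \<ominus> \<psi> a"
proof -
  have "\<psi> (- a) \<oplus> \<psi> a = \<zero>" using \<psi>_add[of "- a" a] \<psi>_zero by simp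
  then show ?thesis by (metis \<psi>_closed minus_equality)
qed

lemma \<psi>_injective: "\<psi> a = \<psi> b \<Longrightarrow> a = b"
proof -
  assume "\<psi> a = \<psi> b"
  then have "\<psi> (a + - b) = \<zero>" unfolding \<psi>_add \<psi>_uminus by (simp add: r_neg)
  then show "a = b" using \<psi>_inj[of "a + - b"] by simp
qed

lemma fractionE:
  assumes "x \<in> carrier L"
  obtains a b where "\<psi> b \<in> Units L" "x \<otimes> \<psi> b = \<psi> a" "x \<in> Units L \<longleftrightarrow> \<psi> a \<in> Units L"
proof -
  obtain a b where ab: "\<psi> b \<in> Units L" "x \<otimes> \<psi> b = \<psi> a" using \<psi>_fraction[OF assms] by blast
  then have "x \<in> Units L \<longleftrightarrow> \<psi> a \<in> Units L"
    using unit_factor[of x "\<psi> b"] assms Units_m_closed[of x "\<psi> b"] by auto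
  with ab that show thesis by blast
qed

lemma center_prime: "prime_set center"
  unfolding prime_set_def
proof (intro conjI allI impI self.subspaceI)
  show "0 \<in> center" using zero_not_unit by (simp add: center_def \<psi>_zero)
  show "a + b \<in> center" if "a \<in> center" "b \<in> center" for a b using that \<psi>_local by (simp add: center_def)
  show "c * a \<in> center" if "a \<in> center" for a c
    using that unit_factor[of "\<psi> a" "\<psi> c"] by (auto simp: center_def \<psi>_mult m_comm)
  show "1 \<notin> center" by (simp add: center_def \<psi>_one)
  show "a \<in> center \<or> b \<in> center" if "a * b \<in> center" for a b
    using that Units_m_closed by (auto simp: center_def \<psi>_mult)
qed

lemma ideal_cancel_unit:
  assumes "ideal J L" "u \<in> Units L" "x \<in> carrier L" "x \<otimes> u \<in> J"
  shows "x \<in> J"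
proof -
  have "x \<otimes> u \<otimes> inv u \<in> J" using assms by (intro ideal.I_r_closed[OF assms(1,4)]) auto
  then show ?thesis using assms by (simp add: m_assoc Units_closed)
qed

lemma ideal_no_units:
  assumes "ideal J L" "J \<noteq> carrier L" "u \<in> Units L"
  shows "u \<notin> J"
proof
  assume "u \<in> J"
  then have "\<one> \<otimes> u \<in> J" using assms(3) by (simp add: Units_closed)
  then have "\<one> \<in> J" by (rule ideal_cancel_unit[OF assms(1,3) one_closed])
  then have "J = carrier L" by (rule ideal.one_imp_carrier[OF assms(1)])
  with assms(2) show False ..
qed

lemma nonunits_ideal: "ideal (carrier L - Units L) L"
proof (intro idealI)
  show "ring L" by (rule ring_axioms)
  have add: "x \<oplus> y \<notin> Units L" if xy: "x \<in> carrier L" "x \<notin> Units L" "y \<in> carrier L" "y \<notin> Units L" for x y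
  proof
    assume u: "x \<oplus> y \<in> Units L"
    obtain a b where ab: "\<psi> b \<in> Units L" "x \<otimes> \<psi> b = \<psi> a" and a: "x \<in> Units L \<longleftrightarrow> \<psi> a \<in> Units L"
      by (rule fractionE[OF xy(1)])
    obtain c d where cd: "\<psi> d \<in> Units L" "y \<otimes> \<psi> d = \<psi> c" and c: "y \<in> Units L \<longleftrightarrow> \<psi> c \<in> Units L"
      by (rule fractionE[OF xy(3)])
    have "(x \<oplus> y) \<otimes> (\<psi> b \<otimes> \<psi> d) = (x \<otimes> \<psi> b) \<otimes> \<psi> d \<oplus> (y \<otimes> \<psi> d) \<otimes> \<psi> b"
      using xy by (simp add: l_distr r_distr m_ac)
    also have "\<dots> = \<psi> (a * d + c * b)"
      unfolding ab(2) cd(2) \<psi>_add \<psi>_mult ..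
    finally have "(x \<oplus> y) \<otimes> (\<psi> b \<otimes> \<psi> d) = \<psi> (a * d + c * b)" .
    moreover have "(x \<oplus> y) \<otimes> (\<psi> b \<otimes> \<psi> d) \<in> Units L" using u ab(1) cd(1) by (intro Units_m_closed)
    ultimately have "\<psi> (a * d + c * b) \<in> Units L" by simp
    moreover have "a \<in> center" "c \<in> center" using a c xy by (simp_all add: center_def)
    then have "a * d + c * b \<in> center"
      using prime_setD(5,8)[OF center_prime] by blast
    ultimately show False by (simp add: center_def)
  qed
  show "subgroup (carrier L - Units L) (add_monoid L)"
  proof (rule add.subgroupI)
    show "carrier L - Units L \<noteq> {}" using zero_not_unit by blast
    show "\<ominus> x \<in> carrier L - Units L" if "x \<in> carrier L - Units L" for x
    proof -
      have "x \<in> Units L" if "\<ominus> x \<in> Units L" "x \<in> carrier L"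
        using unit_factor[of x "\<ominus> \<one>"] that by (simp add: r_minus)
      then show ?thesis using that by auto
    qed
  qed (use add in auto)
  have l: "a \<otimes> x \<in> carrier L - Units L" if "x \<in> carrier L - Units L" "a \<in> carrier L" for x a
    using that unit_factor[of x a] by (auto simp: m_comm)
  show "a \<otimes> x \<in> carrier L - Units L" if "x \<in> carrier L - Units L" "a \<in> carrier L" for x a
    using l[OF that] .
  show "x \<otimes> a \<in> carrier L - Units L" if "x \<in> carrier L - Units L" "a \<in> carrier L" for x a
    using l[OF that] m_comm[of x a] that by simp
qed

lemma maximalideal_iff: "maximalideal m L \<longleftrightarrow> m = carrier L - Units L"
proof -
  have max: "maximalideal (carrier L - Units L) L"
  proof (rule maximalidealI[OF nonunits_ideal])
    show "carrier L \<noteq> carrier L - Units L" using Units_one_closed by blast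
    fix J assume J: "ideal J L" "carrier L - Units L \<subseteq> J" "J \<subseteq> carrier L"
    then show "J = carrier L - Units L \<or> J = carrier L"
      using ideal_no_units[OF J(1)] by blast
  qed
  show ?thesis
  proof
    assume m: "maximalideal m L"
    then interpret m: maximalideal m L .
    have "m \<subseteq> carrier L - Units L"
      using ideal_no_units[OF m.ideal_axioms] m.I_notcarr m.a_subset by blast
    then show "m = carrier L - Units L"
      using m.I_maximal[OF nonunits_ideal] zero_not_unit by (metis Diff_iff Diff_subset Units_one_closed one_closed)
  qed (use max in simp)
qed

text \<open>Every element of \<open>L\<close> comes from the domain up to a unit, and units cancel
  in ideals. Hence it suffices that \<open>B\<close> generates the preimage of \<open>J\<close> up
  to units.\<close>

lemma ideal_generated:
  assumes J: "ideal J L" and B: "\<psi> ` B \<subseteq> J"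
    and gen: "\<And>a. \<psi> a \<in> J \<Longrightarrow> \<exists>s. \<psi> s \<in> Units L \<and> s * a \<in> self.span B"
  shows "J = Idl (\<psi> ` B)"
proof
  show "Idl (\<psi> ` B) \<subseteq> J" using J B by (rule genideal_minimal)
  have I: "ideal (Idl (\<psi> ` B)) L" by (rule genideal_ideal) auto
  then interpret I: ideal "Idl (\<psi> ` B)" L .
  have "self.span B \<subseteq> {a. \<psi> a \<in> Idl (\<psi> ` B)}"
  proof (rule self.span_minimal)
    show "B \<subseteq> {a. \<psi> a \<in> Idl (\<psi> ` B)}" using genideal_self[of "\<psi> ` B"] \<psi>_closed by blast
    show "self.subspace {a. \<psi> a \<in> Idl (\<psi> ` B)}"
      by (rule self.subspaceI)
        (simp_all only: mem_Collect_eq \<psi>_zero \<psi>_add \<psi>_mult I.zero_closed I.a_closed I.I_l_closed \<psi>_closed)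
  qed
  note span = this
  show "J \<subseteq> Idl (\<psi> ` B)"
  proof
    fix x assume x: "x \<in> J"
    have xc: "x \<in> carrier L" using ideal.Icarr[OF J x] .
    obtain a b where ab: "\<psi> b \<in> Units L" "x \<otimes> \<psi> b = \<psi> a" using \<psi>_fraction[OF xc] by blast
    have "\<psi> a \<in> J" unfolding ab(2)[symmetric] using J x by (simp add: ideal.I_r_closed)
    then obtain s where s: "\<psi> s \<in> Units L" "s * a \<in> self.span B" using gen by blast
    have "\<psi> a \<otimes> \<psi> s \<in> Idl (\<psi> ` B)" using s(2) span by (auto simp: \<psi>_mult m_comm)
    then have "\<psi> a \<in> Idl (\<psi> ` B)" by (rule ideal_cancel_unit[OF I s(1) \<psi>_closed])
    then have "x \<otimes> \<psi> b \<in> Idl (\<psi> ` B)" using ab(2) by simp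
    then show "x \<in> Idl (\<psi> ` B)" by (rule ideal_cancel_unit[OF I ab(1) xc])
  qed
qed

lemma noetherian:
  assumes "noetherian_type TYPE('s)"
  shows "noetherian_ring L"
proof (rule noetherian_ringI)
  fix J assume J: "ideal J L"
  then interpret J: ideal J L .
  have "self.subspace {a. \<psi> a \<in> J}"
    by (rule self.subspaceI) (simp_all only: mem_Collect_eq \<psi>_zero \<psi>_add \<psi>_mult J.zero_closed J.a_closed J.I_l_closed \<psi>_closed)
  then obtain B where "finite B" "B \<subseteq> {a. \<psi> a \<in> J}" "{a. \<psi> a \<in> J} \<subseteq> self.span B"
    using assms unfolding noetherian_type_def by blast
  then have "J = Idl (\<psi> ` B)"
    by (intro ideal_generated[OF J]) (auto intro!: exI[of _ 1] simp: \<psi>_one)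
  then show "\<exists>A\<subseteq>carrier L. finite A \<and> J = Idl A"
    using \<open>finite B\<close> by (intro exI[of _ "\<psi> ` B"]) auto
qed

text \<open>Together with \<open>extension\<close> this compares primes of \<open>L\<close> with
  primes of the domain inside \<open>center\<close>, so that chains on the two sides have the same
  lengths.\<close>

definition contraction :: "'b set \<Rightarrow> 's set" where "contraction J = {a. \<psi> a \<in> J}"

definition extension :: "'s set \<Rightarrow> 'b set" where
  "extension q = {x \<in> carrier L. \<exists>a\<in>q. \<exists>b. \<psi> b \<in> Units L \<and> x \<otimes> \<psi> b = \<psi> a}"

lemma contraction_prime:
  assumes "primeideal J L"
  shows "prime_set (contraction J)" "contraction J \<subseteq> center"
proof -
  interpret J: primeideal J L by fact
  have "self.subspace (contraction J)"
    unfolding contraction_def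
    by (rule self.subspaceI) (simp_all only: mem_Collect_eq \<psi>_zero \<psi>_add \<psi>_mult J.zero_closed J.a_closed J.I_l_closed \<psi>_closed)
  moreover have no_units: "u \<notin> J" if "u \<in> Units L" for u
    using ideal_no_units[OF J.ideal_axioms] J.I_notcarr that by blast
  moreover have "a \<in> contraction J \<or> b \<in> contraction J" if "a * b \<in> contraction J" for a b
    using J.I_prime[OF \<psi>_closed \<psi>_closed, of a b] that by (simp add: contraction_def \<psi>_mult)
  ultimately show "prime_set (contraction J)"
    by (simp add: prime_set_def contraction_def \<psi>_one)
  show "contraction J \<subseteq> center" using no_units by (auto simp: contraction_def center_def)
qed

lemma contraction_strict_mono:
  assumes "primeideal J L" "primeideal J' L" "J \<subset> J'"
  shows "contraction J \<subset> contraction J'"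
proof -
  interpret J: primeideal J L by fact
  interpret J': primeideal J' L by fact
  obtain x where x: "x \<in> J'" "x \<notin> J" using assms by blast
  have xc: "x \<in> carrier L" using x(1) by (rule J'.Icarr)
  obtain a b where ab: "\<psi> b \<in> Units L" "x \<otimes> \<psi> b = \<psi> a" using \<psi>_fraction[OF xc] by blast
  have "\<psi> a \<in> J'" unfolding ab(2)[symmetric] using x by (simp add: J'.I_r_closed)
  moreover have "\<psi> a \<notin> J" using ideal_cancel_unit[OF J.ideal_axioms ab(1) xc] ab(2) x by auto
  ultimately show ?thesis using assms(3) by (auto simp: contraction_def)
qed

lemma extension_prime:
  assumes q: "prime_set q" "q \<subseteq> center"
  shows "primeideal (extension q) L" "contraction (extension q) = q"
proof -
  \<comment> \<open>Membership does not depend on the fraction chosen for \<open>x\<close>: two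
    fractions give a cross-multiplied equation in the domain, and the denominators lie outside
    \<open>q\<close>.\<close>
  have mem: "x \<in> extension q \<longleftrightarrow> a \<in> q" if "x \<in> carrier L" "\<psi> b \<in> Units L" "x \<otimes> \<psi> b = \<psi> a" for x a b
  proof
    assume "x \<in> extension q"
    then obtain a' b' where a': "a' \<in> q" "\<psi> b' \<in> Units L" "x \<otimes> \<psi> b' = \<psi> a'" by (auto simp: extension_def)
    have "\<psi> a \<otimes> \<psi> b' = \<psi> a' \<otimes> \<psi> b"
      unfolding that(3)[symmetric] a'(3)[symmetric] using that(1) by (simp add: m_ac)
    then have "a * b' = a' * b" by (intro \<psi>_injective) (simp add: \<psi>_mult)
    then have "a * b' \<in> q" using prime_setD(8)[OF q(1) a'(1)] by simp
    moreover have "b' \<notin> q" using a' q(2) by (auto simp: center_def)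
    ultimately show "a \<in> q" using prime_setD(3)[OF q(1)] by blast
  qed (use that in \<open>auto simp: extension_def\<close>)
  show "contraction (extension q) = q"
    using mem[of "\<psi> a" 1 a for a] by (auto simp: contraction_def \<psi>_one)
  show "primeideal (extension q) L"
  proof (rule primeidealI)
    show "cring L" by (rule is_cring)
    have sub: "extension q \<subseteq> carrier L" by (auto simp: extension_def)
    have l: "y \<otimes> x \<in> extension q" if xy: "x \<in> extension q" "y \<in> carrier L" for x y
    proof -
      have xc: "x \<in> carrier L" using xy sub by blast
      obtain a b where ab: "\<psi> b \<in> Units L" "x \<otimes> \<psi> b = \<psi> a" using \<psi>_fraction[OF xc] by blast
      obtain c d where cd: "\<psi> d \<in> Units L" "y \<otimes> \<psi> d = \<psi> c" using \<psi>_fraction[OF xy(2)] by blast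
      have "a \<in> q" using mem[OF xc ab] xy by simp
      have "(y \<otimes> x) \<otimes> \<psi> (b * d) = (y \<otimes> \<psi> d) \<otimes> (x \<otimes> \<psi> b)"
        using xy xc by (simp add: \<psi>_mult m_ac)
      also have "\<dots> = \<psi> (c * a)" unfolding ab cd by (simp add: \<psi>_mult)
      finally have "(y \<otimes> x) \<otimes> \<psi> (b * d) = \<psi> (c * a)" .
      moreover have "\<psi> (b * d) \<in> Units L" using ab cd by (simp add: \<psi>_mult)
      ultimately show ?thesis
        using mem[of "y \<otimes> x" "b * d" "c * a"] xy xc prime_setD(7)[OF q(1) \<open>a \<in> q\<close>] by simp
    qed
    show "ideal (extension q) L"
    proof (intro idealI)
      show "ring L" by (rule ring_axioms)
      show "subgroup (extension q) (add_monoid L)"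
      proof (rule add.subgroupI)
        show "extension q \<noteq> {}"
          using mem[of \<zero> 1 0] prime_setD(4)[OF q(1)] by (auto simp: \<psi>_zero \<psi>_one)
        show "\<ominus> x \<in> extension q" if "x \<in> extension q" for x
          using l[OF that, of "\<ominus> \<one>"] that sub by (auto simp: l_minus)
        fix x y assume xy: "x \<in> extension q" "y \<in> extension q"
        have xc: "x \<in> carrier L" "y \<in> carrier L" using xy sub by auto
        obtain a b where ab: "\<psi> b \<in> Units L" "x \<otimes> \<psi> b = \<psi> a" using \<psi>_fraction[OF xc(1)] by blast
        obtain c d where cd: "\<psi> d \<in> Units L" "y \<otimes> \<psi> d = \<psi> c" using \<psi>_fraction[OF xc(2)] by blast
        have "a \<in> q" "c \<in> q" using mem[OF xc(1) ab] mem[OF xc(2) cd] xy by auto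
        have "(x \<oplus> y) \<otimes> \<psi> (b * d) = (x \<otimes> \<psi> b) \<otimes> \<psi> d \<oplus> (y \<otimes> \<psi> d) \<otimes> \<psi> b"
          using xc by (simp add: \<psi>_mult l_distr r_distr m_ac)
        also have "\<dots> = \<psi> (a * d + c * b)"
      unfolding ab(2) cd(2) \<psi>_add \<psi>_mult ..
        finally have "(x \<oplus> y) \<otimes> \<psi> (b * d) = \<psi> (a * d + c * b)" .
        moreover have "\<psi> (b * d) \<in> Units L" using ab cd by (simp add: \<psi>_mult)
        moreover have "a * d + c * b \<in> q"
          using \<open>a \<in> q\<close> \<open>c \<in> q\<close> prime_setD(5,8)[OF q(1)] by blast
        ultimately show "x \<oplus> y \<in> extension q"
          using mem[of "x \<oplus> y" "b * d" "a * d + c * b"] xc by simp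
      qed (use sub in auto)
      show "x \<otimes> y \<in> extension q" if "x \<in> extension q" "y \<in> carrier L" for x y
        using l[OF that] that sub by (auto simp: m_comm)
    qed (use l in auto)
    show "carrier L \<noteq> extension q"
      using mem[of \<one> 1 1] prime_setD(2)[OF q(1)] by (auto simp: \<psi>_one)
    fix x y assume xc: "x \<in> carrier L" "y \<in> carrier L" and xy: "x \<otimes> y \<in> extension q"
    obtain a b where ab: "\<psi> b \<in> Units L" "x \<otimes> \<psi> b = \<psi> a" using \<psi>_fraction[OF xc(1)] by blast
    obtain c d where cd: "\<psi> d \<in> Units L" "y \<otimes> \<psi> d = \<psi> c" using \<psi>_fraction[OF xc(2)] by blast
    have "(x \<otimes> y) \<otimes> \<psi> (b * d) = (x \<otimes> \<psi> b) \<otimes> (y \<otimes> \<psi> d)"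
      using xc by (simp add: \<psi>_mult m_ac)
    also have "\<dots> = \<psi> (a * c)" unfolding ab cd by (simp add: \<psi>_mult)
    finally have "(x \<otimes> y) \<otimes> \<psi> (b * d) = \<psi> (a * c)" .
    moreover have "\<psi> (b * d) \<in> Units L" using ab cd by (simp add: \<psi>_mult)
    ultimately have "a * c \<in> q" using mem[of "x \<otimes> y" "b * d" "a * c"] xc xy by simp
    then have "a \<in> q \<or> c \<in> q" by (rule prime_setD(3)[OF q(1)])
    then show "x \<in> extension q \<or> y \<in> extension q" using mem[OF xc(1) ab] mem[OF xc(2) cd] by simp
  qed
qed

lemma krull_dim_center:
  assumes "prime_chain center n c" "\<nexists>c. prime_chain center (Suc n) c"
  shows "krull_dim L = enat n"
  unfolding krull_dim_def
proof (rule antisym)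
  let ?X = "{enat n |n. \<exists>c :: nat \<Rightarrow> 'b set. (\<forall>i\<le>n. primeideal (c i) L) \<and> (\<forall>i<n. c i \<subset> c (Suc i))}"
  have c: "prime_set (c i)" "c i \<subseteq> center" if "i \<le> n" for i
    using assms(1) that by (auto simp: prime_chain_def)
  have "extension (c i) \<subset> extension (c (Suc i))" if "i < n" for i
  proof -
    have sub: "c i \<subset> c (Suc i)" using assms(1) that by (auto simp: prime_chain_def)
    have "extension (c i) \<subseteq> extension (c (Suc i))"
      unfolding extension_def using sub by (intro Collect_mono) blast
    moreover have "contraction (extension (c i)) = c i"
      by (rule extension_prime(2)[OF c[OF less_imp_le[OF that]]])
    moreover have "contraction (extension (c (Suc i))) = c (Suc i)"
      by (rule extension_prime(2)[OF c[OF Suc_leI[OF that]]])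
    moreover have "c i \<noteq> c (Suc i)" using sub by simp
    ultimately show ?thesis by (metis psubsetI)
  qed
  moreover have "primeideal (extension (c i)) L" if "i \<le> n" for i
    by (rule extension_prime(1)[OF c[OF that]])
  ultimately have "enat n \<in> ?X"
    by (intro CollectI exI[of _ n] exI[of _ "\<lambda>i. extension (c i)"] conjI allI impI refl)
  then show "enat n \<le> Sup ?X" by (rule Sup_upper)
  show "Sup ?X \<le> enat n"
  proof (rule Sup_least)
    fix x assume "x \<in> ?X"
    then obtain m J where m: "x = enat m" "\<forall>i\<le>m. primeideal (J i) L" "\<forall>i<m. (J :: nat \<Rightarrow> 'b set) i \<subset> J (Suc i)"
      by blast
    have "m \<le> n"
    proof (rule ccontr)
      assume "\<not> m \<le> n"
      then have "prime_chain center (Suc n) (\<lambda>i. contraction (J i))"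
        unfolding prime_chain_def using m contraction_prime contraction_strict_mono by auto
      then show False using assms(2) by blast
    qed
    then show "x \<le> enat n" using m by simp
  qed
qed

theorem regular_local:
  assumes noeth: "noetherian_type TYPE('s)" and reg: "regular_prime center n"
  shows "regular_local_ring L"
proof -
  obtain B where B: "B \<subseteq> center" "finite B" "card B = n"
    "\<And>g. g \<in> center \<Longrightarrow> \<exists>s. s \<notin> center \<and> s * g \<in> self.span B"
    using reg by (auto simp: regular_prime_def)
  have gen: "carrier L - Units L = Idl (\<psi> ` B)"
    using B(1,4) by (intro ideal_generated[OF nonunits_ideal]) (auto simp: center_def)
  have "card (\<psi> ` B) = n"
    using B(3) \<psi>_injective by (subst card_image) (auto simp: inj_on_def)
  moreover have "krull_dim L = enat n"
    using reg krull_dim_center unfolding regular_prime_def by blast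
  ultimately have "enat (card (\<psi> ` B)) = krull_dim L" by simp
  then have "\<exists>B'. B' \<subseteq> carrier L \<and> finite B' \<and> carrier L - Units L = Idl B' \<and> enat (card B') = krull_dim L"
    using gen B(2) \<psi>_closed by (intro exI[of _ "\<psi> ` B"] conjI) blast+
  then show ?thesis
    unfolding regular_local_ring_def maximalideal_iff
    using noetherian[OF noeth] is_cring by simp
qed

lemma reduced: "reduced_ring L"
  unfolding reduced_ring_def
proof (intro ballI allI impI)
  fix x n assume x: "x \<in> carrier L" "x [^] (n::nat) = \<zero>"
  obtain a b where ab: "\<psi> b \<in> Units L" "x \<otimes> \<psi> b = \<psi> a" using \<psi>_fraction[OF x(1)] by blast
  have pow: "\<psi> (a ^ n) = \<psi> a [^] n" for n
  proof (induction n)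
    case (Suc n)
    have "\<psi> (a ^ Suc n) = \<psi> a [^] n \<otimes> \<psi> a" by (simp only: power_Suc2 \<psi>_mult Suc)
    then show ?case by simp
  qed (simp add: \<psi>_one)
  have "\<psi> (a ^ n) = \<zero>"
    unfolding pow ab(2)[symmetric] using x by (simp add: nat_pow_distrib)
  then have "a = 0" using \<psi>_inj by (metis power_eq_0_iff)
  have "x = x \<otimes> \<psi> b \<otimes> inv \<psi> b" using ab(1) x(1) by (simp add: m_assoc)
  also have "\<dots> = \<zero>" unfolding ab(2) \<open>a = 0\<close> \<psi>_zero using ab(1) by simp
  finally show "x = \<zero>" .
qed

end

section \<open>Lines through lattice points\<close>

text \<open>Congruence modulo the kernel \<open>N\<close> of a homomorphism to a local ring; \<open>U\<close> consists of the
  elements with invertible image.\<close>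

locale local_congruence =
  fixes N U :: "'a::comm_ring_1 set"
  assumes N_subspace: "self.subspace N"
    and one_U: "1 \<in> U"
    and U_mult: "a * b \<in> U \<longleftrightarrow> a \<in> U \<and> b \<in> U"
    and U_add: "a + b \<in> U \<Longrightarrow> a \<in> U \<or> b \<in> U"
    and N_not_U: "a \<in> N \<Longrightarrow> a \<notin> U"
    and cancel: "\<lbrakk>u \<in> U; u * a \<in> N\<rbrakk> \<Longrightarrow> a \<in> N"
begin

lemmas N_zero = self.subspace_0[OF N_subspace] and N_add = self.subspace_add[OF N_subspace]
  and N_diff = self.subspace_diff[OF N_subspace] and N_scale = self.subspace_scale[OF N_subspace]
  and N_uminus = self.subspace_neg[OF N_subspace]

lemma zero_not_U: "0 \<notin> U" using N_zero N_not_U by blast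

lemma U_cong: assumes "a - b \<in> N" shows "a \<in> U \<longleftrightarrow> b \<in> U"
proof -
  have "a - b \<notin> U" "- (a - b) \<notin> U" using N_not_U[OF assms] N_not_U[OF N_uminus[OF assms]] by auto
  moreover have "a \<in> U \<Longrightarrow> a - b \<in> U \<or> b \<in> U" using U_add[of "a - b" b] by simp
  moreover have "b \<in> U \<Longrightarrow> - (a - b) \<in> U \<or> a \<in> U" using U_add[of "- (a - b)" a] by simp
  ultimately show ?thesis by blast
qed

lemma U_power: "a \<in> U \<Longrightarrow> a ^ n \<in> U"
  by (induction n) (auto simp: one_U U_mult)

lemma U_sum: "sum f S \<in> U \<Longrightarrow> \<exists>x\<in>S. f x \<in> U"
  by (induction S rule: infinite_finite_induct) (auto simp: zero_not_U dest: U_add)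

text \<open>The form at a lattice point is dehomogenized to a linear polynomial in one variable. As
  the relations are between products of equal degree, nothing is lost, and they become congruences
  of coefficients modulo \<open>N\<close>.\<close>

definition pcong :: "'a poly \<Rightarrow> 'a poly \<Rightarrow> bool" where
  "pcong p q \<longleftrightarrow> (\<forall>n. coeff p n - coeff q n \<in> N)"

lemma pcongD: "pcong p q \<Longrightarrow> coeff p n - coeff q n \<in> N"
  by (simp add: pcong_def)

lemma pcong_U: "pcong p q \<Longrightarrow> coeff p n \<in> U \<longleftrightarrow> coeff q n \<in> U"
  by (rule U_cong[OF pcongD])

lemma pcong_refl: "pcong p p" by (simp add: pcong_def N_zero)

lemma pcong_sym: assumes "pcong p q" shows "pcong q p"
  unfolding pcong_def
proof
  fix n show "coeff q n - coeff p n \<in> N" using N_uminus[OF pcongD[OF assms, of n]] by simp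
qed

lemma pcong_trans: assumes "pcong p q" "pcong q r" shows "pcong p r"
  unfolding pcong_def
proof
  fix n show "coeff p n - coeff r n \<in> N" using N_add[OF pcongD[OF assms(1), of n] pcongD[OF assms(2), of n]] by simp
qed

lemma pcong_mult_right: "pcong p q \<Longrightarrow> pcong (p * r) (q * r)"
proof -
  assume "pcong p q"
  then have "coeff ((p - q) * r) n \<in> N" for n
    unfolding coeff_mult
  proof (intro self.subspace_sum[OF N_subspace])
    fix i show "coeff (p - q) i * coeff r (n - i) \<in> N"
      using N_scale[OF pcongD[OF \<open>pcong p q\<close>, of i], of "coeff r (n - i)"] by (simp add: mult.commute)
  qed
  then show ?thesis by (simp add: pcong_def left_diff_distrib)
qed

lemma pcong_mult: "pcong p q \<Longrightarrow> pcong r s \<Longrightarrow> pcong (p * r) (q * s)"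
proof -
  assume a: "pcong p q" and b: "pcong r s"
  have "pcong (q * r) (q * s)" using pcong_mult_right[OF b, of q] by (simp only: mult.commute[of q])
  with pcong_mult_right[OF a] show ?thesis by (rule pcong_trans)
qed

lemma pcong_power: "pcong p q \<Longrightarrow> pcong (p ^ n) (q ^ n)"
  by (induction n) (auto intro: pcong_mult pcong_refl)

text \<open>Over the residue field \<open>p\<close> is a nonzero multiple of the n-th power of the
  variable.\<close>

definition mono_at :: "'a poly \<Rightarrow> nat \<Rightarrow> bool" where
  "mono_at p n \<longleftrightarrow> (\<forall>k. coeff p k \<in> U \<longleftrightarrow> k = n)"

text \<open>In each coefficient of the product at most one summand can be a unit, and adding
  non-units to it does not change whether it is one.\<close>

lemma mono_at_mult_coeff:
  assumes "mono_at q m"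
  shows "coeff (p * q) n \<in> U \<longleftrightarrow> m \<le> n \<and> coeff p (n - m) \<in> U"
proof -
  have other: "coeff p i * coeff q (n - i) \<notin> U" if "n - i \<noteq> m" for i
    using assms that by (simp add: mono_at_def U_mult)
  show ?thesis
  proof (cases "m \<le> n")
    case True
    have "coeff (p * q) n = coeff p (n - m) * coeff q (n - (n - m)) + (\<Sum>i\<in>{..n} - {n - m}. coeff p i * coeff q (n - i))"
      unfolding coeff_mult by (subst sum.remove[of _ "n - m"]) auto
    moreover have rest: "(\<Sum>i\<in>{..n} - {n - m}. coeff p i * coeff q (n - i)) \<notin> U" (is "?R \<notin> U")
    proof
      assume "?R \<in> U"
      then obtain i where i: "i \<le> n" "i \<noteq> n - m" "coeff p i * coeff q (n - i) \<in> U" using U_sum by blast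
      then have "n - i \<noteq> m" using True by linarith
      with i(3) other show False by blast
    qed
    moreover have "coeff p (n - m) * coeff q (n - (n - m)) \<in> U \<longleftrightarrow> coeff p (n - m) \<in> U"
      using assms True by (simp add: mono_at_def U_mult)
    moreover have "- ?R \<notin> U"
      using rest U_mult[of "-1" ?R] by simp
    ultimately show ?thesis
      using U_add[of "coeff p (n - m) * coeff q (n - (n - m))" ?R]
        U_add[of "coeff p (n - m) * coeff q (n - (n - m)) + ?R" "- ?R"] True by auto
  next
    case False
    have "coeff (p * q) n \<notin> U"
    proof
      assume "coeff (p * q) n \<in> U"
      then obtain i where i: "i \<le> n" "coeff p i * coeff q (n - i) \<in> U" unfolding coeff_mult using U_sum by blast
      then have "n - i \<noteq> m" using False by linarith
      with i(2) other show False by blast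
    qed
    with False show ?thesis by simp
  qed
qed

lemma mono_at_mult: "mono_at p a \<Longrightarrow> mono_at q b \<Longrightarrow> mono_at (p * q) (a + b)"
proof -
  assume p: "mono_at p a" and q: "mono_at q b"
  show "mono_at (p * q) (a + b)"
    unfolding mono_at_def[of "p * q"]
  proof
    fix k
    have "coeff (p * q) k \<in> U \<longleftrightarrow> b \<le> k \<and> coeff p (k - b) \<in> U" by (rule mono_at_mult_coeff[OF q])
    also have "coeff p (k - b) \<in> U \<longleftrightarrow> k - b = a" using p unfolding mono_at_def by blast
    also have "b \<le> k \<and> k - b = a \<longleftrightarrow> k = a + b" by linarith
    finally show "coeff (p * q) k \<in> U \<longleftrightarrow> k = a + b" .
  qed
qed

lemma mono_at_monom: "mono_at (monom 1 n) n"
  unfolding mono_at_def coeff_monom using one_U zero_not_U by simp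

lemma mono_at_power: "mono_at p a \<Longrightarrow> mono_at (p ^ n) (n * a)"
proof (induction n)
  case 0
  show ?case using mono_at_monom[of 0] by simp
next
  case (Suc n)
  then show ?case using mono_at_mult[of p a "p ^ n" "n * a"] by simp
qed

text \<open>Over the residue field, two linear polynomials whose product is a power of the variable
  are monomials themselves. The degree allows \<open>s\<close> to be 0, 1 or 2 only, and in each
  case three coefficients decide.\<close>

lemma mono_at_linear_factors:
  assumes "pcong ([:a, b:] * [:c, d:]) (monom 1 s)"
  shows "\<exists>i j. mono_at [:a, b:] i \<and> mono_at [:c, d:] j \<and> i + j = s"
proof -
  have prod: "[:a, b:] * [:c, d:] = [:a * c, a * d + b * c, b * d:]" by simp
  have c0: "a * c - (if s = 0 then 1 else 0) \<in> N"
    using pcongD[OF assms, of 0] unfolding prod coeff_monom by simp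
  have c1: "a * d + b * c - (if s = 1 then 1 else 0) \<in> N"
    using pcongD[OF assms, of 1] unfolding prod coeff_monom by simp
  have c2: "b * d - (if s = 2 then 1 else 0) \<in> N"
    using pcongD[OF assms, of 2] unfolding prod coeff_monom by (simp add: numeral_2_eq_2)
  have m: "mono_at [:x, y:] i" if "x \<in> U \<longleftrightarrow> i = 0" "y \<in> U \<longleftrightarrow> i = 1" "i \<le> 1" for x y i
    unfolding mono_at_def
  proof
    fix k
    consider "k = 0" | "k = 1" | l where "k = Suc (Suc l)" by (metis One_nat_def not0_implies_Suc)
    then show "coeff [:x, y:] k \<in> U \<longleftrightarrow> k = i" using that zero_not_U by cases auto
  qed
  have add: "x + y \<in> U" if "x \<in> U" "y \<notin> U" for x y
  proof -
    have "x \<in> U \<Longrightarrow> x + y \<in> U \<or> - y \<in> U" using U_add[of "x + y" "- y"] by simp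
    moreover have "- y \<in> U \<Longrightarrow> y \<in> U" using U_mult[of "-1" y] by simp
    ultimately show ?thesis using that by blast
  qed
  consider "s = 0" | "s = 1" | "s = 2" | "s > 2" by linarith
  then show ?thesis
  proof cases
    case 1
    have "a * c \<in> U" using U_cong[OF c0] one_U 1 by simp
    then have "a \<in> U" "c \<in> U" by (simp_all add: U_mult)
    moreover have "b * d \<notin> U" "a * d + b * c \<notin> U"
      using c1 c2 1 N_not_U by auto
    ultimately have "b \<notin> U" "d \<notin> U"
      using add[of "a * d" "b * c"] add[of "b * c" "a * d"] by (auto simp: add.commute U_mult)
    then show ?thesis using m[of a 0 b] m[of c 0 d] \<open>a \<in> U\<close> \<open>c \<in> U\<close> 1 by auto
  next
    case 2
    note s1 = 2
    have "a * d + b * c \<in> U" using U_cong[OF c1] one_U 2 by simp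
    then have "a * d \<in> U \<or> b * c \<in> U" by (rule U_add)
    moreover have n: "a * c \<notin> U" "b * d \<notin> U" using c0 c2 2 N_not_U by auto
    ultimately consider "a * d \<in> U" | "b * c \<in> U" by blast
    then show ?thesis
    proof cases
      case 1
      then have "a \<in> U" "d \<in> U" "b \<notin> U" "c \<notin> U" using n by (auto simp: U_mult)
      then have "mono_at [:a, b:] 0" "mono_at [:c, d:] 1" using m[of a 0 b] m[of c 1 d] by simp_all
      with s1 show ?thesis by (intro exI[of _ 0] exI[of _ 1]) simp
    next
      case 2
      then have "a \<notin> U" "d \<notin> U" "b \<in> U" "c \<in> U" using n by (auto simp: U_mult)
      then have "mono_at [:a, b:] 1" "mono_at [:c, d:] 0" using m[of a 1 b] m[of c 0 d] by simp_all
      with s1 show ?thesis by (intro exI[of _ 1] exI[of _ 0]) simp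
    qed
  next
    case 3
    have "b * d \<in> U" using U_cong[OF c2] one_U 3 by simp
    then have "b \<in> U" "d \<in> U" by (simp_all add: U_mult)
    moreover have "a * c \<notin> U" "a * d + b * c \<notin> U"
      using c0 c1 3 N_not_U by auto
    ultimately have "a \<notin> U" "c \<notin> U"
      using add[of "a * d" "b * c"] add[of "b * c" "a * d"] by (auto simp: add.commute U_mult)
    then show ?thesis using m[of a 1 b] m[of c 1 d] \<open>b \<in> U\<close> \<open>d \<in> U\<close> 3 by auto
  next
    case 4
    have "coeff ([:a, b:] * [:c, d:]) s = 0"
      using 4 degree_mult_le[of "[:a, b:]" "[:c, d:]"] by (intro coeff_eq_0) (auto split: if_splits)
    then have "- 1 \<in> N" using pcongD[OF assms, of s] by simp
    then have False using N_not_U[OF N_uminus, of "-1"] one_U by simp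
    then show ?thesis ..
  qed
qed

end

section \<open>Configurations of lattice points and lines on them\<close>

definition affine_fun :: "(int \<times> int \<Rightarrow> int) \<Rightarrow> bool" where
  "affine_fun f \<longleftrightarrow> (\<exists>a b c. \<forall>w. f w = a * fst w + b * snd w + c)"

text \<open>What the classification uses of the polygon: barycenters of three points that are
  integral again belong to \<open>A\<close>, and at every point that is extreme for a lexicographic
  order two differences generate all others. The points \<open>e1\<close> and \<open>e2\<close> may
  coincide with each other or with \<open>v\<close>.\<close>

locale point_configuration =
  fixes A :: "(int \<times> int) set"
  assumes convex: "\<lbrakk>p1 \<in> A; p2 \<in> A; p3 \<in> A; m1 + m2 + m3 > (0 :: nat);
      int m1 * fst p1 + int m2 * fst p2 + int m3 * fst p3 = int (m1 + m2 + m3) * fst w;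
      int m1 * snd p1 + int m2 * snd p2 + int m3 * snd p3 = int (m1 + m2 + m3) * snd w\<rbrakk> \<Longrightarrow> w \<in> A"
    and smooth: "\<lbrakk>v \<in> A; \<And>w. w \<in> A \<Longrightarrow> w \<noteq> v \<Longrightarrow>
        f1 * (fst w - fst v) + f2 * (snd w - snd v) > 0 \<or>
        f1 * (fst w - fst v) + f2 * (snd w - snd v) = 0 \<and> g1 * (fst w - fst v) + g2 * (snd w - snd v) > 0\<rbrakk>
      \<Longrightarrow> \<exists>e1\<in>A. \<exists>e2\<in>A. \<forall>w\<in>A. \<exists>m n :: nat.
        fst w - fst v = int m * (fst e1 - fst v) + int n * (fst e2 - fst v) \<and>
        snd w - snd v = int m * (snd e1 - snd v) + int n * (snd e2 - snd v)"

text \<open>Binomials in four points, possibly repeated, are the only equations of the surface that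
  the classification evaluates.\<close>

locale line_on_points = local_congruence N U for N U :: "'a::comm_ring_1 set" +
  fixes A :: "(int \<times> int) set" and \<alpha> \<beta> :: "int \<times> int \<Rightarrow> 'a"
  assumes binomial: "\<lbrakk>p1 \<in> A; p2 \<in> A; p3 \<in> A; p4 \<in> A; m1 + m2 + m3 + m4 = n1 + n2 + n3 + (n4 :: nat);
      int m1 * fst p1 + int m2 * fst p2 + int m3 * fst p3 + int m4 * fst p4 =
        int n1 * fst p1 + int n2 * fst p2 + int n3 * fst p3 + int n4 * fst p4;
      int m1 * snd p1 + int m2 * snd p2 + int m3 * snd p3 + int m4 * snd p4 =
        int n1 * snd p1 + int n2 * snd p2 + int n3 * snd p3 + int n4 * snd p4\<rbrakk> \<Longrightarrow>
      pcong ([:\<alpha> p1, \<beta> p1:] ^ m1 * [:\<alpha> p2, \<beta> p2:] ^ m2 * [:\<alpha> p3, \<beta> p3:] ^ m3 * [:\<alpha> p4, \<beta> p4:] ^ m4)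
        ([:\<alpha> p1, \<beta> p1:] ^ n1 * [:\<alpha> p2, \<beta> p2:] ^ n2 * [:\<alpha> p3, \<beta> p3:] ^ n3 * [:\<alpha> p4, \<beta> p4:] ^ n4)"

context local_congruence
begin

text \<open>The point with coordinate \<open>j\<close> in column \<open>h\<close> is \<open>c\<^sup>j\<close> times the parameter of the line with that
  index; for negative \<open>j\<close> the equation is multiplied out.\<close>

definition scroll_point :: "(int \<times> int \<Rightarrow> 'a) \<Rightarrow> (int \<times> int \<Rightarrow> 'a) \<Rightarrow> 'a \<Rightarrow> int \<Rightarrow> int \<Rightarrow> int \<times> int \<Rightarrow> bool" where
  "scroll_point \<alpha> \<beta> c h j w \<longleftrightarrow> h \<in> {0, 1} \<and>
     (if j \<ge> 0 then \<alpha> w - (if h = 0 then c ^ nat j else 0) \<in> N \<and> \<beta> w - (if h = 1 then c ^ nat j else 0) \<in> N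
      else c \<in> U \<and> c ^ nat (- j) * \<alpha> w - (if h = 0 then 1 else 0) \<in> N \<and>
        c ^ nat (- j) * \<beta> w - (if h = 1 then 1 else 0) \<in> N)"

text \<open>The coordinates (\<open>h\<close>, \<open>j\<close>) put \<open>u\<close>,
  \<open>v\<close> and \<open>W\<close> at (0, 0), (1, 0) and (0, 1). In the triangle case the form
  at \<open>W\<close> is left free, since every line of a plane is allowed.\<close>

definition line_class :: "(int \<times> int) set \<Rightarrow> (int \<times> int \<Rightarrow> 'a) \<Rightarrow> (int \<times> int \<Rightarrow> 'a) \<Rightarrow> int \<times> int \<Rightarrow> int \<times> int \<Rightarrow> bool" where
  "line_class A \<alpha> \<beta> u v \<longleftrightarrow>
     (\<forall>w\<in>A - {u, v}. \<alpha> w \<in> N \<and> \<beta> w \<in> N) \<or>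
     (\<exists>h j. affine_fun h \<and> affine_fun j \<and> h u = 0 \<and> h v = 1 \<and> j u = 0 \<and> j v = 0 \<and>
       (\<exists>W\<in>A. h W = 0 \<and> j W = 1 \<and>
         (A = {u, v, W} \<or> (\<forall>w\<in>A. scroll_point \<alpha> \<beta> (\<alpha> W) (h w) (j w) w))))"

end

text \<open>Heights are nonnegative and \<open>e1\<close> has height one, so it cannot contribute to
  the edge vector (\<sigma>, 0); hence \<open>e2\<close> is this vector. The quantity bounded below
  is then the coefficient of \<open>e2\<close>, and (p, 1) spans the other edge at the
  vertex.\<close>

lemma edge_basis_aux:
  fixes D :: "(int \<times> int) set" and \<sigma> :: int
  assumes \<sigma>: "\<sigma> = 1 \<or> \<sigma> = -1" and D: "e1 \<in> D" "e2 \<in> D" "(\<sigma>, 0) \<in> D" "\<And>w. w \<in> D \<Longrightarrow> snd w \<ge> 0"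
    and gen: "\<And>w. w \<in> D \<Longrightarrow> \<exists>m n :: nat. fst w = int m * fst e1 + int n * fst e2 \<and> snd w = int m * snd e1 + int n * snd e2"
    and e1: "snd e1 = 1"
  shows "\<exists>p. (p, 1) \<in> D \<and> (\<forall>w\<in>D. \<sigma> * (fst w - p * snd w) \<ge> 0)"
proof (intro exI[of _ "fst e1"] conjI ballI)
  show "(fst e1, 1) \<in> D" using D(1) e1 by (metis prod.collapse)
  obtain m n where mn: "\<sigma> = int m * fst e1 + int n * fst e2" "0 = int m * snd e1 + int n * snd e2"
    using gen[OF D(3)] by auto
  have "snd e2 \<ge> 0" by (rule D(4)[OF D(2)])
  then have "int n * snd e2 \<ge> 0" by simp
  moreover have "0 = int m + int n * snd e2" using mn(2) e1 by simp
  ultimately have "int m = 0" "int n * snd e2 = 0" by linarith+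
  then have "m = 0" by simp
  then have n: "\<sigma> = int n * fst e2" using mn(1) by simp
  have "n \<noteq> 0"
  proof
    assume "n = 0"
    then have "\<sigma> = 0" using n by simp
    then show False using \<sigma> by simp
  qed
  have "snd e2 = 0" using \<open>int n * snd e2 = 0\<close> \<open>n \<noteq> 0\<close> by simp
  have "int n dvd 1" using n \<sigma> by (metis dvd_minus_iff dvd_triv_left)
  then have "n = 1" using \<open>n \<noteq> 0\<close> by simp
  then have "fst e2 = \<sigma>" using n by simp
  fix w assume "w \<in> D"
  then obtain k l where "fst w = int k * fst e1 + int l * fst e2" "snd w = int k * snd e1 + int l * snd e2"
    using gen by blast
  then have "fst w - fst e1 * snd w = int l * \<sigma>" using \<open>fst e2 = \<sigma>\<close> \<open>snd e2 = 0\<close> e1 by simp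
  moreover have "\<sigma> * (int l * \<sigma>) = int l" using \<sigma> by auto
  ultimately show "\<sigma> * (fst w - fst e1 * snd w) \<ge> 0" by (simp only: of_nat_0_le_iff)
qed

text \<open>A point of height one is a combination of two generators of nonnegative height, so one
  of them has height one.\<close>

lemma edge_basis:
  fixes D :: "(int \<times> int) set" and \<sigma> :: int
  assumes \<sigma>: "\<sigma> = 1 \<or> \<sigma> = -1" and D: "e1 \<in> D" "e2 \<in> D" "(\<sigma>, 0) \<in> D" "\<And>w. w \<in> D \<Longrightarrow> snd w \<ge> 0"
    and gen: "\<And>w. w \<in> D \<Longrightarrow> \<exists>m n :: nat. fst w = int m * fst e1 + int n * fst e2 \<and> snd w = int m * snd e1 + int n * snd e2"
    and p0: "(p0, 1) \<in> D"
  shows "\<exists>p. (p, 1) \<in> D \<and> (\<forall>w\<in>D. \<sigma> * (fst w - p * snd w) \<ge> 0)"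
proof -
  obtain m n where mn: "1 = int m * snd e1 + int n * snd e2" using gen[OF p0] by auto
  have s: "snd e1 \<ge> 0" "snd e2 \<ge> 0" using D by auto
  then have nn: "int m * snd e1 \<ge> 0" "int n * snd e2 \<ge> 0" by auto
  then consider "int m * snd e1 = 1" | "int n * snd e2 = 1" using mn by linarith
  then show ?thesis
  proof cases
    case 1
    then have "snd e1 = 1" using s zmult_eq_1_iff by fastforce
    then show ?thesis by (intro edge_basis_aux[OF \<sigma> D gen])
  next
    case 2
    then have e2: "snd e2 = 1" using s zmult_eq_1_iff by fastforce
    have gen': "\<exists>m n :: nat. fst w = int m * fst e2 + int n * fst e1 \<and> snd w = int m * snd e2 + int n * snd e1" if "w \<in> D" for w
      using gen[OF that] by (metis add.commute)
    show ?thesis by (rule edge_basis_aux[OF \<sigma> D(2,1,3,4) gen' e2])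
  qed
qed

section \<open>Lines in standard position\<close>

locale standard_line = line_on_points N U A \<alpha> \<beta> + point_configuration A
  for N U :: "'a::comm_ring_1 set" and A \<alpha> \<beta> +
  assumes origin: "(0, 0) \<in> A" "\<alpha> (0, 0) = 1" "\<beta> (0, 0) = 0"
    and unit: "(1, 0) \<in> A" "\<alpha> (1, 0) = 0" "\<beta> (1, 0) = 1"
    and off_line: "\<exists>w\<in>A. snd w \<noteq> 0"
begin

abbreviation ell :: "int \<times> int \<Rightarrow> 'a poly" where "ell w \<equiv> [:\<alpha> w, \<beta> w:]"

text \<open>The origin carries the constant 1, so copies of it can balance the degrees without
  showing up; the point (1, 0) carries the variable, so \<open>b\<close> copies of it are
  \<open>monom 1 b\<close>.\<close>

lemma relation:
  assumes "w \<in> A" "W \<in> A" "fst w + int b + int c * fst W = int b' + int c' * fst W"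
    "snd w + int c * snd W = int c' * snd W"
  shows "pcong (monom 1 b * (ell w * ell W ^ c)) (monom 1 b' * ell W ^ c')"
proof -
  have X: "[:0, 1:] ^ n = (monom 1 n :: 'a poly)" for n by (simp add: monom_altdef)
  have "pcong (ell w ^ 1 * ell (0, 0) ^ (b' + c') * ell (1, 0) ^ b * ell W ^ c)
    (ell w ^ 0 * ell (0, 0) ^ (1 + b + c) * ell (1, 0) ^ b' * ell W ^ c')"
    using assms by (intro binomial origin unit) simp_all
  moreover have e: "ell (0, 0) = 1" "ell (1, 0) ^ n = monom 1 n" for n
    using origin unit X by (simp_all add: one_pCons del: one_poly_eq_simps)
  ultimately show ?thesis
    unfolding e by (simp only: power_0 power_one power_one_right mult_1_left mult_1_right mult_ac)
qed

lemma relation0: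
  assumes "w \<in> A" "fst w + int b = int b'" "snd w = 0"
  shows "pcong (monom 1 b * ell w) (monom 1 b')"
  using relation[OF assms(1) origin(1), of b 0 b' 0] assms(2,3)
  by (simp only: power_0 mult_1_right of_nat_0 mult_zero_left add_0_right)

lemma one_not_N: "1 \<notin> N" "- 1 \<notin> N"
  using one_U N_not_U N_uminus[of "-1"] by auto

lemma linear_coeff: "k \<ge> 2 \<Longrightarrow> coeff (ell w) k = 0"
  by (cases k; cases "k - 1") (auto simp: coeff_pCons)

text \<open>The form at (c, 0) would have to be the c-th power of the variable: for negative
  \<open>c\<close> the constant coefficient contradicts this, for \<open>c\<close> at least 2 the
  degree does.\<close>

lemma on_line:
  assumes "(c, 0) \<in> A"
  shows "c = 0 \<or> c = 1"
proof (rule ccontr)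
  assume "\<not> (c = 0 \<or> c = 1)"
  then consider "c < 0" | "c \<ge> 2" by linarith
  then show False
  proof cases
    case 1
    have "pcong (monom 1 (nat (- c)) * ell (c, 0)) (monom 1 0)"
      using 1 assms by (intro relation0) auto
    from pcongD[OF this, of 0] show False using 1 one_not_N by (simp add: coeff_monom_mult)
  next
    case 2
    have "pcong (monom 1 0 * ell (c, 0)) (monom 1 (nat c))"
      using 2 assms by (intro relation0) auto
    from pcongD[OF this, of "nat c"]
    have "coeff (ell (c, 0)) (nat c) - coeff (monom 1 (nat c)) (nat c) \<in> N"
      unfolding monom_eq_1 mult_1_left .
    moreover have "coeff (ell (c, 0)) (nat c) = 0" using 2 by (intro linear_coeff) linarith
    ultimately show False using one_not_N by simp
  qed
qed

text \<open>The point \<open>z\<close> and \<open>j\<close> copies of \<open>W\<close> add up to a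
  point of the axis, where the product of the forms is a power of the variable. Cancelling
  \<open>ell W\<close>, a monomial over the residue field, lowers the exponent by
  \<open>j * \<tau>\<close>.\<close>

lemma column:
  assumes W: "W \<in> A" "mono_at (ell W) \<tau>" and z: "z \<in> A" "snd z + int j * snd W = 0"
    and t: "t = fst z + int j * fst W - int j * int \<tau>"
  shows "t \<in> {0, 1}" "coeff (ell z) k \<in> U \<longleftrightarrow> int k = t"
proof -
  define s where "s = fst z + int j * fst W"
  define b where "b = nat (- s)"
  define b' where "b' = nat s"
  have "pcong (monom 1 b * (ell z * ell W ^ j)) (monom 1 b' * ell W ^ 0)"
    using z W by (intro relation) (auto simp: b_def b'_def s_def)
  then have rel: "pcong (ell z * (monom 1 b * ell W ^ j)) (monom 1 b')"
    by (simp only: mult.left_commute[of "monom 1 b" "ell z"] power_0 mult_1_right)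
  have q: "mono_at (monom 1 b * ell W ^ j) (b + j * \<tau>)"
    by (intro mono_at_mult mono_at_monom mono_at_power W)
  have iff: "b + j * \<tau> \<le> n \<and> coeff (ell z) (n - (b + j * \<tau>)) \<in> U \<longleftrightarrow> n = b'" for n
    using pcong_U[OF rel, of n] mono_at_monom[of b'] unfolding mono_at_mult_coeff[OF q] mono_at_def by blast
  have ints: "t = int b' - int b - int j * int \<tau>" by (simp add: t b_def b'_def s_def)
  have main: "coeff (ell z) k \<in> U \<longleftrightarrow> int k = t" for k
  proof -
    have "coeff (ell z) k \<in> U \<longleftrightarrow> k + (b + j * \<tau>) = b'" using iff[of "k + (b + j * \<tau>)"] by simp
    also have "\<dots> \<longleftrightarrow> int k = t" unfolding ints by (auto simp flip: of_nat_mult of_nat_add)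
    finally show ?thesis .
  qed
  show "coeff (ell z) k \<in> U \<longleftrightarrow> int k = t" by (rule main)
  have k0: "b + j * \<tau> \<le> b'" "coeff (ell z) (b' - (b + j * \<tau>)) \<in> U" using iff[of b'] by auto
  have "\<not> b' - (b + j * \<tau>) \<ge> 2" using linear_coeff[of "b' - (b + j * \<tau>)" z] k0(2) zero_not_U by auto
  moreover have "int (b' - (b + j * \<tau>)) = t" using main k0(2) by blast
  ultimately show "t \<in> {0, 1}" by auto
qed

text \<open>The triangle over the unit segment with apex \<open>w\<close> at distance n has width 1
  - 1/n at distance one. This suffices for a lattice point: \<open>r\<close> rounds
  \<open>fst w\<close> up to a multiple of n, and the weights 1, r, n - 1 - r exhibit the point as a
  barycenter.\<close>

lemma point_at_height_one:
  assumes w: "w \<in> A" "snd w \<noteq> 0"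
  shows "\<exists>p. (p, sgn (snd w)) \<in> A"
proof -
  define n where "n = \<bar>snd w\<bar>"
  have n: "n > 0" using w by (simp add: n_def)
  define r where "r = (- fst w) mod n"
  define p where "p = - ((- fst w) div n)"
  have r: "0 \<le> r" "r \<le> n - 1" using n pos_mod_bound[of n "- fst w"] by (auto simp: r_def)
  have pr: "fst w + r = n * p"
    using mult_div_mod_eq[of n "- fst w"] unfolding p_def r_def mult_minus_right by linarith
  have "(p, sgn (snd w)) \<in> A"
  proof (rule convex[OF w(1) unit(1) origin(1), of 1 "nat r" "nat (n - 1 - r)"])
    have sum: "int (1 + nat r + nat (n - 1 - r)) = n" using r by simp
    show "int 1 * fst w + int (nat r) * fst (1::int, 0::int) + int (nat (n - 1 - r)) * fst (0::int, 0::int) =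
      int (1 + nat r + nat (n - 1 - r)) * fst (p, sgn (snd w))"
      unfolding sum using r pr by simp
    show "int 1 * snd w + int (nat r) * snd (1::int, 0::int) + int (nat (n - 1 - r)) * snd (0::int, 0::int) =
      int (1 + nat r + nat (n - 1 - r)) * snd (p, sgn (snd w))"
      unfolding sum by (simp add: n_def abs_mult_sgn)
  qed simp
  then show ?thesis ..
qed

text \<open>The column through (c, 0) is cut out by \<open>fst w + \<kappa> * snd w = c\<close>, and
  weights 1 and n - 1 on \<open>w\<close> and (c, 0) give the lattice point next to (c, 0) in the
  direction of \<open>w\<close>.\<close>

lemma neighbour:
  assumes w: "w \<in> A" "w \<noteq> (c, 0)" "fst w + \<kappa> * snd w = c" and c: "c = 0 \<or> c = 1"
  shows "(c - \<kappa> * sgn (snd w), sgn (snd w)) \<in> A" "snd w \<noteq> 0"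
proof -
  show s: "snd w \<noteq> 0" using w by (metis add.right_neutral mult_zero_right prod.collapse)
  define n where "n = \<bar>snd w\<bar>"
  have n: "n > 0" using s by (simp add: n_def)
  have "(c, 0) \<in> A" using c origin unit by auto
  then show "(c - \<kappa> * sgn (snd w), sgn (snd w)) \<in> A"
  proof (rule convex[OF w(1) _ origin(1), of _ 1 "nat (n - 1)" 0])
    have sum: "int (1 + nat (n - 1) + 0) = n" using n by simp
    have ns: "n * sgn (snd w) = snd w" by (simp add: n_def abs_mult_sgn)
    have "n * (c - \<kappa> * sgn (snd w)) = n * c - \<kappa> * (n * sgn (snd w))"
      by (simp only: right_diff_distrib mult.left_commute)
    also have "\<dots> = fst w + (n - 1) * c"
      unfolding ns using w(3) by (simp add: left_diff_distrib)
    finally have "fst w + (n - 1) * c = n * (c - \<kappa> * sgn (snd w))" by (rule sym)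
    then show "int 1 * fst w + int (nat (n - 1)) * fst (c, 0::int) + int 0 * fst (0::int, 0::int) =
      int (1 + nat (n - 1) + 0) * fst (c - \<kappa> * sgn (snd w), sgn (snd w))"
      unfolding sum using n by simp
    show "int 1 * snd w + int (nat (n - 1)) * snd (c, 0::int) + int 0 * snd (0::int, 0::int) =
      int (1 + nat (n - 1) + 0) * snd (c - \<kappa> * sgn (snd w), sgn (snd w))"
      unfolding sum using ns by simp
  qed simp
qed

text \<open>\<open>P\<close> and \<open>Q\<close> are neighbours of the origin and of (1, 0) in the
  two columns, in directions \<open>a\<close> and \<open>b\<close> that may differ. Once
  \<open>\<beta> P\<close> vanishes, the form at \<open>P\<close> is a constant \<open>c\<close>,
  and every other point is related to \<open>P\<close> and the axis. \<open>T\<close> and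
  \<open>C\<close> cover both uses: all points on one side, or enough known units.\<close>

lemma scroll:
  assumes a: "a = 1 \<or> a = -1" and b: "b = 1 \<or> b = (-1 :: int)"
    and W1: "(- \<kappa> * a, a) \<in> A" and W2: "(1 - \<kappa> * b, b) \<in> A"
    and strip: "\<And>z. z \<in> A \<Longrightarrow> fst z + \<kappa> * snd z = 0 \<or> fst z + \<kappa> * snd z = 1"
    and T: "a = b \<or> \<beta> (- \<kappa> * a, a) \<notin> U \<and> \<alpha> (1 - \<kappa> * b, b) \<notin> U"
    and C: "\<alpha> (- \<kappa> * a, a) \<in> U \<or> (\<forall>z\<in>A. a * snd z \<ge> 0)"
  shows "line_class A \<alpha> \<beta> (0, 0) (1, 0)"
proof -
  define P where "P = (- \<kappa> * a, a)"
  define Q where "Q = (1 - \<kappa> * b, b)"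
  have PQ: "P \<in> A" "Q \<in> A" using W1 W2 by (simp_all add: P_def Q_def)
  have aa: "a * a = 1" using a by auto
  \<comment> \<open>For equal directions \<open>ell Q\<close> is the variable times
    \<open>ell P\<close>, and the coefficient of degree 2 is \<open>\<beta> P\<close>. For opposite
    directions the product of \<open>ell P\<close> and \<open>ell Q\<close> is the variable;
    \<open>T\<close> then makes \<open>\<beta> Q\<close> a unit, which cancels from
    \<open>\<beta> Q * \<beta> P\<close>.\<close>
  have \<beta>N: "\<beta> P \<in> N"
  proof (cases "a = b")
    case True
    have "pcong (monom 1 0 * (ell Q * ell P ^ 0)) (monom 1 1 * ell P ^ 1)"
      using PQ True by (intro relation) (auto simp: P_def Q_def)
    from pcongD[OF this, of 2] have "coeff (ell Q) 2 - coeff (monom 1 1 * ell P) 2 \<in> N"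
      unfolding monom_eq_1 mult_1_left power_0 mult_1_right power_one_right .
    moreover have "coeff (ell Q) 2 = 0" by (rule linear_coeff) simp
    moreover have "coeff (monom 1 1 * ell P) 2 = \<beta> P"
      unfolding coeff_monom_mult by (simp add: numeral_2_eq_2)
    ultimately show ?thesis using N_uminus[of "- \<beta> P"] by simp
  next
    case False
    then have b': "b = - a" using a b by auto
    have "pcong (monom 1 0 * (ell Q * ell P ^ 1)) (monom 1 1 * ell P ^ 0)"
      using PQ by (intro relation) (auto simp: P_def Q_def b')
    then have rel: "pcong (ell Q * ell P) (monom 1 1)"
      unfolding monom_eq_1 mult_1_left power_0 mult_1_right power_one_right .
    have prod: "ell Q * ell P = [:\<alpha> Q * \<alpha> P, \<alpha> Q * \<beta> P + \<beta> Q * \<alpha> P, \<beta> Q * \<beta> P:]" by simp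
    have "\<alpha> Q * \<beta> P + \<beta> Q * \<alpha> P - 1 \<in> N" using pcongD[OF rel, of 1] unfolding prod by simp
    then have "\<alpha> Q * \<beta> P + \<beta> Q * \<alpha> P \<in> U" using U_cong one_U by blast
    then have "\<beta> Q \<in> U" using U_add[of "\<alpha> Q * \<beta> P" "\<beta> Q * \<alpha> P"] T False by (auto simp: U_mult P_def Q_def)
    moreover have "\<beta> Q * \<beta> P \<in> N" using pcongD[OF rel, of 2] unfolding prod by (simp add: numeral_2_eq_2)
    ultimately show ?thesis by (rule cancel)
  qed
  define c where "c = \<alpha> P"
  have "pcong (ell P) [:c:]"
    unfolding pcong_def
  proof
    fix n :: nat
    consider "n = 0" | "n = 1" | "n \<ge> 2" by linarith
    then show "coeff (ell P) n - coeff [:c:] n \<in> N"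
    proof cases
      case 3
      then have "coeff [:c:] n = 0" by (cases n) auto
      then show ?thesis using linear_coeff[OF 3] N_zero by simp
    qed (use \<beta>N N_zero in \<open>auto simp: c_def\<close>)
  qed
  then have power: "pcong (ell P ^ n) [:c ^ n:]" for n
    using pcong_power[of "ell P" "[:c:]" n] by (simp add: poly_const_pow)
  \<comment> \<open>The sign of \<open>a * snd z\<close> decides on which side of the relation the
    power of \<open>ell P\<close> stands. If it is negative, \<open>C\<close> guarantees that
    \<open>c\<close> is a unit.\<close>
  have point: "scroll_point \<alpha> \<beta> c (fst z + \<kappa> * snd z) (a * snd z) z" if z: "z \<in> A" for z
  proof -
    define h where "h = nat (fst z + \<kappa> * snd z)"
    have h: "fst z + \<kappa> * snd z = int h" "h = 0 \<or> h = 1" using strip[OF z] by (auto simp: h_def)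
    have coeffs: "coeff (smult d (monom 1 h)) 0 = (if h = 0 then d else 0)"
      "coeff (smult d (monom 1 h)) 1 = (if h = 1 then d else 0)" for d :: 'a by auto
    show ?thesis
    proof (cases "a * snd z \<ge> 0")
      case True
      define n where "n = nat (a * snd z)"
      have n: "int n * a = snd z" using True a by (auto simp: n_def)
      have "pcong (monom 1 0 * (ell z * ell P ^ 0)) (monom 1 h * ell P ^ n)"
      proof (rule relation[OF z PQ(1)])
        have "int n * fst P = - \<kappa> * (int n * a)" by (simp add: P_def)
        then show "fst z + int 0 + int 0 * fst P = int h + int n * fst P" using h(1) unfolding n by simp
        show "snd z + int 0 * snd P = int n * snd P" using n by (simp add: P_def)
      qed
      then have "pcong (ell z) (monom 1 h * ell P ^ n)"
        unfolding monom_eq_1 mult_1_left power_0 mult_1_right .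
      then have "pcong (ell z) (monom 1 h * [:c ^ n:])"
        by (rule pcong_trans[OF _ pcong_mult[OF pcong_refl power]])
      then have "pcong (ell z) (smult (c ^ n) (monom 1 h))" by simp
      from pcongD[OF this, of 0] pcongD[OF this, of 1]
      have "\<alpha> z - (if h = 0 then c ^ n else 0) \<in> N" "\<beta> z - (if h = 1 then c ^ n else 0) \<in> N"
        unfolding coeffs by simp_all
      then show ?thesis using True h unfolding scroll_point_def h(1) n_def by simp
    next
      case False
      define n where "n = nat (- (a * snd z))"
      have n: "int n * a = - snd z" using False a by (auto simp: n_def)
      have "pcong (monom 1 0 * (ell z * ell P ^ n)) (monom 1 h * ell P ^ 0)"
      proof (rule relation[OF z PQ(1)])
        have "int n * fst P = - \<kappa> * (int n * a)" by (simp add: P_def)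
        then show "fst z + int 0 + int n * fst P = int h + int 0 * fst P" using h(1) unfolding n by simp
        show "snd z + int n * snd P = int 0 * snd P" using n by (simp add: P_def)
      qed
      then have "pcong (ell z * ell P ^ n) (monom 1 h)"
        unfolding monom_eq_1 mult_1_left power_0 mult_1_right .
      then have "pcong (ell z * [:c ^ n:]) (monom 1 h)"
        by (rule pcong_trans[OF pcong_sym[OF pcong_mult[OF pcong_refl power]]])
      then have "pcong (smult (c ^ n) (ell z)) (smult 1 (monom 1 h))" by simp
      from pcongD[OF this, of 0] pcongD[OF this, of 1]
      have "c ^ n * \<alpha> z - (if h = 0 then 1 else 0) \<in> N" "c ^ n * \<beta> z - (if h = 1 then 1 else 0) \<in> N"
        unfolding coeffs by simp_all
      moreover have "c \<in> U" using C False z by (auto simp: c_def P_def)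
      ultimately show ?thesis using False h unfolding scroll_point_def h(1) n_def by simp
    qed
  qed
  show ?thesis
    unfolding line_class_def
  proof (rule disjI2, rule exI[of _ "\<lambda>z. fst z + \<kappa> * snd z"], rule exI[of _ "\<lambda>z. a * snd z"], intro conjI)
    show "affine_fun (\<lambda>z. fst z + \<kappa> * snd z)"
      unfolding affine_fun_def by (intro exI[of _ 1] exI[of _ \<kappa>] exI[of _ 0]) simp
    show "affine_fun (\<lambda>z. a * snd z)"
      unfolding affine_fun_def by (intro exI[of _ 0] exI[of _ a]) simp
    show "\<exists>W\<in>A. fst W + \<kappa> * snd W = 0 \<and> a * snd W = 1 \<and>
      (A = {(0, 0), (1, 0), W} \<or> (\<forall>w\<in>A. scroll_point \<alpha> \<beta> (\<alpha> W) (fst w + \<kappa> * snd w) (a * snd w) w))"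
      using PQ(1) point aa by (intro bexI[of _ P] conjI disjI2 ballI) (simp_all add: P_def c_def)
  qed simp_all
qed

text \<open>The segment from the origin to (1, 0) is an edge, so smoothness is available at both of
  its ends. It determines the neighbouring edges, and with them the three cases.\<close>

lemma same_side:
  assumes nonneg: "\<And>w. w \<in> A \<Longrightarrow> snd w \<ge> 0"
  shows "line_class A \<alpha> \<beta> (0, 0) (1, 0)"
proof -
  obtain w0 where w0: "w0 \<in> A" "snd w0 \<noteq> 0" using off_line by blast
  then have "sgn (snd w0) = 1" using nonneg[of w0] by simp
  then obtain p0 where p0: "(p0, 1) \<in> A" using point_at_height_one[OF w0] by auto
  have bottom: "w = (0, 0) \<or> w = (1, 0)" if "w \<in> A" "\<not> snd w > 0" for w
  proof -
    have "snd w = 0" using nonneg[of w] that by simp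
    then have "w = (fst w, 0)" by (metis prod.collapse)
    then show ?thesis using on_line[of "fst w"] that(1) by metis
  qed
  have "\<exists>e1\<in>A. \<exists>e2\<in>A. \<forall>w\<in>A. \<exists>m n :: nat.
      fst w - fst (0 :: int, 0 :: int) = int m * (fst e1 - fst (0 :: int, 0 :: int)) + int n * (fst e2 - fst (0 :: int, 0 :: int)) \<and>
      snd w - snd (0 :: int, 0 :: int) = int m * (snd e1 - snd (0 :: int, 0 :: int)) + int n * (snd e2 - snd (0 :: int, 0 :: int))"
  proof (rule smooth[OF origin(1), of 0 1 1 0])
    fix w assume "w \<in> A" "w \<noteq> (0, 0)"
    then show "0 < 0 * (fst w - fst (0, 0)) + 1 * (snd w - snd (0, 0)) \<or>
      0 * (fst w - fst (0, 0)) + 1 * (snd w - snd (0, 0)) = 0 \<and> 0 < 1 * (fst w - fst (0, 0)) + 0 * (snd w - snd (0, 0))"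
      using bottom[of w] by auto
  qed
  then obtain e1 e2 where e12: "e1 \<in> A" "e2 \<in> A" "\<forall>w\<in>A. \<exists>m n :: nat.
      fst w = int m * fst e1 + int n * fst e2 \<and> snd w = int m * snd e1 + int n * snd e2"
    unfolding fst_conv snd_conv diff_zero by blast
  note e = e12(1,2) e12(3)[rule_format]
  obtain p where p: "(p, 1) \<in> A" and p_le: "\<And>w. w \<in> A \<Longrightarrow> 1 * (fst w - p * snd w) \<ge> 0"
    using edge_basis[of 1 e1 A e2 p0, OF _ e(1,2) unit(1) nonneg e(3) p0] by auto
  have "\<exists>e1\<in>A. \<exists>e2\<in>A. \<forall>w\<in>A. \<exists>m n :: nat.
      fst w - fst (1 :: int, 0 :: int) = int m * (fst e1 - fst (1 :: int, 0 :: int)) + int n * (fst e2 - fst (1 :: int, 0 :: int)) \<and>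
      snd w - snd (1 :: int, 0 :: int) = int m * (snd e1 - snd (1 :: int, 0 :: int)) + int n * (snd e2 - snd (1 :: int, 0 :: int))"
  proof (rule smooth[OF unit(1), of 0 1 "-1" 0])
    fix w assume "w \<in> A" "w \<noteq> (1, 0)"
    then show "0 < 0 * (fst w - fst (1, 0)) + 1 * (snd w - snd (1, 0)) \<or>
      0 * (fst w - fst (1, 0)) + 1 * (snd w - snd (1, 0)) = 0 \<and> 0 < - 1 * (fst w - fst (1, 0)) + 0 * (snd w - snd (1, 0))"
      using bottom[of w] by auto
  qed
  then obtain d1 d2 where d12: "d1 \<in> A" "d2 \<in> A" "\<forall>w\<in>A. \<exists>m n :: nat.
      fst w - 1 = int m * (fst d1 - 1) + int n * (fst d2 - 1) \<and> snd w = int m * snd d1 + int n * snd d2"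
    unfolding fst_conv snd_conv diff_zero by blast
  note d = d12(1,2) d12(3)[rule_format]
  \<comment> \<open>Translated by -1, so that the right end of the edge becomes the origin and the
    edge points in direction -1.\<close>
  define D where "D = (\<lambda>w. (fst w - 1, snd w)) ` A"
  have "\<exists>q. (q, 1) \<in> D \<and> (\<forall>w\<in>D. - 1 * (fst w - q * snd w) \<ge> 0)"
  proof (rule edge_basis[of "-1" "(fst d1 - 1, snd d1)" D "(fst d2 - 1, snd d2)" "p0 - 1"])
    show "(- 1, 0) \<in> D" using origin(1) unfolding D_def by force
    show "(p0 - 1, 1) \<in> D" using p0 unfolding D_def by force
    show "0 \<le> snd w" if "w \<in> D" for w using that nonneg by (auto simp: D_def)
    show "\<exists>m n. fst w = int m * fst (fst d1 - 1, snd d1) + int n * fst (fst d2 - 1, snd d2) \<and>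
      snd w = int m * snd (fst d1 - 1, snd d1) + int n * snd (fst d2 - 1, snd d2)" if "w \<in> D" for w
      using that d(3) by (auto simp: D_def)
  qed (use d in \<open>auto simp: D_def\<close>)
  then obtain q' where q': "(q', 1) \<in> D" "\<And>w. w \<in> D \<Longrightarrow> - 1 * (fst w - q' * snd w) \<ge> 0" by blast
  \<comment> \<open>At height one the points run from \<open>p\<close> to \<open>p + b\<close>, and
    \<open>A\<close> lies between the rays from the two ends of the edge through these points. The
    number 1 - b is the self-intersection of the curve belonging to the edge.\<close>
  define b where "b = q' + 1 - p"
  have pb: "(p + b, 1) \<in> A" using q'(1) by (auto simp: D_def b_def)
  have le_q: "fst w \<le> 1 + (p + b - 1) * snd w" if "w \<in> A" for w
    using q'(2)[of "(fst w - 1, snd w)"] that by (auto simp: D_def b_def)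
  have ge_p: "p * snd w \<le> fst w" if "w \<in> A" for w using p_le[OF that] by simp
  have "b \<ge> 0" using le_q[OF p] by simp
  then consider "b = 0" | "b = 1" | "b \<ge> 2" by linarith
  then show ?thesis
  proof cases
    case 1
    \<comment> \<open>For b = 0 the two rays meet at height one, which leaves a unimodular
      triangle.\<close>
    have "w \<in> {(0, 0), (1, 0), (p, 1)}" if w: "w \<in> A" for w
    proof (cases "snd w > 0")
      case True
      have "p * snd w \<le> 1 + (p - 1) * snd w" using ge_p[OF w] le_q[OF w] 1 by simp
      then have "snd w = 1" using True by (simp add: left_diff_distrib)
      then have "fst w = p" using ge_p[OF w] le_q[OF w] 1 by simp
      then show ?thesis using \<open>snd w = 1\<close> by (metis insertCI prod.collapse)
    qed (use bottom w in blast)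
    then have A: "A = {(0, 0), (1, 0), (p, 1)}" using origin unit p by blast
    have "affine_fun (\<lambda>z. fst z - p * snd z)" "affine_fun snd"
      unfolding affine_fun_def
      by (rule exI[of _ 1], rule exI[of _ "- p"], rule exI[of _ 0], simp)
        (rule exI[of _ 0], rule exI[of _ 1], rule exI[of _ 0], simp)
    then show ?thesis
      unfolding line_class_def
      by (intro disjI2, rule_tac x = "\<lambda>z. fst z - p * snd z" in exI, rule_tac x = snd in exI)
        (use p A in \<open>auto intro!: bexI[of _ "(p, 1)"]\<close>)
  next
    case 2
    show ?thesis
    proof (rule scroll[of 1 1 "- p"])
      show "fst z + - p * snd z = 0 \<or> fst z + - p * snd z = 1" if "z \<in> A" for z
        using ge_p[OF that] le_q[OF that] 2 by simp linarith
    qed (use p pb 2 nonneg in \<open>auto simp: add.commute\<close>)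
  next
    case 3
    \<comment> \<open>Three consecutive points exist at height one, and each form is the variable
      times the previous one. Linearity of the second and third forms forces both coefficients of
      the first to vanish, and with them the forms of all points of positive height.\<close>
    have p1: "(p + 1, 1) \<in> A"
      using 3 by (intro convex[OF p pb p, of "nat (b - 1)" 1 0]) (auto simp: algebra_simps)
    have p2: "(p + 2, 1) \<in> A"
      using 3 by (intro convex[OF p pb p, of "nat (b - 2)" 2 0]) (auto simp: algebra_simps)
    have r1: "pcong (monom 1 0 * (ell (p + 1, 1) * ell (p, 1) ^ 0)) (monom 1 1 * ell (p, 1) ^ 1)"
      using p1 p by (intro relation) simp_all
    have r2: "pcong (monom 1 0 * (ell (p + 2, 1) * ell (p + 1, 1) ^ 0)) (monom 1 1 * ell (p + 1, 1) ^ 1)"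
      using p2 p1 by (intro relation) simp_all
    have e: "coeff (monom 1 1 * ell w) 2 = \<beta> w" "coeff (monom 1 1 * ell w) 1 = \<alpha> w" for w
      unfolding coeff_monom_mult by (simp_all add: numeral_2_eq_2)
    have "\<beta> (p, 1) \<in> N"
      using pcongD[OF r1, of 2] N_uminus linear_coeff[of 2 "(p + 1, 1)"]
      unfolding monom_eq_1 mult_1_left power_0 mult_1_right power_one_right e by fastforce
    have "\<beta> (p + 1, 1) \<in> N"
      using pcongD[OF r2, of 2] N_uminus linear_coeff[of 2 "(p + 2, 1)"]
      unfolding monom_eq_1 mult_1_left power_0 mult_1_right power_one_right e by fastforce
    moreover have "\<beta> (p + 1, 1) - \<alpha> (p, 1) \<in> N"
      using pcongD[OF r1, of 1] unfolding monom_eq_1 mult_1_left power_0 mult_1_right power_one_right e by simp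
    ultimately have "\<beta> (p + 1, 1) - (\<beta> (p + 1, 1) - \<alpha> (p, 1)) \<in> N" by (rule N_diff)
    then have "\<alpha> (p, 1) \<in> N" by simp
    have coeffs: "coeff (ell (p, 1)) n \<in> N" for n
    proof (cases "n \<ge> 2")
      case True then show ?thesis using linear_coeff[OF True] N_zero by simp
    next
      case False
      then have "n = 0 \<or> n = 1" by linarith
      then show ?thesis using \<open>\<alpha> (p, 1) \<in> N\<close> \<open>\<beta> (p, 1) \<in> N\<close> by auto
    qed
    then have zero: "pcong (ell (p, 1)) 0" by (simp add: pcong_def)
    have "\<alpha> w \<in> N \<and> \<beta> w \<in> N" if w: "w \<in> A" "w \<noteq> (0, 0)" "w \<noteq> (1, 0)" for w
    proof -
      have s: "snd w > 0" using bottom w by blast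
      define i where "i = fst w - p * snd w"
      have i: "i \<ge> 0" using ge_p[OF w(1)] by (simp add: i_def)
      have "pcong (monom 1 0 * (ell w * ell (p, 1) ^ 0)) (monom 1 (nat i) * ell (p, 1) ^ nat (snd w))"
        using w(1) p s i by (intro relation) (simp_all add: i_def)
      then have r: "pcong (ell w) (monom 1 (nat i) * ell (p, 1) ^ nat (snd w))"
        unfolding monom_eq_1 mult_1_left power_0 mult_1_right .
      have "pcong (ell (p, 1) ^ nat (snd w)) (0 ^ nat (snd w))" by (rule pcong_power[OF zero])
      then have "pcong (ell (p, 1) ^ nat (snd w)) 0" using s by (simp add: power_0_left)
      from pcong_trans[OF r pcong_mult[OF pcong_refl this]] have "pcong (ell w) 0" by simp
      from pcongD[OF this, of 0] pcongD[OF this, of 1] show ?thesis by simp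
    qed
    then show ?thesis unfolding line_class_def by blast
  qed
qed

text \<open>Forms at heights 1 and -1 multiply to a power of the variable, so both are monomials
  over the residue field. Via \<open>column\<close> this spreads to all points: each form has
  exactly one unit coefficient, and an affine function tells which.\<close>

lemma both_sides:
  assumes wp: "w1 \<in> A" "snd w1 > 0" and wm: "w2 \<in> A" "snd w2 < 0"
  shows "line_class A \<alpha> \<beta> (0, 0) (1, 0)"
proof -
  obtain p where p: "(p, 1) \<in> A" using point_at_height_one[OF wp(1)] wp(2) by auto
  obtain p' where p': "(p', - 1) \<in> A" using point_at_height_one[OF wm(1)] wm(2) by auto
  define s where "s = p + p'"
  have rel: "pcong (monom 1 (nat (- s)) * (ell (p, 1) * ell (p', - 1) ^ 1)) (monom 1 (nat s) * ell (p', - 1) ^ 0)"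
    using p p' by (intro relation) (simp_all add: s_def)
  then have rel: "pcong (monom 1 (nat (- s)) * (ell (p, 1) * ell (p', - 1))) (monom 1 (nat s))"
    unfolding power_0 mult_1_right power_one_right .
  have s: "s \<ge> 0"
  proof (rule ccontr)
    assume "\<not> s \<ge> 0"
    then have "coeff (monom 1 (nat (- s)) * (ell (p, 1) * ell (p', - 1))) 0 = 0" "coeff (monom 1 (nat s) :: 'a poly) 0 = 1"
      unfolding coeff_monom_mult by simp_all
    then show False using pcongD[OF rel, of 0] one_not_N by simp
  qed
  then have "nat (- s) = 0" by simp
  then have "pcong (ell (p, 1) * ell (p', - 1)) (monom 1 (nat s))"
    using rel by (simp only: monom_eq_1 mult_1_left)
  then obtain \<tau> \<tau>' where \<tau>: "mono_at (ell (p, 1)) \<tau>" "mono_at (ell (p', - 1)) \<tau>'" "\<tau> + \<tau>' = nat s"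
    using mono_at_linear_factors by blast
  \<comment> \<open>Chosen so that \<open>h\<close> takes the value \<open>\<tau>\<close> at (p, 1)
    and \<open>\<tau>'\<close> at (p', -1).\<close>
  define \<kappa> where "\<kappa> = p' - int \<tau>'"
  have \<kappa>: "\<kappa> = - (p - int \<tau>)" using \<tau>(3) s by (simp add: \<kappa>_def s_def)
  define h where "h z = fst z + \<kappa> * snd z" for z :: "int \<times> int"
  have h: "h z \<in> {0, 1} \<and> (\<forall>k. coeff (ell z) k \<in> U \<longleftrightarrow> int k = h z)" if z: "z \<in> A" for z
  proof (cases "snd z \<ge> 0")
    case True
    define j where "j = nat (snd z)"
    have "snd z + int j * snd (p', - 1 :: int) = 0" using True by (simp add: j_def)
    moreover have "h z = fst z + int j * fst (p', - 1 :: int) - int j * int \<tau>'"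
      using True by (simp add: h_def \<kappa>_def j_def left_diff_distrib right_diff_distrib mult.commute)
    ultimately show ?thesis using column[OF p' \<tau>(2) z] by blast
  next
    case False
    define j where "j = nat (- snd z)"
    have "snd z + int j * snd (p, 1 :: int) = 0" using False by (simp add: j_def)
    moreover have "h z = fst z + int j * fst (p, 1 :: int) - int j * int \<tau>"
      using False by (simp add: h_def \<kappa> j_def left_diff_distrib right_diff_distrib mult.commute)
    ultimately show ?thesis using column[OF p \<tau>(1) z] by blast
  qed
  have \<alpha>U: "\<alpha> z \<in> U \<longleftrightarrow> h z = 0" if "z \<in> A" for z using h[OF that, THEN conjunct2, rule_format, of 0] by auto
  have \<beta>U: "\<beta> z \<in> U \<longleftrightarrow> h z = 1" if "z \<in> A" for z using h[OF that, THEN conjunct2, rule_format, of 1] by auto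
  \<comment> \<open>If (c, 0) were alone in its column, it would be a vertex whose distance to the
    other column is one. Smoothness would then allow that column at most two heights, but it would
    contain points of heights 1, 0 and -1.\<close>
  have other: "\<exists>z\<in>A. h z = c \<and> z \<noteq> (c, 0)" if c: "c = 0 \<or> c = 1" for c
  proof (rule ccontr)
    assume none: "\<not> ?thesis"
    define f where "f = (if c = 0 then 1 else (-1 :: int))"
    have f: "f * (x - c) = 1 \<longleftrightarrow> x \<noteq> c" if "x \<in> {0, 1}" for x
      using that c unfolding f_def by (elim disjE insertE emptyE) simp_all
    have cA: "(c, 0) \<in> A" using c origin unit by auto
    have hw: "f * (h w - c) = 1" if "w \<in> A" "w \<noteq> (c, 0)" for w
    proof -
      have "h w \<noteq> c" using none that by blast
      then show ?thesis using f[OF h[OF that(1), THEN conjunct1]] by simp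
    qed
    have "\<exists>e1\<in>A. \<exists>e2\<in>A. \<forall>w\<in>A. \<exists>m n :: nat.
      fst w - fst (c, 0 :: int) = int m * (fst e1 - fst (c, 0 :: int)) + int n * (fst e2 - fst (c, 0 :: int)) \<and>
      snd w - snd (c, 0 :: int) = int m * (snd e1 - snd (c, 0 :: int)) + int n * (snd e2 - snd (c, 0 :: int))"
    proof (rule smooth[OF cA, of f "f * \<kappa>" 0 0])
      fix w assume "w \<in> A" "w \<noteq> (c, 0)"
      then have one: "f * (h w - c) = 1" by (rule hw)
      have "f * (fst w - fst (c, 0 :: int)) + f * \<kappa> * (snd w - snd (c, 0 :: int)) = f * (h w - c)"
        unfolding h_def fst_conv snd_conv diff_zero right_diff_distrib distrib_left mult.assoc by linarith
      then have E: "f * (fst w - fst (c, 0 :: int)) + f * \<kappa> * (snd w - snd (c, 0 :: int)) = 1"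
        using one by (rule trans)
      show "0 < f * (fst w - fst (c, 0 :: int)) + f * \<kappa> * (snd w - snd (c, 0 :: int)) \<or>
        f * (fst w - fst (c, 0 :: int)) + f * \<kappa> * (snd w - snd (c, 0 :: int)) = 0 \<and>
        0 < 0 * (fst w - fst (c, 0 :: int)) + 0 * (snd w - snd (c, 0 :: int))"
        by (rule disjI1) (simp only: E zero_less_one)
    qed
    then obtain e1 e2 where e: "e1 \<in> A" "e2 \<in> A" and gen: "\<forall>w\<in>A. \<exists>m n :: nat.
      fst w - c = int m * (fst e1 - c) + int n * (fst e2 - c) \<and> snd w = int m * snd e1 + int n * snd e2"
      unfolding fst_conv snd_conv diff_zero by blast
    \<comment> \<open>Along \<open>f * (h w - c)\<close> each point of the other column has value 1,
      and the generators have value 1, or value 0 together with height 0. So exactly one generator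
      of value 1 occurs, once, and it determines the height.\<close>
    have snds: "snd w \<in> {snd e1, snd e2}" if w: "w \<in> A" "w \<noteq> (c, 0)" for w
    proof -
      obtain m n :: nat where mn: "fst w - c = int m * (fst e1 - c) + int n * (fst e2 - c)"
        "snd w = int m * snd e1 + int n * snd e2" using bspec[OF gen w(1)] by blast
      have "h w - c = (fst w - c) + \<kappa> * snd w" by (simp add: h_def)
      also have "\<dots> = int m * (h e1 - c) + int n * (h e2 - c)"
        unfolding mn h_def right_diff_distrib distrib_left mult.left_commute[of \<kappa>] by linarith
      finally have "f * (h w - c) = int m * (f * (h e1 - c)) + int n * (f * (h e2 - c))"
        by (simp only: distrib_left mult.left_commute)
      then have one: "1 = int m * (f * (h e1 - c)) + int n * (f * (h e2 - c))" unfolding hw[OF w] .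
      have z: "f * (h e - c) = 0 \<and> snd e = 0 \<or> f * (h e - c) = 1" if "e \<in> A" for e

      proof (cases "e = (c, 0)")
        case True
        then show ?thesis by (simp add: h_def)
      qed (use hw[OF that] in blast)
      from z[OF e(1)] z[OF e(2)] show ?thesis
      proof (elim disjE conjE)
        assume z: "f * (h e1 - c) = 1" "f * (h e2 - c) = 1"
        have "int m + int n = 1" using one unfolding z by simp
        then have "m = 1 \<and> n = 0 \<or> m = 0 \<and> n = 1" by linarith
        then show ?thesis using mn(2) by auto
      next
        assume z: "f * (h e1 - c) = 1" "f * (h e2 - c) = 0" "snd e2 = 0"
        have "m = 1" using one unfolding z by simp
        then show ?thesis using mn(2) z(3) by simp
      next
        assume z: "f * (h e1 - c) = 0" "f * (h e2 - c) = 1" "snd e1 = 0"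
        have "n = 1" using one unfolding z by simp
        then show ?thesis using mn(2) z(3) by simp
      next
        assume z: "f * (h e1 - c) = 0" "f * (h e2 - c) = 0"
        show ?thesis using one unfolding z by simp
      qed
    qed
    have three: "snd (p, 1 :: int) \<in> {snd e1, snd e2}" "snd (p', - 1 :: int) \<in> {snd e1, snd e2}"
      by (rule snds; use p p' in simp)+
    have "(1 - c, 0) \<in> A" using c origin unit by auto
    then have "snd (1 - c, 0 :: int) \<in> {snd e1, snd e2}" using c by (intro snds) auto
    with three show False by auto
  qed
  obtain z1 where z1: "z1 \<in> A" "h z1 = 0" "z1 \<noteq> (0, 0)" using other[of 0] by auto
  obtain z2 where z2: "z2 \<in> A" "h z2 = 1" "z2 \<noteq> (1, 0)" using other[of 1] by auto
  have P: "(- \<kappa> * sgn (snd z1), sgn (snd z1)) \<in> A" "snd z1 \<noteq> 0"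
    using neighbour[of z1 0 \<kappa>] z1 by (auto simp: h_def)
  have Q: "(1 - \<kappa> * sgn (snd z2), sgn (snd z2)) \<in> A" "snd z2 \<noteq> 0"
    using neighbour[of z2 1 \<kappa>] z2 by (auto simp: h_def)
  show ?thesis
  proof (rule scroll[OF _ _ P(1) Q(1)])
    show "sgn (snd z1) = 1 \<or> sgn (snd z1) = - 1" "sgn (snd z2) = 1 \<or> sgn (snd z2) = - 1"
      using P(2) Q(2) by (auto simp: sgn_if)
    show "fst z + \<kappa> * snd z = 0 \<or> fst z + \<kappa> * snd z = 1" if "z \<in> A" for z
      using h[OF that] by (auto simp: h_def)
    show "sgn (snd z1) = sgn (snd z2) \<or>
      \<beta> (- \<kappa> * sgn (snd z1), sgn (snd z1)) \<notin> U \<and> \<alpha> (1 - \<kappa> * sgn (snd z2), sgn (snd z2)) \<notin> U"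
      using \<beta>U[OF P(1)] \<alpha>U[OF Q(1)] by (simp add: h_def)
    show "\<alpha> (- \<kappa> * sgn (snd z1), sgn (snd z1)) \<in> U \<or> (\<forall>z\<in>A. 0 \<le> sgn (snd z1) * snd z)"
      using \<alpha>U[OF P(1)] by (simp add: h_def)
  qed
qed

end

section \<open>Reduction to standard position\<close>

locale lattice_frame =
  fixes u1 u2 d1 d2 E1 E2 \<sigma> :: int
  assumes det: "d1 * E2 - d2 * E1 = \<sigma>" and \<sigma>: "\<sigma> = 1 \<or> \<sigma> = -1"
begin

definition T :: "int \<times> int \<Rightarrow> int \<times> int" where
  "T p = (u1 + d1 * fst p + E1 * snd p, u2 + d2 * fst p + E2 * snd p)"

definition T' :: "int \<times> int \<Rightarrow> int \<times> int" where
  "T' q = (\<sigma> * (E2 * (fst q - u1) - E1 * (snd q - u2)), \<sigma> * (d1 * (snd q - u2) - d2 * (fst q - u1)))"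

lemma \<sigma>_square: "\<sigma> * \<sigma> = 1" using \<sigma> by auto

lemma T_T': "T (T' q) = q"
proof (rule prod_eqI)
  have "d1 * (\<sigma> * (E2 * x - E1 * y)) + E1 * (\<sigma> * (d1 * y - d2 * x)) = \<sigma> * (d1 * E2 - d2 * E1) * x" for x y
    by (simp add: algebra_simps)
  then have "d1 * (\<sigma> * (E2 * x - E1 * y)) + E1 * (\<sigma> * (d1 * y - d2 * x)) = x" for x y
    unfolding det \<sigma>_square by simp
  then show "fst (T (T' q)) = fst q" unfolding T_def T'_def fst_conv snd_conv add.assoc by simp
  have "d2 * (\<sigma> * (E2 * x - E1 * y)) + E2 * (\<sigma> * (d1 * y - d2 * x)) = \<sigma> * (d1 * E2 - d2 * E1) * y" for x y
    by (simp add: algebra_simps)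
  then have "d2 * (\<sigma> * (E2 * x - E1 * y)) + E2 * (\<sigma> * (d1 * y - d2 * x)) = y" for x y
    unfolding det \<sigma>_square by simp
  then show "snd (T (T' q)) = snd q" unfolding T_def T'_def fst_conv snd_conv add.assoc by simp
qed

lemma T'_T: "T' (T p) = p"
proof (rule prod_eqI)
  have "\<sigma> * (E2 * (u1 + d1 * x + E1 * y - u1) - E1 * (u2 + d2 * x + E2 * y - u2)) = \<sigma> * (d1 * E2 - d2 * E1) * x" for x y
    by (simp add: algebra_simps)
  then show "fst (T' (T p)) = fst p" unfolding T_def T'_def fst_conv snd_conv det \<sigma>_square by simp
  have "\<sigma> * (d1 * (u2 + d2 * x + E2 * y - u2) - d2 * (u1 + d1 * x + E1 * y - u1)) = \<sigma> * (d1 * E2 - d2 * E1) * y" for x y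
    by (simp add: algebra_simps)
  then show "snd (T' (T p)) = snd p" unfolding T_def T'_def fst_conv snd_conv det \<sigma>_square by simp
qed

lemma affine_T': "affine_fun h \<Longrightarrow> affine_fun (\<lambda>q. h (T' q))"
proof -
  assume "affine_fun h"
  then obtain a b c where h: "\<And>w. h w = a * fst w + b * snd w + c" unfolding affine_fun_def by blast
  have "h (T' q) = (a * \<sigma> * E2 - b * \<sigma> * d2) * fst q + (b * \<sigma> * d1 - a * \<sigma> * E1) * snd q +
      (a * \<sigma> * (E1 * u2 - E2 * u1) + b * \<sigma> * (d2 * u1 - d1 * u2) + c)" for q
    unfolding h T'_def fst_conv snd_conv by (simp add: algebra_simps)
  then show ?thesis unfolding affine_fun_def by blast
qed

end

locale general_line = line_on_points N U A \<alpha> \<beta> + point_configuration A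
  for N U :: "'a::comm_ring_1 set" and A \<alpha> \<beta> +
  fixes u v :: "int \<times> int"
  assumes u: "u \<in> A" "\<alpha> u = 1" "\<beta> u = 0" and v: "v \<in> A" "\<alpha> v = 0" "\<beta> v = 1"
    and noncollinear: "\<exists>w\<in>A. (fst v - fst u) * (snd w - snd u) - (snd v - snd u) * (fst w - fst u) \<noteq> 0"
begin

text \<open>If \<open>v - u\<close> were n \<ge> 2 times a lattice vector, the point
  \<open>w\<close> next to \<open>u\<close> would satisfy
  \<open>(\<alpha> w + \<beta> w X)^n = X\<close> modulo \<open>N\<close>. The coefficient in degree
  1 makes \<open>\<beta> w\<close> a unit, the one in degree n puts \<open>\<beta> w ^ n\<close>
  into \<open>N\<close>.\<close>

lemma primitive: "coprime (fst v - fst u) (snd v - snd u)"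
proof -
  define g where "g = gcd (fst v - fst u) (snd v - snd u)"
  obtain a b where ab: "fst v - fst u = g * a" "snd v - snd u = g * b"
    unfolding g_def by (meson dvdE gcd_dvd1 gcd_dvd2)
  have "g \<noteq> 0" using noncollinear ab by auto
  then have "g > 0" using gcd_ge_0_int[of "fst v - fst u" "snd v - snd u"] unfolding g_def by linarith
  define n where "n = nat g"
  have n: "int n = g" using \<open>g > 0\<close> by (simp add: n_def)
  define w where "w = (fst u + a, snd u + b)"
  have "g = 1"
  proof (rule ccontr)
    assume "g \<noteq> 1"
    then have n2: "n \<ge> 2" using n \<open>g > 0\<close> by linarith
    have n1: "int (n - 1) = g - 1" using n n2 by linarith
    have w: "w \<in> A"
    proof (rule convex[OF v(1) u(1) u(1), of 1 "n - 1" 0])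
      have sum: "int (1 + (n - 1) + 0) = g" using n n2 by linarith
      show "int 1 * fst v + int (n - 1) * fst u + int 0 * fst u = int (1 + (n - 1) + 0) * fst w"
        unfolding sum n1 w_def fst_conv using ab(1) by (simp add: algebra_simps)
      show "int 1 * snd v + int (n - 1) * snd u + int 0 * snd u = int (1 + (n - 1) + 0) * snd w"
        unfolding sum n1 w_def snd_conv using ab(2) by (simp add: algebra_simps)
    qed simp
    have "pcong ([:\<alpha> w, \<beta> w:] ^ n * [:\<alpha> u, \<beta> u:] ^ 0 * [:\<alpha> v, \<beta> v:] ^ 0 * [:\<alpha> u, \<beta> u:] ^ 0)
      ([:\<alpha> w, \<beta> w:] ^ 0 * [:\<alpha> u, \<beta> u:] ^ (n - 1) * [:\<alpha> v, \<beta> v:] ^ 1 * [:\<alpha> u, \<beta> u:] ^ 0)"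
    proof (rule binomial[OF w u(1) v(1) u(1)])
      show "n + 0 + 0 + 0 = 0 + (n - 1) + 1 + 0" using n2 by simp
      show "int n * fst w + int 0 * fst u + int 0 * fst v + int 0 * fst u =
        int 0 * fst w + int (n - 1) * fst u + int 1 * fst v + int 0 * fst u"
        unfolding n n1 w_def fst_conv using ab(1) by (simp add: algebra_simps)
      show "int n * snd w + int 0 * snd u + int 0 * snd v + int 0 * snd u =
        int 0 * snd w + int (n - 1) * snd u + int 1 * snd v + int 0 * snd u"
        unfolding n n1 w_def snd_conv using ab(2) by (simp add: algebra_simps)
    qed
    moreover have "[:\<alpha> u, \<beta> u:] = 1" unfolding u by (simp add: one_pCons del: one_poly_eq_simps)
    ultimately have "pcong ([:\<alpha> w, \<beta> w:] ^ n) [:\<alpha> v, \<beta> v:]"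
      by (simp only: power_0 power_one power_one_right mult_1_left mult_1_right)
    then have rel: "pcong ([:\<alpha> w, \<beta> w:] ^ n) [:0, 1:]" unfolding v .
    have "of_nat (n choose 1) * \<beta> w ^ 1 * \<alpha> w ^ (n - 1) - 1 \<in> N"
      using pcongD[OF rel, of 1] n2 by (simp add: coeff_linear_poly_power)
    then have "of_nat (n choose 1) * \<beta> w ^ 1 * \<alpha> w ^ (n - 1) \<in> U" using U_cong one_U by blast
    then have "\<beta> w ^ n \<in> U" using U_power by (simp add: U_mult)
    moreover have "coeff [:0, 1 :: 'a:] n = 0" using n2 by (intro coeff_eq_0) simp
    then have "\<beta> w ^ n \<in> N" using pcongD[OF rel, of n] by (simp add: coeff_linear_poly_power)
    ultimately show False using N_not_U by blast
  qed
  then show ?thesis unfolding g_def by (simp add: coprime_iff_gcd_eq_1)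
qed

text \<open>The affine lattice isomorphism \<open>T\<close> takes the standard segment to the
  segment from \<open>u\<close> to \<open>v\<close>. Binomials, barycenters and lexicographic
  vertices are all preserved by it.\<close>

lemma transport:
  assumes "lattice_frame (fst v - fst u) (snd v - snd u) E1 E2 \<sigma>"
    and side: "(\<forall>w\<in>A. snd (lattice_frame.T' (fst u) (snd u) (fst v - fst u) (snd v - snd u) E1 E2 \<sigma> w) \<ge> 0) \<or>
      (\<exists>w1\<in>A. \<exists>w2\<in>A. snd (lattice_frame.T' (fst u) (snd u) (fst v - fst u) (snd v - snd u) E1 E2 \<sigma> w1) > 0 \<and>
        snd (lattice_frame.T' (fst u) (snd u) (fst v - fst u) (snd v - snd u) E1 E2 \<sigma> w2) < 0)"
  shows "line_class A \<alpha> \<beta> u v"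
proof -
  interpret lattice_frame "fst u" "snd u" "fst v - fst u" "snd v - snd u" E1 E2 \<sigma> by fact
  define B where "B = {p. T p \<in> A}"
  define \<alpha>' where "\<alpha>' p = \<alpha> (T p)" for p
  define \<beta>' where "\<beta>' p = \<beta> (T p)" for p
  have T_origin: "T (0, 0) = u" "T (1, 0) = v" by (simp_all add: T_def)
  have fstT: "fst (T p) = fst u + (fst v - fst u) * fst p + E1 * snd p"
    and sndT: "snd (T p) = snd u + (snd v - snd u) * fst p + E2 * snd p" for p by (simp_all add: T_def)
  have T'_B: "T' w \<in> B" if "w \<in> A" for w using that by (simp add: B_def T_T')
  interpret std: standard_line N U B \<alpha>' \<beta>'
  proof unfold_locales
    show "(0, 0) \<in> B" "(1, 0) \<in> B" using u v by (simp_all add: B_def T_origin)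
    show "\<alpha>' (0, 0) = 1" "\<beta>' (0, 0) = 0" "\<alpha>' (1, 0) = 0" "\<beta>' (1, 0) = 1"
      using u v by (simp_all add: \<alpha>'_def \<beta>'_def T_origin)
    obtain w where w: "w \<in> A" "(fst v - fst u) * (snd w - snd u) - (snd v - snd u) * (fst w - fst u) \<noteq> 0"
      using noncollinear by blast
    then have "snd (T' w) \<noteq> 0" using \<sigma> by (auto simp: T'_def)
    then show "\<exists>w\<in>B. snd w \<noteq> 0" using T'_B w by blast
  next
    fix p1 p2 p3 p4 :: "int \<times> int" and m1 m2 m3 m4 n1 n2 n3 n4 :: nat
    assume p: "p1 \<in> B" "p2 \<in> B" "p3 \<in> B" "p4 \<in> B" and deg: "m1 + m2 + m3 + m4 = n1 + n2 + n3 + n4"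
      and f: "int m1 * fst p1 + int m2 * fst p2 + int m3 * fst p3 + int m4 * fst p4 =
        int n1 * fst p1 + int n2 * fst p2 + int n3 * fst p3 + int n4 * fst p4"
      and s: "int m1 * snd p1 + int m2 * snd p2 + int m3 * snd p3 + int m4 * snd p4 =
        int n1 * snd p1 + int n2 * snd p2 + int n3 * snd p3 + int n4 * snd p4"
    have expand: "k1 * (c + d * x1 + e * y1) + k2 * (c + d * x2 + e * y2) + k3 * (c + d * x3 + e * y3) + k4 * (c + d * x4 + e * y4) =
      (k1 + k2 + k3 + k4) * c + d * (k1 * x1 + k2 * x2 + k3 * x3 + k4 * x4) + e * (k1 * y1 + k2 * y2 + k3 * y3 + k4 * y4)"
      for k1 k2 k3 k4 c d e x1 x2 x3 x4 y1 y2 y3 y4 :: int by (simp add: algebra_simps)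
    have ideg: "int m1 + int m2 + int m3 + int m4 = int n1 + int n2 + int n3 + int n4" using deg by linarith
    show "pcong ([:\<alpha>' p1, \<beta>' p1:] ^ m1 * [:\<alpha>' p2, \<beta>' p2:] ^ m2 * [:\<alpha>' p3, \<beta>' p3:] ^ m3 * [:\<alpha>' p4, \<beta>' p4:] ^ m4)
        ([:\<alpha>' p1, \<beta>' p1:] ^ n1 * [:\<alpha>' p2, \<beta>' p2:] ^ n2 * [:\<alpha>' p3, \<beta>' p3:] ^ n3 * [:\<alpha>' p4, \<beta>' p4:] ^ n4)"
      unfolding \<alpha>'_def \<beta>'_def
    proof (rule binomial)
      show "T p1 \<in> A" "T p2 \<in> A" "T p3 \<in> A" "T p4 \<in> A" using p by (simp_all add: B_def)
      show "m1 + m2 + m3 + m4 = n1 + n2 + n3 + n4" by fact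
      show "int m1 * fst (T p1) + int m2 * fst (T p2) + int m3 * fst (T p3) + int m4 * fst (T p4) =
        int n1 * fst (T p1) + int n2 * fst (T p2) + int n3 * fst (T p3) + int n4 * fst (T p4)"
        unfolding fstT expand f s ideg ..
      show "int m1 * snd (T p1) + int m2 * snd (T p2) + int m3 * snd (T p3) + int m4 * snd (T p4) =
        int n1 * snd (T p1) + int n2 * snd (T p2) + int n3 * snd (T p3) + int n4 * snd (T p4)"
        unfolding sndT expand f s ideg ..
    qed
  next
    fix p1 p2 p3 w :: "int \<times> int" and m1 m2 m3 :: nat
    assume p: "p1 \<in> B" "p2 \<in> B" "p3 \<in> B" and pos: "0 < m1 + m2 + m3"
      and f: "int m1 * fst p1 + int m2 * fst p2 + int m3 * fst p3 = int (m1 + m2 + m3) * fst w"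
      and s: "int m1 * snd p1 + int m2 * snd p2 + int m3 * snd p3 = int (m1 + m2 + m3) * snd w"
    have expand: "k1 * (c + d * x1 + e * y1) + k2 * (c + d * x2 + e * y2) + k3 * (c + d * x3 + e * y3) =
      (k1 + k2 + k3) * c + d * (k1 * x1 + k2 * x2 + k3 * x3) + e * (k1 * y1 + k2 * y2 + k3 * y3)"
      for k1 k2 k3 c d e x1 x2 x3 y1 y2 y3 :: int by (simp add: algebra_simps)
    have collect: "k * c + d * (k * x) + e * (k * y) = k * (c + d * x + e * y)" for k c d e x y :: int by (simp add: algebra_simps)
    have sum: "int m1 + int m2 + int m3 = int (m1 + m2 + m3)" by simp
    have "T w \<in> A"
    proof (rule convex)
      show "T p1 \<in> A" "T p2 \<in> A" "T p3 \<in> A" using p by (simp_all add: B_def)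
      show "0 < m1 + m2 + m3" by fact
      show "int m1 * fst (T p1) + int m2 * fst (T p2) + int m3 * fst (T p3) = int (m1 + m2 + m3) * fst (T w)"
        unfolding fstT expand f s sum collect ..
      show "int m1 * snd (T p1) + int m2 * snd (T p2) + int m3 * snd (T p3) = int (m1 + m2 + m3) * snd (T w)"
        unfolding sndT expand f s sum collect ..
    qed
    then show "w \<in> B" by (simp add: B_def)
  next
    fix p :: "int \<times> int" and f1 f2 g1 g2 :: int
    assume p: "p \<in> B" and lex: "\<And>w. w \<in> B \<Longrightarrow> w \<noteq> p \<Longrightarrow>
        f1 * (fst w - fst p) + f2 * (snd w - snd p) > 0 \<or>
        f1 * (fst w - fst p) + f2 * (snd w - snd p) = 0 \<and> g1 * (fst w - fst p) + g2 * (snd w - snd p) > 0"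
    \<comment> \<open>The coefficients of the functional (a, b) after the change of coordinates, up
      to a constant that cancels in differences.\<close>
    define F1 where "F1 a b = \<sigma> * (a * E2 - b * (snd v - snd u))" for a b
    define F2 where "F2 a b = \<sigma> * (b * (fst v - fst u) - a * E1)" for a b
    have change: "F1 a b * (fst w - fst q) + F2 a b * (snd w - snd q) = a * (fst (T' w) - fst (T' q)) + b * (snd (T' w) - snd (T' q))" for a b w q
      unfolding F1_def F2_def T'_def fst_conv snd_conv by (simp add: algebra_simps)
    have "\<exists>e1\<in>A. \<exists>e2\<in>A. \<forall>w\<in>A. \<exists>m n :: nat.
        fst w - fst (T p) = int m * (fst e1 - fst (T p)) + int n * (fst e2 - fst (T p)) \<and>
        snd w - snd (T p) = int m * (snd e1 - snd (T p)) + int n * (snd e2 - snd (T p))"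
    proof (rule smooth)
      show "T p \<in> A" using p by (simp add: B_def)
      fix w assume w: "w \<in> A" "w \<noteq> T p"
      then have "T' w \<in> B" "T' w \<noteq> p" using T'_B[OF w(1)] T_T'[of w] by auto
      then show "F1 f1 f2 * (fst w - fst (T p)) + F2 f1 f2 * (snd w - snd (T p)) > 0 \<or>
        F1 f1 f2 * (fst w - fst (T p)) + F2 f1 f2 * (snd w - snd (T p)) = 0 \<and>
        F1 g1 g2 * (fst w - fst (T p)) + F2 g1 g2 * (snd w - snd (T p)) > 0"
        unfolding change T'_T by (rule lex)
    qed
    then obtain e1 e2 where e: "e1 \<in> A" "e2 \<in> A" and gen: "\<forall>w\<in>A. \<exists>m n :: nat.
        fst w - fst (T p) = int m * (fst e1 - fst (T p)) + int n * (fst e2 - fst (T p)) \<and>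
        snd w - snd (T p) = int m * (snd e1 - snd (T p)) + int n * (snd e2 - snd (T p))" by blast
    show "\<exists>e1\<in>B. \<exists>e2\<in>B. \<forall>w\<in>B. \<exists>m n :: nat.
        fst w - fst p = int m * (fst e1 - fst p) + int n * (fst e2 - fst p) \<and>
        snd w - snd p = int m * (snd e1 - snd p) + int n * (snd e2 - snd p)"
    proof (rule bexI[of _ "T' e1"], rule bexI[of _ "T' e2"], rule ballI)
      show "T' e1 \<in> B" "T' e2 \<in> B" using e T'_B by auto
      fix w assume "w \<in> B"
      then have "T w \<in> A" by (simp add: B_def)
      then obtain m n :: nat where mn: "fst (T w) - fst (T p) = int m * (fst e1 - fst (T p)) + int n * (fst e2 - fst (T p))"
        "snd (T w) - snd (T p) = int m * (snd e1 - snd (T p)) + int n * (snd e2 - snd (T p))" using gen by blast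
      \<comment> \<open>Generation is transported through arbitrary functionals; the functionals (1,
        0) and (0, 1) then give back the two coordinates.\<close>
      have lin: "a * (fst w - fst p) + b * (snd w - snd p) =
          int m * (a * (fst (T' e1) - fst p) + b * (snd (T' e1) - snd p)) +
          int n * (a * (fst (T' e2) - fst p) + b * (snd (T' e2) - snd p))" for a b
      proof -
        have "a * (fst w - fst p) + b * (snd w - snd p) = F1 a b * (fst (T w) - fst (T p)) + F2 a b * (snd (T w) - snd (T p))"
          unfolding change T'_T ..
        also have "\<dots> = int m * (F1 a b * (fst e1 - fst (T p)) + F2 a b * (snd e1 - snd (T p))) +
          int n * (F1 a b * (fst e2 - fst (T p)) + F2 a b * (snd e2 - snd (T p)))"
          unfolding mn by (simp add: algebra_simps)
        finally show ?thesis unfolding change T'_T .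
      qed
      show "\<exists>m n. fst w - fst p = int m * (fst (T' e1) - fst p) + int n * (fst (T' e2) - fst p) \<and>
        snd w - snd p = int m * (snd (T' e1) - snd p) + int n * (snd (T' e2) - snd p)"
        using lin[of 1 0] lin[of 0 1] by (intro exI[of _ m] exI[of _ n]) simp
    qed
  qed
  have "line_class B \<alpha>' \<beta>' (0, 0) (1, 0)"
    using side
  proof (elim disjE bexE conjE)
    assume *: "\<forall>w\<in>A. 0 \<le> snd (T' w)"
    show ?thesis
    proof (rule std.same_side)
      fix w assume "w \<in> B"
      then have "0 \<le> snd (T' (T w))" using * by (simp add: B_def)
      then show "0 \<le> snd w" by (simp only: T'_T)
    qed
  next
    fix w1 w2 assume "w1 \<in> A" "w2 \<in> A" "0 < snd (T' w1)" "snd (T' w2) < 0"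
    then show ?thesis using std.both_sides[of "T' w1" "T' w2"] T'_B by blast
  qed
  then consider (edge) "\<forall>w\<in>B - {(0, 0), (1, 0)}. \<alpha>' w \<in> N \<and> \<beta>' w \<in> N"
    | (other) h j W where "affine_fun h" "affine_fun j" "h (0, 0) = 0" "h (1, 0) = 1" "j (0, 0) = 0" "j (1, 0) = 0"
      "W \<in> B" "h W = 0" "j W = 1"
      "B = {(0, 0), (1, 0), W} \<or> (\<forall>w\<in>B. scroll_point \<alpha>' \<beta>' (\<alpha>' W) (h w) (j w) w)"
    unfolding line_class_def by blast
  then show ?thesis
  proof cases
    case edge
    have "\<alpha> w \<in> N \<and> \<beta> w \<in> N" if w: "w \<in> A - {u, v}" for w
    proof -
      have "T' w \<in> B - {(0, 0), (1, 0)}" using w T'_B T_T'[of w] T_origin by auto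
      from bspec[OF edge this] show ?thesis unfolding \<alpha>'_def \<beta>'_def T_T' .
    qed
    then show ?thesis unfolding line_class_def by blast
  next
    case other
    have T'_origin: "T' u = (0, 0)" "T' v = (1, 0)" using T'_T[of "(0, 0)"] T'_T[of "(1, 0)"] T_origin by simp_all
    have A: "A = {u, v, T W} \<or> (\<forall>w\<in>A. scroll_point \<alpha> \<beta> (\<alpha> (T W)) (h (T' w)) (j (T' w)) w)"
      using other(10)
    proof
      assume B: "B = {(0, 0), (1, 0), W}"
      have "w = u \<or> w = v \<or> w = T W" if "w \<in> A" for w
        using T'_B[OF that] T_T'[of w] T_origin unfolding B by auto
      moreover have "T W \<in> A" using other(7) by (simp add: B_def)
      ultimately have "A = {u, v, T W}" using u v by blast
      then show ?thesis ..
    next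
      assume s: "\<forall>w\<in>B. scroll_point \<alpha>' \<beta>' (\<alpha>' W) (h w) (j w) w"
      have "scroll_point \<alpha> \<beta> (\<alpha> (T W)) (h (T' w)) (j (T' w)) w" if "w \<in> A" for w
        using bspec[OF s T'_B[OF that]] unfolding scroll_point_def \<alpha>'_def \<beta>'_def T_T' .
      then show ?thesis by blast
    qed
    show ?thesis
      unfolding line_class_def
    proof (rule disjI2, rule exI[of _ "\<lambda>w. h (T' w)"], rule exI[of _ "\<lambda>w. j (T' w)"], intro conjI)
      show "affine_fun (\<lambda>w. h (T' w))" "affine_fun (\<lambda>w. j (T' w))" by (intro affine_T' other)+
      show "\<exists>W\<in>A. h (T' W) = 0 \<and> j (T' W) = 1 \<and>
        (A = {u, v, W} \<or> (\<forall>w\<in>A. scroll_point \<alpha> \<beta> (\<alpha> W) (h (T' w)) (j (T' w)) w))"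
        using A other(7,8,9) by (intro bexI[of _ "T W"] conjI) (simp_all add: T'_T B_def)
    qed (simp_all add: T'_origin other)
  qed
qed

theorem classification: "line_class A \<alpha> \<beta> u v"
proof -
  \<comment> \<open>A Bezout relation completes the primitive vector \<open>v - u\<close> to a
    lattice basis. The sign \<open>\<sigma>\<close> selects which side of the line has positive
    second coordinate.\<close>
  obtain x y where xy: "x * (fst v - fst u) + y * (snd v - snd u) = 1"
    using bezout_int[of "fst v - fst u" "snd v - snd u"] primitive by (auto simp: coprime_iff_gcd_eq_1)
  have frame: "lattice_frame (fst v - fst u) (snd v - snd u) (- \<sigma> * y) (\<sigma> * x) \<sigma>" if "\<sigma> = 1 \<or> \<sigma> = -1" for \<sigma>
    using that xy by unfold_locales (auto simp: algebra_simps)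
  define side where "side w = (fst v - fst u) * (snd w - snd u) - (snd v - snd u) * (fst w - fst u)" for w
  have T': "snd (lattice_frame.T' (fst u) (snd u) (fst v - fst u) (snd v - snd u) (- \<sigma> * y) (\<sigma> * x) \<sigma> w) = \<sigma> * side w"
    if "\<sigma> = 1 \<or> \<sigma> = -1" for \<sigma> w
    unfolding lattice_frame.T'_def[OF frame[OF that]] side_def by simp
  consider "\<forall>w\<in>A. side w \<ge> 0" | "\<forall>w\<in>A. side w \<le> 0" | "(\<exists>w1\<in>A. \<exists>w2\<in>A. side w1 > 0 \<and> side w2 < 0)"
    by (meson not_le)
  then show ?thesis
  proof cases
    case 1
    then show ?thesis using transport[OF frame[of 1]] T'[of 1] by simp
  next
    case 2
    then show ?thesis using transport[OF frame[of "-1"]] T'[of "-1"] by simp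
  next
    case 3
    then show ?thesis using transport[OF frame[of 1]] T'[of 1] by simp
  qed
qed

end

section \<open>Smooth vertices\<close>

lemma cring_ring_on:
  fixes C :: "'a::comm_ring_1 set"
  assumes "0 \<in> C" "1 \<in> C" "\<And>x y. x \<in> C \<Longrightarrow> y \<in> C \<Longrightarrow> x + y \<in> C"
    "\<And>x y. x \<in> C \<Longrightarrow> y \<in> C \<Longrightarrow> x * y \<in> C" "\<And>x. x \<in> C \<Longrightarrow> - x \<in> C"
  shows "cring (ring_on C)"
proof (rule cringI)
  show "abelian_group (ring_on C)"
  proof (rule abelian_groupI)
    fix x assume "x \<in> carrier (ring_on C)"
    then show "\<exists>y\<in>carrier (ring_on C). y \<oplus>\<^bsub>ring_on C\<^esub> x = \<zero>\<^bsub>ring_on C\<^esub>"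
      using assms(5)[of x] by (intro bexI[of _ "- x"]) (simp_all add: ring_on_def)
  qed (use assms in \<open>simp_all add: ring_on_def add_ac\<close>)
  show "Group.comm_monoid (ring_on C)"
    by (rule comm_monoidI) (use assms in \<open>simp_all add: ring_on_def mult_ac\<close>)
qed (simp add: ring_on_def distrib_right)

lemma ring_on_simps [simp]:
  "carrier (ring_on C) = C" "mult (ring_on C) = (*)" "one (ring_on C) = 1" "zero (ring_on C) = 0" "add (ring_on C) = (+)"
  by (simp_all add: ring_on_def)

lemma sum_single_lookup: "(\<Sum>m\<in>Poly_Mapping.keys p. Poly_Mapping.single m (Poly_Mapping.lookup p m)) = p"
  by (rule poly_mapping_eqI) (simp add: lookup_sum lookup_single when_def in_keys_iff)

text \<open>Any finite set of pairs with sum \<open>k\<close> that catches all contributing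
  exponents may be used. At a vertex the possible decompositions are few, so \<open>Q\<close> can be
  written down explicitly.\<close>

lemma lookup_mult_pairs:
  fixes f g :: "'e::comm_monoid_add \<Rightarrow>\<^sub>0 'k::comm_semiring_1"
  assumes Q: "finite Q" "\<And>x y. (x, y) \<in> Q \<Longrightarrow> x + y = k"
    and cover: "\<And>x y. x \<in> Poly_Mapping.keys f \<Longrightarrow> y \<in> Poly_Mapping.keys g \<Longrightarrow> x + y = k \<Longrightarrow> (x, y) \<in> Q"
  shows "Poly_Mapping.lookup (f * g) k = (\<Sum>(x, y)\<in>Q. Poly_Mapping.lookup f x * Poly_Mapping.lookup g y)"
proof -
  let ?K = "Poly_Mapping.keys f \<times> Poly_Mapping.keys g"
  have "f * g = (\<Sum>x\<in>Poly_Mapping.keys f. \<Sum>y\<in>Poly_Mapping.keys g.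
      Poly_Mapping.single (x + y) (Poly_Mapping.lookup f x * Poly_Mapping.lookup g y))"
    by (subst sum_single_lookup[of f, symmetric], subst sum_single_lookup[of g, symmetric]) (simp add: sum_product mult_single)
  then have "Poly_Mapping.lookup (f * g) k = (\<Sum>(x, y)\<in>?K.
      if x + y = k then Poly_Mapping.lookup f x * Poly_Mapping.lookup g y else 0)"
    by (simp add: lookup_sum lookup_single when_def sum.cartesian_product case_prod_unfold)
  also have "\<dots> = (\<Sum>(x, y)\<in>?K \<inter> Q. Poly_Mapping.lookup f x * Poly_Mapping.lookup g y)"
    using cover Q(2) by (intro sum.mono_neutral_cong_right) (auto split: if_splits)
  also have "\<dots> = (\<Sum>(x, y)\<in>Q. Poly_Mapping.lookup f x * Poly_Mapping.lookup g y)"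
    using Q(1) by (intro sum.mono_neutral_left) (auto simp: in_keys_iff)
  finally show ?thesis .
qed

section \<open>The graded semigroup and its vertices\<close>

lemma cone_semigroup_add:
  assumes "x \<in> cone_semigroup P" "y \<in> cone_semigroup P"
  shows "x + y \<in> cone_semigroup P"
  using assms(1)
proof (induction rule: cone_semigroup.induct)
  case (add u x)
  then show ?case using cone_semigroup.add[of u P "x + y"] by (simp add: add.assoc)
qed (use assms(2) in simp)

lemma cone_semigroup_generator: "u \<in> lattice_points P \<Longrightarrow> (u, 1) \<in> cone_semigroup P"
  using cone_semigroup.add[OF _ cone_semigroup.zero, of u P] by simp

lemma cone_semigroup_snd: "x \<in> cone_semigroup P \<Longrightarrow> snd x \<ge> 0"
  by (induction rule: cone_semigroup.induct) auto

text \<open>The number of elements of degree d therefore grows at most quadratically in d, which is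
  the count behind the dimension bound for the stalk.\<close>

lemma cone_semigroup_bounded:
  assumes "x \<in> cone_semigroup P" and K: "\<And>u. u \<in> lattice_points P \<Longrightarrow> \<bar>fst u\<bar> \<le> K \<and> \<bar>snd u\<bar> \<le> K"
  shows "\<bar>fst (fst x)\<bar> \<le> K * snd x \<and> \<bar>snd (fst x)\<bar> \<le> K * snd x"
  using assms(1)
proof (induction rule: cone_semigroup.induct)
  case (add u x)
  show ?case using add.IH K[OF add.hyps(1)] by (auto simp: distrib_left abs_le_iff)
qed simp

text \<open>At an end of an edge the functional that vanishes on the edge does not single out the
  vertex; the second functional breaks the tie along the edge.\<close>

definition lexpos :: "int \<Rightarrow> int \<Rightarrow> int \<Rightarrow> int \<Rightarrow> int \<times> int \<Rightarrow> bool" where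
  "lexpos f1 f2 g1 g2 x \<longleftrightarrow> f1 * fst x + f2 * snd x > 0 \<or> f1 * fst x + f2 * snd x = 0 \<and> g1 * fst x + g2 * snd x > 0"

lemma lexpos_add: "lexpos f1 f2 g1 g2 x \<Longrightarrow> lexpos f1 f2 g1 g2 y \<Longrightarrow> lexpos f1 f2 g1 g2 (x + y)"
  unfolding lexpos_def by (auto simp: distrib_left)

lemma lexpos_not_zero: "lexpos f1 f2 g1 g2 x \<Longrightarrow> x \<noteq> 0"
  by (auto simp: lexpos_def)

text \<open>At a lattice point \<open>v\<close> that is extreme for a lexicographic order, the points of the polygon
  are viewed relative to \<open>v\<close>: \<open>(w, d)\<close> becomes \<open>w - d v\<close>.\<close>

locale lex_vertex =
  fixes P :: "(real \<times> real) set" and v :: "int \<times> int" and f1 f2 g1 g2 :: int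
  assumes v: "v \<in> lattice_points P"
    and vertex: "\<And>w. w \<in> lattice_points P \<Longrightarrow> w \<noteq> v \<Longrightarrow> lexpos f1 f2 g1 g2 (w - v)"
begin

definition \<delta> :: "(int \<times> int) \<times> int \<Rightarrow> int \<times> int" where
  "\<delta> x = (fst (fst x) - snd x * fst v, snd (fst x) - snd x * snd v)"

definition point_over :: "int \<times> int \<Rightarrow> int \<Rightarrow> (int \<times> int) \<times> int" where
  "point_over e d = ((fst e + d * fst v, snd e + d * snd v), d)"

lemma \<delta>_add: "\<delta> (x + y) = \<delta> x + \<delta> y"
  by (simp add: \<delta>_def distrib_right)

lemma \<delta>_point_over [simp]: "\<delta> (point_over e d) = e" "snd (point_over e d) = d"
  by (simp_all add: \<delta>_def point_over_def)

lemma point_over_\<delta>: "point_over (\<delta> x) (snd x) = x"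
  by (simp add: \<delta>_def point_over_def)

lemma point_over_eq_iff: "point_over e d = point_over e' d' \<longleftrightarrow> e = e' \<and> d = d'"
  by (metis \<delta>_point_over)

lemma point_over_add: "point_over e d + point_over e' d' = point_over (e + e') (d + d')"
  by (simp add: point_over_def distrib_right)

abbreviation S where "S \<equiv> cone_semigroup P"

definition \<sigma> :: "(int \<times> int) set" where "\<sigma> = \<delta> ` S"

lemma \<sigma>_add: "x \<in> \<sigma> \<Longrightarrow> y \<in> \<sigma> \<Longrightarrow> x + y \<in> \<sigma>"
proof -
  assume "x \<in> \<sigma>" "y \<in> \<sigma>"
  then obtain a b where "a \<in> S" "b \<in> S" "x = \<delta> a" "y = \<delta> b" unfolding \<sigma>_def by blast
  then have "x + y = \<delta> (a + b)" "a + b \<in> S" by (simp_all add: \<delta>_add cone_semigroup_add)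
  then show ?thesis unfolding \<sigma>_def by (rule image_eqI)
qed

lemma \<delta>_generator: "\<delta> (u, 1) = u - v"
  by (simp add: \<delta>_def prod_eq_iff)

lemma \<delta>_lexpos: "x \<in> S \<Longrightarrow> \<delta> x = 0 \<or> lexpos f1 f2 g1 g2 (\<delta> x)"
proof (induction rule: cone_semigroup.induct)
  case zero then show ?case by (simp add: \<delta>_def prod_eq_iff)
next
  case (add u x)
  have "u - v = 0 \<or> lexpos f1 f2 g1 g2 (u - v)" using vertex[OF add.hyps(1)] by auto
  then show ?case using add.IH lexpos_add[of f1 f2 g1 g2 "u - v" "\<delta> x"] unfolding \<delta>_add \<delta>_generator by auto
qed

text \<open>Nonzero elements are lexicographically positive, and positive elements cannot add up to
  zero.\<close>

lemma \<sigma>_pointed: "x \<in> \<sigma> \<Longrightarrow> y \<in> \<sigma> \<Longrightarrow> x + y = 0 \<Longrightarrow> x = 0 \<and> y = 0"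
proof -
  assume "x \<in> \<sigma>" "y \<in> \<sigma>" and 0: "x + y = 0"
  then have "x = 0 \<or> lexpos f1 f2 g1 g2 x" "y = 0 \<or> lexpos f1 f2 g1 g2 y"
    using \<delta>_lexpos by (auto simp: \<sigma>_def)
  then show ?thesis using 0 lexpos_add[of f1 f2 g1 g2 x y] lexpos_not_zero[of f1 f2 g1 g2 "x + y"] by auto
qed

definition irreducible_\<sigma> :: "int \<times> int \<Rightarrow> bool" where
  "irreducible_\<sigma> e \<longleftrightarrow> e \<noteq> 0 \<and> (\<forall>x\<in>\<sigma>. \<forall>y\<in>\<sigma>. e = x + y \<longrightarrow> x = 0 \<or> y = 0)"

end

section \<open>The stalk of the surface at a vertex\<close>

locale toric_vertex = lex_vertex P v f1 f2 g1 g2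
  for P v f1 f2 g1 g2 +
  fixes K :: "'k::field itself"
  assumes finite_points: "finite (lattice_points P)"
begin

abbreviation C :: "'k torus_algebra set" where "C \<equiv> {f. Poly_Mapping.keys f \<subseteq> S}"
abbreviation R :: "'k torus_algebra ring" where "R \<equiv> semigroup_algebra P"
abbreviation G :: "nat \<Rightarrow> 'k torus_algebra set" where "G \<equiv> semigroup_algebra_component P"

lemma R_eq: "R = ring_on C" by (simp add: semigroup_algebra_def)

lemma G_def: "G d = {f. Poly_Mapping.keys f \<subseteq> {x \<in> S. snd x = int d}}"
  by (simp add: semigroup_algebra_component_def)

lemma keys_mult_subset:
  assumes "Poly_Mapping.keys f \<subseteq> X" "Poly_Mapping.keys g \<subseteq> Y" "\<And>x y. x \<in> X \<Longrightarrow> y \<in> Y \<Longrightarrow> x + y \<in> Z"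
  shows "Poly_Mapping.keys (f * g :: 'k torus_algebra) \<subseteq> Z"
  using keys_mult[of f g] assms by blast

lemma C_closed:
  "0 \<in> C" "1 \<in> C" "x \<in> C \<Longrightarrow> y \<in> C \<Longrightarrow> x + y \<in> C" "x \<in> C \<Longrightarrow> y \<in> C \<Longrightarrow> x * y \<in> C" "x \<in> C \<Longrightarrow> - x \<in> C"
  using Poly_Mapping.keys_add[of x y] keys_mult_subset[of x S y S S] cone_semigroup_add cone_semigroup.zero[of P] by auto

sublocale R: cring R
  unfolding R_eq by (intro cring_ring_on C_closed)

lemma G_closed:
  "0 \<in> G d" "1 \<in> G 0" "x \<in> G d \<Longrightarrow> y \<in> G d \<Longrightarrow> x + y \<in> G d" "x \<in> G d \<Longrightarrow> y \<in> G e \<Longrightarrow> x * y \<in> G (d + e)"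
  "x \<in> G d \<Longrightarrow> - x \<in> G d" "G d \<subseteq> C" "Poly_Mapping.single 0 c \<in> G 0"
proof -
  show "x * y \<in> G (d + e)" if "x \<in> G d" "y \<in> G e"
  proof -
    have "Poly_Mapping.keys x \<subseteq> {z \<in> S. snd z = int d}" "Poly_Mapping.keys y \<subseteq> {z \<in> S. snd z = int e}"
      using that by (auto simp: G_def)
    then have "Poly_Mapping.keys (x * y) \<subseteq> {z \<in> S. snd z = int (d + e)}"
      by (rule keys_mult_subset) (auto intro: cone_semigroup_add)
    then show ?thesis by (simp add: G_def)
  qed
  show "x + y \<in> G d" if "x \<in> G d" "y \<in> G d"
    using that Poly_Mapping.keys_add[of x y] by (auto simp: G_def)
qed (use cone_semigroup.zero[of P] in \<open>auto simp: G_def\<close>)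

lemma G_power: "x \<in> G d \<Longrightarrow> x ^ n \<in> G (d * n)"
  using G_closed(4)[of x d] by (induction n) (auto simp: G_closed(2))

definition lk :: "'k torus_algebra \<Rightarrow> int \<times> int \<Rightarrow> nat \<Rightarrow> 'k" where
  "lk f e d = Poly_Mapping.lookup f (point_over e (int d))"

lemma lk_simps [simp]: "lk 0 e d = 0" "lk (f + g) e d = lk f e d + lk g e d" "lk (- f) e d = - lk f e d" "lk 1 0 0 = 1"
  by (simp_all add: lk_def lookup_add lookup_one point_over_def zero_prod_def)

text \<open>By pointedness a sum of two semigroup elements lies on the ray over \<open>v\<close>
  only if both summands do. Along the ray the product is thus that of polynomials in one
  variable.\<close>

lemma ray_coeff_mult:
  assumes "f \<in> C" "g \<in> C"
  shows "lk (f * g) 0 n = (\<Sum>i\<le>n. lk f 0 i * lk g 0 (n - i))"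
proof -
  let ?Q = "(\<lambda>i. (point_over 0 (int i), point_over 0 (int (n - i)))) ` {..n}"
  have "lk (f * g) 0 n = (\<Sum>(x, y)\<in>?Q. Poly_Mapping.lookup f x * Poly_Mapping.lookup g y)"
    unfolding lk_def
  proof (rule lookup_mult_pairs)
    show "x + y = point_over 0 (int n)" if "(x, y) \<in> ?Q" for x y
      using that by (auto simp: point_over_add of_nat_diff)
    fix x y assume xy: "x \<in> Poly_Mapping.keys f" "y \<in> Poly_Mapping.keys g" and sum: "x + y = point_over 0 (int n)"
    have S: "x \<in> S" "y \<in> S" using xy assms by auto
    have "\<delta> x + \<delta> y = 0" using arg_cong[OF sum, of \<delta>] by (simp add: \<delta>_add)
    then have \<delta>: "\<delta> x = 0" "\<delta> y = 0" using \<sigma>_pointed[of "\<delta> x" "\<delta> y"] S by (auto simp: \<sigma>_def)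
    have s: "snd x + snd y = int n" using arg_cong[OF sum, of snd] by simp
    have "snd x \<ge> 0" "snd y \<ge> 0" using S cone_semigroup_snd by auto
    then have "int (nat (snd x)) = snd x" "int (n - nat (snd x)) = snd y" "nat (snd x) \<le> n" using s by auto
    moreover have "x = point_over 0 (snd x)" "y = point_over 0 (snd y)"
      using \<delta> point_over_\<delta>[of x] point_over_\<delta>[of y] by auto
    ultimately have "x = point_over 0 (int (nat (snd x)))" "y = point_over 0 (int (n - nat (snd x)))" "nat (snd x) \<le> n"
      by simp_all
    then show "(x, y) \<in> ?Q" by blast
  qed simp
  also have "\<dots> = (\<Sum>i\<le>n. lk f 0 i * lk g 0 (n - i))"
    by (subst sum.reindex) (auto simp: inj_on_def point_over_eq_iff lk_def)
  finally show ?thesis .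
qed

lemma homogeneous_lookup: "f \<in> G d \<Longrightarrow> n \<noteq> d \<Longrightarrow> lk f e n = 0"
  unfolding G_def lk_def by (metis (mono_tags, lifting) \<delta>_point_over(2) in_keys_iff mem_Collect_eq of_nat_eq_iff subset_eq)

lemma ray_mult: "a \<in> G m \<Longrightarrow> b \<in> G n \<Longrightarrow> lk (a * b) 0 (m + n) = lk a 0 m * lk b 0 n"
proof -
  assume ab: "a \<in> G m" "b \<in> G n"
  have "lk (a * b) 0 (m + n) = (\<Sum>i\<le>m + n. lk a 0 i * lk b 0 (m + n - i))"
    using ab G_closed(6) by (intro ray_coeff_mult) auto
  also have "\<dots> = (\<Sum>i\<in>{m}. lk a 0 i * lk b 0 (m + n - i))"
    using homogeneous_lookup[OF ab(1)] by (intro sum.mono_neutral_right) auto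
  finally show ?thesis by simp
qed

text \<open>On monomials that are irreducible over \<open>v\<close>, the coefficient is a derivation at the prime of \<open>v\<close>.\<close>

lemma leibniz:
  assumes e: "irreducible_\<sigma> e" and ab: "a \<in> G m" "b \<in> G n"
  shows "lk (a * b) e (m + n) = lk a 0 m * lk b e n + lk a e m * lk b 0 n"
proof -
  let ?Q = "{(point_over 0 (int m), point_over e (int n)), (point_over e (int m), point_over 0 (int n))}"
  have "lk (a * b) e (m + n) = (\<Sum>(x, y)\<in>?Q. Poly_Mapping.lookup a x * Poly_Mapping.lookup b y)"
    unfolding lk_def
  proof (rule lookup_mult_pairs)
    show "x + y = point_over e (int (m + n))" if "(x, y) \<in> ?Q" for x y
      using that by (auto simp: point_over_add)
    fix x y assume xy: "x \<in> Poly_Mapping.keys a" "y \<in> Poly_Mapping.keys b" and sum: "x + y = point_over e (int (m + n))"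
    have S: "x \<in> S" "y \<in> S" "snd x = int m" "snd y = int n" using xy ab by (auto simp: G_def)
    have \<delta>: "\<delta> x + \<delta> y = e" using arg_cong[OF sum, of \<delta>] by (simp add: \<delta>_add)
    then have "\<delta> x = 0 \<or> \<delta> y = 0" using e S(1,2) by (auto simp: irreducible_\<sigma>_def \<sigma>_def)
    then show "(x, y) \<in> ?Q" using point_over_\<delta>[of x] point_over_\<delta>[of y] S(3,4) \<delta> by auto
  qed simp
  also have "\<dots> = lk a 0 m * lk b e n + lk a e m * lk b 0 n"
    using e by (auto simp: point_over_eq_iff irreducible_\<sigma>_def lk_def)
  finally show ?thesis .
qed

text \<open>The homogeneous prime of the torus-fixed point belonging to the vertex
  \<open>v\<close>.\<close>

definition p :: "'k torus_algebra set" where "p = {f \<in> C. \<forall>d. lk f 0 d = 0}"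

text \<open>Restriction to the ray through (v, 1). It is a ring homomorphism with kernel
  \<open>p\<close>, so \<open>p\<close> is prime because polynomials over a field form a
  domain.\<close>

definition ray_poly :: "'k torus_algebra \<Rightarrow> 'k poly" where "ray_poly f = Abs_poly (\<lambda>d. lk f 0 d)"

lemma coeff_ray_poly: "coeff (ray_poly f) d = lk f 0 d"
proof -
  have "inj (\<lambda>d. point_over 0 (int d))" by (auto simp: inj_def point_over_eq_iff)
  then have "finite ((\<lambda>d. point_over 0 (int d)) -` Poly_Mapping.keys f)" by (intro finite_vimageI) auto
  then have "finite {d. lk f 0 d \<noteq> 0}" by (simp add: vimage_def in_keys_iff lk_def)
  then have "\<forall>\<^sub>\<infinity>d. lk f 0 d = 0" by (simp add: MOST_iff_cofinite)
  then show ?thesis unfolding ray_poly_def by (simp add: Abs_poly_inverse)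
qed

lemma p_iff: "f \<in> p \<longleftrightarrow> f \<in> C \<and> ray_poly f = 0"
  by (auto simp: p_def poly_eq_iff coeff_ray_poly)

lemma ray_poly_mult: "f \<in> C \<Longrightarrow> g \<in> C \<Longrightarrow> ray_poly (f * g) = ray_poly f * ray_poly g"
  by (rule poly_eqI) (simp only: coeff_ray_poly coeff_mult ray_coeff_mult)

lemma p_ideal: "ideal p R"
proof (intro idealI)
  show "ring R" by (rule R.ring_axioms)
  show "subgroup p (add_monoid R)"
  proof (rule R.add.subgroupI)
    show "p \<subseteq> carrier R" by (auto simp: p_def R_eq)
    have "0 \<in> p" by (simp add: p_def)
    then show "p \<noteq> {}" by blast
    fix a b assume ab: "a \<in> p" "b \<in> p"
    then show "a \<oplus>\<^bsub>R\<^esub> b \<in> p" using C_closed(3)[of a b] by (auto simp: p_def R_eq)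
    have aR: "a \<in> carrier R" "- a \<in> carrier R" using ab(1) C_closed(5)[of a] by (auto simp: p_def R_eq)
    then have "\<ominus>\<^bsub>R\<^esub> a = - a" by (intro R.minus_equality) (auto simp: R_eq)
    then show "\<ominus>\<^bsub>R\<^esub> a \<in> p" using ab C_closed(5)[of a] by (auto simp: p_def)
  qed
  fix a x assume "a \<in> p" "x \<in> carrier R"
  then have "ray_poly (x * a) = ray_poly x * ray_poly a" "ray_poly a = 0" "x * a \<in> C"
    using C_closed(4)[of x a] by (auto simp: p_iff R_eq ray_poly_mult)
  then show "x \<otimes>\<^bsub>R\<^esub> a \<in> p" "a \<otimes>\<^bsub>R\<^esub> x \<in> p" by (auto simp: p_iff R_eq mult.commute)
qed

lemma p_prime: "primeideal p R"
proof (rule primeidealI)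
  show "ideal p R" by (rule p_ideal)
  show "cring R" by (rule R.is_cring)
  have "1 \<notin> p"
  proof
    assume "1 \<in> p"
    then have "lk 1 0 0 = 0" unfolding p_def by blast
    then show False by simp
  qed
  then show "carrier R \<noteq> p" using C_closed(2) by (auto simp: R_eq)
  fix a b assume "a \<in> carrier R" "b \<in> carrier R" "a \<otimes>\<^bsub>R\<^esub> b \<in> p"
  then show "a \<in> p \<or> b \<in> p" by (auto simp: p_iff R_eq ray_poly_mult)
qed

lemma homogeneous_in_p: "a \<in> G d \<Longrightarrow> a \<in> p \<longleftrightarrow> lk a 0 d = 0"
proof -
  assume a: "a \<in> G d"
  have "lk a 0 d = 0 \<Longrightarrow> lk a 0 n = 0" for n using homogeneous_lookup[OF a, of n 0] by (cases "n = d") auto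
  moreover have "a \<in> C" using a G_closed(6) by blast
  ultimately show ?thesis unfolding p_def by blast
qed

lemma p_point: "p \<in> points (toric_surface K P)"
proof -
  have "p \<subseteq> Idl\<^bsub>R\<^esub> (p \<inter> (\<Union>d. G d))"
  proof
    fix f assume f: "f \<in> p"
    let ?I = "Idl\<^bsub>R\<^esub> (p \<inter> (\<Union>d. G d))"
    have I: "ideal ?I R" by (rule R.genideal_ideal) (auto simp: p_def R_eq)
    interpret I: ideal ?I R by (rule I)
    \<comment> \<open>An element of \<open>p\<close> is the sum of its monomials, each of which is
      homogeneous and has no part on the ray; hence \<open>p\<close> is generated by homogeneous
      elements.\<close>
    have mono: "Poly_Mapping.single x (Poly_Mapping.lookup f x) \<in> ?I" if x: "x \<in> Poly_Mapping.keys f" for x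
    proof -
      let ?m = "Poly_Mapping.single x (Poly_Mapping.lookup f x)"
      have xS: "x \<in> S" using x f by (auto simp: p_def)
      then have G: "?m \<in> G (nat (snd x))" using cone_semigroup_snd[of x P] by (auto simp: G_def)
      have "lk ?m 0 (nat (snd x)) = 0"
      proof (cases "x = point_over 0 (int (nat (snd x)))")
        case True
        have "Poly_Mapping.lookup f x = lk f 0 (nat (snd x))"
          unfolding lk_def by (rule arg_cong[OF True])
        also have "\<dots> = 0" using f unfolding p_def by blast
        finally show ?thesis by (simp add: lk_def)
      qed (simp add: lk_def lookup_single)
      then have "?m \<in> p" using homogeneous_in_p[OF G] by simp
      then have "?m \<in> p \<inter> (\<Union>d. G d)" using G by blast
      moreover have "p \<inter> (\<Union>d. G d) \<subseteq> ?I" by (rule R.genideal_self) (auto simp: p_def R_eq)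
      ultimately show ?thesis by blast
    qed
    have "(\<Sum>x\<in>X. Poly_Mapping.single x (Poly_Mapping.lookup f x)) \<in> ?I" if "X \<subseteq> Poly_Mapping.keys f" "finite X" for X
      using that(2,1)
    proof (induction X rule: finite_induct)
      case empty
      then show ?case using I.zero_closed by (simp add: R_eq)
    next
      case (insert x X)
      then have "Poly_Mapping.single x (Poly_Mapping.lookup f x) \<oplus>\<^bsub>R\<^esub>
          (\<Sum>x\<in>X. Poly_Mapping.single x (Poly_Mapping.lookup f x)) \<in> ?I"
        by (intro I.a_closed mono) simp_all
      then show ?case using insert.hyps by (simp add: R_eq)
    qed
    then have "(\<Sum>x\<in>Poly_Mapping.keys f. Poly_Mapping.single x (Poly_Mapping.lookup f x)) \<in> ?I" by simp
    moreover have "(\<Sum>x\<in>Poly_Mapping.keys f. Poly_Mapping.single x (Poly_Mapping.lookup f x)) = f"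
      by (rule sum_single_lookup)
    ultimately show "f \<in> ?I" by simp
  qed
  moreover have "Idl\<^bsub>R\<^esub> (p \<inter> (\<Union>d. G d)) \<subseteq> p" using p_ideal by (rule R.genideal_minimal) blast
  ultimately have gen: "p = Idl\<^bsub>R\<^esub> (p \<inter> (\<Union>d. G d))" by (rule equalityI)
  have v1: "Poly_Mapping.single (v, 1) 1 \<in> G 1" using cone_semigroup_generator[OF v] by (simp add: G_def)
  then have "Poly_Mapping.single (v, 1) 1 \<notin> p"
    using homogeneous_in_p[of "Poly_Mapping.single (v, 1) 1" 1] by (simp add: lk_def point_over_def lookup_single)
  with v1 have relevant: "\<not> (\<Union>d\<in>{1..}. G d) \<subseteq> p" by (meson UN_I atLeast_iff le_refl subset_eq)
  have "points (toric_surface K P) =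
    {p. primeideal p R \<and> p = Idl\<^bsub>R\<^esub> (p \<inter> (\<Union>d. G d)) \<and> \<not> (\<Union>d\<in>{1..}. G d) \<subseteq> p}"
    unfolding toric_surface_def Proj_def scheme_stalks.simps ..
  then show ?thesis using p_prime gen relevant by blast
qed

definition St :: "('k torus_algebra \<times> 'k torus_algebra) set ring" where
  "St = stalk (toric_surface K P) p"

definition M :: "'k torus_algebra set" where "M = (\<Union>d. G d) - p"

abbreviation Fr where "Fr \<equiv> fraction R M"

lemma St_eq: "St = (localization R M)\<lparr> carrier := {Fr a s | a s d. a \<in> G d \<and> s \<in> G d - p} \<rparr>"
  by (simp add: St_def toric_surface_def Proj_def M_def Let_def)

sublocale loc: mult_closed_set R M
proof unfold_locales
  show "M \<subseteq> carrier R" using G_closed(6) by (auto simp: M_def R_eq)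
  show "\<one>\<^bsub>R\<^esub> \<in> M"
    using G_closed(2) homogeneous_in_p[OF G_closed(2)] by (auto simp: M_def R_eq)
  fix s t assume "s \<in> M" "t \<in> M"
  then obtain d e where st: "s \<in> G d" "s \<notin> p" "t \<in> G e" "t \<notin> p" by (auto simp: M_def)
  then have "s * t \<in> G (d + e)" "lk (s * t) 0 (d + e) \<noteq> 0"
    using G_closed(4) by (auto simp: ray_mult homogeneous_in_p)
  then show "s \<otimes>\<^bsub>R\<^esub> t \<in> M" using homogeneous_in_p[of "s * t" "d + e"] by (auto simp: M_def R_eq)
qed

definition N :: "nat \<Rightarrow> 'k torus_algebra set" where "N d = G d - p"

lemma N_G: "s \<in> N d \<Longrightarrow> s \<in> G d" and N_lk: "s \<in> N d \<Longrightarrow> lk s 0 d \<noteq> 0" and N_M: "s \<in> N d \<Longrightarrow> s \<in> M"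
  by (auto simp: N_def M_def homogeneous_in_p)

lemma N_I: "s \<in> G d \<Longrightarrow> lk s 0 d \<noteq> 0 \<Longrightarrow> s \<in> N d"
  by (auto simp: N_def homogeneous_in_p)

lemma N_mult: "s \<in> N d \<Longrightarrow> t \<in> N e \<Longrightarrow> s * t \<in> N (d + e)"
  by (intro N_I G_closed(4)) (auto simp: N_G ray_mult N_lk)

lemma N_one: "1 \<in> N 0"
  by (intro N_I G_closed(2)) simp

lemma N_power: "s \<in> N d \<Longrightarrow> s ^ n \<in> N (d * n)"
  using N_mult[of s d] by (induction n) (auto simp: N_one)

lemma G_carrier: "a \<in> G d \<Longrightarrow> a \<in> carrier R"
  using G_closed(6) by (auto simp: R_eq)

lemma St_carrier: "carrier St = {Fr a s | a s d. a \<in> G d \<and> s \<in> N d}"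
  by (simp add: St_eq N_def)

lemma Fr_carrier: "a \<in> G d \<Longrightarrow> s \<in> N d \<Longrightarrow> Fr a s \<in> carrier St"
  unfolding St_carrier by blast

lemma R_ops: "mult R = (*)" "add R = (+)" "one R = 1" "zero R = 0"
  by (simp_all add: R_eq)

lemma St_ops: "mult St = mult (localization R M)" "add St = add (localization R M)"
  "one St = one (localization R M)" "zero St = zero (localization R M)"
  by (simp_all add: St_eq)

lemma St_mult:
  assumes "a \<in> G d" "s \<in> N d" "b \<in> G e" "t \<in> N e"
  shows "Fr a s \<otimes>\<^bsub>St\<^esub> Fr b t = Fr (a * b) (s * t)"
  using loc.localization_mult[OF G_carrier[OF assms(1)] G_carrier[OF assms(3)] N_M[OF assms(2)] N_M[OF assms(4)]]
  unfolding R_ops St_ops .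

lemma St_add:
  assumes "a \<in> G d" "s \<in> N d" "b \<in> G e" "t \<in> N e"
  shows "Fr a s \<oplus>\<^bsub>St\<^esub> Fr b t = Fr (t * a + s * b) (s * t)"
  using loc.localization_add[OF G_carrier[OF assms(1)] G_carrier[OF assms(3)] N_M[OF assms(2)] N_M[OF assms(4)]]
  unfolding R_ops St_ops .

lemma St_one: "\<one>\<^bsub>St\<^esub> = Fr 1 1" and St_zero: "\<zero>\<^bsub>St\<^esub> = Fr 0 1"
  unfolding St_ops loc.localization_one loc.localization_zero R_ops by (rule refl)+

lemma Fr_eq_iff:
  assumes "a \<in> G d" "s \<in> N d" "b \<in> G e" "t \<in> N e"
  shows "Fr a s = Fr b t \<longleftrightarrow> (\<exists>w\<in>M. w * (t * a) = w * (s * b))"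
  using loc.fraction_eq_iff[OF G_carrier[OF assms(1)] G_carrier[OF assms(3)] N_M[OF assms(2)] N_M[OF assms(4)]]
  unfolding R_ops .

lemma Fr_eqI:
  assumes "a \<in> G d" "s \<in> N d" "b \<in> G e" "t \<in> N e" "t * a = s * b"
  shows "Fr a s = Fr b t"
  unfolding Fr_eq_iff[OF assms(1-4)] assms(5) using N_M[OF N_one] by blast

lemma Fr_zero: assumes "s \<in> N d" shows "Fr 0 s = \<zero>\<^bsub>St\<^esub>"
  unfolding St_zero by (rule Fr_eqI[OF G_closed(1) assms G_closed(1) N_one]) simp

lemma Fr_self: assumes "s \<in> N d" shows "Fr s s = \<one>\<^bsub>St\<^esub>"
  unfolding St_one by (rule Fr_eqI[OF N_G[OF assms] assms G_closed(2) N_one]) simp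

lemma St_add_same:
  assumes "a \<in> G d" "b \<in> G d" "s \<in> N d"
  shows "Fr a s \<oplus>\<^bsub>St\<^esub> Fr b s = Fr (a + b) s"
proof -
  have "s * a + s * b \<in> G (d + d)" by (intro G_closed(3) G_closed(4) N_G assms)
  then have "Fr (s * a + s * b) (s * s) = Fr (a + b) s"
    by (rule Fr_eqI[OF _ N_mult[OF assms(3) assms(3)] G_closed(3)[OF assms(1,2)] assms(3)]) (simp add: algebra_simps)
  then show ?thesis using St_add[OF assms(1,3) assms(2,3)] by simp
qed

text \<open>The derivation at an irreducible \<open>e\<close> extends to the maximal ideal of the stalk.\<close>

lemma derivation_fraction:
  assumes e: "irreducible_\<sigma> e" and ab: "a \<in> G d" "lk a 0 d = 0" "s \<in> N d" "b \<in> G d'" "lk b 0 d' = 0" "t \<in> N d'"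
    and eq: "Fr a s = Fr b t"
  shows "lk t 0 d' * lk a e d = lk s 0 d * lk b e d'"
proof -
  obtain w where w: "w \<in> M" "w * (t * a) = w * (s * b)" using Fr_eq_iff[OF ab(1,3,4,6)] eq by blast
  then obtain c where c: "w \<in> N c" unfolding M_def N_def by blast
  have "lk (w * (t * a)) e (c + (d' + d)) = lk w 0 c * (lk t 0 d' * lk a e d)"
    using leibniz[OF e N_G[OF c] G_closed(4)[OF N_G[OF ab(6)] ab(1)]] leibniz[OF e N_G[OF ab(6)] ab(1)]
      ray_mult[OF N_G[OF ab(6)] ab(1)] ab(2) by simp
  moreover have "lk (w * (s * b)) e (c + (d + d')) = lk w 0 c * (lk s 0 d * lk b e d')"
    using leibniz[OF e N_G[OF c] G_closed(4)[OF N_G[OF ab(3)] ab(4)]] leibniz[OF e N_G[OF ab(3)] ab(4)]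
      ray_mult[OF N_G[OF ab(3)] ab(4)] ab(5) by simp
  ultimately show ?thesis using w(2) N_lk[OF c] by (simp add: add.commute)
qed

text \<open>The kernel of a linear form on the cotangent space at the fixed point: a combination,
  with coefficients \<alpha>, of the derivations in the directions \<open>e i\<close>. For \<alpha>
  = 0 it is the whole maximal ideal.\<close>

definition hyperplane :: "(nat \<Rightarrow> int \<times> int) \<Rightarrow> (nat \<Rightarrow> 'k) \<Rightarrow> ('k torus_algebra \<times> 'k torus_algebra) set set" where
  "hyperplane e \<alpha> = {Fr a s | a s d. a \<in> G d \<and> lk a 0 d = 0 \<and> s \<in> N d \<and> (\<Sum>i<3. \<alpha> i * lk a (e i) d) = 0}"

text \<open>On numerators that vanish at the point, the Leibniz rule makes a derivation linear over
  the values at the point, so the linear condition survives sums and multiples.\<close>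

lemma hyperplane_ideal:
  assumes "cring St" and e: "\<And>i. i < 3 \<Longrightarrow> irreducible_\<sigma> (e i)"
  shows "ideal (hyperplane e \<alpha>) St"
proof -
  interpret St: cring St by fact
  have sub: "hyperplane e \<alpha> \<subseteq> carrier St" unfolding hyperplane_def St_carrier by blast
  have l: "y \<otimes>\<^bsub>St\<^esub> x \<in> hyperplane e \<alpha>" if x: "x \<in> hyperplane e \<alpha>" and y: "y \<in> carrier St" for x y
  proof -
    obtain a s d where a: "a \<in> G d" "lk a 0 d = 0" "s \<in> N d" "(\<Sum>i<3. \<alpha> i * lk a (e i) d) = 0" "x = Fr a s"
      using x unfolding hyperplane_def by blast
    obtain b t c where b: "b \<in> G c" "t \<in> N c" "y = Fr b t" using y unfolding St_carrier by blast
    have "(\<Sum>i<3. \<alpha> i * lk (b * a) (e i) (c + d)) = (\<Sum>i<3. lk b 0 c * (\<alpha> i * lk a (e i) d))"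
      by (rule sum.cong) (simp_all add: leibniz[OF e b(1) a(1)] a(2) mult.left_commute)
    also have "\<dots> = 0" using a(4) by (simp only: sum_distrib_left[symmetric] mult_zero_right)
    finally have "(\<Sum>i<3. \<alpha> i * lk (b * a) (e i) (c + d)) = 0" .
    moreover have "lk (b * a) 0 (c + d) = 0" using ray_mult[OF b(1) a(1)] a(2) by simp
    moreover have "y \<otimes>\<^bsub>St\<^esub> x = Fr (b * a) (t * s)" unfolding a(5) b(3) by (rule St_mult[OF b(1,2) a(1,3)])
    ultimately show ?thesis using G_closed(4)[OF b(1) a(1)] N_mult[OF b(2) a(3)] unfolding hyperplane_def by blast
  qed
  show ?thesis
  proof (intro idealI)
    show "ring St" by (rule St.ring_axioms)
    show "subgroup (hyperplane e \<alpha>) (add_monoid St)"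
    proof (rule St.add.subgroupI)
      show "hyperplane e \<alpha> \<subseteq> carrier St" by (rule sub)
      have "Fr 0 1 \<in> hyperplane e \<alpha>" unfolding hyperplane_def using G_closed(1)[of 0] N_one by fastforce
      then show "hyperplane e \<alpha> \<noteq> {}" by blast
      show "\<ominus>\<^bsub>St\<^esub> x \<in> hyperplane e \<alpha>" if "x \<in> hyperplane e \<alpha>" for x
        using l[OF that, of "\<ominus>\<^bsub>St\<^esub> \<one>\<^bsub>St\<^esub>"] that sub by (auto simp: St.l_minus)
      fix x y assume xy: "x \<in> hyperplane e \<alpha>" "y \<in> hyperplane e \<alpha>"
      obtain a s d where a: "a \<in> G d" "lk a 0 d = 0" "s \<in> N d" "(\<Sum>i<3. \<alpha> i * lk a (e i) d) = 0" "x = Fr a s"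
        using xy(1) unfolding hyperplane_def by blast
      obtain b t c where b: "b \<in> G c" "lk b 0 c = 0" "t \<in> N c" "(\<Sum>i<3. \<alpha> i * lk b (e i) c) = 0" "y = Fr b t"
        using xy(2) unfolding hyperplane_def by blast
      define z where "z = t * a + s * b"
      have zG: "t * a \<in> G (d + c)" "s * b \<in> G (d + c)"
        using G_closed(4)[OF N_G[OF b(3)] a(1)] G_closed(4)[OF N_G[OF a(3)] b(1)] by (simp_all add: add.commute)
      have l1: "lk (t * a) (e i) (d + c) = lk t 0 c * lk a (e i) d" if "i < 3" for i
        using leibniz[OF e[OF that] N_G[OF b(3)] a(1)] a(2) by (simp add: add.commute)
      have l2: "lk (s * b) (e i) (d + c) = lk s 0 d * lk b (e i) c" if "i < 3" for i
        using leibniz[OF e[OF that] N_G[OF a(3)] b(1)] b(2) by simp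
      have "(\<Sum>i<3. \<alpha> i * lk z (e i) (d + c)) =
          (\<Sum>i<3. lk t 0 c * (\<alpha> i * lk a (e i) d) + lk s 0 d * (\<alpha> i * lk b (e i) c))"
        by (rule sum.cong) (simp_all add: z_def l1 l2 distrib_left mult.left_commute)
      also have "\<dots> = lk t 0 c * (\<Sum>i<3. \<alpha> i * lk a (e i) d) + lk s 0 d * (\<Sum>i<3. \<alpha> i * lk b (e i) c)"
        by (simp only: sum.distrib sum_distrib_left)
      also have "\<dots> = 0" unfolding a(4) b(4) by simp
      finally have "(\<Sum>i<3. \<alpha> i * lk z (e i) (d + c)) = 0" .
      moreover have "lk z 0 (d + c) = 0"
        using ray_mult[OF N_G[OF b(3)] a(1)] ray_mult[OF N_G[OF a(3)] b(1)] a(2) b(2) by (simp add: z_def add.commute)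
      moreover have "x \<oplus>\<^bsub>St\<^esub> y = Fr z (s * t)" unfolding a(5) b(5) z_def by (rule St_add[OF a(1,3) b(1,3)])
      ultimately show "x \<oplus>\<^bsub>St\<^esub> y \<in> hyperplane e \<alpha>"
        using G_closed(3)[OF zG] N_mult[OF a(3) b(3)] unfolding hyperplane_def z_def by blast
    qed
    show "x \<otimes>\<^bsub>St\<^esub> y \<in> hyperplane e \<alpha>" if "x \<in> hyperplane e \<alpha>" "y \<in> carrier St" for x y
      using l[OF that] that sub by (auto simp: St.m_comm)
  qed (use l in auto)
qed

end

section \<open>Dimension of the stalk and generators of the vertex semigroup\<close>

lemma lookup_single_zero_mult:
  "Poly_Mapping.lookup (Poly_Mapping.single 0 c * g) e = c * Poly_Mapping.lookup (g :: 'e::comm_monoid_add \<Rightarrow>\<^sub>0 'k::comm_semiring_1) e"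
  by (simp flip: mult_map_scale_conv_mult add: Poly_Mapping.map.rep_eq when_def)

inductive_set additive_hull :: "(int \<times> int) set \<Rightarrow> (int \<times> int) set" for E where
  zero: "0 \<in> additive_hull E"
| add: "e \<in> E \<Longrightarrow> x \<in> additive_hull E \<Longrightarrow> e + x \<in> additive_hull E"

lemma additive_hull_add:
  assumes "x \<in> additive_hull E" "y \<in> additive_hull E"
  shows "x + y \<in> additive_hull E"
  using assms(1)
proof (induction rule: additive_hull.induct)
  case (add e x)
  then show ?case using additive_hull.add[of e E "x + y"] by (simp add: add.assoc)
qed (use assms(2) in simp)

lemma additive_hull_base: "e \<in> E \<Longrightarrow> e \<in> additive_hull E"
  using additive_hull.add[OF _ additive_hull.zero, of e E] by simp

lemma additive_hull_minimal:
  assumes "E \<subseteq> additive_hull F" "x \<in> additive_hull E"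
  shows "x \<in> additive_hull F"
  using assms(2)
proof (induction rule: additive_hull.induct)
  case (add e x)
  then show ?case using assms(1) additive_hull_add by blast
qed (rule additive_hull.zero)

lemma additive_hull_split:
  assumes "x \<in> additive_hull E"
  shows "x \<in> additive_hull (E - {e}) \<or> (\<exists>y\<in>additive_hull E. x = e + y)"
  using assms
proof (induction rule: additive_hull.induct)
  case (add f x)
  consider "f = e" | "f \<noteq> e" "x \<in> additive_hull (E - {e})" | y where "y \<in> additive_hull E" "x = e + y"
    using add.IH by blast
  then show ?case
  proof cases
    case 1 then show ?thesis using add.hyps by blast
  next
    case 2 then show ?thesis using add.hyps additive_hull.add[of f "E - {e}" x] by blast
  next
    case 3
    have "f + x = e + (f + y)" using 3(2) by (simp add: add.left_commute)
    moreover have "f + y \<in> additive_hull E" using additive_hull.add[OF add.hyps(1) 3(1)] .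
    ultimately show ?thesis by blast
  qed
qed (simp add: additive_hull.zero)

lemma additive_hull_pair:
  assumes "x \<in> additive_hull {a, b}"
  shows "\<exists>m n :: nat. fst x = int m * fst a + int n * fst b \<and> snd x = int m * snd a + int n * snd b"
  using assms
proof (induction rule: additive_hull.induct)
  case zero
  then show ?case by (intro exI[of _ 0]) simp
next
  case (add e x)
  then obtain m n :: nat where mn: "fst x = int m * fst a + int n * fst b" "snd x = int m * snd a + int n * snd b" by blast
  from add.hyps(1) consider "e = a" | "e = b" by blast
  then show ?case
  proof cases
    case 1 then show ?thesis using mn by (intro exI[of _ "Suc m"] exI[of _ n]) (simp add: distrib_right)
  next
    case 2 then show ?thesis using mn by (intro exI[of _ m] exI[of _ "Suc n"]) (simp add: distrib_right)
  qed
qed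

context toric_vertex
begin

text \<open>The products of degree \<open>3 * n\<close> in three elements and \<open>t\<close>, all
  of degree \<open>D\<close>, lie in the degree \<open>D * (3 * n)\<close> part of the semigroup
  algebra, whose dimension is quadratic in \<open>n\<close>, while their number is cubic.\<close>

lemma algebraic_relation:
  fixes b :: "nat \<Rightarrow> 'k torus_algebra"
  assumes b: "\<And>i. i < 3 \<Longrightarrow> b i \<in> G D" and t: "t \<in> G D"
  obtains n f where
    "(\<Sum>i\<le>n. \<Sum>j\<le>n. \<Sum>k\<le>n. Poly_Mapping.single 0 (f i j k) * (b 0 ^ i * b 1 ^ j * b 2 ^ k * t ^ (3 * n - i - j - k))) = 0"
    "\<exists>i\<le>n. \<exists>j\<le>n. \<exists>k\<le>n. f i j k \<noteq> (0 :: 'k)"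
proof -
  have "finite ((\<lambda>u. max \<bar>fst u\<bar> \<bar>snd u\<bar>) ` lattice_points P)" using finite_points by simp
  then obtain K0 where K0: "\<forall>x\<in>(\<lambda>u. max \<bar>fst u\<bar> \<bar>snd u\<bar>) ` lattice_points P. x \<le> K0"
    using bdd_above_finite unfolding bdd_above_def by blast
  define K where "K = nat K0"
  have K: "\<bar>fst u\<bar> \<le> int K \<and> \<bar>snd u\<bar> \<le> int K" if "u \<in> lattice_points P" for u
  proof -
    have "max \<bar>fst u\<bar> \<bar>snd u\<bar> \<le> K0" using K0 that by blast
    then show ?thesis unfolding K_def by linarith
  qed
  \<comment> \<open>In degree \<open>D * (3 * n)\<close> both coordinates are bounded by
    \<open>B = 3 * K * D * n\<close>, so each takes at most \<open>2 * B + 1\<close> values; this is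
    the origin of the factor 6.\<close>
  obtain n where n: "((6 * K * D) * n + 1)\<^sup>2 < (n + 1) ^ 3" by (rule cubic_exceeds_square)
  define E where "E = {x \<in> S. snd x = int (D * (3 * n))}"
  define B where "B = int (3 * K * D * n)"
  have EB: "E \<subseteq> (\<lambda>ij. (ij, int (D * (3 * n)))) ` ({-B..B} \<times> {-B..B})"
  proof
    fix x assume x: "x \<in> E"
    have "\<bar>fst (fst x)\<bar> \<le> int K * snd x \<and> \<bar>snd (fst x)\<bar> \<le> int K * snd x"
      using x K by (intro cone_semigroup_bounded) (auto simp: E_def)
    moreover have "int K * snd x = B" using x by (simp add: E_def B_def mult_ac)
    ultimately have "fst x \<in> {-B..B} \<times> {-B..B}" by (auto simp: mem_Times_iff abs_le_iff)
    moreover have sx: "snd x = int (D * (3 * n))" using x unfolding E_def by blast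
    have "x = (fst x, int (D * (3 * n)))" unfolding sx[symmetric] by (rule prod.collapse[symmetric])
    ultimately show "x \<in> (\<lambda>ij. (ij, int (D * (3 * n)))) ` ({-B..B} \<times> {-B..B})" by (rule rev_image_eqI)
  qed
  have finB: "finite ({-B..B} \<times> {-B..B})" by simp
  have E_fin: "finite E" using EB finB by (meson finite_imageI finite_subset)
  have cB: "card {-B..B} = (6 * K * D) * n + 1" by (simp add: B_def nat_add_distrib nat_mult_distrib)
  have "card E \<le> card ((\<lambda>ij. (ij, int (D * (3 * n)))) ` ({-B..B} \<times> {-B..B}))"
    by (rule card_mono[OF finite_imageI[OF finB] EB])
  also have "\<dots> \<le> card ({-B..B} \<times> {-B..B})" by (rule card_image_le[OF finB])
  also have "\<dots> = ((6 * K * D) * n + 1)\<^sup>2" unfolding card_cartesian_product cB by (simp only: power2_eq_square)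
  finally have "card E < (n + 1) ^ 3" using n by simp
  define I where "I = {..n} \<times> {..n} \<times> {..n}"
  have "card I = (n + 1) ^ 3" by (simp add: I_def power3_eq_cube)
  define g where "g = (\<lambda>(i, j, k). b 0 ^ i * b 1 ^ j * b 2 ^ k * t ^ (3 * n - i - j - k))"
  obtain c where c: "\<exists>x\<in>I. c x \<noteq> 0" "\<forall>e\<in>E. (\<Sum>x\<in>I. c x * Poly_Mapping.lookup (g x) e) = 0"
    using homogeneous_system_nontrivial[OF E_fin, of I "\<lambda>x e. Poly_Mapping.lookup (g x) e"]
      \<open>card E < _\<close> \<open>card I = _\<close> by (auto simp: I_def)
  have g: "g x \<in> G (D * (3 * n))" if xI: "x \<in> I" for x
  proof -
    obtain i j k where x: "x = (i, j, k)" "i \<le> n" "j \<le> n" "k \<le> n" using xI by (auto simp: I_def)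
    have "b 0 ^ i * b 1 ^ j * b 2 ^ k * t ^ (3 * n - i - j - k) \<in> G (D * i + D * j + D * k + D * (3 * n - i - j - k))"
      by (intro G_closed(4) G_power b t) simp_all
    moreover have "i + j + k + (3 * n - i - j - k) = 3 * n" using x by linarith
    then have "D * i + D * j + D * k + D * (3 * n - i - j - k) = D * (3 * n)" by (metis distrib_left)
    ultimately show ?thesis by (simp add: g_def x)
  qed
  have "(\<Sum>x\<in>I. Poly_Mapping.single 0 (c x) * g x) = 0"
  proof (rule poly_mapping_eqI)
    fix e
    have "(\<Sum>x\<in>I. c x * Poly_Mapping.lookup (g x) e) = 0"
    proof (cases "e \<in> E")
      case False
      have "Poly_Mapping.lookup (g x) e = 0" if "x \<in> I" for x
        using g[OF that] False by (auto simp: G_def E_def in_keys_iff)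
      then show ?thesis by simp
    qed (use c in blast)
    then show "Poly_Mapping.lookup (\<Sum>x\<in>I. Poly_Mapping.single 0 (c x) * g x) e = Poly_Mapping.lookup 0 e"
      by (simp add: lookup_sum lookup_single_zero_mult)
  qed
  then have "(\<Sum>i\<le>n. \<Sum>j\<le>n. \<Sum>k\<le>n. Poly_Mapping.single 0 (c (i, j, k)) * (b 0 ^ i * b 1 ^ j * b 2 ^ k * t ^ (3 * n - i - j - k))) = 0"
    by (simp add: I_def g_def sum.cartesian_product case_prod_unfold)
  moreover have "\<exists>i\<le>n. \<exists>j\<le>n. \<exists>k\<le>n. c (i, j, k) \<noteq> 0" using c(1) by (auto simp: I_def)
  ultimately show thesis by (rule that[of "\<lambda>i j k. c (i, j, k)" n])
qed

text \<open>Elements separating four primes of the stalk are brought to a common denominator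
  \<open>t\<close>; their numerators satisfy a relation for reasons of dimension, and the chain
  forbids it.\<close>

lemma no_prime_chain_St:
  assumes "cring St" and prime: "\<And>i. i \<le> 3 \<Longrightarrow> primeideal (c i) St" and strict: "\<And>i. i < 3 \<Longrightarrow> c i \<subset> c (Suc i)"
  shows False
proof -
  interpret St: cring St by fact
  have "\<forall>i. \<exists>X. i < 3 \<longrightarrow> X \<in> c (Suc i) \<and> X \<notin> c i" using strict by blast
  then obtain X where X: "\<And>i. i < 3 \<Longrightarrow> X i \<in> c (Suc i)" "\<And>i. i < 3 \<Longrightarrow> X i \<notin> c i" by metis
  have ideal: "ideal (c i) St" if "i \<le> 3" for i using prime[OF that] by (rule primeideal.axioms(1))
  have "\<exists>a s d. a \<in> G d \<and> s \<in> N d \<and> X i = Fr a s" if i: "i < 3" for i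
  proof -
    have "X i \<in> carrier St" using ideal.Icarr[OF ideal[of "Suc i"] X(1)[OF i]] i by simp
    then show ?thesis unfolding St_carrier by blast
  qed
  then obtain a s d where as: "\<And>i. i < 3 \<Longrightarrow> a i \<in> G (d i)" "\<And>i. i < 3 \<Longrightarrow> s i \<in> N (d i)" "\<And>i. i < 3 \<Longrightarrow> X i = Fr (a i) (s i)"
    by metis
  define D where "D = d 0 + d 1 + d 2"
  define t where "t = s 0 * s 1 * s 2"
  have t: "t \<in> N D" unfolding t_def D_def by (intro N_mult as) simp_all
  define b where "b i = (if i = 0 then a 0 * (s 1 * s 2) else if i = 1 then a 1 * (s 0 * s 2) else a 2 * (s 0 * s 1))" for i :: nat
  have bG: "b i \<in> G D" if "i < 3" for i
  proof -
    have "a 0 * (s 1 * s 2) \<in> G (d 0 + (d 1 + d 2))" "a 1 * (s 0 * s 2) \<in> G (d 1 + (d 0 + d 2))"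
      "a 2 * (s 0 * s 1) \<in> G (d 2 + (d 0 + d 1))"
      by (intro G_closed(4) as N_G; simp)+
    then show ?thesis by (simp add: b_def D_def add_ac)
  qed
  have bX: "Fr (b i) t = X i" if i: "i < 3" for i
  proof -
    consider "i = 0" | "i = 1" | "i = 2" using i by linarith
    then have "s i * b i = t * a i" by cases (simp_all add: b_def t_def mult_ac)
    then show ?thesis using Fr_eqI[OF bG[OF i] t as(1)[OF i] as(2)[OF i]] as(3)[OF i] by simp
  qed
  \<comment> \<open>The degree \<open>D * n\<close> numerators whose fraction over
    \<open>t ^ n\<close> lies in the prime. The minimum repeats the last prime at larger indices,
    where the locale still demands that zero be a member.\<close>
  define H where "H i n = {x \<in> G (D * n). Fr x (t ^ n) \<in> c (min i 3)}" for i n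
  have tn: "t ^ n \<in> N (D * n)" for n by (rule N_power[OF t])
  have m3: "min i 3 \<le> 3" for i :: nat by simp
  interpret graded_prime_chain "\<lambda>n. G (D * n)" H
  proof
    show "0 \<in> G (D * n)" "1 \<in> G (D * 0)" for n using G_closed(1,2) by simp_all
    show "x + y \<in> G (D * n)" if "x \<in> G (D * n)" "y \<in> G (D * n)" for x y n using that by (rule G_closed(3))
    show "x * y \<in> G (D * (m + n))" if "x \<in> G (D * m)" "y \<in> G (D * n)" for x y m n
      using G_closed(4)[OF that] by (simp add: distrib_left)
    show "0 \<in> H i n" for i n
      using additive_subgroup.zero_closed[OF ideal.axioms(1)[OF ideal[OF m3]]] G_closed(1)
      by (simp add: H_def Fr_zero[OF tn])
    show "x - y \<in> H i n" if i: "i \<le> 3" and xy: "x \<in> H i n" "y \<in> H i n" for i n x y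
    proof -
      have x: "x \<in> G (D * n)" "Fr x (t ^ n) \<in> c (min i 3)" and y: "y \<in> G (D * n)" "Fr y (t ^ n) \<in> c (min i 3)"
        using xy by (simp_all add: H_def)
      have "Fr (-1) 1 \<otimes>\<^bsub>St\<^esub> Fr y (t ^ n) = Fr (- y) (t ^ n)"
        using St_mult[OF G_closed(5)[OF G_closed(2)] N_one y(1) tn] by simp
      moreover have "Fr (-1) 1 \<otimes>\<^bsub>St\<^esub> Fr y (t ^ n) \<in> c (min i 3)"
        by (rule ideal.I_l_closed[OF ideal[OF m3] y(2) Fr_carrier[OF G_closed(5)[OF G_closed(2)] N_one]])
      ultimately have "Fr x (t ^ n) \<oplus>\<^bsub>St\<^esub> Fr (- y) (t ^ n) \<in> c (min i 3)"
        using additive_subgroup.a_closed[OF ideal.axioms(1)[OF ideal[OF m3]] x(2)] by simp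
      then have "Fr (x + - y) (t ^ n) \<in> c (min i 3)"
        using St_add_same[OF x(1) G_closed(5)[OF y(1)] tn] by simp
      moreover have "x + - y \<in> G (D * n)" by (rule G_closed(3)[OF x(1) G_closed(5)[OF y(1)]])
      ultimately show ?thesis by (simp add: H_def)
    qed
    have FrM: "Fr (x * y) (t ^ (m + n)) = Fr x (t ^ m) \<otimes>\<^bsub>St\<^esub> Fr y (t ^ n)" if "x \<in> G (D * m)" "y \<in> G (D * n)" for x y m n
      using St_mult[OF that(1) tn that(2) tn] by (simp add: power_add)
    show "x * y \<in> H i (m + n)" if i: "i \<le> 3" and x: "x \<in> H i m" and y: "y \<in> G (D * n)" for i m n x y
    proof -
      have x': "x \<in> G (D * m)" "Fr x (t ^ m) \<in> c (min i 3)" using x by (simp_all add: H_def)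
      have "Fr (x * y) (t ^ (m + n)) \<in> c (min i 3)"
        unfolding FrM[OF x'(1) y] by (rule ideal.I_r_closed[OF ideal[OF m3] x'(2) Fr_carrier[OF y tn]])
      moreover have "x * y \<in> G (D * (m + n))" using G_closed(4)[OF x'(1) y] by (simp add: distrib_left)
      ultimately show ?thesis by (simp add: H_def)
    qed
    show "x \<in> H i m \<or> y \<in> H i n" if i: "i \<le> 3" and xy: "x \<in> G (D * m)" "y \<in> G (D * n)" and prod: "x * y \<in> H i (m + n)" for i m n x y
    proof -
      have "Fr x (t ^ m) \<otimes>\<^bsub>St\<^esub> Fr y (t ^ n) \<in> c (min i 3)" using prod FrM[OF xy] by (simp add: H_def)
      then have "Fr x (t ^ m) \<in> c (min i 3) \<or> Fr y (t ^ n) \<in> c (min i 3)"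
        by (rule primeideal.I_prime[OF prime[OF m3] Fr_carrier[OF xy(1) tn] Fr_carrier[OF xy(2) tn]])
      then show ?thesis using xy by (simp add: H_def)
    qed
    show "H i n \<subseteq> H (Suc i) n" if "i < 3" for i n
    proof -
      have "min i 3 = i" "min (Suc i) 3 = Suc i" using that by auto
      then show ?thesis using strict[OF that] unfolding H_def by auto
    qed
  qed
  obtain n f where f: "(\<Sum>i\<le>n. \<Sum>j\<le>n. \<Sum>k\<le>n. Poly_Mapping.single 0 (f i j k) * (b 0 ^ i * b 1 ^ j * b 2 ^ k * t ^ (3 * n - i - j - k))) = 0"
    "\<exists>i\<le>n. \<exists>j\<le>n. \<exists>k\<le>n. f i j k \<noteq> (0 :: 'k)"
    by (rule algebraic_relation[of b D t]) (use bG N_G[OF t] in auto)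
  have "f i j k = 0" if "i \<le> n" "j \<le> n" "k \<le> n" for i j k
  proof (rule no_algebraic_relation[of b t "Poly_Mapping.single 0" f n])
    fix i :: nat assume i: "i < 3"
    have mi: "min i 3 = i" "min (Suc i) 3 = Suc i" using i by auto
    show "b i \<in> G (D * 1)" using bG[OF i] by simp
    show "b i \<notin> H i 1" "b i \<in> H (Suc i) 1"
      unfolding H_def mem_Collect_eq mi power_one_right mult_1_right bX[OF i] using X[OF i] bG[OF i] by blast+
  next
    show "t \<in> G (D * 1)" using N_G[OF t] by simp
    fix m show "t ^ m \<notin> H 3 m"
    proof
      assume "t ^ m \<in> H 3 m"
      then have "\<one>\<^bsub>St\<^esub> \<in> c 3" by (simp add: H_def Fr_self[OF tn])
      then show False using ideal.one_imp_carrier[OF ideal[of 3]] primeideal.I_notcarr[OF prime[of 3]] by simp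
    qed
  next
    show "Poly_Mapping.single 0 c \<in> G (D * 0)" for c using G_closed(7) by simp
    fix c :: 'k assume "c \<noteq> 0"
    then show "\<exists>d\<in>G (D * 0). Poly_Mapping.single 0 c * d = 1"
      using G_closed(7) by (intro bexI[of _ "Poly_Mapping.single 0 (1 / c)"]) (simp_all add: mult_single)
  qed (use f(1) that in simp_all)
  with f(2) show False by blast
qed

lemma krull_dim_St: "cring St \<Longrightarrow> krull_dim St \<le> 2"
  unfolding krull_dim_def
proof (rule Sup_least, clarify)
  fix n and c :: "nat \<Rightarrow> ('k torus_algebra \<times> 'k torus_algebra) set set"
  assume "cring St" and c: "\<forall>i\<le>n. primeideal (c i) St" "\<forall>i<n. c i \<subset> c (Suc i)"
  have "\<not> 3 \<le> n"
  proof
    assume "3 \<le> n"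
    then show False using no_prime_chain_St[OF \<open>cring St\<close>, of c] c by simp
  qed
  then have "enat n \<le> enat 2" by simp
  then show "enat n \<le> 2" by (simp add: numeral_eq_enat)
qed

text \<open>The maximal ideal has at most two generators, so some nonzero combination of three
  derivations kills all of them and hence the whole ideal. But the monomials at the three directions
  are dual to the derivations.\<close>

lemma few_irreducibles:
  fixes e :: "nat \<Rightarrow> int \<times> int"
  assumes reg: "regular_local_ring St" and irr: "\<And>i. i < 3 \<Longrightarrow> irreducible_\<sigma> (e i)"
    and gen: "\<And>i. i < 3 \<Longrightarrow> e i + v \<in> lattice_points P" and inj: "inj_on e {..<3}"
  shows False
proof -
  have cr: "cring St" using reg by (simp add: regular_local_ring_def)
  interpret St: cring St by (rule cr)
  obtain m where m: "maximalideal m St" using reg by (auto simp: regular_local_ring_def)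
  obtain B where B: "B \<subseteq> carrier St" "finite B" "m = Idl\<^bsub>St\<^esub> B" "enat (card B) = krull_dim St"
    using reg m by (auto simp: regular_local_ring_def)
  interpret m: maximalideal m St by (rule m)
  have "enat (card B) \<le> 2" using krull_dim_St[OF cr] B(4) by simp
  then have cardB: "card B < 3" by (simp add: numeral_eq_enat)
  \<comment> \<open>With zero coefficients the linear condition is empty: these are the fractions
    vanishing at the point, and they turn out to be the maximal ideal.\<close>
  define m0 where "m0 = hyperplane e (\<lambda>_. 0)"
  have m0: "ideal m0 St" unfolding m0_def by (rule hyperplane_ideal[OF cr irr])
  have m_m0: "m \<subseteq> m0"
  proof
    fix x assume x: "x \<in> m"
    then have "x \<in> carrier St" by (rule m.Icarr)
    then obtain a s d where a: "a \<in> G d" "s \<in> N d" "x = Fr a s" unfolding St_carrier by blast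
    have "lk a 0 d = 0"
    proof (rule ccontr)
      assume nz: "lk a 0 d \<noteq> 0"
      have aN: "a \<in> N d" by (rule N_I[OF a(1) nz])
      have "Fr s a \<otimes>\<^bsub>St\<^esub> x \<in> m" by (rule m.I_l_closed[OF x Fr_carrier[OF N_G[OF a(2)] aN]])
      moreover have "Fr s a \<otimes>\<^bsub>St\<^esub> x = Fr (s * a) (a * s)" unfolding a(3) by (rule St_mult[OF N_G[OF a(2)] aN a(1,2)])
      moreover have "Fr (s * a) (a * s) = \<one>\<^bsub>St\<^esub>" using Fr_self[OF N_mult[OF aN a(2)]] by (simp add: mult.commute)
      ultimately have "\<one>\<^bsub>St\<^esub> \<in> m" by simp
      then show False using m.one_imp_carrier m.I_notcarr by simp
    qed
    then show "x \<in> m0" using a unfolding m0_def hyperplane_def by fastforce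
  qed
  have one_m0: "\<one>\<^bsub>St\<^esub> \<notin> m0"
  proof
    assume "\<one>\<^bsub>St\<^esub> \<in> m0"
    then obtain a s d where a: "a \<in> G d" "lk a 0 d = 0" "s \<in> N d" "Fr 1 1 = Fr a s"
      unfolding m0_def hyperplane_def St_one by blast
    then obtain w where w: "w \<in> M" "w * (s * 1) = w * (1 * a)" using Fr_eq_iff[OF G_closed(2) N_one a(1,3)] by blast
    then obtain c where c: "w \<in> N c" unfolding M_def N_def by blast
    have "lk (w * s) 0 (c + d) = lk w 0 c * lk s 0 d" by (rule ray_mult[OF N_G[OF c] N_G[OF a(3)]])
    moreover have "lk (w * a) 0 (c + d) = lk w 0 c * lk a 0 d" by (rule ray_mult[OF N_G[OF c] a(1)])
    moreover have "w * s = w * a" using w(2) by simp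
    ultimately show False using N_lk[OF c] N_lk[OF a(3)] a(2) by simp
  qed
  have "m0 \<subseteq> carrier St" using ideal.Icarr[OF m0] by blast
  then have "m0 = m \<or> m0 = carrier St" using m.I_maximal[OF m0 m_m0] by blast
  then have mm: "m0 = m" using one_m0 St.one_closed by blast
  have "\<exists>a s d. a \<in> G d \<and> lk a 0 d = 0 \<and> s \<in> N d \<and> y = Fr a s" if "y \<in> B" for y
  proof -
    have "y \<in> m0" using that St.genideal_self[OF B(1)] B(3) mm by blast
    then show ?thesis unfolding m0_def hyperplane_def by blast
  qed
  then obtain a s d where as: "\<And>y. y \<in> B \<Longrightarrow> a y \<in> G (d y) \<and> lk (a y) 0 (d y) = 0 \<and> s y \<in> N (d y) \<and> y = Fr (a y) (s y)"
    by metis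
  \<comment> \<open>Three unknown coefficients against at most two equations, one for each generator
    in \<open>B\<close>.\<close>
  obtain \<alpha> where \<alpha>: "\<exists>i\<in>{..<3}. \<alpha> i \<noteq> 0" "\<forall>y\<in>B. (\<Sum>i\<in>{..<3}. \<alpha> i * lk (a y) (e i) (d y)) = 0"
    using homogeneous_system_nontrivial[OF B(2), of "{..<3}" "\<lambda>i y. lk (a y) (e i) (d y)"] cardB by auto
  have "B \<subseteq> hyperplane e \<alpha>" using as \<alpha>(2) unfolding hyperplane_def by blast
  moreover have "ideal (hyperplane e \<alpha>) St" by (rule hyperplane_ideal[OF cr irr])
  ultimately have m_sub: "m \<subseteq> hyperplane e \<alpha>" using B(3) St.genideal_minimal by simp
  obtain i where i: "i < 3" "\<alpha> i \<noteq> 0" using \<alpha>(1) by auto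
  \<comment> \<open>The local coordinate x/y in a direction \<open>e i\<close> with nonzero
    coefficient: it vanishes at the point but is not killed by the combination of
    derivations.\<close>
  define x where "x = (Poly_Mapping.single (point_over (e i) 1) 1 :: 'k torus_algebra)"
  define y where "y = (Poly_Mapping.single (point_over 0 1) 1 :: 'k torus_algebra)"
  have pt: "point_over (e i) 1 = (e i + v, 1)" "point_over 0 1 = (v, 1)" by (simp_all add: point_over_def prod_eq_iff)
  have x: "x \<in> G 1" using cone_semigroup_generator[OF gen[OF i(1)]] unfolding x_def pt by (simp add: G_def)
  have y: "y \<in> N 1"
    using cone_semigroup_generator[OF v] unfolding y_def pt by (intro N_I) (simp_all add: G_def lk_def pt)
  have "e i \<noteq> 0" using irr[OF i(1)] by (simp add: irreducible_\<sigma>_def)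
  then have x0: "lk x 0 1 = 0" by (simp add: lk_def x_def lookup_single when_def point_over_eq_iff)
  have "Fr x y \<in> m0" unfolding m0_def hyperplane_def using x x0 y by fastforce
  then have "Fr x y \<in> hyperplane e \<alpha>" using mm m_sub by blast
  then obtain b t c where b: "b \<in> G c" "lk b 0 c = 0" "t \<in> N c" "(\<Sum>k<3. \<alpha> k * lk b (e k) c) = 0" "Fr x y = Fr b t"
    unfolding hyperplane_def by blast
  have ly: "lk y 0 1 = 1" by (simp add: lk_def y_def)
  have lx: "lk x (e k) 1 = (if k = i then 1 else 0)" if "k < 3" for k
    using inj that i(1) by (auto simp: lk_def x_def lookup_single when_def point_over_eq_iff inj_on_def)
  \<comment> \<open>Membership in \<open>hyperplane\<close> only provides some representative b/t;
    \<open>derivation_fraction\<close> carries the condition over to the representative x/y.\<close>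
  have "lk t 0 c * lk x (e k) 1 = lk b (e k) c" if "k < 3" for k
    using derivation_fraction[OF irr[OF that] x x0 y b(1,2,3,5)] ly by simp
  then have "(\<Sum>k<3. \<alpha> k * (lk t 0 c * lk x (e k) 1)) = 0" using b(4) by simp
  moreover have "(\<Sum>k<3. \<alpha> k * (lk t 0 c * lk x (e k) 1)) = (\<Sum>k<3. if k = i then \<alpha> i * lk t 0 c else 0)"
    by (rule sum.cong) (auto simp: lx[unfolded One_nat_def])
  moreover have "\<dots> = \<alpha> i * lk t 0 c" using i(1) by simp
  ultimately show False using i(2) N_lk[OF b(3)] by simp
qed

lemma \<sigma>_hull: "\<sigma> = additive_hull ((\<lambda>w. w - v) ` lattice_points P - {0})"
proof
  show "\<sigma> \<subseteq> additive_hull ((\<lambda>w. w - v) ` lattice_points P - {0})"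
  proof
    fix x assume "x \<in> \<sigma>"
    then obtain y where y: "y \<in> S" "x = \<delta> y" by (auto simp: \<sigma>_def)
    have "\<delta> y \<in> additive_hull ((\<lambda>w. w - v) ` lattice_points P - {0})"
      using y(1)
    proof (induction rule: cone_semigroup.induct)
      case zero
      then show ?case by (simp add: \<delta>_def additive_hull.zero flip: zero_prod_def)
    next
      case (add u y)
      then show ?case using additive_hull.add[of "u - v" _ "\<delta> y"] unfolding \<delta>_add \<delta>_generator by (cases "u - v = 0") auto
    qed
    then show "x \<in> additive_hull ((\<lambda>w. w - v) ` lattice_points P - {0})" using y(2) by simp
  qed
  show "additive_hull ((\<lambda>w. w - v) ` lattice_points P - {0}) \<subseteq> \<sigma>"
  proof
    fix x assume "x \<in> additive_hull ((\<lambda>w. w - v) ` lattice_points P - {0})"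
    then show "x \<in> \<sigma>"
    proof (induction rule: additive_hull.induct)
      case zero
      have "\<delta> 0 = 0" by (simp add: \<delta>_def prod_eq_iff)
      then show ?case unfolding \<sigma>_def using cone_semigroup.zero by (metis image_eqI)
    next
      case (add e x)
      then obtain w where w: "w \<in> lattice_points P" "e = w - v" by blast
      have "e \<in> \<sigma>" unfolding \<sigma>_def w(2) \<delta>_generator[symmetric] by (rule imageI[OF cone_semigroup_generator[OF w(1)]])
      then show ?case using add.IH by (rule \<sigma>_add)
    qed
  qed
qed

text \<open>The elements of a minimal generating set of the vertex semigroup are irreducible, hence there
  are at most two of them.\<close>

theorem smooth_vertex:
  assumes reg: "regular_local_ring St"
  shows "\<exists>e1\<in>lattice_points P. \<exists>e2\<in>lattice_points P. \<forall>w\<in>lattice_points P. \<exists>m n :: nat.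
    fst w - fst v = int m * (fst e1 - fst v) + int n * (fst e2 - fst v) \<and>
    snd w - snd v = int m * (snd e1 - snd v) + int n * (snd e2 - snd v)"
proof -
  define V where "V = (\<lambda>w. w - v) ` lattice_points P - {0}"
  have V: "finite V" "0 \<notin> V" using finite_points by (auto simp: V_def)
  have \<sigma>V: "\<sigma> = additive_hull V" unfolding V_def by (rule \<sigma>_hull)
  have "V \<subseteq> V \<and> V \<subseteq> additive_hull V" using additive_hull_base by blast
  \<comment> \<open>A generating subset of least cardinality, so that no element of it is generated
    by the others.\<close>
  then have "\<exists>E. (E \<subseteq> V \<and> V \<subseteq> additive_hull E) \<and> (\<forall>F. F \<subseteq> V \<and> V \<subseteq> additive_hull F \<longrightarrow> card E \<le> card F)"
    using ex_has_least_nat[of "\<lambda>E. E \<subseteq> V \<and> V \<subseteq> additive_hull E" V card] by blast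
  then obtain E where E_min: "(E \<subseteq> V \<and> V \<subseteq> additive_hull E) \<and> (\<forall>F. F \<subseteq> V \<and> V \<subseteq> additive_hull F \<longrightarrow> card E \<le> card F)"
    by (rule exE)
  then have E: "E \<subseteq> V" "V \<subseteq> additive_hull E" by simp_all
  have min: "card E \<le> card F" if "F \<subseteq> V" "V \<subseteq> additive_hull F" for F using E_min that by simp
  have finE: "finite E" using E(1) V(1) by (rule finite_subset)
  have \<sigma>E: "x \<in> additive_hull E" if "x \<in> \<sigma>" for x
    using that unfolding \<sigma>V by (rule additive_hull_minimal[OF E(2)])
  have E\<sigma>: "x \<in> \<sigma>" if "x \<in> additive_hull E" for x
    unfolding \<sigma>V using that
    by (rule additive_hull_minimal[rotated]) (use E(1) additive_hull_base[of _ V] in blast)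
  have not_gen: "e \<notin> additive_hull (E - {e})" if e: "e \<in> E" for e
  proof
    assume "e \<in> additive_hull (E - {e})"
    then have "E \<subseteq> additive_hull (E - {e})" using additive_hull_base[of _ "E - {e}"] by blast
    then have "V \<subseteq> additive_hull (E - {e})" using E(2) additive_hull_minimal[of E "E - {e}"] by blast
    then have "card E \<le> card (E - {e})" using E(1) by (intro min) auto
    then show False using card_Diff1_less[OF finE e] by simp
  qed
  have irr: "irreducible_\<sigma> e" if e: "e \<in> E" for e
    unfolding irreducible_\<sigma>_def
  proof (intro conjI ballI impI)
    show "e \<noteq> 0" using e E(1) V(2) by blast
    have zero: "y = 0" if "x \<in> additive_hull E" "y \<in> \<sigma>" "e = (e + x) + y" for x y
      using \<sigma>_pointed[OF E\<sigma>[OF that(1)] that(2)] that(3) by (simp add: add.assoc)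
    fix x y assume xy: "x \<in> \<sigma>" "y \<in> \<sigma>" "e = x + y"
    from additive_hull_split[OF \<sigma>E[OF xy(1)], of e] additive_hull_split[OF \<sigma>E[OF xy(2)], of e]
    consider "x \<in> additive_hull (E - {e})" "y \<in> additive_hull (E - {e})"
      | z where "z \<in> additive_hull E" "x = e + z" | z where "z \<in> additive_hull E" "y = e + z" by blast
    then show "x = 0 \<or> y = 0"
    proof cases
      case 1
      then have "e \<in> additive_hull (E - {e})" unfolding xy(3) by (rule additive_hull_add)
      then show ?thesis using not_gen[OF e] by blast
    next
      case 2
      then show ?thesis using zero[OF 2(1) xy(2)] xy(3) by simp
    next
      case 3
      then show ?thesis using zero[OF 3(1) xy(1)] xy(3) by (simp add: add.commute)
    qed
  qed
  have "card E < 3"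
  proof (rule ccontr)
    assume "\<not> card E < 3"
    then obtain F where F: "F \<subseteq> E" "card F = 3" using obtain_subset_with_card_n[of 3 E] by (auto simp: not_less)
    then have "finite F" using finE finite_subset by blast
    then obtain e where e: "bij_betw e {0..<3 :: nat} F" using ex_bij_betw_nat_finite[of F] F(2) by auto
    have "e i \<in> E" if "i < 3" for i using e F(1) that by (auto simp: bij_betw_def)
    moreover have "x + v \<in> lattice_points P" if "x \<in> E" for x using that E(1) by (auto simp: V_def)
    ultimately show False
      using few_irreducibles[OF reg, of e] irr e by (auto simp: bij_betw_def lessThan_atLeast0)
  qed
  \<comment> \<open>Missing generators are filled up with 0, which corresponds to the vertex
    \<open>v\<close> itself.\<close>
  then have "\<exists>a b. E \<subseteq> {a, b} \<and> a \<in> insert 0 V \<and> b \<in> insert 0 V"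
  proof -
    consider "card E = 0" | "card E = 1" | "card E = 2" using \<open>card E < 3\<close> by linarith
    then show ?thesis
    proof cases
      case 1 then show ?thesis using finE by (intro exI[of _ 0]) auto
    next
      case 2
      then obtain a where "E = {a}" by (rule card_1_singletonE)
      then show ?thesis using E(1) by (intro exI[of _ a]) auto
    next
      case 3
      then obtain a b where "E = {a, b}" by (auto simp: card_2_iff)
      then show ?thesis using E(1) by (intro exI[of _ a] exI[of _ b]) auto
    qed
  qed
  then obtain a b where ab: "E \<subseteq> {a, b}" "a \<in> insert 0 V" "b \<in> insert 0 V" by (elim exE conjE)
  have VA: "x + v \<in> lattice_points P" if "x \<in> insert 0 V" for x
  proof -
    from that consider "x = 0" | w where "w \<in> lattice_points P" "x = w - v" unfolding V_def by blast
    then show ?thesis by cases (simp_all add: v)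
  qed
  show ?thesis
  proof (rule bexI[of _ "a + v"], rule bexI[of _ "b + v"], rule ballI)
    show "a + v \<in> lattice_points P" "b + v \<in> lattice_points P" by (rule VA[OF ab(2)], rule VA[OF ab(3)])
    fix w assume w: "w \<in> lattice_points P"
    have "w - v \<in> additive_hull {a, b}"
    proof (cases "w = v")
      case False
      then have "w - v \<in> V" using w by (simp add: V_def)
      then have "w - v \<in> additive_hull E" using E(2) by blast
      moreover have "E \<subseteq> additive_hull {a, b}" using ab(1) additive_hull_base[of _ "{a, b}"] by blast
      ultimately show ?thesis by (rule additive_hull_minimal[rotated])
    qed (simp add: additive_hull.zero)
    then show "\<exists>m n :: nat. fst w - fst v = int m * (fst (a + v) - fst v) + int n * (fst (b + v) - fst v) \<and>
        snd w - snd v = int m * (snd (a + v) - snd v) + int n * (snd (b + v) - snd v)"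
      using additive_hull_pair[of "w - v" a b] by simp
  qed
qed

end

section \<open>Charts of the Fano scheme\<close>

lemma polys_in_simps:
  fixes f g :: "('v, 'k::comm_ring_1) mpoly"
  shows "0 \<in> polys_in V" "1 \<in> polys_in V" "f \<in> polys_in V \<Longrightarrow> g \<in> polys_in V \<Longrightarrow> f + g \<in> polys_in V"
    "f \<in> polys_in V \<Longrightarrow> g \<in> polys_in V \<Longrightarrow> f * g \<in> polys_in V" "f \<in> polys_in V \<Longrightarrow> - f \<in> polys_in V"
    "Const c \<in> polys_in V" "w \<in> V \<Longrightarrow> Var w \<in> polys_in V"
proof -
  show "f + g \<in> polys_in V" if "f \<in> polys_in V" "g \<in> polys_in V"
    using that Poly_Mapping.keys_add[of f g] unfolding polys_in_def by blast
  show "f * g \<in> polys_in V" if fg: "f \<in> polys_in V" "g \<in> polys_in V"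
    unfolding polys_in_def
  proof (intro CollectI ballI)
    fix m assume "m \<in> Poly_Mapping.keys (f * g)"
    then obtain a b where "a \<in> Poly_Mapping.keys f" "b \<in> Poly_Mapping.keys g" "m = a + b"
      using keys_mult[of f g] by blast
    then show "Poly_Mapping.keys m \<subseteq> V"
      using fg Poly_Mapping.keys_add[of a b] unfolding polys_in_def by blast
  qed
qed (auto simp: polys_in_def split: if_splits)

lemma polys_in_sum:
  fixes f :: "'x \<Rightarrow> ('v, 'k::comm_ring_1) mpoly"
  shows "(\<And>x. x \<in> S \<Longrightarrow> f x \<in> polys_in V) \<Longrightarrow> sum f S \<in> polys_in V"
  by (induction S rule: infinite_finite_induct) (simp_all add: polys_in_simps)

lemma polys_in_prod:
  fixes f :: "'x \<Rightarrow> ('v, 'k::comm_ring_1) mpoly"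
  shows "(\<And>x. x \<in> S \<Longrightarrow> f x \<in> polys_in V) \<Longrightarrow> prod f S \<in> polys_in V"
  by (induction S rule: infinite_finite_induct) (simp_all add: polys_in_simps)

lemma polys_in_power:
  fixes f :: "('v, 'k::comm_ring_1) mpoly"
  shows "f \<in> polys_in V \<Longrightarrow> f ^ n \<in> polys_in V"
  by (induction n) (simp_all add: polys_in_simps)

lemma mpoly_expand: "f = (\<Sum>m\<in>Poly_Mapping.keys f. Const (Poly_Mapping.lookup f m) *
    (\<Prod>w\<in>Poly_Mapping.keys m. Var w ^ Poly_Mapping.lookup m w))"
  for f :: "('v, 'k::comm_ring_1) mpoly"
  unfolding mon_var
  by (rule poly_mapping_eqI) (simp add: mult_single lookup_sum lookup_single when_def in_keys_iff)

lemma polys_in_induct [consumes 1, case_names Const Var add mult]: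
  fixes f :: "('v, 'k::comm_ring_1) mpoly"
  assumes f: "f \<in> polys_in V"
    and "\<And>c. Q (Const c)" "\<And>w. w \<in> V \<Longrightarrow> Q (Var w)"
    and add: "\<And>f g. Q f \<Longrightarrow> Q g \<Longrightarrow> Q (f + g)" and mult: "\<And>f g. Q f \<Longrightarrow> Q g \<Longrightarrow> Q (f * g)"
  shows "Q f"
proof -
  have Q0: "Q 0" "Q 1" using assms(2)[of 0] assms(2)[of 1] by simp_all
  have sum: "Q (sum h S)" if "\<And>x. x \<in> S \<Longrightarrow> Q (h x)" for h :: "('v \<Rightarrow>\<^sub>0 nat) \<Rightarrow> _" and S
    using that by (induction S rule: infinite_finite_induct) (auto intro: Q0 add)
  have prod: "Q (prod h S)" if "\<And>x. x \<in> S \<Longrightarrow> Q (h x)" for h :: "'v \<Rightarrow> _" and S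
    using that by (induction S rule: infinite_finite_induct) (auto intro: Q0 mult)
  have power: "Q (h ^ n)" if "Q h" for h n
    using that by (induction n) (auto intro: Q0 mult)
  have "Q (\<Sum>m\<in>Poly_Mapping.keys f. Const (Poly_Mapping.lookup f m) *
    (\<Prod>w\<in>Poly_Mapping.keys m. Var w ^ Poly_Mapping.lookup m w))"
    using f by (intro sum mult assms(2) prod power assms(3)) (auto simp: polys_in_def)
  then show ?thesis by (subst mpoly_expand)
qed

text \<open>The entries of the universal matrix at points of \<open>A\<close> use only variables
  outside the columns \<open>u\<close> and \<open>v\<close>. The set \<open>D\<close> of polynomials
  in the line parameters with such coefficients is closed under the ring operations, so it contains
  every restricted equation.\<close>

lemma fano_equations_polys_in:
  fixes I :: "('v, 'k::field) mpoly set"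
  assumes "I \<subseteq> polys_in A"
  shows "fano_equations I u v \<subseteq> polys_in (UNIV \<times> (A - {u, v}))"
proof -
  let ?V = "UNIV \<times> (A - {u, v}) :: (bool \<times> 'v) set"
  define D where "D = {F :: (bool, (bool \<times> 'v, 'k) mpoly) mpoly. \<forall>m. Poly_Mapping.lookup F m \<in> polys_in ?V}"
  have D_single: "Poly_Mapping.single m c \<in> D" if "c \<in> polys_in ?V" for m c
    using that by (auto simp: D_def lookup_single when_def polys_in_simps)
  have D_add: "F + G \<in> D" if "F \<in> D" "G \<in> D" for F G
    using that by (auto simp: D_def lookup_add polys_in_simps)
  have D_sum: "sum F S \<in> D" if "\<And>x. x \<in> S \<Longrightarrow> F x \<in> D" for F :: "'x \<Rightarrow> _" and S
    using that by (auto simp: D_def lookup_sum intro: polys_in_sum)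
  have D_mult: "F * G \<in> D" if "F \<in> D" "G \<in> D" for F G
  proof -
    have "F * G = (\<Sum>m\<in>Poly_Mapping.keys F. \<Sum>n\<in>Poly_Mapping.keys G.
        Poly_Mapping.single (m + n) (Poly_Mapping.lookup F m * Poly_Mapping.lookup G n))"
      by (subst sum_single_lookup[of F, symmetric], subst sum_single_lookup[of G, symmetric]) (simp add: sum_product mult_single)
    also have "\<dots> \<in> D"
      using that by (intro D_sum D_single polys_in_simps(4)) (auto simp: D_def)
    finally show ?thesis .
  qed
  have D_one: "1 \<in> D" using D_single[OF polys_in_simps(2), of 0] by simp
  have D_prod: "prod F S \<in> D" if "\<And>x. x \<in> S \<Longrightarrow> F x \<in> D" for F :: "'x \<Rightarrow> _" and S
    using that by (induction S rule: infinite_finite_induct) (auto intro: D_one D_mult)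
  have D_power: "F ^ n \<in> D" if "F \<in> D" for F n
    using that by (induction n) (auto intro: D_one D_mult)
  have entry: "universal_line u v r w \<in> polys_in ?V" if "w \<in> A" for r w
    using that by (auto simp del: One_nat_def simp: universal_line_def polys_in_simps)
  have "restrict_to_line Const (universal_line u v) f \<in> D" if "f \<in> I" for f
  proof -
    have keys: "w \<in> A" if "m \<in> Poly_Mapping.keys f" "w \<in> Poly_Mapping.keys m" for m w
      using \<open>f \<in> I\<close> assms that unfolding polys_in_def by blast
    show ?thesis
      unfolding restrict_to_line_def substitute_def
    proof (intro D_sum D_mult D_prod D_power)
      show "Const (Const (Poly_Mapping.lookup f m)) \<in> D" for m
        by (intro D_single polys_in_simps)
      fix m w r assume "m \<in> Poly_Mapping.keys f" "w \<in> Poly_Mapping.keys m"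
      then show "Const (universal_line u v r w) \<in> D" by (intro D_single entry keys)
      show "Var r \<in> D" for r by (intro D_single polys_in_simps)
    qed
  qed
  then show ?thesis unfolding fano_equations_def D_def by blast
qed

section \<open>The local ring of a chart at a point\<close>

locale chart_point =
  fixes A :: "'v set" and I :: "('v, 'k::field) mpoly set" and u v :: 'v and q
  assumes I: "I \<subseteq> polys_in A"
    and q: "primeideal q (fano_chart A I (u, v))"
begin

abbreviation V :: "(bool \<times> 'v) set" where "V \<equiv> UNIV \<times> (A - {u, v})"

definition R :: "(bool \<times> 'v, 'k) mpoly ring" where "R = ring_on (polys_in V)"
definition J where "J = Idl\<^bsub>R\<^esub> (fano_equations I u v)"
definition Q where "Q = R Quot J"
definition M where "M = carrier Q - q"
definition L where "L = localization Q M"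

lemma Q_eq: "fano_chart A I (u, v) = Q"
  by (simp add: fano_chart_def Q_def R_def J_def Let_def)

sublocale R: cring R
  unfolding R_def by (rule cring_ring_on) (simp_all add: polys_in_simps)

lemma R_ops: "carrier R = polys_in V" "mult R = (*)" "add R = (+)" "one R = 1" "zero R = 0"
  by (simp_all add: R_def)

sublocale J: ideal J R
  unfolding J_def using fano_equations_polys_in[OF I] by (intro R.genideal_ideal) (simp add: R_ops)

sublocale Q: cring Q
  unfolding Q_def by (rule J.quotient_is_cring[OF R.is_cring])

sublocale q: primeideal q Q
  using q by (simp add: Q_eq)

sublocale loc: mult_closed_set Q M
proof unfold_locales
  show "M \<subseteq> carrier Q" by (auto simp: M_def)
  show "\<one>\<^bsub>Q\<^esub> \<in> M" using q.one_imp_carrier q.I_notcarr by (auto simp: M_def)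
  show "s \<otimes>\<^bsub>Q\<^esub> t \<in> M" if "s \<in> M" "t \<in> M" for s t
    using that q.I_prime by (auto simp: M_def)
qed

sublocale L: cring L
  unfolding L_def by (rule loc.cring_localization)

text \<open>A retraction of all polynomials onto those in the variables \<open>V\<close>. Through it
  the map \<open>\<theta>\<close> to the local ring is a homomorphism on the whole type, as the
  type-class based locale \<open>local_congruence\<close> requires.\<close>

definition \<rho> :: "(bool \<times> 'v, 'k) mpoly \<Rightarrow> (bool \<times> 'v, 'k) mpoly" where
  "\<rho> = substitute Const (\<lambda>w. if w \<in> V then Var w else 0)"

sublocale \<rho>: coeff_hom \<rho>
  unfolding \<rho>_def by (rule coeff_hom.substitute_hom[OF Const_hom])

lemma \<rho>_in: "\<rho> f \<in> polys_in V"
  unfolding \<rho>_def substitute_def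
  by (intro polys_in_sum polys_in_simps(4) polys_in_prod polys_in_power) (simp_all del: One_nat_def add: polys_in_simps)

lemma \<rho>_id: "f \<in> polys_in V \<Longrightarrow> \<rho> f = f"
proof (induction f rule: polys_in_induct)
  case (Const c)
  show ?case unfolding \<rho>_def by (rule coeff_hom.substitute_const[OF Const_hom])
next
  case (Var w)
  then show ?case unfolding \<rho>_def by (subst coeff_hom.substitute_var[OF Const_hom]) simp
qed (simp_all add: \<rho>.hom_add \<rho>.hom_mult)

definition cls :: "(bool \<times> 'v, 'k) mpoly \<Rightarrow> (bool \<times> 'v, 'k) mpoly set" where
  "cls g = J +>\<^bsub>R\<^esub> \<rho> g"

lemma cls_ring_hom: "(+>\<^bsub>R\<^esub>) J \<in> ring_hom R Q"
  unfolding Q_def by (rule J.rcos_ring_hom)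

lemma cls_closed: "cls g \<in> carrier Q"
  and cls_add: "cls (f + g) = cls f \<oplus>\<^bsub>Q\<^esub> cls g"
  and cls_mult: "cls (f * g) = cls f \<otimes>\<^bsub>Q\<^esub> cls g"
  and cls_one: "cls 1 = \<one>\<^bsub>Q\<^esub>"
proof -
  have \<rho>R: "\<rho> g \<in> carrier R" for g by (simp add: R_ops \<rho>_in)
  show "cls g \<in> carrier Q" unfolding cls_def by (rule ring_hom_closed[OF cls_ring_hom \<rho>R])
  show "cls (f + g) = cls f \<oplus>\<^bsub>Q\<^esub> cls g"
    using ring_hom_add[OF cls_ring_hom \<rho>R \<rho>R, of f g] by (simp add: cls_def \<rho>.hom_add R_ops)
  show "cls (f * g) = cls f \<otimes>\<^bsub>Q\<^esub> cls g"
    using ring_hom_mult[OF cls_ring_hom \<rho>R \<rho>R, of f g] by (simp add: cls_def \<rho>.hom_mult R_ops)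
  show "cls 1 = \<one>\<^bsub>Q\<^esub>"
    using ring_hom_one[OF cls_ring_hom] by (simp add: cls_def \<rho>.hom_one R_ops)
qed

lemma cls_surj: "x \<in> carrier Q \<Longrightarrow> \<exists>g\<in>polys_in V. x = cls g"
proof -
  assume "x \<in> carrier Q"
  then obtain g where "g \<in> carrier R" "x = J +>\<^bsub>R\<^esub> g"
    unfolding Q_def FactRing_def A_RCOSETS_def' by auto
  then show ?thesis using \<rho>_id[of g] unfolding cls_def R_ops by (metis)
qed

lemma cls_zero_iff: "cls g = \<zero>\<^bsub>Q\<^esub> \<longleftrightarrow> \<rho> g \<in> J"
proof -
  have "\<zero>\<^bsub>Q\<^esub> = J" by (simp add: Q_def FactRing_def)
  moreover have "J +>\<^bsub>R\<^esub> \<rho> g = J \<longleftrightarrow> \<rho> g \<in> J"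
    using J.a_rcos_const J.rcos_const_imp_mem \<rho>_in[of g] unfolding R_ops(1)[symmetric] by blast
  ultimately show ?thesis by (simp add: cls_def)
qed

definition \<theta> :: "(bool \<times> 'v, 'k) mpoly \<Rightarrow> ((bool \<times> 'v, 'k) mpoly set \<times> (bool \<times> 'v, 'k) mpoly set) set" where
  "\<theta> g = fraction Q M (cls g) \<one>\<^bsub>Q\<^esub>"

lemma \<theta>_closed [simp]: "\<theta> g \<in> carrier L"
  unfolding \<theta>_def L_def by (rule loc.fraction_in_carrier[OF cls_closed loc.M_one])

lemma \<theta>_add: "\<theta> (f + g) = \<theta> f \<oplus>\<^bsub>L\<^esub> \<theta> g"
  unfolding \<theta>_def L_def cls_add
  by (subst loc.localization_add[OF cls_closed cls_closed loc.M_one loc.M_one]) (simp add: cls_closed)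

lemma \<theta>_mult: "\<theta> (f * g) = \<theta> f \<otimes>\<^bsub>L\<^esub> \<theta> g"
  unfolding \<theta>_def L_def cls_mult
  by (subst loc.localization_mult[OF cls_closed cls_closed loc.M_one loc.M_one]) (simp add: cls_closed)

lemma \<theta>_one: "\<theta> 1 = \<one>\<^bsub>L\<^esub>"
  unfolding \<theta>_def L_def cls_one loc.localization_one ..

lemma \<theta>_unit_inverse:
  assumes "cls s \<in> M"
  shows "\<theta> s \<otimes>\<^bsub>L\<^esub> fraction Q M \<one>\<^bsub>Q\<^esub> (cls s) = \<one>\<^bsub>L\<^esub>" "fraction Q M \<one>\<^bsub>Q\<^esub> (cls s) \<in> carrier L"
proof -
  show "fraction Q M \<one>\<^bsub>Q\<^esub> (cls s) \<in> carrier L"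
    unfolding L_def by (rule loc.fraction_in_carrier[OF Q.one_closed assms])
  have "\<theta> s \<otimes>\<^bsub>L\<^esub> fraction Q M \<one>\<^bsub>Q\<^esub> (cls s) = fraction Q M (cls s) (cls s)"
    unfolding \<theta>_def L_def
    by (subst loc.localization_mult[OF cls_closed Q.one_closed loc.M_one assms]) (simp add: cls_closed)
  then show "\<theta> s \<otimes>\<^bsub>L\<^esub> fraction Q M \<one>\<^bsub>Q\<^esub> (cls s) = \<one>\<^bsub>L\<^esub>"
    unfolding L_def loc.localization_one loc.fraction_unit[OF assms] .
qed

lemma \<theta>_unit_iff: "\<theta> s \<in> Units L \<longleftrightarrow> cls s \<notin> q"
proof
  assume "cls s \<notin> q"
  then have "cls s \<in> M" using cls_closed by (simp add: M_def)
  then show "\<theta> s \<in> Units L"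
    using \<theta>_unit_inverse[of s] L.m_comm[of "\<theta> s"] by (auto simp: Units_def)
next
  assume "\<theta> s \<in> Units L"
  then obtain y where y: "y \<in> carrier L" "\<theta> s \<otimes>\<^bsub>L\<^esub> y = \<one>\<^bsub>L\<^esub>" using L.Units_r_inv_ex by blast
  obtain c m where cm: "c \<in> carrier Q" "m \<in> M" "y = fraction Q M c m"
    using y(1) unfolding L_def by (rule loc.localization_cases)
  have "fraction Q M (cls s \<otimes>\<^bsub>Q\<^esub> c) (\<one>\<^bsub>Q\<^esub> \<otimes>\<^bsub>Q\<^esub> m) = fraction Q M \<one>\<^bsub>Q\<^esub> \<one>\<^bsub>Q\<^esub>"
    using y(2) loc.localization_mult[OF cls_closed cm(1) loc.M_one cm(2), of s]
    unfolding cm(3) \<theta>_def L_def loc.localization_one by simp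
  then have "fraction Q M (cls s \<otimes>\<^bsub>Q\<^esub> c) m = fraction Q M \<one>\<^bsub>Q\<^esub> \<one>\<^bsub>Q\<^esub>"
    using cm(2) by simp
  then obtain w where w: "w \<in> M" "w \<otimes>\<^bsub>Q\<^esub> (\<one>\<^bsub>Q\<^esub> \<otimes>\<^bsub>Q\<^esub> (cls s \<otimes>\<^bsub>Q\<^esub> c)) = w \<otimes>\<^bsub>Q\<^esub> (m \<otimes>\<^bsub>Q\<^esub> \<one>\<^bsub>Q\<^esub>)"
    using loc.fraction_eq_iff[OF Q.m_closed[OF cls_closed cm(1)] Q.one_closed cm(2) loc.M_one] by blast
  have "w \<otimes>\<^bsub>Q\<^esub> m \<in> M" by (rule loc.M_mult[OF w(1) cm(2)])
  then have "w \<otimes>\<^bsub>Q\<^esub> (cls s \<otimes>\<^bsub>Q\<^esub> c) \<notin> q" using w(2) cm cls_closed w(1) by (simp add: M_def)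
  then show "cls s \<notin> q"
    using q.I_l_closed[OF q.I_r_closed[OF _ cm(1)] loc.M_closed[OF w(1)]] by blast
qed

lemma \<theta>_fraction: "x \<in> carrier L \<Longrightarrow> \<exists>g\<in>polys_in V. \<exists>s\<in>polys_in V. \<theta> s \<in> Units L \<and> x \<otimes>\<^bsub>L\<^esub> \<theta> s = \<theta> g"
proof -
  assume "x \<in> carrier L"
  then obtain c m where cm: "c \<in> carrier Q" "m \<in> M" "x = fraction Q M c m"
    unfolding L_def by (rule loc.localization_cases)
  obtain g where g: "g \<in> polys_in V" "c = cls g" using cls_surj[OF cm(1)] by blast
  obtain s where s: "s \<in> polys_in V" "m = cls s" using cls_surj[OF loc.M_closed[OF cm(2)]] by blast
  have sM: "cls s \<in> M" using cm(2) s(2) by simp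
  have "x \<otimes>\<^bsub>L\<^esub> \<theta> s = fraction Q M (cls g \<otimes>\<^bsub>Q\<^esub> cls s) (cls s \<otimes>\<^bsub>Q\<^esub> \<one>\<^bsub>Q\<^esub>)"
    unfolding \<theta>_def L_def cm(3) g(2) s(2) by (rule loc.localization_mult[OF cls_closed cls_closed sM loc.M_one])
  also have "\<dots> = \<theta> g"
    unfolding \<theta>_def
    by (rule loc.fraction_eqI[of _ _ _ _ "\<one>\<^bsub>Q\<^esub>"]) (use sM cls_closed loc.M_one in \<open>simp_all add: Q.m_comm\<close>)
  finally have "x \<otimes>\<^bsub>L\<^esub> \<theta> s = \<theta> g" .
  moreover have "\<theta> s \<in> Units L" using sM by (simp add: \<theta>_unit_iff M_def)
  ultimately show ?thesis using g(1) s(1) by blast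
qed

lemma \<theta>_zero_iff: "\<theta> g = \<zero>\<^bsub>L\<^esub> \<longleftrightarrow> (\<exists>s\<in>polys_in V. \<theta> s \<in> Units L \<and> s * \<rho> g \<in> J)"
proof -
  have "\<theta> g = \<zero>\<^bsub>L\<^esub> \<longleftrightarrow> (\<exists>w\<in>M. w \<otimes>\<^bsub>Q\<^esub> (\<one>\<^bsub>Q\<^esub> \<otimes>\<^bsub>Q\<^esub> cls g) = w \<otimes>\<^bsub>Q\<^esub> (\<one>\<^bsub>Q\<^esub> \<otimes>\<^bsub>Q\<^esub> \<zero>\<^bsub>Q\<^esub>))"
    unfolding \<theta>_def L_def loc.localization_zero
    by (rule loc.fraction_eq_iff[OF cls_closed Q.zero_closed loc.M_one loc.M_one])
  also have "\<dots> \<longleftrightarrow> (\<exists>w\<in>M. w \<otimes>\<^bsub>Q\<^esub> cls g = \<zero>\<^bsub>Q\<^esub>)"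
    using cls_closed[of g] by (intro bex_cong) simp_all
  also have "\<dots> \<longleftrightarrow> (\<exists>s\<in>polys_in V. \<theta> s \<in> Units L \<and> s * \<rho> g \<in> J)"
  proof
    assume "\<exists>w\<in>M. w \<otimes>\<^bsub>Q\<^esub> cls g = \<zero>\<^bsub>Q\<^esub>"
    then obtain w where w: "w \<in> M" "w \<otimes>\<^bsub>Q\<^esub> cls g = \<zero>\<^bsub>Q\<^esub>" by blast
    obtain s where s: "s \<in> polys_in V" "w = cls s" using cls_surj[OF loc.M_closed[OF w(1)]] by blast
    have "cls (s * g) = \<zero>\<^bsub>Q\<^esub>" using w(2) s(2) by (simp add: cls_mult)
    then have "s * \<rho> g \<in> J" unfolding cls_zero_iff \<rho>.hom_mult \<rho>_id[OF s(1)] .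
    moreover have "\<theta> s \<in> Units L" using w(1) s(2) by (simp add: \<theta>_unit_iff M_def)
    ultimately show "\<exists>s\<in>polys_in V. \<theta> s \<in> Units L \<and> s * \<rho> g \<in> J" using s(1) by blast
  next
    assume "\<exists>s\<in>polys_in V. \<theta> s \<in> Units L \<and> s * \<rho> g \<in> J"
    then obtain s where s: "s \<in> polys_in V" "\<theta> s \<in> Units L" "s * \<rho> g \<in> J" by blast
    have "\<rho> (s * g) \<in> J" unfolding \<rho>.hom_mult \<rho>_id[OF s(1)] by (rule s(3))
    then have "cls s \<otimes>\<^bsub>Q\<^esub> cls g = \<zero>\<^bsub>Q\<^esub>" unfolding cls_mult[symmetric] cls_zero_iff .
    moreover have "cls s \<in> M" using s(2) cls_closed by (simp add: \<theta>_unit_iff M_def)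
    ultimately show "\<exists>w\<in>M. w \<otimes>\<^bsub>Q\<^esub> cls g = \<zero>\<^bsub>Q\<^esub>" by blast
  qed
  finally show ?thesis .
qed

lemma \<theta>_equation: "g \<in> fano_equations I u v \<Longrightarrow> \<theta> g = \<zero>\<^bsub>L\<^esub>"
proof -
  assume g: "g \<in> fano_equations I u v"
  have gV: "g \<in> polys_in V" using fano_equations_polys_in[OF I] g by blast
  have "g \<in> J" unfolding J_def
    using R.genideal_self[of "fano_equations I u v"] fano_equations_polys_in[OF I] g by (auto simp: R_ops)
  then have "1 * \<rho> g \<in> J" using \<rho>_id[OF gV] by simp
  moreover have "\<theta> 1 \<in> Units L" by (simp add: \<theta>_one)
  ultimately show ?thesis unfolding \<theta>_zero_iff using polys_in_simps(2) by blast
qed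

definition N where "N = {g. \<theta> g = \<zero>\<^bsub>L\<^esub>}"
definition U where "U = {g. \<theta> g \<in> Units L}"

lemma \<theta>_zero: "\<theta> 0 = \<zero>\<^bsub>L\<^esub>"
proof -
  have "\<theta> 0 \<oplus>\<^bsub>L\<^esub> \<theta> 0 = \<theta> 0 \<oplus>\<^bsub>L\<^esub> \<zero>\<^bsub>L\<^esub>" using \<theta>_add[of 0 0] by simp
  then show ?thesis using L.add.l_cancel[of "\<theta> 0" "\<theta> 0" "\<zero>\<^bsub>L\<^esub>"] by simp
qed

lemma \<theta>_eq_iff: "\<theta> f = \<theta> g \<longleftrightarrow> f - g \<in> N"
proof -
  have "\<theta> f = \<theta> (f - g) \<oplus>\<^bsub>L\<^esub> \<theta> g" using \<theta>_add[of "f - g" g] by simp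
  then have "\<theta> f = \<theta> g \<longleftrightarrow> \<theta> (f - g) \<oplus>\<^bsub>L\<^esub> \<theta> g = \<zero>\<^bsub>L\<^esub> \<oplus>\<^bsub>L\<^esub> \<theta> g" by simp
  also have "\<dots> \<longleftrightarrow> \<theta> (f - g) = \<zero>\<^bsub>L\<^esub>" by (rule L.add.right_cancel) simp_all
  finally show ?thesis by (simp add: N_def)
qed

lemma local_add: "\<theta> (a + b) \<in> Units L \<Longrightarrow> \<theta> a \<in> Units L \<or> \<theta> b \<in> Units L"
  unfolding \<theta>_unit_iff cls_add using q.a_closed by blast

lemma units_mult: "\<theta> (a * b) \<in> Units L \<longleftrightarrow> \<theta> a \<in> Units L \<and> \<theta> b \<in> Units L"
  unfolding \<theta>_unit_iff cls_mult using q.I_prime q.I_l_closed q.I_r_closed cls_closed by metis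

sublocale local_congruence N U
proof
  show "self.subspace N"
    by (rule self.subspaceI) (simp_all add: N_def \<theta>_zero \<theta>_add \<theta>_mult)
  show "1 \<in> U" by (simp add: U_def \<theta>_one)
  show "a * b \<in> U \<longleftrightarrow> a \<in> U \<and> b \<in> U" for a b by (simp add: U_def units_mult)
  show "a \<in> U \<or> b \<in> U" if "a + b \<in> U" for a b using local_add that by (simp add: U_def)
  show "a \<notin> U" if "a \<in> N" for a
  proof -
    have "cls 0 \<in> q"
    proof -
      have "\<rho> 0 \<in> J" using J.zero_closed unfolding R_ops(5) by (simp add: \<rho>.hom_zero)
      then show ?thesis using cls_zero_iff[of 0] q.zero_closed by simp
    qed
    then have "\<theta> 0 \<notin> Units L" by (simp add: \<theta>_unit_iff)
    then show ?thesis using that by (simp add: U_def N_def \<theta>_zero)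
  qed
  show "a \<in> N" if "u \<in> U" "u * a \<in> N" for u a
  proof -
    have u: "\<theta> u \<in> Units L" "\<theta> u \<otimes>\<^bsub>L\<^esub> \<theta> a = \<zero>\<^bsub>L\<^esub>" using that by (simp_all add: U_def N_def \<theta>_mult)
    have "\<theta> a = inv\<^bsub>L\<^esub> \<theta> u \<otimes>\<^bsub>L\<^esub> \<theta> u \<otimes>\<^bsub>L\<^esub> \<theta> a" using u(1) by simp
    also have "\<dots> = \<zero>\<^bsub>L\<^esub>" unfolding L.m_assoc[OF L.Units_inv_closed[OF u(1)] \<theta>_closed \<theta>_closed] u(2) by (rule L.r_null[OF L.Units_inv_closed[OF u(1)]])
    finally show ?thesis by (simp add: N_def)
  qed
qed

end

text \<open>A parametrization \<open>\<psi>\<close> of the chart by a domain: up to units, every coordinate is a function of the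
  parameters. The homomorphism \<open>\<phi>\<close> is the corresponding family of lines.\<close>

locale chart_param = chart_point A I u v q
  for A :: "'v set" and I :: "('v, 'k::field) mpoly set" and u v q +
  fixes \<psi> :: "'s::idom \<Rightarrow> (bool \<times> 'v, 'k) mpoly" and \<phi> :: "(bool \<times> 'v, 'k) mpoly \<Rightarrow> 'f::idom"
  assumes \<psi>_hom: "coeff_hom \<psi>" and \<psi>_in: "\<psi> a \<in> polys_in V"
    and \<psi>_const: "\<exists>a. \<psi> a = Const c"
    and \<phi>_hom: "coeff_hom \<phi>"
    and \<phi>_inj: "\<phi> (\<psi> a) = 0 \<Longrightarrow> a = 0"
    and coordinate: "w \<in> A - {u, v} \<Longrightarrow>
      \<exists>a b. \<psi> b \<in> U \<and> \<psi> b * Var (r, w) - \<psi> a \<in> N \<and> \<phi> (\<psi> b) * \<phi> (Var (r, w)) = \<phi> (\<psi> a)"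
begin

sublocale \<psi>: coeff_hom \<psi> by (rule \<psi>_hom)
sublocale \<phi>: coeff_hom \<phi> by (rule \<phi>_hom)

text \<open>The polynomials that have such a fraction are closed under sums and products. One
  numerator and one denominator serve both modulo \<open>N\<close> and along \<open>\<phi>\<close>,
  which is what the proof of injectivity needs.\<close>

lemma quotient: "g \<in> polys_in V \<Longrightarrow> \<exists>a b. \<psi> b \<in> U \<and> \<psi> b * g - \<psi> a \<in> N \<and> \<phi> (\<psi> b) * \<phi> g = \<phi> (\<psi> a)"
proof (induction g rule: polys_in_induct)
  case (Const c)
  obtain a where "\<psi> a = Const c" using \<psi>_const by blast
  then show ?case using one_U N_zero by (intro exI[of _ a] exI[of _ 1]) (simp add: \<psi>.hom_one \<phi>.hom_one)
next
  case (Var w)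
  then show ?case using coordinate[of "snd w" "fst w"] by (auto simp: mem_Times_iff)
next
  case (add f g)
  then obtain a b c d where h: "\<psi> b \<in> U" "\<psi> b * f - \<psi> a \<in> N" "\<phi> (\<psi> b) * \<phi> f = \<phi> (\<psi> a)"
    "\<psi> d \<in> U" "\<psi> d * g - \<psi> c \<in> N" "\<phi> (\<psi> d) * \<phi> g = \<phi> (\<psi> c)" by blast
  have "\<psi> (b * d) * (f + g) - \<psi> (d * a + b * c) = \<psi> d * (\<psi> b * f - \<psi> a) + \<psi> b * (\<psi> d * g - \<psi> c)"
    by (simp add: \<psi>.hom_add \<psi>.hom_mult algebra_simps)
  also have "\<dots> \<in> N" by (intro N_add N_scale h)
  finally have "\<psi> (b * d) * (f + g) - \<psi> (d * a + b * c) \<in> N" .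
  moreover have "\<phi> (\<psi> (b * d)) * \<phi> (f + g) = \<phi> (\<psi> (d * a + b * c))"
    unfolding \<psi>.hom_add \<psi>.hom_mult \<phi>.hom_add \<phi>.hom_mult h(3)[symmetric] h(6)[symmetric] by (simp add: algebra_simps)
  moreover have "\<psi> (b * d) \<in> U" using h by (simp add: \<psi>.hom_mult U_mult)
  ultimately show ?case by blast
next
  case (mult f g)
  then obtain a b c d where h: "\<psi> b \<in> U" "\<psi> b * f - \<psi> a \<in> N" "\<phi> (\<psi> b) * \<phi> f = \<phi> (\<psi> a)"
    "\<psi> d \<in> U" "\<psi> d * g - \<psi> c \<in> N" "\<phi> (\<psi> d) * \<phi> g = \<phi> (\<psi> c)" by blast
  have "\<psi> (b * d) * (f * g) - \<psi> (a * c) = (\<psi> d * g) * (\<psi> b * f - \<psi> a) + \<psi> a * (\<psi> d * g - \<psi> c)"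
    by (simp add: \<psi>.hom_mult algebra_simps)
  also have "\<dots> \<in> N" by (intro N_add N_scale h)
  finally have "\<psi> (b * d) * (f * g) - \<psi> (a * c) \<in> N" .
  moreover have "\<phi> (\<psi> (b * d)) * \<phi> (f * g) = \<phi> (\<psi> (a * c))"
    unfolding \<psi>.hom_mult \<phi>.hom_mult h(3)[symmetric] h(6)[symmetric] by (simp add: algebra_simps)
  moreover have "\<psi> (b * d) \<in> U" using h by (simp add: \<psi>.hom_mult U_mult)
  ultimately show ?case by blast
qed

text \<open>If \<open>\<psi> a\<close> vanishes in the local ring, some \<open>s\<close> invertible
  there multiplies it into the ideal of equations. The family \<open>\<phi>\<close> kills these
  equations, so for nonzero \<open>a\<close> it kills \<open>s\<close>. But \<open>s\<close> is a
  fraction of parameters up to a unit, so its numerator is zero and \<open>s\<close> vanishes in the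
  local ring, where it is a unit.\<close>

lemma injective:
  assumes kill: "\<And>g. g \<in> fano_equations I u v \<Longrightarrow> \<phi> g = 0" and a: "\<psi> a \<in> N"
  shows "a = 0"
proof (rule ccontr)
  assume "a \<noteq> 0"
  then have \<phi>a: "\<phi> (\<psi> a) \<noteq> 0" using \<phi>_inj by blast
  have K: "ideal {g \<in> polys_in V. \<phi> g = 0} R"
  proof (intro idealI)
    show "ring R" by (rule R.ring_axioms)
    show "subgroup {g \<in> polys_in V. \<phi> g = 0} (add_monoid R)"
    proof (rule R.add.subgroupI)
      show "{g \<in> polys_in V. \<phi> g = 0} \<subseteq> carrier R" by (auto simp: R_ops)
      show "{g \<in> polys_in V. \<phi> g = 0} \<noteq> {}" using polys_in_simps(1) \<phi>.hom_zero by blast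
      show "x \<oplus>\<^bsub>R\<^esub> y \<in> {g \<in> polys_in V. \<phi> g = 0}" if "x \<in> {g \<in> polys_in V. \<phi> g = 0}" "y \<in> {g \<in> polys_in V. \<phi> g = 0}" for x y
        using that by (simp add: R_ops polys_in_simps \<phi>.hom_add)
      fix x assume x: "x \<in> {g \<in> polys_in V. \<phi> g = 0}"
      have "\<ominus>\<^bsub>R\<^esub> x = - x" using x by (intro R.minus_equality) (simp_all add: R_ops polys_in_simps)
      moreover have "\<phi> (- x) = 0" using \<phi>.hom_add[of x "- x"] x by (simp add: \<phi>.hom_zero)
      ultimately show "\<ominus>\<^bsub>R\<^esub> x \<in> {g \<in> polys_in V. \<phi> g = 0}" using x by (simp add: polys_in_simps)
    qed
  qed (simp_all add: R_ops polys_in_simps \<phi>.hom_mult)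
  have JK: "J \<subseteq> {g \<in> polys_in V. \<phi> g = 0}"
    unfolding J_def using K by (rule R.genideal_minimal) (use kill fano_equations_polys_in[OF I] in blast)
  obtain s where s: "s \<in> polys_in V" "\<theta> s \<in> Units L" "s * \<rho> (\<psi> a) \<in> J"
    using a \<theta>_zero_iff by (auto simp: N_def)
  have "\<phi> s * \<phi> (\<psi> a) = 0" using JK s(3) \<rho>_id[OF \<psi>_in] by (auto simp: \<phi>.hom_mult)
  then have "\<phi> s = 0" using \<phi>a by simp
  obtain c d where cd: "\<psi> d \<in> U" "\<psi> d * s - \<psi> c \<in> N" "\<phi> (\<psi> d) * \<phi> s = \<phi> (\<psi> c)" using quotient[OF s(1)] by blast
  have "c = 0" using cd(3) \<open>\<phi> s = 0\<close> \<phi>_inj by simp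
  then have "\<psi> d * s \<in> N" using cd(2) by (simp add: \<psi>.hom_zero)
  moreover have "\<psi> d * s \<in> U" using cd(1) s(2) by (simp add: U_mult) (simp add: U_def)
  ultimately show False using N_not_U by blast
qed

lemma stalk_regular:
  assumes inj: "\<And>a. \<psi> a \<in> N \<Longrightarrow> a = 0" and noeth: "noetherian_type TYPE('s)"
    and reg: "\<And>p :: 's set. prime_set p \<Longrightarrow> \<exists>n. regular_prime p n"
  shows "regular_local_ring L \<and> reduced_ring L"
proof -
  interpret D: domain_localization L "\<lambda>a. \<theta> (\<psi> a)"
  proof
    show "\<theta> (\<psi> a) \<in> carrier L" for a by simp
    show "\<theta> (\<psi> (a + b)) = \<theta> (\<psi> a) \<oplus>\<^bsub>L\<^esub> \<theta> (\<psi> b)" for a b by (simp add: \<psi>.hom_add \<theta>_add)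
    show "\<theta> (\<psi> (a * b)) = \<theta> (\<psi> a) \<otimes>\<^bsub>L\<^esub> \<theta> (\<psi> b)" for a b by (simp add: \<psi>.hom_mult \<theta>_mult)
    show "\<theta> (\<psi> 1) = \<one>\<^bsub>L\<^esub>" by (simp add: \<psi>.hom_one \<theta>_one)
    show "a = 0" if "\<theta> (\<psi> a) = \<zero>\<^bsub>L\<^esub>" for a using that inj by (simp add: N_def)
    show "\<theta> (\<psi> (a + b)) \<notin> Units L" if "\<theta> (\<psi> a) \<notin> Units L" "\<theta> (\<psi> b) \<notin> Units L" for a b
      using local_add[of "\<psi> a" "\<psi> b"] that by (auto simp: \<psi>.hom_add)
    fix x assume x: "x \<in> carrier L"
    obtain g s where gs: "g \<in> polys_in V" "s \<in> polys_in V" "\<theta> s \<in> Units L" "x \<otimes>\<^bsub>L\<^esub> \<theta> s = \<theta> g"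
      using \<theta>_fraction[OF x] by blast
    obtain a b where ab: "\<psi> b \<in> U" "\<psi> b * g - \<psi> a \<in> N" using quotient[OF gs(1)] by blast
    obtain c d where cd: "\<psi> d \<in> U" "\<psi> d * s - \<psi> c \<in> N" using quotient[OF gs(2)] by blast
    have bg: "\<theta> (\<psi> b) \<otimes>\<^bsub>L\<^esub> \<theta> g = \<theta> (\<psi> a)" using ab(2) unfolding \<theta>_eq_iff[symmetric] \<theta>_mult .
    have ds: "\<theta> (\<psi> d) \<otimes>\<^bsub>L\<^esub> \<theta> s = \<theta> (\<psi> c)" using cd(2) unfolding \<theta>_eq_iff[symmetric] \<theta>_mult .
    have "\<theta> (\<psi> c) \<in> Units L" unfolding ds[symmetric] using cd(1) gs(3) by (simp add: U_def)
    then have "\<theta> (\<psi> (b * c)) \<in> Units L" using ab(1) by (simp add: \<psi>.hom_mult \<theta>_mult U_def)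
    moreover have "x \<otimes>\<^bsub>L\<^esub> \<theta> (\<psi> (b * c)) = \<theta> (\<psi> d) \<otimes>\<^bsub>L\<^esub> (\<theta> (\<psi> b) \<otimes>\<^bsub>L\<^esub> (x \<otimes>\<^bsub>L\<^esub> \<theta> s))"
      using x unfolding \<psi>.hom_mult \<theta>_mult ds[symmetric] by (simp add: L.m_ac)
    then have "x \<otimes>\<^bsub>L\<^esub> \<theta> (\<psi> (b * c)) = \<theta> (\<psi> (d * a))" unfolding gs(4) bg \<psi>.hom_mult \<theta>_mult .
    ultimately show "\<exists>a b. \<theta> (\<psi> b) \<in> Units L \<and> x \<otimes>\<^bsub>L\<^esub> \<theta> (\<psi> b) = \<theta> (\<psi> a)" by blast
  qed
  obtain n where "regular_prime D.center n" using reg[OF D.center_prime] by blast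
  then show ?thesis using D.regular_local[OF noeth] D.reduced by blast
qed

end

section \<open>Lattice polygons\<close>

abbreviation plane_point :: "int \<times> int \<Rightarrow> real \<times> real" where
  "plane_point w \<equiv> (of_int (fst w), of_int (snd w))"

lemma lattice_points_iff: "w \<in> lattice_points P \<longleftrightarrow> plane_point w \<in> P"
  by (simp add: lattice_points_def case_prod_beta)

lemma finite_lattice_points:
  assumes "bounded P"
  shows "finite (lattice_points P)"
proof -
  obtain B where B: "\<And>x. x \<in> P \<Longrightarrow> norm x \<le> B" using assms by (auto simp: bounded_iff)
  have "lattice_points P \<subseteq> {- \<lceil>B\<rceil>..\<lceil>B\<rceil>} \<times> {- \<lceil>B\<rceil>..\<lceil>B\<rceil>}"
  proof
    fix w assume "w \<in> lattice_points P"
    then have "norm (plane_point w) \<le> B" using B by (simp add: lattice_points_iff)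
    then have "\<bar>of_int (fst w) :: real\<bar> \<le> B" "\<bar>of_int (snd w) :: real\<bar> \<le> B"
      using norm_fst_le[of "of_int (fst w) :: real" "of_int (snd w) :: real"]
        norm_snd_le[of "of_int (snd w) :: real" "of_int (fst w) :: real"] by simp_all
    then have "\<bar>fst w\<bar> \<le> \<lceil>B\<rceil>" "\<bar>snd w\<bar> \<le> \<lceil>B\<rceil>" by linarith+
    then show "w \<in> {- \<lceil>B\<rceil>..\<lceil>B\<rceil>} \<times> {- \<lceil>B\<rceil>..\<lceil>B\<rceil>}" by (auto simp: mem_Times_iff)
  qed
  then show ?thesis by (rule finite_subset) simp
qed

lemma lattice_points_barycenter:
  assumes "convex P" "p1 \<in> lattice_points P" "p2 \<in> lattice_points P" "p3 \<in> lattice_points P"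
    and pos: "m1 + m2 + m3 > (0 :: nat)"
    and eq: "int m1 * fst p1 + int m2 * fst p2 + int m3 * fst p3 = int (m1 + m2 + m3) * fst w"
      "int m1 * snd p1 + int m2 * snd p2 + int m3 * snd p3 = int (m1 + m2 + m3) * snd w"
  shows "w \<in> lattice_points P"
proof -
  let ?s = "real (m1 + m2 + m3)"
  have s: "?s > 0" using pos by (simp only: of_nat_0_less_iff)
  have bary: "real m1 / ?s * of_int (f p1) + real m2 / ?s * of_int (f p2) + real m3 / ?s * of_int (f p3) = of_int (f w)"
    if "int m1 * f p1 + int m2 * f p2 + int m3 * f p3 = int (m1 + m2 + m3) * f w" for f :: "int \<times> int \<Rightarrow> int"
  proof -
    have "real m1 * of_int (f p1) + real m2 * of_int (f p2) + real m3 * of_int (f p3) = ?s * of_int (f w)"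
      using arg_cong[OF that, of real_of_int] by simp
    then have "(real m1 * of_int (f p1) + real m2 * of_int (f p2) + real m3 * of_int (f p3)) / ?s = of_int (f w)"
      using s by simp
    then show ?thesis by (simp add: add_divide_distrib)
  qed
  have "real m1 / ?s + real m2 / ?s + real m3 / ?s = 1" using s by (simp flip: add_divide_distrib of_nat_add)
  moreover have "plane_point w = (real m1 / ?s) *\<^sub>R plane_point p1 + (real m2 / ?s) *\<^sub>R plane_point p2 + (real m3 / ?s) *\<^sub>R plane_point p3"
    using bary[OF eq(1)] bary[OF eq(2)] by (simp add: prod_eq_iff)
  moreover have "0 \<le> real m1 / ?s" "0 \<le> real m2 / ?s" "0 \<le> real m3 / ?s" by simp_all
  ultimately have "plane_point w \<in> convex hull {plane_point p1, plane_point p2, plane_point p3}"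
    unfolding convex_hull_3 by blast
  also have "\<dots> \<subseteq> P" by (rule hull_minimal) (use assms in \<open>simp_all add: lattice_points_iff\<close>)
  finally show ?thesis by (simp add: lattice_points_iff)
qed

text \<open>The polygon is the convex hull of its vertices, which are lattice points. If all lattice
  points lay on the line through \<open>u\<close> and \<open>v\<close>, its dimension would be at
  most one.\<close>

lemma lattice_polygon_noncollinear:
  assumes P: "lattice_polygon P" and "u \<noteq> v"
  shows "\<exists>w\<in>lattice_points P. (fst v - fst u) * (snd w - snd u) - (snd v - snd u) * (fst w - fst u) \<noteq> 0"
proof (rule ccontr)
  define n where "n = plane_point (- (snd v - snd u), fst v - fst u)"
  define H where "H = {x. n \<bullet> x = n \<bullet> plane_point u}"
  have n: "n \<noteq> 0" using \<open>u \<noteq> v\<close> by (auto simp: n_def prod_eq_iff)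
  have poly: "polytope P" "aff_dim P = 2" "\<And>x. x extreme_point_of P \<Longrightarrow> x \<in> \<int> \<times> \<int>"
    using P by (auto simp: lattice_polygon_def)
  assume "\<not> ?thesis"
  then have col: "(fst v - fst u) * (snd w - snd u) - (snd v - snd u) * (fst w - fst u) = 0" if "w \<in> lattice_points P" for w
    using that by blast
  have "x \<in> H" if x: "x extreme_point_of P" for x
  proof -
    obtain a b where ab: "x = plane_point (a, b)" using poly(3)[OF x] by (auto elim!: Ints_cases)
    have "(a, b) \<in> lattice_points P" using x ab by (simp add: lattice_points_iff extreme_point_of_def)
    then have "real_of_int ((fst v - fst u) * (b - snd u) - (snd v - snd u) * (a - fst u)) = 0" using col by fastforce
    then show ?thesis by (simp add: H_def n_def ab algebra_simps)
  qed
  moreover have "P = convex hull {x. x extreme_point_of P}"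
    using poly(1) by (intro Krein_Milman_Minkowski polytope_imp_compact polytope_imp_convex)
  moreover have "convex H" unfolding H_def by (rule convex_hyperplane)
  ultimately have "P \<subseteq> H" using hull_minimal[of "{x. x extreme_point_of P}" H convex] by blast
  then have "aff_dim P \<le> aff_dim H" by (rule aff_dim_subset)
  then show False using aff_dim_hyperplane[OF n, of "n \<bullet> plane_point u"] poly(2) by (simp add: H_def)
qed

section \<open>Families of lines on the toric surface\<close>

lemma torus_single_hom: "coeff_hom (Poly_Mapping.single 0 :: 'k::comm_ring_1 \<Rightarrow> 'e::comm_monoid_add \<Rightarrow>\<^sub>0 'k)"
  by unfold_locales (auto simp: single_add mult_single)

lemma torus_single_power:
  "(Poly_Mapping.single ((a, b), d) 1 :: 'k::field torus_algebra) ^ n =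
    Poly_Mapping.single ((int n * a, int n * b), int n * d) 1"
  by (induction n) (simp_all add: mult_single distrib_right flip: zero_prod_def)

lemma binomial_toric_ideal:
  assumes "p1 \<in> lattice_points P" "p2 \<in> lattice_points P" "p3 \<in> lattice_points P" "p4 \<in> lattice_points P"
    and deg: "m1 + m2 + m3 + m4 = n1 + n2 + n3 + (n4 :: nat)"
    and eq: "int m1 * fst p1 + int m2 * fst p2 + int m3 * fst p3 + int m4 * fst p4 =
        int n1 * fst p1 + int n2 * fst p2 + int n3 * fst p3 + int n4 * fst p4"
      "int m1 * snd p1 + int m2 * snd p2 + int m3 * snd p3 + int m4 * snd p4 =
        int n1 * snd p1 + int n2 * snd p2 + int n3 * snd p3 + int n4 * snd p4"
  shows "Var p1 ^ m1 * Var p2 ^ m2 * Var p3 ^ m3 * Var p4 ^ m4 +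
      - (Var p1 ^ n1 * Var p2 ^ n2 * Var p3 ^ n3 * Var p4 ^ n4) \<in>
    (toric_ideal P :: (int \<times> int, 'k::field) mpoly set)" (is "?F \<in> _")
proof -
  let ?s = "substitute (Poly_Mapping.single 0) (\<lambda>u. Poly_Mapping.single (u, 1) 1 :: 'k torus_algebra)"
  interpret c: coeff_hom "Poly_Mapping.single 0 :: 'k \<Rightarrow> 'k torus_algebra" by (rule torus_single_hom)
  interpret s: coeff_hom ?s by (rule c.substitute_hom)
  have neg: "?s (- f) = - ?s f" for f :: "(int \<times> int, 'k) mpoly"
  proof -
    have "?s f + ?s (- f) = 0" using s.hom_add[of f "- f"] by (simp add: c.substitute_zero)
    then show ?thesis by (simp add: add_eq_0_iff)
  qed
  have var: "?s (Var p) ^ k = Poly_Mapping.single ((int k * fst p, int k * snd p), int k) 1" for p k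
    unfolding c.substitute_var using torus_single_power[of "fst p" "snd p" 1 k] by simp
  have "int m1 + int m2 + int m3 + int m4 = int n1 + int n2 + int n3 + int n4" using deg by linarith
  then have "?s ?F = 0"
    unfolding s.hom_add neg s.hom_mult s.hom_power var using eq by (simp add: mult_single)
  moreover have "?F \<in> polys_in (lattice_points P)"
    by (intro polys_in_simps polys_in_power assms)
  ultimately show ?thesis by (simp add: toric_ideal_def)
qed

context chart_point
begin

text \<open>Setting the first parameter of the line to 1 turns restriction to the line into
  substitution of linear polynomials. The resulting coefficients are combinations of chart
  equations, which vanish in the local ring.\<close>

lemma equation_coefficients:
  assumes "f \<in> I"
  shows "coeff (substitute (\<lambda>c. [:Const c:]) (\<lambda>w. [:universal_line u v False w, universal_line u v True w:]) f) n \<in> N"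
proof -
  let ?T = "substitute (\<lambda>a :: (bool \<times> 'v, 'k) mpoly. [:a:]) (\<lambda>r :: bool. if r then [:0, 1:] else 1)"
  interpret c: coeff_hom "\<lambda>a :: (bool \<times> 'v, 'k) mpoly. [:a:]"
    by unfold_locales (simp_all add: one_pCons del: one_poly_eq_simps)
  interpret T: coeff_hom ?T by (rule c.substitute_hom)
  let ?F = "restrict_to_line Const (universal_line u v) f"
  have "?T ?F = substitute (\<lambda>c. [:Const c:]) (\<lambda>w. [:universal_line u v False w, universal_line u v True w:]) f"
    unfolding restrict_to_line_def T.hom_substitute T.hom_sum T.hom_mult c.substitute_const c.substitute_var
    by (simp add: UNIV_bool)
  moreover have "coeff (?T ?F) n \<in> N"
    unfolding substitute_def coeff_sum
  proof (rule self.subspace_sum[OF N_subspace])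
    fix m
    have "Poly_Mapping.lookup ?F m \<in> fano_equations I u v" using assms by (auto simp: fano_equations_def)
    then have "Poly_Mapping.lookup ?F m \<in> N" using \<theta>_equation by (simp add: N_def)
    then show "coeff ([:Poly_Mapping.lookup ?F m:] * (\<Prod>r\<in>Poly_Mapping.keys m. (if r then [:0, 1:] else 1) ^ Poly_Mapping.lookup m r)) n \<in> N"
      using N_scale by (simp add: mult.commute[of "Poly_Mapping.lookup ?F m"])
  qed
  ultimately show ?thesis by simp
qed

end

text \<open>\<open>\<tau>\<close> is the value of the monomial coordinate functions on the family of lines.\<close>

lemma line_contained_toricI:
  fixes \<phi> :: "'k::field \<Rightarrow> 'a::comm_ring_1" and \<tau> :: "(int \<times> int) \<times> int \<Rightarrow> (bool, 'a) mpoly"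
  assumes \<phi>: "coeff_hom \<phi>" and zero: "\<tau> 0 = 1"
    and add: "\<And>w x. w \<in> lattice_points P \<Longrightarrow> x \<in> cone_semigroup P \<Longrightarrow>
      \<tau> ((w, 1) + x) = (\<Sum>r\<in>UNIV. Const (M r w) * Var r) * \<tau> x"
  shows "line_contained \<phi> M (toric_ideal P)"
  unfolding line_contained_def
proof
  interpret \<phi>: coeff_hom \<phi> by (rule \<phi>)
  interpret C: coeff_hom "\<lambda>c. Const (\<phi> c) :: (bool, 'a) mpoly"
    by unfold_locales (simp_all add: \<phi>.hom_add \<phi>.hom_mult \<phi>.hom_one single_add mult_single)
  let ?l = "\<lambda>w. \<Sum>r\<in>UNIV. Const (M r w) * Var r :: (bool, 'a) mpoly"
  let ?e = "\<lambda>w. Poly_Mapping.single (w, 1) 1 :: 'k torus_algebra"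
  \<comment> \<open>Pairs of a monomial of the semigroup algebra and its value on the family of
    lines.\<close>
  define good where "good = (\<lambda>(a :: 'k torus_algebra) b. \<exists>x\<in>cone_semigroup P. a = Poly_Mapping.single x 1 \<and> b = \<tau> x)"
  have good_one: "good 1 1"
    unfolding good_def using zero cone_semigroup.zero by (intro bexI[of _ 0]) simp_all
  have good_mult: "good (?e w * a) (?l w * b)" if ab: "good a b" and w: "w \<in> lattice_points P" for a b w
  proof -
    obtain x where x: "x \<in> cone_semigroup P" "a = Poly_Mapping.single x 1" "b = \<tau> x"
      using ab unfolding good_def by blast
    have "?e w * a = Poly_Mapping.single ((w, 1) + x) 1" by (simp add: x mult_single)
    then show ?thesis unfolding good_def x(3)
      using cone_semigroup.add[OF w x(1)] add[OF w x(1)] by metis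
  qed
  have good_power: "good (?e w ^ n * a) (?l w ^ n * b)" if "good a b" "w \<in> lattice_points P" for a b w n
    using that(1) by (induction n) (use good_mult that(2) in \<open>simp_all add: mult.assoc\<close>)
  have good_prod: "good (\<Prod>w\<in>S. ?e w ^ k w) (\<Prod>w\<in>S. ?l w ^ k w)" if "finite S" "S \<subseteq> lattice_points P" for S and k :: "_ \<Rightarrow> nat"
    using that by (induction S rule: finite_induct) (use good_one good_power in simp_all)
  \<comment> \<open>The additive extension of \<open>\<tau>\<close> to the semigroup algebra.
    Restriction to the family factors through it, so everything in the kernel that defines the toric
    ideal restricts to zero.\<close>
  define \<Theta> where "\<Theta> = (\<lambda>g :: 'k torus_algebra. \<Sum>x\<in>Poly_Mapping.keys g. Const (\<phi> (Poly_Mapping.lookup g x)) * \<tau> x)"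
  have \<Theta>_superset: "\<Theta> g = (\<Sum>x\<in>S. Const (\<phi> (Poly_Mapping.lookup g x)) * \<tau> x)"
    if "finite S" "Poly_Mapping.keys g \<subseteq> S" for g S
    unfolding \<Theta>_def using that by (intro sum.mono_neutral_left) (auto simp: in_keys_iff C.hom_zero \<phi>.hom_zero)
  have \<Theta>_zero: "\<Theta> 0 = 0" by (simp add: \<Theta>_def)
  have \<Theta>_add: "\<Theta> (g + h) = \<Theta> g + \<Theta> h" for g h
  proof -
    let ?S = "Poly_Mapping.keys g \<union> Poly_Mapping.keys h"
    have "Poly_Mapping.keys (g + h) \<subseteq> ?S" by (rule Poly_Mapping.keys_add)
    then show ?thesis
      by (simp add: \<Theta>_superset[of ?S "g + h"] \<Theta>_superset[of ?S g] \<Theta>_superset[of ?S h] lookup_add C.hom_add distrib_right sum.distrib)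
  qed
  have \<Theta>_sum: "\<Theta> (sum F S) = (\<Sum>i\<in>S. \<Theta> (F i))" for F and S :: "((int \<times> int) \<Rightarrow>\<^sub>0 nat) set"
    by (induction S rule: infinite_finite_induct) (simp_all add: \<Theta>_zero \<Theta>_add)
  have \<Theta>_single: "\<Theta> (Poly_Mapping.single x c) = Const (\<phi> c) * \<tau> x" for x c
    by (subst \<Theta>_superset[of "{x}"]) auto
  fix f assume "f \<in> (toric_ideal P :: (int \<times> int, 'k) mpoly set)"
  then have f: "f \<in> polys_in (lattice_points P)" "substitute (Poly_Mapping.single 0) ?e f = 0"
    by (simp_all add: toric_ideal_def)
  have "Const (\<phi> (Poly_Mapping.lookup f m)) * (\<Prod>w\<in>Poly_Mapping.keys m. ?l w ^ Poly_Mapping.lookup m w) =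
      \<Theta> (Poly_Mapping.single 0 (Poly_Mapping.lookup f m) * (\<Prod>w\<in>Poly_Mapping.keys m. ?e w ^ Poly_Mapping.lookup m w))"
    if "m \<in> Poly_Mapping.keys f" for m
  proof -
    have "Poly_Mapping.keys m \<subseteq> lattice_points P" using f(1) that by (auto simp: polys_in_def)
    then obtain x where "(\<Prod>w\<in>Poly_Mapping.keys m. ?e w ^ Poly_Mapping.lookup m w) = Poly_Mapping.single x 1"
      "(\<Prod>w\<in>Poly_Mapping.keys m. ?l w ^ Poly_Mapping.lookup m w) = \<tau> x"
      using good_prod[of "Poly_Mapping.keys m" "Poly_Mapping.lookup m"] unfolding good_def by auto
    then show ?thesis by (simp add: mult_single \<Theta>_single)
  qed
  then have "restrict_to_line \<phi> M f = \<Theta> (substitute (Poly_Mapping.single 0) ?e f)"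
    unfolding restrict_to_line_def substitute_def \<Theta>_sum by (rule sum.cong[OF refl])
  then show "restrict_to_line \<phi> M f = 0" unfolding f(2) \<Theta>_zero .
qed

text \<open>An affine function on the plane becomes linear on the cone over it, hence additive on
  the semigroup, and can serve as an exponent.\<close>

lemma affine_fun_homogenize:
  assumes "affine_fun h"
  obtains H :: "(int \<times> int) \<times> int \<Rightarrow> int" where "H 0 = 0" "\<And>w x. H ((w, 1) + x) = h w + H x"
proof -
  obtain a b c where h: "\<And>w. h w = a * fst w + b * snd w + c" using assms unfolding affine_fun_def by blast
  show thesis
    by (rule that[of "\<lambda>x. a * fst (fst x) + b * snd (fst x) + c * snd x"]) (simp_all add: h algebra_simps)
qed

text \<open>A semigroup element of degree d takes the value t^J x^(d-H) y^H, where H and J are the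
  homogenized columns and heights. The strip keeps H between 0 and d, while J may be
  negative.\<close>

lemma scroll_line_contained:
  fixes t :: "'a::field"
  assumes \<phi>: "coeff_hom \<phi>" and t: "t \<noteq> 0" and "affine_fun h" "affine_fun j"
    and range: "\<And>w. w \<in> lattice_points P \<Longrightarrow> h w \<in> {0, 1}"
  shows "line_contained \<phi> (\<lambda>r w. if h w = (if r then 1 else 0) then t powi j w else 0) (toric_ideal P)"
proof -
  obtain H :: "(int \<times> int) \<times> int \<Rightarrow> int" where H: "H 0 = 0" "\<And>w x. H ((w, 1) + x) = h w + H x" using affine_fun_homogenize[OF assms(3)] by blast
  obtain J :: "(int \<times> int) \<times> int \<Rightarrow> int" where J: "J 0 = 0" "\<And>w x. J ((w, 1) + x) = j w + J x" using affine_fun_homogenize[OF assms(4)] by blast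
  have cone: "0 \<le> H x \<and> H x \<le> snd x" if "x \<in> cone_semigroup P" for x
    using that
  proof (induction rule: cone_semigroup.induct)
    case (add w x)
    then show ?case using range[OF add.hyps(1)] by (auto simp: H)
  qed (simp add: H)
  show ?thesis
  proof (rule line_contained_toricI[OF \<phi>, where \<tau> = "\<lambda>x. Const (t powi J x) *
      (Var False ^ nat (snd x - H x) * Var True ^ nat (H x))"])
    show "Const (t powi J 0) * (Var False ^ nat (snd (0 :: (int \<times> int) \<times> int) - H 0) * Var True ^ nat (H 0)) = (1 :: (bool, 'a) mpoly)"
      by (simp add: H J)
    fix w x assume wx: "w \<in> lattice_points P" "x \<in> cone_semigroup P"
    let ?l = "\<Sum>r\<in>UNIV. Const (if h w = (if r then 1 else 0) then t powi j w else 0) * Var r :: (bool, 'a) mpoly"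
    have l: "?l = Const (t powi j w) * (if h w = 1 then Var True else Var False)"
      using range[OF wx(1)] by (auto simp: UNIV_bool)
    have c: "Const (t powi (j w + J x)) = Const (t powi j w) * (Const (t powi J x) :: (bool, 'a) mpoly)"
      using t by (simp add: power_int_add mult_single)
    have n: "nat (1 + snd x - H x) = Suc (nat (snd x - H x))" "nat (1 + H x) = Suc (nat (H x))"
      using cone[OF wx(2)] by linarith+
    show "Const (t powi J ((w, 1) + x)) *
        (Var False ^ nat (snd ((w, 1) + x) - H ((w, 1) + x)) * Var True ^ nat (H ((w, 1) + x))) =
      ?l * (Const (t powi J x) * (Var False ^ nat (snd x - H x) * Var True ^ nat (H x)))"
      unfolding l H J c using range[OF wx(1)] n by (auto simp del: One_nat_def simp: mult_ac)
  qed
qed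

text \<open>The coordinates H and J of a semigroup element of degree d count how often
  \<open>v\<close> and \<open>W\<close> occur in it, and \<open>u\<close> occurs d - H - J times.
  Its value is the corresponding product of the forms, whatever the form at \<open>W\<close>
  is.\<close>

lemma triangle_line_contained:
  assumes \<phi>: "coeff_hom \<phi>" and "affine_fun h" "affine_fun j" and P: "lattice_points P = {u, v, W}"
    and u: "h u = 0" "j u = 0" "M False u = 1" "M True u = 0"
    and v: "h v = 1" "j v = 0" "M False v = 0" "M True v = 1"
    and W: "h W = 0" "j W = 1"
  shows "line_contained \<phi> M (toric_ideal P)"
proof -
  obtain H :: "(int \<times> int) \<times> int \<Rightarrow> int" where H: "H 0 = 0" "\<And>w x. H ((w, 1) + x) = h w + H x" using affine_fun_homogenize[OF assms(2)] by blast
  obtain J :: "(int \<times> int) \<times> int \<Rightarrow> int" where J: "J 0 = 0" "\<And>w x. J ((w, 1) + x) = j w + J x" using affine_fun_homogenize[OF assms(3)] by blast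
  have cone: "0 \<le> H x \<and> 0 \<le> J x \<and> H x + J x \<le> snd x" if "x \<in> cone_semigroup P" for x
    using that
  proof (induction rule: cone_semigroup.induct)
    case (add w x)
    have "w = u \<or> w = v \<or> w = W" using add.hyps(1) P by blast
    then show ?case using add.IH u v W by (auto simp: H J)
  qed (simp add: H J)
  let ?l = "\<lambda>w. \<Sum>r\<in>UNIV. Const (M r w) * Var r :: (bool, 'b) mpoly"
  show ?thesis
  proof (rule line_contained_toricI[OF \<phi>, where \<tau> = "\<lambda>x. Var False ^ nat (snd x - H x - J x) *
      (Var True ^ nat (H x) * ?l W ^ nat (J x))"])
    show "Var False ^ nat (snd (0 :: (int \<times> int) \<times> int) - H 0 - J 0) * (Var True ^ nat (H 0) * ?l W ^ nat (J 0)) = 1"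
      by (simp add: H J)
    fix w x assume wx: "w \<in> lattice_points P" "x \<in> cone_semigroup P"
    have n: "nat (1 + snd x - H x - J x) = Suc (nat (snd x - H x - J x))" "nat (1 + H x) = Suc (nat (H x))"
        "nat (1 + J x) = Suc (nat (J x))"
      using cone[OF wx(2)] by linarith+
    have l: "?l u = Var False" "?l v = Var True" using u v by (simp_all add: UNIV_bool)
    have "w = u \<or> w = v \<or> w = W" using wx(1) P by blast
    then show "Var False ^ nat (snd ((w, 1) + x) - H ((w, 1) + x) - J ((w, 1) + x)) *
        (Var True ^ nat (H ((w, 1) + x)) * ?l W ^ nat (J ((w, 1) + x))) =
      ?l w * (Var False ^ nat (snd x - H x - J x) * (Var True ^ nat (H x) * ?l W ^ nat (J x)))"
    proof (elim disjE)
      assume "w = u"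
      then show ?thesis unfolding H J using u n l by (simp del: One_nat_def add: mult_ac)
    next
      assume "w = v"
      then show ?thesis unfolding H J using v n l by (simp del: One_nat_def add: mult_ac)
    next
      assume w: "w = W"
      have m: "nat (snd ((W, 1) + x) - (0 + H x) - (1 + J x)) = nat (snd x - H x - J x)"
        by (rule arg_cong[of _ _ nat]) simp
      show ?thesis unfolding H J w W m by (simp del: One_nat_def add: n mult_ac)
    qed
  qed
qed

section \<open>Evaluation of polynomials along a homomorphism\<close>

context coeff_hom
begin

definition eval_poly :: "'a \<Rightarrow> 'k poly \<Rightarrow> 'a" where
  "eval_poly x p = poly (map_poly \<phi> p) x"

lemma eval_pCons: "eval_poly x (pCons a p) = \<phi> a + x * eval_poly x p"
  by (cases "p = 0 \<and> a = 0") (auto simp: eval_poly_def hom_zero map_poly_pCons)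

lemma eval_zero: "eval_poly x 0 = 0"
  by (simp add: eval_poly_def)

lemma eval_const: "eval_poly x [:a:] = \<phi> a"
  by (simp add: eval_pCons eval_zero)

lemma eval_variable: "eval_poly x [:0, 1:] = x"
  by (simp add: eval_pCons eval_zero hom_zero hom_one)

lemma eval_hom: "coeff_hom (eval_poly x)"
proof
  show add: "eval_poly x (p + q) = eval_poly x p + eval_poly x q" for p q
  proof (induction p arbitrary: q)
    case (pCons a p)
    show ?case by (cases q) (simp add: pCons.IH eval_pCons hom_add, simp add: algebra_simps)
  qed (simp add: eval_zero)
  have smult: "eval_poly x (smult a q) = \<phi> a * eval_poly x q" for a q
    by (induction q) (simp_all add: eval_pCons eval_zero hom_mult algebra_simps)
  show "eval_poly x (p * q) = eval_poly x p * eval_poly x q" for p q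
    by (induction p) (simp_all add: eval_pCons eval_zero add smult hom_zero algebra_simps)
  show "eval_poly x 1 = 1" using eval_const[of x 1] by (simp add: hom_one one_pCons del: one_poly_eq_simps)
qed

lemma hom_eval:
  assumes "coeff_hom \<psi>"
  shows "\<phi> (coeff_hom.eval_poly \<psi> x p) = coeff_hom.eval_poly (\<lambda>c. \<phi> (\<psi> c)) (\<phi> x) p"
proof -
  interpret \<psi>: coeff_hom \<psi> by (rule assms)
  interpret c: coeff_hom "\<lambda>c. \<phi> (\<psi> c)"
    by unfold_locales (simp_all add: \<psi>.hom_add \<psi>.hom_mult \<psi>.hom_one hom_add hom_mult hom_one)
  show ?thesis
    by (induction p) (simp_all add: \<psi>.eval_pCons \<psi>.eval_zero c.eval_pCons c.eval_zero hom_zero hom_add hom_mult)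
qed

lemma eval_closed:
  assumes "x \<in> S" "\<And>a. \<phi> a \<in> S" "\<And>a b. a \<in> S \<Longrightarrow> b \<in> S \<Longrightarrow> a + b \<in> S" "\<And>a b. a \<in> S \<Longrightarrow> b \<in> S \<Longrightarrow> a * b \<in> S"
  shows "eval_poly x p \<in> S"
  by (induction p) (use assms(2)[of 0] in \<open>simp_all add: eval_zero eval_pCons hom_zero assms\<close>)

end

section \<open>The local rings of the Fano scheme\<close>

lemma toric_ideal_polys_in: "toric_ideal P \<subseteq> polys_in (lattice_points P)"
  by (auto simp: toric_ideal_def)

lemma nonsingular_point_configuration:
  fixes K :: "'k::field itself"
  assumes P: "lattice_polygon P" and ns: "nonsingular (toric_surface K P)"
  shows "point_configuration (lattice_points P)"
proof
  have poly: "polytope P" using P by (simp add: lattice_polygon_def)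
  show "w \<in> lattice_points P" if "p1 \<in> lattice_points P" "p2 \<in> lattice_points P" "p3 \<in> lattice_points P"
      "m1 + m2 + m3 > (0 :: nat)" "int m1 * fst p1 + int m2 * fst p2 + int m3 * fst p3 = int (m1 + m2 + m3) * fst w"
      "int m1 * snd p1 + int m2 * snd p2 + int m3 * snd p3 = int (m1 + m2 + m3) * snd w" for p1 p2 p3 w m1 m2 m3
    by (rule lattice_points_barycenter[OF polytope_imp_convex[OF poly] that])
  fix v f1 f2 g1 g2
  assume v: "v \<in> lattice_points P" "\<And>w. w \<in> lattice_points P \<Longrightarrow> w \<noteq> v \<Longrightarrow>
        f1 * (fst w - fst v) + f2 * (snd w - snd v) > 0 \<or>
        f1 * (fst w - fst v) + f2 * (snd w - snd v) = 0 \<and> g1 * (fst w - fst v) + g2 * (snd w - snd v) > 0"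
  interpret t: toric_vertex P v f1 f2 g1 g2 K
  proof
    show "finite (lattice_points P)" by (rule finite_lattice_points[OF polytope_imp_bounded[OF poly]])
    show "v \<in> lattice_points P" by (rule v(1))
    show "lexpos f1 f2 g1 g2 (w - v)" if "w \<in> lattice_points P" "w \<noteq> v" for w
      using v(2)[OF that] by (simp add: lexpos_def)
  qed
  have "regular_local_ring t.St"
    using ns t.p_point unfolding nonsingular_def t.St_def by blast
  then show "\<exists>e1\<in>lattice_points P. \<exists>e2\<in>lattice_points P. \<forall>w\<in>lattice_points P. \<exists>m n :: nat.
      fst w - fst v = int m * (fst e1 - fst v) + int n * (fst e2 - fst v) \<and>
      snd w - snd v = int m * (snd e1 - snd v) + int n * (snd e2 - snd v)"
    by (rule t.smooth_vertex)
qed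

locale toric_chart_point = chart_point "lattice_points P" "toric_ideal P" u v q
  for P :: "(real \<times> real) set" and u v :: "int \<times> int"
    and q :: "(bool \<times> (int \<times> int), 'k::alg_closed_field) mpoly set set" +
  assumes P: "lattice_polygon P" and ns: "nonsingular (toric_surface TYPE('k) P)"
    and uv: "u \<in> lattice_points P" "v \<in> lattice_points P" "u \<noteq> v"
begin

abbreviation \<alpha> :: "int \<times> int \<Rightarrow> (bool \<times> (int \<times> int), 'k) mpoly" where "\<alpha> \<equiv> universal_line u v False"
abbreviation \<beta> :: "int \<times> int \<Rightarrow> (bool \<times> (int \<times> int), 'k) mpoly" where "\<beta> \<equiv> universal_line u v True"

sublocale line: general_line N U "lattice_points P" \<alpha> \<beta> u v
proof -
  interpret c: coeff_hom "\<lambda>c :: 'k. [:Const c :: (bool \<times> (int \<times> int), 'k) mpoly:]"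
    by unfold_locales (simp_all add: single_add mult_single one_pCons mult.commute del: one_poly_eq_simps)
  interpret s: coeff_hom "substitute (\<lambda>c. [:Const c:]) (\<lambda>w. [:\<alpha> w, \<beta> w:])" by (rule c.substitute_hom)
  interpret point_configuration "lattice_points P" by (rule nonsingular_point_configuration[OF P ns])
  show "general_line N U (lattice_points P) \<alpha> \<beta> u v"
  proof unfold_locales
    fix p1 p2 p3 p4 m1 m2 m3 m4 n1 n2 n3 n4
    assume h: "p1 \<in> lattice_points P" "p2 \<in> lattice_points P" "p3 \<in> lattice_points P" "p4 \<in> lattice_points P"
      "m1 + m2 + m3 + m4 = n1 + n2 + n3 + (n4 :: nat)"
      "int m1 * fst p1 + int m2 * fst p2 + int m3 * fst p3 + int m4 * fst p4 =
        int n1 * fst p1 + int n2 * fst p2 + int n3 * fst p3 + int n4 * fst p4"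
      "int m1 * snd p1 + int m2 * snd p2 + int m3 * snd p3 + int m4 * snd p4 =
        int n1 * snd p1 + int n2 * snd p2 + int n3 * snd p3 + int n4 * snd p4"
    let ?s = "substitute (\<lambda>c. [:Const c:]) (\<lambda>w. [:\<alpha> w, \<beta> w:])"
    have neg: "?s (- f) = - ?s f" for f
      using s.hom_add[of f "- f"] by (simp add: s.hom_zero eq_neg_iff_add_eq_0 add.commute)
    have "coeff (?s (Var p1 ^ m1 * Var p2 ^ m2 * Var p3 ^ m3 * Var p4 ^ m4 +
      - (Var p1 ^ n1 * Var p2 ^ n2 * Var p3 ^ n3 * Var p4 ^ n4))) n \<in> N" for n
      by (rule equation_coefficients[OF binomial_toric_ideal[OF h]])
    then show "pcong ([:\<alpha> p1, \<beta> p1:] ^ m1 * [:\<alpha> p2, \<beta> p2:] ^ m2 * [:\<alpha> p3, \<beta> p3:] ^ m3 * [:\<alpha> p4, \<beta> p4:] ^ m4)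
        ([:\<alpha> p1, \<beta> p1:] ^ n1 * [:\<alpha> p2, \<beta> p2:] ^ n2 * [:\<alpha> p3, \<beta> p3:] ^ n3 * [:\<alpha> p4, \<beta> p4:] ^ n4)"
      unfolding pcong_def s.hom_add neg s.hom_mult s.hom_power c.substitute_var by simp
  qed (use uv lattice_polygon_noncollinear[OF P uv(3)] in \<open>simp_all add: universal_line_def\<close>)
qed

lemma universal_line_var: "w \<noteq> u \<Longrightarrow> w \<noteq> v \<Longrightarrow> universal_line u v r w = Var (r, w)"
  by (simp add: universal_line_def)

text \<open>All coordinates vanish in the local ring, so it is generated by constants, and nonzero
  constants are units: the point is isolated and reduced.\<close>

lemma edge_stalk:
  assumes "\<And>w. w \<in> lattice_points P - {u, v} \<Longrightarrow> \<alpha> w \<in> N \<and> \<beta> w \<in> N"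
  shows "regular_local_ring L \<and> reduced_ring L"
proof -
  let ?\<phi> = "substitute (\<lambda>c :: 'k. c) (\<lambda>_ :: bool \<times> (int \<times> int). 0)"
  interpret i: coeff_hom "\<lambda>c :: 'k. c" by unfold_locales auto
  interpret p: chart_param "lattice_points P" "toric_ideal P" u v q Const ?\<phi>
  proof
    fix w r assume w: "w \<in> lattice_points P - {u, v}"
    have eq: "universal_line u v r w = Var (r, w)" using w by (intro universal_line_var) auto
    have "universal_line u v r w \<in> N" using assms[OF w] by (cases r) auto
    then have "Var (r, w) \<in> N" unfolding eq .
    then have "Const 1 \<in> U \<and> Const 1 * Var (r, w) - Const 0 \<in> N \<and> ?\<phi> (Const 1) * ?\<phi> (Var (r, w)) = ?\<phi> (Const 0)"
      using one_U by (simp add: i.substitute_zero i.substitute_single)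
    then show "\<exists>a b. Const b \<in> U \<and> Const b * Var (r, w) - Const a \<in> N \<and> ?\<phi> (Const b) * ?\<phi> (Var (r, w)) = ?\<phi> (Const a)"
      by blast
  qed (auto simp: polys_in_simps i.substitute_const Const_hom i.substitute_hom intro: coeff_hom.hom_add coeff_hom.hom_mult coeff_hom.hom_one)
  show ?thesis
  proof (rule p.stalk_regular[OF _ noetherian_field regular_prime_field])
    fix a :: 'k assume a: "Const a \<in> N"
    show "a = 0"
    proof (rule ccontr)
      assume "a \<noteq> 0"
      then have "Const a * Const (inverse a) = (1 :: (bool \<times> (int \<times> int), 'k) mpoly)" by (simp add: mult_single)
      then have "Const a \<in> U" using one_U U_mult by metis
      then show False using N_not_U[OF a] by blast
    qed
  qed
qed

lemma normalized_kill:
  assumes "coeff_hom \<phi>0" "normalized_at u v M0" "line_contained \<phi>0 M0 (toric_ideal P :: (int \<times> int, 'k) mpoly set)"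
    and "g \<in> fano_equations (toric_ideal P) u v"
  shows "substitute \<phi>0 (\<lambda>(r, w). M0 r w) g = 0"
proof -
  interpret coeff_hom \<phi>0 by (rule assms(1))
  show ?thesis using fano_equations_universal[of \<phi>0 u v M0 "toric_ideal P", OF hom_add hom_mult hom_one uv(3) assms(2)] assms(3,4) by blast
qed

lemma scroll_stalk:
  assumes "affine_fun h" "affine_fun j" and uv_col: "h u = 0" "h v = 1" "j u = 0" "j v = 0"
    and W: "W \<in> lattice_points P" "h W = 0" "j W = 1"
    and scroll: "\<And>w. w \<in> lattice_points P \<Longrightarrow> scroll_point \<alpha> \<beta> (\<alpha> W) (h w) (j w) w"
  shows "regular_local_ring L \<and> reduced_ring L"
proof -
  note One_nat_def [simp del]
  have Wuv: "W \<noteq> u" "W \<noteq> v" using uv_col W by auto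
  let ?X = "Var (False, W) :: (bool \<times> (int \<times> int), 'k) mpoly"
  have \<alpha>W: "\<alpha> W = ?X" by (rule universal_line_var[OF Wuv])
  interpret C: coeff_hom "Const :: 'k \<Rightarrow> (bool \<times> (int \<times> int), 'k) mpoly" by (rule Const_hom)
  \<comment> \<open>Points with negative \<open>j\<close> carry negative powers of the parameter, so
    the family lives over the fraction field of the polynomial ring, although the parameters only
    form the polynomial ring.\<close>
  define \<phi>0 where "\<phi>0 = (\<lambda>c :: 'k. Fraction_Field.Fract [:c:] 1)"
  define t where "t = Fraction_Field.Fract [:0, 1 :: 'k:] 1"
  have t: "t \<noteq> 0" by (simp add: t_def Zero_fract_def eq_fract)
  interpret c: coeff_hom \<phi>0
    by unfold_locales (simp_all add: \<phi>0_def One_fract_def eq_fract one_pCons del: one_poly_eq_simps)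
  \<comment> \<open>The generic line of the ruling. Its entry at \<open>W\<close> is
    \<open>t\<close>, which identifies the coordinate there with the parameter.\<close>
  define M0 where "M0 = (\<lambda>r w. if h w = (if r then 1 else 0) then t powi j w else 0)"
  let ?\<phi> = "substitute \<phi>0 (\<lambda>(r, w). M0 r w)"
  interpret s: coeff_hom ?\<phi> by (rule c.substitute_hom)
  let ?\<psi> = "C.eval_poly ?X"
  interpret \<psi>: coeff_hom ?\<psi> by (rule C.eval_hom)
  have range: "h w \<in> {0, 1}" if "w \<in> lattice_points P" for w
    using scroll[OF that] by (simp add: scroll_point_def)
  have X: "?\<phi> ?X = t" using W by (simp add: c.substitute_single c.hom_one M0_def)
  have \<phi>\<psi>: "?\<phi> (?\<psi> f) = Fraction_Field.Fract f 1" for f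
  proof -
    have "?\<phi> (?\<psi> f) = c.eval_poly t f"
      unfolding s.hom_eval[OF Const_hom] X by (simp add: c.substitute_const)
    also have "\<dots> = Fraction_Field.Fract f 1"
    proof (induction f)
      case (pCons a f)
      have "\<phi>0 a + t * Fraction_Field.Fract f 1 = Fraction_Field.Fract (pCons a f) 1"
        by (simp add: \<phi>0_def t_def)
      then show ?case unfolding c.eval_pCons pCons.IH .
    qed (simp add: c.eval_zero Zero_fract_def)
    finally show ?thesis .
  qed
  have \<psi>X: "?\<psi> ([:0, 1:] ^ n) = ?X ^ n" for n by (simp only: \<psi>.hom_power C.eval_variable)
  have \<psi>01: "?\<psi> (if b then [:0, 1:] ^ n else 0) = (if b then ?X ^ n else 0)" "?\<psi> (if b then 1 else 0) = (if b then 1 else 0)" for b n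
    using \<psi>X by (simp_all add: \<psi>.hom_zero \<psi>.hom_one)
  interpret p: chart_param "lattice_points P" "toric_ideal P" u v q ?\<psi> ?\<phi>
  proof
    show "?\<psi> a \<in> polys_in V" for a
      by (rule C.eval_closed) (use W Wuv in \<open>auto intro: polys_in_simps\<close>)
    show "\<exists>a. ?\<psi> a = Const c" for c using C.eval_const by blast
    show "a = 0" if "?\<phi> (?\<psi> a) = 0" for a
      using that unfolding \<phi>\<psi> by (simp add: Zero_fract_def eq_fract)
    fix w r assume w: "w \<in> lattice_points P - {u, v}"
    let ?e = "h w = (if r then 1 else 0)"
    have var: "universal_line u v r w = Var (r, w)" using w by (intro universal_line_var) auto
    have \<phi>w: "?\<phi> (Var (r, w)) = (if ?e then t powi j w else 0)" by (simp add: c.substitute_single c.hom_one M0_def)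
    have sc: "scroll_point \<alpha> \<beta> ?X (h w) (j w) w" using scroll[of w] w \<alpha>W by simp
    show "\<exists>a b. ?\<psi> b \<in> U \<and> ?\<psi> b * Var (r, w) - ?\<psi> a \<in> N \<and> ?\<phi> (?\<psi> b) * ?\<phi> (Var (r, w)) = ?\<phi> (?\<psi> a)"
    proof (cases "j w \<ge> 0")
      case True
      have "Var (r, w) - (if ?e then ?X ^ nat (j w) else 0) \<in> N"
        using sc True unfolding var[symmetric] scroll_point_def by (cases r) simp_all
      then have "?\<psi> 1 \<in> U \<and> ?\<psi> 1 * Var (r, w) - ?\<psi> (if ?e then [:0, 1:] ^ nat (j w) else 0) \<in> N \<and>
          ?\<phi> (?\<psi> 1) * ?\<phi> (Var (r, w)) = ?\<phi> (?\<psi> (if ?e then [:0, 1:] ^ nat (j w) else 0))"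
        unfolding \<psi>01 \<phi>w \<psi>.hom_one s.hom_one using one_U True
        by (simp add: s.hom_power X s.hom_zero power_int_def)
      then show ?thesis by blast
    next
      case False
      have "?X ^ nat (- j w) * Var (r, w) - (if ?e then 1 else 0) \<in> N"
        using sc False unfolding var[symmetric] scroll_point_def by (cases r) simp_all
      moreover have "?X \<in> U" using sc False by (simp add: scroll_point_def)
      ultimately have "?\<psi> ([:0, 1:] ^ nat (- j w)) \<in> U \<and>
          ?\<psi> ([:0, 1:] ^ nat (- j w)) * Var (r, w) - ?\<psi> (if ?e then 1 else 0) \<in> N \<and>
          ?\<phi> (?\<psi> ([:0, 1:] ^ nat (- j w))) * ?\<phi> (Var (r, w)) = ?\<phi> (?\<psi> (if ?e then 1 else 0))"
        unfolding \<psi>01 \<psi>X \<phi>w s.hom_power X using False t U_power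
        by (simp add: s.hom_zero s.hom_one power_int_def flip: power_mult_distrib)
      then show ?thesis by blast
    qed
  qed
  have "normalized_at u v M0" using uv_col by (simp add: normalized_at_def M0_def)
  moreover have "line_contained \<phi>0 M0 (toric_ideal P)"
    unfolding M0_def by (rule scroll_line_contained[OF c.coeff_hom_axioms t assms(1,2) range])
  ultimately have kill: "?\<phi> g = 0" if "g \<in> fano_equations (toric_ideal P) u v" for g
    using normalized_kill[OF c.coeff_hom_axioms _ _ that] by blast
  show ?thesis
    by (rule p.stalk_regular[OF p.injective[OF kill] noetherian_poly[OF noetherian_field] regular_prime_field_poly])
qed

text \<open>The surface is a plane and the chart is an affine plane, with the two entries of column
  \<open>W\<close> as coordinates.\<close>

lemma triangle_stalk:
  assumes "affine_fun h" "affine_fun j" and uv_col: "h u = 0" "h v = 1" "j u = 0" "j v = 0"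
    and W: "h W = 0" "j W = 1" and A: "lattice_points P = {u, v, W}"
  shows "regular_local_ring L \<and> reduced_ring L"
proof -
  note One_nat_def [simp del]
  have Wuv: "W \<noteq> u" "W \<noteq> v" using uv_col W by auto
  let ?X = "Var (False, W) :: (bool \<times> (int \<times> int), 'k) mpoly"
  let ?Y = "Var (True, W) :: (bool \<times> (int \<times> int), 'k) mpoly"
  interpret C: coeff_hom "Const :: 'k \<Rightarrow> (bool \<times> (int \<times> int), 'k) mpoly" by (rule Const_hom)
  interpret E: coeff_hom "C.eval_poly ?X" by (rule C.eval_hom)
  let ?\<psi> = "E.eval_poly ?Y"
  interpret \<psi>: coeff_hom ?\<psi> by (rule E.eval_hom)
  define \<phi>0 where "\<phi>0 = (\<lambda>c :: 'k. [:[:c:]:])"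
  interpret c: coeff_hom \<phi>0
    by unfold_locales (simp_all add: \<phi>0_def one_pCons del: one_poly_eq_simps)
  \<comment> \<open>The generic line of the plane: the inner variable is the first and the outer
    variable the second entry of column \<open>W\<close>, so that \<open>?\<phi>\<close> inverts
    \<open>?\<psi>\<close>.\<close>
  define M0 :: "bool \<Rightarrow> int \<times> int \<Rightarrow> 'k poly poly" where
    "M0 = (\<lambda>r w. if w = W then (if r then [:0, 1:] else [:[:0, 1:]:]) else if w = (if r then v else u) then 1 else 0)"
  let ?\<phi> = "substitute \<phi>0 (\<lambda>(r, w). M0 r w)"
  interpret s: coeff_hom ?\<phi> by (rule c.substitute_hom)
  have XY: "?\<phi> ?X = [:[:0, 1:]:]" "?\<phi> ?Y = [:0, 1:]" by (simp_all add: c.substitute_single c.hom_one M0_def)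
  have \<phi>E: "?\<phi> (C.eval_poly ?X f) = [:f:]" for f
  proof -
    have "?\<phi> (C.eval_poly ?X f) = c.eval_poly [:[:0, 1:]:] f"
      unfolding s.hom_eval[OF Const_hom] XY by (simp add: c.substitute_const)
    also have "\<dots> = [:f:]"
    proof (induction f)
      case (pCons a f)
      have "\<phi>0 a + [:[:0, 1:]:] * [:f:] = [:pCons a f:]" by (simp add: \<phi>0_def)
      then show ?case unfolding c.eval_pCons pCons.IH .
    qed (simp add: c.eval_zero)
    finally show ?thesis .
  qed
  interpret k: coeff_hom "\<lambda>f :: 'k poly. [:f:]"
    by unfold_locales (simp_all add: one_pCons del: one_poly_eq_simps)
  have \<phi>\<psi>: "?\<phi> (?\<psi> F) = F" for F
  proof -
    have "?\<phi> (?\<psi> F) = k.eval_poly [:0, 1:] F"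
      unfolding s.hom_eval[OF E.coeff_hom_axioms] XY \<phi>E ..
    also have "\<dots> = F" by (induction F) (simp_all add: k.eval_zero k.eval_pCons)
    finally show ?thesis .
  qed
  have \<psi>_const: "?\<psi> [:[:a:]:] = Const a" and \<psi>_X: "?\<psi> [:[:0, 1:]:] = ?X" and \<psi>_Y: "?\<psi> [:0, 1:] = ?Y" for a
    by (simp_all only: E.eval_const C.eval_const C.eval_variable E.eval_variable)
  interpret p: chart_param "lattice_points P" "toric_ideal P" u v q ?\<psi> ?\<phi>
  proof
    have "C.eval_poly ?X a \<in> polys_in V" for a
      by (rule C.eval_closed) (use A Wuv in \<open>auto intro: polys_in_simps\<close>)
    then show "?\<psi> a \<in> polys_in V" for a
      by (intro E.eval_closed) (use A Wuv in \<open>auto intro: polys_in_simps\<close>)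
    show "\<exists>a. ?\<psi> a = Const c" for c using \<psi>_const by blast
    show "a = 0" if "?\<phi> (?\<psi> a) = 0" for a using that unfolding \<phi>\<psi> .
    fix w r assume w: "w \<in> lattice_points P - {u, v}"
    then have "Var (r, w) = ?\<psi> (if r then [:0, 1:] else [:[:0, 1:]:])" using A \<psi>_X \<psi>_Y by auto
    then obtain a where a: "Var (r, w) = ?\<psi> a" by blast
    have "?\<psi> 1 \<in> U \<and> ?\<psi> 1 * Var (r, w) - ?\<psi> a \<in> N \<and> ?\<phi> (?\<psi> 1) * ?\<phi> (Var (r, w)) = ?\<phi> (?\<psi> a)"
      unfolding a using one_U N_zero by (simp add: \<psi>.hom_one s.hom_one)
    then show "\<exists>a b. ?\<psi> b \<in> U \<and> ?\<psi> b * Var (r, w) - ?\<psi> a \<in> N \<and> ?\<phi> (?\<psi> b) * ?\<phi> (Var (r, w)) = ?\<phi> (?\<psi> a)"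
      by blast
  qed
  have M0: "M0 False u = 1" "M0 True u = 0" "M0 False v = 0" "M0 True v = 1"
    using Wuv uv(3) by (auto simp: M0_def)
  then have "normalized_at u v M0" by (simp add: normalized_at_def)
  moreover have "line_contained \<phi>0 M0 (toric_ideal P)"
    by (rule triangle_line_contained[OF c.coeff_hom_axioms assms(1,2) A uv_col(1,3) M0(1,2) uv_col(2,4) M0(3,4) W])
  ultimately have kill: "?\<phi> g = 0" if "g \<in> fano_equations (toric_ideal P) u v" for g
    using normalized_kill[OF c.coeff_hom_axioms _ _ that] by blast
  show ?thesis
    by (rule p.stalk_regular[OF p.injective[OF kill] noetherian_poly[OF noetherian_poly[OF noetherian_field]] regular_prime_poly_poly])
qed

theorem stalk: "regular_local_ring L \<and> reduced_ring L"
  using line.classification unfolding line_class_def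
proof (elim disjE exE conjE bexE)
  assume "\<forall>w\<in>lattice_points P - {u, v}. \<alpha> w \<in> N \<and> \<beta> w \<in> N"
  then show ?thesis by (intro edge_stalk) blast
next
  fix h j W assume "affine_fun h" "affine_fun j" "h u = 0" "h v = 1" "j u = 0" "j v = 0" "W \<in> lattice_points P"
    "h W = 0" "j W = 1" "\<forall>w\<in>lattice_points P. scroll_point \<alpha> \<beta> (\<alpha> W) (h w) (j w) w"
  then show ?thesis by (intro scroll_stalk[of h j W]) blast+
qed (rule triangle_stalk)

end

theorem corollary2p4:
  fixes P :: "(real \<times> real) set"
  assumes "lattice_polygon P"
    and "nonsingular (toric_surface TYPE('k::alg_closed_field) P)"
  shows "nonsingular (toric_fano_scheme TYPE('k) P) \<and>
         reduced_scheme (toric_fano_scheme TYPE('k) P)"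
proof -
  have "regular_local_ring (stalk (toric_fano_scheme TYPE('k) P) x) \<and> reduced_ring (stalk (toric_fano_scheme TYPE('k) P) x)"
    if "x \<in> points (toric_fano_scheme TYPE('k) P)" for x
  proof -
    obtain u v q where x: "x = ((u, v), q)" by (metis prod.exhaust)
    have "u \<in> lattice_points P" "v \<in> lattice_points P" "u \<noteq> v"
      "primeideal q (fano_chart (lattice_points P) (toric_ideal P) (u, v))"
      using that by (simp_all add: x toric_fano_scheme_def fano_scheme_lines_def affine_cover_scheme_def)
    then interpret toric_chart_point P u v q
      by (intro toric_chart_point.intro chart_point.intro toric_chart_point_axioms.intro) (use assms toric_ideal_polys_in in auto)
    have "stalk (toric_fano_scheme TYPE('k) P) x = L"
      by (simp add: toric_fano_scheme_def fano_scheme_lines_def affine_cover_scheme_def x Q_eq L_def M_def)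
    then show ?thesis using stalk by simp
  qed
  then show ?thesis by (simp add: nonsingular_def reduced_scheme_def)
qed

end
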